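(* Let $G$ be a connected semisimple Lie group with finite center, let $\tau$ be an involutive automorphism of $G$, and let $H$ be an open subgroup of the fixed point group $G^\tau=\{g\in G\mid \tau(g)=g\}$. Let $Y=G/H$ be the corresponding semisimple symmetric space, equipped with a $G$-invariant positive measure $dy$. Let $1\leq p<\infty$, let $E_p=L^p(Y)=L^p(Y,dy)$, and let $E_p^\infty$ denote the space of smooth vectors for the left regular representation $L$ of $G$ on $E_p$. Then $$E_p^\infty\subset C_0^\infty(Y),$$ where $C_0^\infty(Y)$ is the space of smooth functions on $Y$ which vanish at infinity.
   Context: The measure $dy$ is the $G$-invariant positive (Radon) measure on $Y=G/H$; it is unique up to a positive scalar. The left regular representation $L$ of $G$ on $E_p=L^p(Y)$ is the continuous isometric representation given by $[L(g)f](y)=f(g^{-1}y)$ for $g\in G$, $y\in Y$, $f\in E_p$. An element $f\in E_p$ is a smooth vector for $L$ if the map $G\to E_p$, $g\mapsto L(g)f$, is a smooth map into the Banach space $E_p$; $E_p^\infty$ is the space of all smooth vectors. A function $f$ on $Y$ vanishes at infinity if for every $\varepsilon>0$ there is a compact set $C\subset Y$ such that $|f(y)|<\varepsilon$ for all $y\in Y\setminus C$; $C_0^\infty(Y)$ is the space of $f\in C^\infty(Y)$ that vanish at infinity (no condition is imposed on derivatives). Elements of $E_p$ are classes of functions modulo equality almost everywhere, and the inclusion means that each $f\in E_p^\infty$ agrees almost everywhere with a function in $C_0^\infty(Y)$. *)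

theory Defs
  imports "HOL-Analysis.Analysis" "HOL-Algebra.Left_Coset"
begin

section \<open>Smooth maps between open subsets of Euclidean spaces\<close>

text \<open>Only used for open \<open>S\<close>, where the Frechet derivative is unique.  As the domain is
  finite-dimensional, \<open>x \<mapsto> Df(x)\<close> is \<open>C\<^sup>k\<close> iff \<open>x \<mapsto> Df(x) v\<close> is \<open>C\<^sup>k\<close> for every \<open>v\<close>.\<close>

primrec Ck_on :: "nat \<Rightarrow> 'a::euclidean_space set \<Rightarrow> ('a \<Rightarrow> 'b::real_normed_vector) \<Rightarrow> bool" where
  "Ck_on 0 S f \<longleftrightarrow> continuous_on S f"
| "Ck_on (Suc k) S f \<longleftrightarrow>
     (\<forall>x\<in>S. f differentiable (at x)) \<and> (\<forall>v. Ck_on k S (\<lambda>x. frechet_derivative f (at x) v))"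

definition smooth_on :: "'a::euclidean_space set \<Rightarrow> ('a \<Rightarrow> 'b::real_normed_vector) \<Rightarrow> bool" where
  "smooth_on S f \<longleftrightarrow> (\<forall>k. Ck_on k S f)"

section \<open>Smooth manifolds\<close>

text \<open>A chart is a pair of its domain and its coordinate map; the values of the coordinate map
  outside of the domain are irrelevant.  An atlas is not required to be maximal.\<close>

type_synonym ('a, 'e) chart = "'a set \<times> ('a \<Rightarrow> 'e)"

definition is_chart :: "'a topology \<Rightarrow> ('a, 'e::euclidean_space) chart \<Rightarrow> bool" where
  "is_chart X = (\<lambda>(U, \<phi>). openin X U \<and> open (\<phi> ` U) \<and>
     homeomorphic_map (subtopology X U) (top_of_set (\<phi> ` U)) \<phi>)"

text \<open>Euclidean spaces in the sense of the type class have positive dimension.  A manifold of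
  dimension zero, that is a countable discrete space, is therefore represented by the empty atlas.
  This is consistent with the definitions below, which all quantify over charts: every map out
  of a discrete space is smooth, and a continuous map into a discrete space is smooth.\<close>

definition smooth_manifold :: "'a topology \<Rightarrow> ('a, 'e::euclidean_space) chart set \<Rightarrow> bool" where
  "smooth_manifold X A \<longleftrightarrow>
     Hausdorff_space X \<and> second_countable X \<and>
     (\<forall>c\<in>A. is_chart X c) \<and>
     (\<forall>(U, \<phi>)\<in>A. \<forall>(V, \<psi>)\<in>A. smooth_on (\<phi> ` (U \<inter> V)) (\<lambda>x. \<psi> (inv_into U \<phi> x))) \<and>
     ((\<Union>(U, \<phi>)\<in>A. U) = topspace X \<or> (A = {} \<and> X = discrete_topology (topspace X)))"

definition smooth_map ::
  "'a topology \<Rightarrow> ('a, 'e::euclidean_space) chart set \<Rightarrow>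
   'b topology \<Rightarrow> ('b, 'f::euclidean_space) chart set \<Rightarrow> ('a \<Rightarrow> 'b) \<Rightarrow> bool" where
  "smooth_map X A Y B F \<longleftrightarrow> continuous_map X Y F \<and>
     (\<forall>(U, \<phi>)\<in>A. \<forall>(V, \<psi>)\<in>B.
        smooth_on (\<phi> ` {a \<in> U. F a \<in> V}) (\<lambda>x. \<psi> (F (inv_into U \<phi> x))))"

definition submersion ::
  "'a topology \<Rightarrow> ('a, 'e::euclidean_space) chart set \<Rightarrow>
   'b topology \<Rightarrow> ('b, 'f::euclidean_space) chart set \<Rightarrow> ('a \<Rightarrow> 'b) \<Rightarrow> bool" where
  "submersion X A Y B F \<longleftrightarrow> smooth_map X A Y B F \<and>
     (\<forall>(U, \<phi>)\<in>A. \<forall>(V, \<psi>)\<in>B. \<forall>a\<in>U. F a \<in> V \<longrightarrow>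
        surj (frechet_derivative (\<lambda>x. \<psi> (F (inv_into U \<phi> x))) (at (\<phi> a))))"

definition smooth_function ::
  "('a, 'e::euclidean_space) chart set \<Rightarrow> ('a \<Rightarrow> 'b::real_normed_vector) \<Rightarrow> bool" where
  "smooth_function A f \<longleftrightarrow> (\<forall>(U, \<phi>)\<in>A. smooth_on (\<phi> ` U) (\<lambda>x. f (inv_into U \<phi> x)))"

definition prod_atlas ::
  "('a, 'e::euclidean_space) chart set \<Rightarrow> ('b, 'f::euclidean_space) chart set \<Rightarrow>
   ('a \<times> 'b, 'e \<times> 'f) chart set" where
  "prod_atlas A B = (\<lambda>((U, \<phi>), (V, \<psi>)). (U \<times> V, map_prod \<phi> \<psi>)) ` (A \<times> B)"

section \<open>Semisimple Lie groups\<close>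

definition lie_group ::
  "'g monoid \<Rightarrow> 'g topology \<Rightarrow> ('g, 'e::euclidean_space) chart set \<Rightarrow> bool" where
  "lie_group G T A \<longleftrightarrow>
     group G \<and> topspace T = carrier G \<and> smooth_manifold T A \<and>
     smooth_map (prod_topology T T) (prod_atlas A A) T A (\<lambda>(x, y). x \<otimes>\<^bsub>G\<^esub> y) \<and>
     smooth_map T A T A (\<lambda>x. inv\<^bsub>G\<^esub> x)"

text \<open>For a chart \<open>(U, \<phi>)\<close> at the identity \<open>e\<close>, the Lie algebra \<open>T\<^sub>e G\<close> is identified with
  the model space by means of \<open>d\<phi>(e)\<close>.  Then \<open>Ad g\<close> is the derivative at \<open>e\<close> of conjugation by
  \<open>g\<close>, and \<open>[u, v] = ad(u) v\<close>, where \<open>ad\<close> is the derivative of \<open>Ad\<close> at \<open>e\<close>.\<close>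

definition Ad_chart ::
  "'g monoid \<Rightarrow> ('g, real ^ 'n) chart \<Rightarrow> 'g \<Rightarrow> real ^ 'n \<Rightarrow> real ^ 'n" where
  "Ad_chart G = (\<lambda>(U, \<phi>) g v.
     frechet_derivative (\<lambda>x. \<phi> (g \<otimes>\<^bsub>G\<^esub> inv_into U \<phi> x \<otimes>\<^bsub>G\<^esub> inv\<^bsub>G\<^esub> g)) (at (\<phi> \<one>\<^bsub>G\<^esub>)) v)"

definition lie_bracket ::
  "'g monoid \<Rightarrow> ('g, real ^ 'n) chart \<Rightarrow> real ^ 'n \<Rightarrow> real ^ 'n \<Rightarrow> real ^ 'n" where
  "lie_bracket G = (\<lambda>(U, \<phi>) u v.
     frechet_derivative (\<lambda>x. Ad_chart G (U, \<phi>) (inv_into U \<phi> x) v) (at (\<phi> \<one>\<^bsub>G\<^esub>)) u)"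

definition killing_form ::
  "'g monoid \<Rightarrow> ('g, real ^ 'n) chart \<Rightarrow> real ^ 'n \<Rightarrow> real ^ 'n \<Rightarrow> real" where
  "killing_form G c u v = trace (matrix (\<lambda>w. lie_bracket G c u (lie_bracket G c v w)))"

text \<open>Following Helgason (Differential Geometry, Lie Groups, and Symmetric Spaces, II.6), a Lie
  group is semisimple if the Killing form of its Lie algebra is nondegenerate.\<close>

definition semisimple_lie_group ::
  "'g monoid \<Rightarrow> 'g topology \<Rightarrow> ('g, real ^ 'n) chart set \<Rightarrow> bool" where
  "semisimple_lie_group G T A \<longleftrightarrow> lie_group G T A \<and>
     (\<forall>c\<in>A. \<one>\<^bsub>G\<^esub> \<in> fst c \<longrightarrow> (\<forall>u. (\<forall>v. killing_form G c u v = 0) \<longrightarrow> u = 0))"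

definition group_center :: "'g monoid \<Rightarrow> 'g set" where
  "group_center G = {z \<in> carrier G. \<forall>g\<in>carrier G. z \<otimes>\<^bsub>G\<^esub> g = g \<otimes>\<^bsub>G\<^esub> z}"

definition involutive_automorphism ::
  "'g monoid \<Rightarrow> 'g topology \<Rightarrow> ('g, 'e::euclidean_space) chart set \<Rightarrow> ('g \<Rightarrow> 'g) \<Rightarrow> bool" where
  "involutive_automorphism G T A \<tau> \<longleftrightarrow>
     \<tau> \<in> iso G G \<and> smooth_map T A T A \<tau> \<and> (\<forall>g\<in>carrier G. \<tau> (\<tau> g) = g)"

definition fixed_group :: "'g monoid \<Rightarrow> ('g \<Rightarrow> 'g) \<Rightarrow> 'g set" where
  "fixed_group G \<tau> = {g \<in> carrier G. \<tau> g = g}"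

section \<open>The homogeneous space \<open>G/H\<close>\<close>

text \<open>The points of \<open>G/H\<close> are the left cosets of \<open>H\<close>, and \<open>g\<close> acts on them by
  \<open>y \<mapsto> g <#\<^bsub>G\<^esub> y\<close>.\<close>

definition coset_topology :: "'g monoid \<Rightarrow> 'g topology \<Rightarrow> 'g set \<Rightarrow> 'g set topology" where
  "coset_topology G T H = topology (\<lambda>S. S \<subseteq> lcosets\<^bsub>G\<^esub> H \<and>
     openin T {g \<in> carrier G. g <#\<^bsub>G\<^esub> H \<in> S})"

lemma openin_coset_topology:
  assumes "topspace T = carrier G"
  shows "openin (coset_topology G T H) S \<longleftrightarrow>
    S \<subseteq> lcosets\<^bsub>G\<^esub> H \<and> openin T {g \<in> carrier G. g <#\<^bsub>G\<^esub> H \<in> S}"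
proof -
  let ?P = "\<lambda>S. {g \<in> carrier G. g <#\<^bsub>G\<^esub> H \<in> S}"
  have "istopology (\<lambda>S. S \<subseteq> lcosets\<^bsub>G\<^esub> H \<and> openin T (?P S))"
    unfolding istopology_def
  proof (intro conjI allI impI)
    fix S S' assume "S \<subseteq> lcosets\<^bsub>G\<^esub> H \<and> openin T (?P S)" "S' \<subseteq> lcosets\<^bsub>G\<^esub> H \<and> openin T (?P S')"
    moreover have "?P (S \<inter> S') = ?P S \<inter> ?P S'" by auto
    ultimately show "S \<inter> S' \<subseteq> lcosets\<^bsub>G\<^esub> H" "openin T (?P (S \<inter> S'))" by auto
  next
    fix K assume "\<forall>S\<in>K. S \<subseteq> lcosets\<^bsub>G\<^esub> H \<and> openin T (?P S)"
    moreover have "?P (\<Union>K) = (\<Union>S\<in>K. ?P S)" by auto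
    ultimately show "\<Union>K \<subseteq> lcosets\<^bsub>G\<^esub> H" "openin T (?P (\<Union>K))" by auto
  qed
  then show ?thesis
    unfolding coset_topology_def by simp
qed

lemma quotient_map_coset_topology:
  assumes "topspace T = carrier G"
  shows "quotient_map T (coset_topology G T H) (\<lambda>g. g <#\<^bsub>G\<^esub> H)"
proof -
  have im: "(\<lambda>g. g <#\<^bsub>G\<^esub> H) ` carrier G = lcosets\<^bsub>G\<^esub> H"
    by (auto simp: LCOSETS_def)
  have "{g \<in> carrier G. g <#\<^bsub>G\<^esub> H \<in> lcosets\<^bsub>G\<^esub> H} = topspace T"
    using assms im by auto
  then have "openin (coset_topology G T H) (lcosets\<^bsub>G\<^esub> H)"
    by (simp add: openin_coset_topology[OF assms])
  then have "topspace (coset_topology G T H) = lcosets\<^bsub>G\<^esub> H"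
    by (metis openin_coset_topology[OF assms] openin_subset openin_topspace subset_antisym)
  then show ?thesis
    unfolding quotient_map_def using assms im by (auto simp: openin_coset_topology)
qed

text \<open>\<open>G/H\<close> carries a unique smooth structure for which the projection \<open>G \<rightarrow> G/H\<close> is a
  submersion.  The following predicate says that the atlas \<open>B\<close> defines this structure.\<close>

definition quotient_atlas ::
  "'g monoid \<Rightarrow> 'g topology \<Rightarrow> ('g, 'e::euclidean_space) chart set \<Rightarrow> 'g set \<Rightarrow>
   ('g set, 'f::euclidean_space) chart set \<Rightarrow> bool" where
  "quotient_atlas G T A H B \<longleftrightarrow>
     smooth_manifold (coset_topology G T H) B \<and>
     submersion T A (coset_topology G T H) B (\<lambda>g. g <#\<^bsub>G\<^esub> H)"

text \<open>Since \<open>G/H\<close> is locally compact, Hausdorff and second countable, the Radon measures are the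
  Borel measures which are finite on compact sets.\<close>

definition invariant_radon_measure ::
  "'g monoid \<Rightarrow> 'g topology \<Rightarrow> 'g set \<Rightarrow> 'g set measure \<Rightarrow> bool" where
  "invariant_radon_measure G T H \<mu> \<longleftrightarrow>
     space \<mu> = lcosets\<^bsub>G\<^esub> H \<and>
     sets \<mu> = sigma_sets (lcosets\<^bsub>G\<^esub> H) {S. openin (coset_topology G T H) S} \<and>
     (\<forall>K. compactin (coset_topology G T H) K \<longrightarrow> emeasure \<mu> K < \<infinity>) \<and>
     emeasure \<mu> (space \<mu>) \<noteq> 0 \<and>
     (\<forall>g\<in>carrier G. \<forall>S\<in>sets \<mu>. emeasure \<mu> ((\<lambda>y. g <#\<^bsub>G\<^esub> y) ` S) = emeasure \<mu> S)"

section \<open>Smooth maps into \<open>L\<^sup>p\<close>\<close>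

text \<open>Elements of \<open>L\<^sup>p(\<mu>)\<close> are represented by functions; equality in \<open>L\<^sup>p(\<mu>)\<close> is
  equality almost everywhere.\<close>

definition Lp_space :: "'y measure \<Rightarrow> real \<Rightarrow> ('y \<Rightarrow> complex) set" where
  "Lp_space \<mu> p =
     {f \<in> borel_measurable \<mu>. integrable \<mu> (\<lambda>y. cmod (f y) powr p)}"

definition Lp_norm :: "'y measure \<Rightarrow> real \<Rightarrow> ('y \<Rightarrow> complex) \<Rightarrow> real" where
  "Lp_norm \<mu> p f = (LINT y|\<mu>. cmod (f y) powr p) powr (1 / p)"

text \<open>Frechet differentiability at \<open>x\<close> of a map \<open>F\<close> from a Euclidean space into the Banach space
  \<open>L\<^sup>p(\<mu>)\<close>, with derivative \<open>D\<close>.  Linear maps on the finite-dimensional domain are bounded.\<close>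

definition has_Lp_derivative ::
  "'y measure \<Rightarrow> real \<Rightarrow> ('e::euclidean_space \<Rightarrow> 'y \<Rightarrow> complex) \<Rightarrow> ('e \<Rightarrow> 'y \<Rightarrow> complex) \<Rightarrow>
   'e \<Rightarrow> bool" where
  "has_Lp_derivative \<mu> p F D x \<longleftrightarrow>
     (\<forall>v. D v \<in> Lp_space \<mu> p) \<and>
     (\<forall>a b u v. AE y in \<mu>. D (a *\<^sub>R u + b *\<^sub>R v) y = a *\<^sub>R D u y + b *\<^sub>R D v y) \<and>
     ((\<lambda>v. Lp_norm \<mu> p (\<lambda>y. F (x + v) y - F x y - D v y) / norm v) \<longlongrightarrow> 0) (at 0)"

text \<open>The analogue of \<^const>\<open>Ck_on\<close> for maps from an open set \<open>S\<close> into \<open>L\<^sup>p(\<mu>)\<close>.\<close>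

primrec Lp_Ck_on ::
  "'y measure \<Rightarrow> real \<Rightarrow> nat \<Rightarrow> 'e::euclidean_space set \<Rightarrow> ('e \<Rightarrow> 'y \<Rightarrow> complex) \<Rightarrow> bool" where
  "Lp_Ck_on \<mu> p 0 S F \<longleftrightarrow> (\<forall>x\<in>S. F x \<in> Lp_space \<mu> p \<and>
     ((\<lambda>x'. Lp_norm \<mu> p (\<lambda>y. F x' y - F x y)) \<longlongrightarrow> 0) (at x within S))"
| "Lp_Ck_on \<mu> p (Suc k) S F \<longleftrightarrow> (\<forall>x\<in>S. F x \<in> Lp_space \<mu> p) \<and>
     (\<exists>D. (\<forall>x\<in>S. has_Lp_derivative \<mu> p F (D x) x) \<and>
          (\<forall>v. Lp_Ck_on \<mu> p k S (\<lambda>x. D x v)))"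

definition Lp_smooth_on ::
  "'y measure \<Rightarrow> real \<Rightarrow> 'e::euclidean_space set \<Rightarrow> ('e \<Rightarrow> 'y \<Rightarrow> complex) \<Rightarrow> bool" where
  "Lp_smooth_on \<mu> p S F \<longleftrightarrow> (\<forall>k. Lp_Ck_on \<mu> p k S F)"

section \<open>The spaces \<open>E\<^sub>p\<^sup>\<infinity>\<close> and \<open>C\<^sub>0\<^sup>\<infinity>(Y)\<close>\<close>

definition left_regular :: "'g monoid \<Rightarrow> 'g \<Rightarrow> ('g set \<Rightarrow> complex) \<Rightarrow> 'g set \<Rightarrow> complex" where
  "left_regular G g f = (\<lambda>y. f ((inv\<^bsub>G\<^esub> g) <#\<^bsub>G\<^esub> y))"

definition smooth_vectors ::
  "'g monoid \<Rightarrow> ('g, 'e::euclidean_space) chart set \<Rightarrow> 'g set measure \<Rightarrow> real \<Rightarrow>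
   ('g set \<Rightarrow> complex) set" where
  "smooth_vectors G A \<mu> p = {f \<in> Lp_space \<mu> p.
     \<forall>(U, \<phi>)\<in>A. Lp_smooth_on \<mu> p (\<phi> ` U) (\<lambda>x. left_regular G (inv_into U \<phi> x) f)}"

definition vanishes_at_infinity :: "'y topology \<Rightarrow> ('y \<Rightarrow> complex) \<Rightarrow> bool" where
  "vanishes_at_infinity Y f \<longleftrightarrow>
     (\<forall>\<epsilon>>0. \<exists>C. compactin Y C \<and> (\<forall>y\<in>topspace Y - C. cmod (f y) < \<epsilon>))"

definition C0_smooth ::
  "'y topology \<Rightarrow> ('y, 'f::euclidean_space) chart set \<Rightarrow> ('y \<Rightarrow> complex) set" where
  "C0_smooth Y B = {f. smooth_function B f \<and> vanishes_at_infinity Y f}"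

end

theory Submission
  imports Defs
begin

text \<open>
  Local part: for a smooth vector \<open>f\<close> the map \<open>a \<mapsto> L(a) f\<close> is locally a smooth map from a cube into \<open>L\<^sup>p\<close>.  A
  Sobolev type argument gives, for almost every \<open>y\<close>, a smooth version of \<open>a \<mapsto> f(a\<^sup>-\<^sup>1 y)\<close> which is dominated
  by \<open>v(y)\<close> for some \<open>v\<close> in \<open>L\<^sup>p\<close>.  So \<open>f\<close> has a smooth version \<open>h\<close> with \<open>\<bar>h(a\<^sup>-\<^sup>1 y)\<bar> \<le> v(y)\<close> for \<open>a\<close> in a
  neighbourhood \<open>W\<close> of the identity.

  Volume part: the volume of \<open>W z\<close> is bounded below uniformly in \<open>z = g H\<close>.  In the (-1)-eigenspace of the
  involution \<open>Ad(g) \<theta> Ad(g)\<^sup>-\<^sup>1\<close> choose an orthonormal basis \<open>e\<^sub>i\<close>, and let \<open>v\<^sub>i\<close> be bounded vectors which are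
  dual to it for the Killing form.  The orbit maps \<open>t \<mapsto> \<beta>(t) y\<close>, where \<open>\<beta>(t)\<close> has coordinates \<open>\<Sum> t\<^sub>i v\<^sub>i\<close>, are
  injective near \<open>z\<close> because the stabilizer of \<open>z\<close> is nearly orthogonal to the \<open>e\<^sub>i\<close>, and their Jacobian is
  bounded below because \<open>Ad(g)\<close> preserves the Killing form, which is nondegenerate on the eigenspace.  So
  orbits spend little time in small balls at \<open>z\<close>, and by Fubini many \<open>y\<close>, all of them in \<open>W z\<close>, have an
  orbit through such a ball.

  If \<open>\<bar>h(z)\<bar> \<ge> \<epsilon>\<close>, then \<open>v \<ge> \<epsilon>\<close> almost everywhere on \<open>W z\<close>.  Hence at most finitely many such \<open>W z\<close> are
  disjoint, and \<open>{\<bar>h\<bar> \<ge> \<epsilon>}\<close> lies in a compact set.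
\<close>

section \<open>Calculus of \<open>C\<^sup>k\<close> maps\<close>

text \<open>The obstacle is uniformity in \<open>g\<close>: \<open>H\<close> is in general not
  compact and \<open>Ad g\<close> is unbounded, so compactness controls nothing near a distant point
  \<open>g H\<close>. Three facts replace it. An orthonormal frame of \<open>Ad g\<close> applied to
  the (-1)-eigenspace has a Gram matrix for the Killing form with bounded entries; its determinant
  times \<open>(det M)\<^sup>2\<close>, with \<open>M\<close> the base change, is the fixed Gram
  determinant at the base point, so \<open>M\<close> cannot degenerate. The function
  \<open>ch x e\<close>, the trace of Ad(x) ad(e), vanishes when \<open>x\<close> fixes the point
  and \<open>e\<close> lies in the (-1)-eigenspace there, and its differential at the identity is
  the Killing pairing with \<open>e\<close>; so the stabilizer is controlled on a neighbourhood of
  the identity that does not depend on \<open>g\<close>. Finally, only ratios of volumes enter: the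
  radius of the test ball may shrink with \<open>g\<close>, because its volume occurs on both sides
  of the estimate and cancels.\<close>

lemma frechet_derivative_cong_open:
  assumes "open S" "x \<in> S" "\<And>x. x \<in> S \<Longrightarrow> f x = g x"
  shows "frechet_derivative f (at x) = frechet_derivative g (at x)"
proof -
  have "(f has_derivative f') (at x) \<longleftrightarrow> (g has_derivative f') (at x)" for f'
    using assms has_derivative_transform_within_open[of f f' x UNIV S g]
      has_derivative_transform_within_open[of g f' x UNIV S f] by (metis)
  then show ?thesis unfolding frechet_derivative_def by simp
qed

lemma Ck_on_cong:
  assumes "open S" "\<And>x. x \<in> S \<Longrightarrow> f x = g x" "Ck_on k S f"
  shows "Ck_on k S g"
  using assms(2,3)
proof (induction k arbitrary: f g)
  case 0
  then show ?case by (simp add: continuous_on_cong[of S S f g])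
next
  case (Suc k)
  have "frechet_derivative f (at x) = frechet_derivative g (at x)" if "x \<in> S" for x
    using frechet_derivative_cong_open[OF assms(1) that] Suc.prems(1) by blast
  moreover have "g differentiable at x" if "x \<in> S" for x
    using Suc.prems that assms(1) unfolding differentiable_def Ck_on.simps
    by (metis has_derivative_transform_within_open)
  moreover have "Ck_on k S (\<lambda>x. frechet_derivative g (at x) v)" for v
    using Suc.IH[of "\<lambda>x. frechet_derivative f (at x) v" "\<lambda>x. frechet_derivative g (at x) v"]
      Suc.prems(2) calculation(1) by simp
  ultimately show ?case by simp
qed

text \<open>Uniqueness of the derivative on open sets lets any explicit candidate \<open>D\<close>
  stand for \<open>frechet_derivative\<close>, which is defined by a choice operator. Most closure
  properties below go through this rule.\<close>

lemma Ck_on_SucI: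
  assumes "open S" "\<And>x. x \<in> S \<Longrightarrow> (f has_derivative D x) (at x)"
    "\<And>v. Ck_on k S (\<lambda>x. D x v)"
  shows "Ck_on (Suc k) S f"
proof -
  have "frechet_derivative f (at x) = D x" if "x \<in> S" for x
    using assms(2)[OF that] frechet_derivative_at by metis
  then have "Ck_on k S (\<lambda>x. frechet_derivative f (at x) v)" for v
    using Ck_on_cong[OF assms(1) _ assms(3)[of v]] by simp
  then show ?thesis using assms(2) by (auto simp: differentiable_def)
qed

lemma Ck_on_SucD:
  assumes "Ck_on (Suc k) S f" "x \<in> S"
  shows "(f has_derivative frechet_derivative f (at x)) (at x)"
  using assms by (simp add: frechet_derivative_works)

lemma Ck_on_subset: "Ck_on k S f \<Longrightarrow> T \<subseteq> S \<Longrightarrow> Ck_on k T f"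
proof (induction k arbitrary: f)
  case 0 then show ?case using continuous_on_subset by auto
qed auto

lemma Ck_on_imp_continuous_on: "Ck_on k S f \<Longrightarrow> continuous_on S f"
  by (cases k) (auto simp: continuous_at_imp_continuous_on differentiable_imp_continuous_within)

lemma Ck_on_pred: "Ck_on (Suc k) S f \<Longrightarrow> Ck_on k S f"
proof (induction k arbitrary: f)
  case 0 then show ?case using Ck_on_imp_continuous_on[of "Suc 0" S f] by simp
qed auto

lemma Ck_on_local:
  assumes "\<And>x. x \<in> S \<Longrightarrow> \<exists>T. open T \<and> x \<in> T \<and> Ck_on k T f"
  shows "Ck_on k S f"
  using assms
proof (induction k arbitrary: f)
  case 0
  have "isCont f x" if x: "x \<in> S" for x
  proof -
    obtain T where "open T" "x \<in> T" "continuous_on T f" using "0.prems"[OF x] by auto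
    then show ?thesis by (simp add: continuous_on_eq_continuous_at)
  qed
  then show ?case by (simp add: continuous_at_imp_continuous_on)
next
  case (Suc k)
  then show ?case by (simp; metis)
qed

lemma Ck_on_const: "open S \<Longrightarrow> Ck_on k S (\<lambda>x. c)"
proof (induction k arbitrary: c)
  case (Suc k)
  show ?case by (rule Ck_on_SucI[where D = "\<lambda>x v. 0"]) (use Suc in auto)
qed auto

lemma Ck_on_bounded_linear_id:
  assumes "bounded_linear L" "open S"
  shows "Ck_on k S L"
proof (cases k)
  case 0 then show ?thesis using assms by (simp add: linear_continuous_on)
next
  case (Suc j)
  show ?thesis unfolding Suc
    by (rule Ck_on_SucI[where D = "\<lambda>x. L"])
      (use assms Ck_on_const in \<open>auto intro: bounded_linear_imp_has_derivative\<close>)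
qed

lemma Ck_on_add:
  assumes "open S" "Ck_on k S f" "Ck_on k S g"
  shows "Ck_on k S (\<lambda>x. f x + g x)"
  using assms(2,3)
proof (induction k arbitrary: f g)
  case 0 then show ?case by (simp add: continuous_on_add)
next
  case (Suc k)
  note d = Ck_on_SucD[OF Suc.prems(1)] Ck_on_SucD[OF Suc.prems(2)]
  show ?case
    by (rule Ck_on_SucI[OF assms(1), where D = "\<lambda>x v. frechet_derivative f (at x) v + frechet_derivative g (at x) v"])
      (use Suc.prems in \<open>auto intro!: has_derivative_add d Suc.IH\<close>)
qed

lemma Ck_on_bounded_linear:
  assumes "open S" "bounded_linear L" "Ck_on k S f"
  shows "Ck_on k S (\<lambda>x. L (f x))"
  using assms(3)
proof (induction k arbitrary: f)
  case 0 then show ?case using assms(2) by (simp add: bounded_linear.continuous_on)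
next
  case (Suc k)
  show ?case
    by (rule Ck_on_SucI[OF assms(1), where D = "\<lambda>x v. L (frechet_derivative f (at x) v)"])
      (use Suc.prems in \<open>auto intro!: bounded_linear.has_derivative[OF assms(2)] Ck_on_SucD[OF Suc.prems] Suc.IH\<close>)
qed

lemma Ck_on_bilinear:
  assumes "open S" "bounded_bilinear B" "Ck_on k S f" "Ck_on k S g"
  shows "Ck_on k S (\<lambda>x. B (f x) (g x))"
  using assms(3,4)
proof (induction k arbitrary: f g)
  case 0 then show ?case using assms(2) by (simp add: bounded_bilinear.continuous_on)
next
  case (Suc k)
  show ?case
  proof (rule Ck_on_SucI[OF assms(1), where D = "\<lambda>x v. B (f x) (frechet_derivative g (at x) v)
        + B (frechet_derivative f (at x) v) (g x)"])
    show "((\<lambda>x. B (f x) (g x)) has_derivative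
        (\<lambda>v. B (f x) (frechet_derivative g (at x) v) + B (frechet_derivative f (at x) v) (g x))) (at x)"
      if "x \<in> S" for x
      by (rule bounded_bilinear.FDERIV[OF assms(2) Ck_on_SucD[OF Suc.prems(1) that] Ck_on_SucD[OF Suc.prems(2) that]])
    show "Ck_on k S (\<lambda>x. B (f x) (frechet_derivative g (at x) v)
        + B (frechet_derivative f (at x) v) (g x))" for v
      using Suc.prems
      by (intro Ck_on_add[OF assms(1)] Suc.IH Ck_on_pred[OF Suc.prems(1)] Ck_on_pred[OF Suc.prems(2)]) auto
  qed
qed

lemma Ck_on_sum:
  assumes "open S" "\<And>i. i \<in> I \<Longrightarrow> Ck_on k S (f i)"
  shows "Ck_on k S (\<lambda>x. \<Sum>i\<in>I. f i x)"
  using assms(2)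
  by (induction I rule: infinite_finite_induct) (auto simp: Ck_on_const Ck_on_add assms(1))

lemma Ck_on_prod:
  fixes f :: "'i \<Rightarrow> 'a::euclidean_space \<Rightarrow> real"
  assumes "open S" "\<And>i. i \<in> I \<Longrightarrow> Ck_on k S (f i)"
  shows "Ck_on k S (\<lambda>x. \<Prod>i\<in>I. f i x)"
  using assms(2)
  by (induction I rule: infinite_finite_induct)
    (auto simp: Ck_on_const assms(1) intro!: Ck_on_bilinear[OF assms(1) bounded_bilinear_mult])

lemma Ck_on_inverse:
  fixes f :: "'a::euclidean_space \<Rightarrow> real"
  assumes "open S" "\<And>x. x \<in> S \<Longrightarrow> f x \<noteq> 0" "Ck_on k S f"
  shows "Ck_on k S (\<lambda>x. inverse (f x))"
  using assms(3)
proof (induction k)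
  case 0 then show ?case using assms(2) by (auto intro: continuous_on_inverse)
next
  case (Suc k)
  show ?case
  proof (rule Ck_on_SucI[where D = "\<lambda>x v. - (inverse (f x) * frechet_derivative f (at x) v * inverse (f x))"])
    show "((\<lambda>x. inverse (f x)) has_derivative
        (\<lambda>v. - (inverse (f x) * frechet_derivative f (at x) v * inverse (f x)))) (at x)" if "x \<in> S" for x
      by (rule Deriv.has_derivative_inverse[OF assms(2)[OF that] Ck_on_SucD[OF Suc.prems that]])
    have "Ck_on k S (\<lambda>x. frechet_derivative f (at x) v)" for v using Suc.prems by simp
    then show "Ck_on k S (\<lambda>x. - (inverse (f x) * frechet_derivative f (at x) v * inverse (f x)))" for v
      using Suc by (intro Ck_on_bounded_linear[OF assms(1) bounded_linear_minus[OF bounded_linear_ident]]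
        Ck_on_bilinear[OF assms(1) bounded_bilinear_mult] Suc.IH Ck_on_pred[of k S f])
  qed (use assms in auto)
qed

lemma Ck_on_Pair:
  assumes "open S" "Ck_on k S f" "Ck_on k S g"
  shows "Ck_on k S (\<lambda>x. (f x, g x))"
  using assms(2,3)
proof (induction k arbitrary: f g)
  case 0 then show ?case by (auto intro: continuous_intros)
next
  case (Suc k)
  note d = Ck_on_SucD[OF Suc.prems(1)] Ck_on_SucD[OF Suc.prems(2)]
  show ?case
    by (rule Ck_on_SucI[OF assms(1), where D = "\<lambda>x v. (frechet_derivative f (at x) v, frechet_derivative g (at x) v)"])
      (use Suc.prems in \<open>auto intro!: has_derivative_Pair d Suc.IH\<close>)
qed

lemma Ck_on_compose:
  fixes f :: "'a::euclidean_space \<Rightarrow> 'b::euclidean_space" and g :: "'b \<Rightarrow> 'c::real_normed_vector"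
  assumes "open S" "open T" "\<And>x. x \<in> S \<Longrightarrow> f x \<in> T" "Ck_on k S f" "Ck_on k T g"
  shows "Ck_on k S (\<lambda>x. g (f x))"
  using assms(4,5)
proof (induction k arbitrary: g)
  case 0
  then show ?case using assms(3) by (auto intro: continuous_on_compose2)
next
  case (Suc k)
  \<comment> \<open>\<open>Ck_on\<close> speaks of fixed directions, but the chain rule evaluates
    the derivative of \<open>g\<close> in the direction Df(x) v, which moves with \<open>x\<close>.
    Expanding that direction in \<open>Basis\<close> leaves finitely many products, and the
    induction hypothesis, stated for arbitrary \<open>g\<close>, applies to each directional
    derivative.\<close>
  let ?D = "\<lambda>x v. \<Sum>b\<in>Basis. (frechet_derivative f (at x) v \<bullet> b) *\<^sub>R frechet_derivative g (at (f x)) b"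
  show ?case
  proof (rule Ck_on_SucI[where D = ?D])
    fix x assume x: "x \<in> S"
    have Df: "(f has_derivative frechet_derivative f (at x)) (at x)"
      and Dg: "(g has_derivative frechet_derivative g (at (f x))) (at (f x))"
      using Ck_on_SucD Suc.prems assms(3) x by blast+
    have lin: "linear (frechet_derivative g (at (f x)))"
      using Dg has_derivative_linear by blast
    have "frechet_derivative g (at (f x)) (frechet_derivative f (at x) v) = ?D x v" for v
    proof -
      have "frechet_derivative g (at (f x)) (frechet_derivative f (at x) v) =
        frechet_derivative g (at (f x)) (\<Sum>b\<in>Basis. (frechet_derivative f (at x) v \<bullet> b) *\<^sub>R b)"
        by (simp add: euclidean_representation)
      then show ?thesis using lin by (simp add: linear_sum linear_scale)
    qed
    then show "((\<lambda>x. g (f x)) has_derivative ?D x) (at x)"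
      using has_derivative_compose[OF Df Dg] by (simp add: o_def)
  next
    fix v
    have "Ck_on k S (\<lambda>x. frechet_derivative g (at (f x)) b)" for b
      using Suc.IH[of "\<lambda>y. frechet_derivative g (at y) b"] Suc.prems Ck_on_pred[of k S f] by simp
    moreover have "Ck_on k S (\<lambda>x. frechet_derivative f (at x) v \<bullet> b)" for b
      using Suc.prems by (intro Ck_on_bounded_linear[OF assms(1) bounded_linear_inner_left]) auto
    ultimately show "Ck_on k S (\<lambda>x. ?D x v)"
      by (intro Ck_on_sum assms(1) Ck_on_bilinear[OF assms(1) bounded_bilinear_scaleR])
  qed (use assms in auto)
qed

lemma smooth_onD: "smooth_on S f \<Longrightarrow> Ck_on k S f"
  by (simp add: smooth_on_def)

lemma smooth_on_imp_continuous_on: "smooth_on S f \<Longrightarrow> continuous_on S f"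
  using Ck_on_imp_continuous_on smooth_onD by blast

lemma smooth_on_has_derivative:
  assumes "smooth_on S f" "x \<in> S"
  shows "(f has_derivative frechet_derivative f (at x)) (at x)"
  using assms Ck_on_SucD smooth_onD by blast

lemma smooth_on_frechet_derivative:
  "smooth_on S f \<Longrightarrow> smooth_on S (\<lambda>x. frechet_derivative f (at x) v)"
  unfolding smooth_on_def by (metis Ck_on.simps(2))

lemma smooth_on_cong:
  "open S \<Longrightarrow> (\<And>x. x \<in> S \<Longrightarrow> f x = g x) \<Longrightarrow> smooth_on S f \<Longrightarrow> smooth_on S g"
  unfolding smooth_on_def using Ck_on_cong by blast

lemma smooth_on_subset: "smooth_on S f \<Longrightarrow> T \<subseteq> S \<Longrightarrow> smooth_on T f"
  unfolding smooth_on_def using Ck_on_subset by blast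

lemma smooth_on_local:
  assumes "\<And>x. x \<in> S \<Longrightarrow> \<exists>T. open T \<and> x \<in> T \<and> smooth_on T f"
  shows "smooth_on S f"
  unfolding smooth_on_def
  by (intro allI Ck_on_local) (use assms smooth_onD in blast)

lemma smooth_on_compose:
  fixes f :: "'a::euclidean_space \<Rightarrow> 'b::euclidean_space" and g :: "'b \<Rightarrow> 'c::real_normed_vector"
  assumes "open S" "open T" "\<And>x. x \<in> S \<Longrightarrow> f x \<in> T" "smooth_on S f" "smooth_on T g"
  shows "smooth_on S (\<lambda>x. g (f x))"
  using assms Ck_on_compose unfolding smooth_on_def by blast

lemma smooth_on_Pair:
  assumes "open S" "smooth_on S f" "smooth_on S g"
  shows "smooth_on S (\<lambda>x. (f x, g x))"
  using assms Ck_on_Pair unfolding smooth_on_def by blast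

lemma smooth_on_bounded_linear_id: "bounded_linear L \<Longrightarrow> open S \<Longrightarrow> smooth_on S L"
  unfolding smooth_on_def using Ck_on_bounded_linear_id by blast

lemma smooth_on_const: "open S \<Longrightarrow> smooth_on S (\<lambda>x. c)"
  unfolding smooth_on_def using Ck_on_const by blast

lemma smooth_on_add:
  "open S \<Longrightarrow> smooth_on S f \<Longrightarrow> smooth_on S g \<Longrightarrow> smooth_on S (\<lambda>x. f x + g x)"
  unfolding smooth_on_def using Ck_on_add by blast

section \<open>Submersions: local straightening and descent of smoothness\<close>

lemma continuous_on_Blinfun_frechet_derivative:
  fixes f :: "'a::euclidean_space \<Rightarrow> 'b::real_normed_vector"
  assumes "smooth_on S f"
  shows "continuous_on S (\<lambda>x. Blinfun (frechet_derivative f (at x)))"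
proof (rule continuous_on_blinfun_componentwise)
  fix i :: 'a
  have "blinfun_apply (Blinfun (frechet_derivative f (at x))) i = frechet_derivative f (at x) i"
    if "x \<in> S" for x
    using smooth_on_has_derivative[OF assms that] has_derivative_bounded_linear
    by (metis bounded_linear_Blinfun_apply)
  moreover have "continuous_on S (\<lambda>x. frechet_derivative f (at x) i)"
    using smooth_on_frechet_derivative[OF assms] smooth_on_imp_continuous_on by blast
  ultimately show "continuous_on S (\<lambda>x. blinfun_apply (Blinfun (frechet_derivative f (at x))) i)"
    by (simp cong: continuous_on_cong)
qed

text \<open>With \<open>R\<close> a right inverse of \<open>P\<close>, the map
  \<open>F x = x - R (P (x - x0)) + R (p x - p x0)\<close> has the identity as derivative at
  \<open>x0\<close> and satisfies \<open>P (F x - x0) = p x - p x0\<close>. Its local inverse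
  \<open>g\<close> therefore turns \<open>p\<close> into an affine map.\<close>

lemma submersion_straighten:
  fixes p :: "'a::euclidean_space \<Rightarrow> 'b::euclidean_space"
  assumes S: "open S" and p: "smooth_on S p" and x0: "x0 \<in> S"
    and surj: "surj (frechet_derivative p (at x0))"
  obtains V g where "open V" "x0 \<in> V" "g x0 = x0" "(g has_derivative (\<lambda>v. v)) (at x0)"
    "\<And>\<xi>. \<xi> \<in> V \<Longrightarrow> g \<xi> \<in> S \<and> p (g \<xi>) = p x0 + frechet_derivative p (at x0) (\<xi> - x0)"
    "continuous_on V g"
proof -
  define P where "P = frechet_derivative p (at x0)"
  have Pd: "(p has_derivative P) (at x0)" unfolding P_def by (rule smooth_on_has_derivative[OF p x0])
  then have linP: "linear P" using has_derivative_linear by blast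
  obtain R where R: "linear R" "P \<circ> R = id"
    using linear_surjective_right_inverse[OF linP] surj unfolding P_def by blast
  then have PR: "P (R y) = y" for y by (metis comp_apply id_apply)
  have blP: "bounded_linear P" and blR: "bounded_linear R"
    using linP R linear_conv_bounded_linear by auto
  define F where "F = (\<lambda>x. x - R (P (x - x0)) + R (p x - p x0))"
  define D where "D = (\<lambda>x v. v - R (P v) + R (frechet_derivative p (at x) v))"
  have DF: "(F has_derivative D x) (at x)" if "x \<in> S" for x
    unfolding F_def D_def
    using smooth_on_has_derivative[OF p that]
    by (auto intro!: derivative_eq_intros bounded_linear.has_derivative[OF blR] bounded_linear.has_derivative[OF blP])
  have blD: "bounded_linear (D x)" if "x \<in> S" for x
    using DF[OF that] has_derivative_bounded_linear by blast
  have cont: "continuous_on S (\<lambda>x. Blinfun (D x))"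
  proof (rule continuous_on_blinfun_componentwise)
    fix i :: 'a
    have "continuous_on S (\<lambda>x. D x i)"
      unfolding D_def
      by (intro continuous_intros bounded_linear.continuous_on[OF blR]
        smooth_on_imp_continuous_on[OF smooth_on_frechet_derivative[OF p]])
    then show "continuous_on S (\<lambda>x. blinfun_apply (Blinfun (D x)) i)"
      using blD by (simp add: bounded_linear_Blinfun_apply cong: continuous_on_cong)
  qed
  have D0: "D x0 = (\<lambda>v. v)" unfolding D_def P_def[symmetric] by auto
  have F0: "F x0 = x0" using R linP by (simp add: F_def linear_0)
  have "id_blinfun o\<^sub>L Blinfun (D x0) = id_blinfun"
    by (rule blinfun_eqI) (simp add: D0 bounded_linear_Blinfun_apply bounded_linear_ident)
  then obtain U' V g g' where *: "open U'" "U' \<subseteq> S" "x0 \<in> U'" "open V" "F x0 \<in> V"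
    "homeomorphism U' V F g"
    "\<And>y. y \<in> V \<Longrightarrow> (g has_derivative g' y) (at y)"
    "\<And>y. y \<in> V \<Longrightarrow> g' y = inv_into UNIV (blinfun_apply (Blinfun (D (g y))))"
    using inverse_function_theorem[OF S _ cont x0, of F id_blinfun] DF blD
    by (metis bounded_linear_Blinfun_apply)
  have g0: "g x0 = x0" using *(3,5,6) F0 by (metis homeomorphism_apply1)
  have "g' x0 = (\<lambda>v. v)"
    using *(5) *(8)[of x0] F0 g0 blD[OF x0] D0 by (simp add: bounded_linear_Blinfun_apply inv_into_def fun_eq_iff)
  then have gd: "(g has_derivative (\<lambda>v. v)) (at x0)" using *(5,7) F0 by metis
  have "g \<xi> \<in> S \<and> p (g \<xi>) = p x0 + P (\<xi> - x0)" if "\<xi> \<in> V" for \<xi>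
  proof
    have gU: "g \<xi> \<in> U'" and Fg: "F (g \<xi>) = \<xi>"
      using *(6) that by (auto simp: homeomorphism_def)
    show "g \<xi> \<in> S" using gU *(2) by blast
    have "P (\<xi> - x0) = P (F (g \<xi>) - x0)" using Fg by simp
    also have "\<dots> = p (g \<xi>) - p x0"
      unfolding F_def by (simp add: linear_diff[OF linP] linear_add[OF linP] PR)
    finally show "p (g \<xi>) = p x0 + P (\<xi> - x0)" by simp
  qed
  moreover have "continuous_on V g" using *(6) by (simp add: homeomorphism_def)
  ultimately show ?thesis using that[of V g] *(4,5) F0 g0 gd unfolding P_def by simp
qed

text \<open>A local section of \<open>p\<close> yields continuity and differentiability of \<eta>,
  but the section is known to be differentiable at a single point only. Higher order comes from the
  linear equation D\<eta>(p x) (Dp(x) w) = D(\<eta> o p)(x) w, whose right side is C^k: solving it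
  for D\<eta>(p x) v keeps the regularity, and the induction hypothesis is applied to the derivative
  of \<eta>.\<close>

lemma Ck_on_descend_submersion:
  fixes p :: "'a::euclidean_space \<Rightarrow> real^'m" and \<eta> :: "real^'m \<Rightarrow> 'c::real_normed_vector"
  assumes S: "open S" and p: "smooth_on S p"
    and surj: "\<And>x. x \<in> S \<Longrightarrow> surj (frechet_derivative p (at x))"
    and c: "Ck_on k S (\<lambda>x. \<eta> (p x))"
  shows "Ck_on k (p ` S) \<eta>"
  using c
proof (induction k arbitrary: \<eta>)
  case 0
  have "isCont \<eta> (p x)" if x: "x \<in> S" for x
  proof -
    define P where "P = frechet_derivative p (at x)"
    have linP: "linear P" using smooth_on_has_derivative[OF p x] has_derivative_linear P_def by blast
    obtain R where R: "linear R" "P \<circ> R = id"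
      using linear_surjective_right_inverse[OF linP] surj[OF x] unfolding P_def by blast
    obtain V g where g: "open V" "x \<in> V" "g x = x" "continuous_on V g"
      "\<And>\<xi>. \<xi> \<in> V \<Longrightarrow> g \<xi> \<in> S \<and> p (g \<xi>) = p x + P (\<xi> - x)"
      using submersion_straighten[OF S p x surj[OF x]] unfolding P_def by metis
    define s where "s = (\<lambda>y. x + R (y - p x))"
    define W where "W = s -` V"
    have "continuous_on UNIV s" unfolding s_def
      by (intro continuous_intros linear_continuous_on_compose[OF _ R(1)])
    then have W: "open W" "p x \<in> W"
      using g(1,2) R(1) by (auto simp: W_def s_def linear_0 continuous_on_open_vimage)
    have "\<eta> (p (g (s y))) = \<eta> y" if "y \<in> W" for y
    proof -
      have "P (s y - x) = y - p x" using R(2) by (simp add: s_def fun_eq_iff)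
      then show ?thesis using g(5)[of "s y"] that by (simp add: W_def)
    qed
    moreover have "continuous_on W (\<lambda>y. \<eta> (p (g (s y))))"
    proof (rule continuous_on_compose2[of S "\<lambda>x. \<eta> (p x)"])
      show "continuous_on W (\<lambda>y. g (s y))"
        using continuous_on_compose2[OF g(4) continuous_on_subset[OF \<open>continuous_on UNIV s\<close>], of W]
        by (auto simp: W_def)
    qed (use 0 g(5) in \<open>auto simp: W_def\<close>)
    ultimately have "continuous_on W \<eta>" using continuous_on_eq[of W "\<lambda>y. \<eta> (p (g (s y)))" \<eta>] by simp
    then show ?thesis using W by (simp add: continuous_on_eq_continuous_at)
  qed
  then show ?case by (auto intro!: continuous_at_imp_continuous_on)
next
  case (Suc k)
  define D where "D = (\<lambda>y. frechet_derivative \<eta> (at y))"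
  have diff: "(\<eta> has_derivative D (p x)) (at (p x))" if x: "x \<in> S" for x
  proof -
    define P where "P = frechet_derivative p (at x)"
    have linP: "linear P" using smooth_on_has_derivative[OF p x] has_derivative_linear P_def by blast
    obtain R where R: "linear R" "P \<circ> R = id"
      using linear_surjective_right_inverse[OF linP] surj[OF x] unfolding P_def by blast
    obtain V g where g: "open V" "x \<in> V" "g x = x" "(g has_derivative (\<lambda>v. v)) (at x)"
      "\<And>\<xi>. \<xi> \<in> V \<Longrightarrow> g \<xi> \<in> S \<and> p (g \<xi>) = p x + P (\<xi> - x)"
      using submersion_straighten[OF S p x surj[OF x]] unfolding P_def by metis
    define s where "s = (\<lambda>y. x + R (y - p x))"
    define W where "W = s -` V"
    have "continuous_on UNIV s" unfolding s_def
      by (intro continuous_intros linear_continuous_on_compose[OF _ R(1)])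
    then have W: "open W" "p x \<in> W"
      using g(1,2) R(1) by (auto simp: W_def s_def linear_0 continuous_on_open_vimage)
    have eq: "\<eta> (p (g (s y))) = \<eta> y" if "y \<in> W" for y
    proof -
      have "P (s y - x) = y - p x" using R(2) by (simp add: s_def fun_eq_iff)
      then show ?thesis using g(5)[of "s y"] that by (simp add: W_def)
    qed
    have sx: "s (p x) = x" using R(1) by (simp add: s_def linear_0)
    have "(s has_derivative R) (at (p x))"
    proof -
      have "bounded_linear R" using R(1) linear_conv_bounded_linear by blast
      then have "((\<lambda>y. R (y - p x)) has_derivative R) (at (p x))"
        by (rule bounded_linear.has_derivative) (auto intro!: derivative_eq_intros)
      then show ?thesis
        unfolding s_def using has_derivative_add[OF has_derivative_const[of x]] by fastforce
    qed
    then have "((\<lambda>y. g (s y)) has_derivative R) (at (p x))"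
      using has_derivative_compose[of s R "p x" UNIV g "\<lambda>v. v"] g(4) sx by simp
    then have "((\<lambda>y. \<eta> (p (g (s y)))) has_derivative
        (\<lambda>v. frechet_derivative (\<lambda>x. \<eta> (p x)) (at x) (R v))) (at (p x))"
      using has_derivative_compose[of "\<lambda>y. g (s y)" R "p x" UNIV "\<lambda>x. \<eta> (p x)"]
        Ck_on_SucD[OF Suc.prems x] sx g(3) by simp
    then have "\<eta> differentiable (at (p x))"
      using has_derivative_transform_within_open[OF _ W] eq unfolding differentiable_def by blast
    then show ?thesis unfolding D_def by (simp add: frechet_derivative_works)
  qed
  have chain: "frechet_derivative (\<lambda>x. \<eta> (p x)) (at x) w = D (p x) (frechet_derivative p (at x) w)"
    if x: "x \<in> S" for x w
    using has_derivative_compose[OF smooth_on_has_derivative[OF p x] diff[OF x]] frechet_derivative_at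
    by metis
  have "Ck_on k S (\<lambda>x. D (p x) v)" for v
  proof (rule Ck_on_local)
    fix x0 assume x0: "x0 \<in> S"
    define P where "P = frechet_derivative p (at x0)"
    have linP: "linear P" using smooth_on_has_derivative[OF p x0] has_derivative_linear P_def by blast
    obtain R where R: "linear R" "P \<circ> R = id"
      using linear_surjective_right_inverse[OF linP] surj[OF x0] unfolding P_def by blast
    \<comment> \<open>The matrix of Dp(x) on the range of \<open>R\<close>. It is the identity at
      \<open>x0\<close>, hence invertible near \<open>x0\<close>, and Cramer's rule gives a solution
      \<open>a\<close> of \<open>M x *v a x = v\<close> with C^k entries.\<close>
    define M :: "'a \<Rightarrow> real^'m^'m" where "M = (\<lambda>x. \<chi> i j. frechet_derivative p (at x) (R (axis j 1)) $ i)"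
    have Mk: "Ck_on k S (\<lambda>x. M x $ i $ j)" for i j
      unfolding M_def
      using Ck_on_bounded_linear[OF S bounded_linear_vec_nth smooth_onD[OF smooth_on_frechet_derivative[OF p]]]
      by simp
    have det_k: "Ck_on k S (\<lambda>x. det (N x))" if "\<And>i j. Ck_on k S (\<lambda>x. N x $ i $ j)" for N :: "'a \<Rightarrow> real^'m^'m"
      unfolding det_def
      by (intro Ck_on_sum[OF S] Ck_on_bilinear[OF S bounded_bilinear_mult] Ck_on_prod[OF S] that Ck_on_const[OF S])
    define W where "W = {x \<in> S. det (M x) \<noteq> 0}"
    have "W = S \<inter> (\<lambda>x. det (M x)) -` (- {0})" by (auto simp: W_def)
    then have W: "open W" "W \<subseteq> S"
      using continuous_open_preimage[OF Ck_on_imp_continuous_on[OF det_k[OF Mk]] S, of "-{0}"] by auto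
    have "M x0 = mat 1"
      using R(2) by (auto simp: M_def mat_def vec_eq_iff fun_eq_iff P_def axis_def)
    then have "x0 \<in> W" using x0 by (simp add: W_def)
    define a where "a = (\<lambda>x. \<chi> k. det (\<chi> i j. if j = k then v $ i else M x $ i $ j) / det (M x))"
    have Ma: "M x *v a x = v" if "x \<in> W" for x
      using cramer[of "M x" "a x" v] that by (simp add: W_def a_def)
    have ak: "Ck_on k W (\<lambda>x. a x $ l)" for l
    proof -
      have "Ck_on k S (\<lambda>x. det (\<chi> i j. if j = l then v $ i else M x $ i $ j))"
        by (rule det_k, rename_tac i j, case_tac "j = l") (simp_all add: Mk Ck_on_const[OF S])
      then have "Ck_on k W (\<lambda>x. det (\<chi> i j. if j = l then v $ i else M x $ i $ j))"
        using Ck_on_subset W(2) by blast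
      moreover have "Ck_on k W (\<lambda>x. inverse (det (M x)))"
        by (rule Ck_on_inverse[OF W(1) _ Ck_on_subset[OF det_k[OF Mk] W(2)]]) (simp add: W_def)
      ultimately have "Ck_on k W (\<lambda>x. det (\<chi> i j. if j = l then v $ i else M x $ i $ j) * inverse (det (M x)))"
        by (rule Ck_on_bilinear[OF W(1) bounded_bilinear_mult])
      then show ?thesis by (simp add: a_def divide_inverse)
    qed
    have e1: "D (p x) v = (\<Sum>l\<in>UNIV. a x $ l *\<^sub>R frechet_derivative (\<lambda>x. \<eta> (p x)) (at x) (R (axis l 1)))"
      if x: "x \<in> W" for x
    proof -
      have xS: "x \<in> S" using x W by blast
      have lD: "linear (D (p x))" using diff[OF xS] has_derivative_linear by blast
      have "v = (\<Sum>l\<in>UNIV. a x $ l *\<^sub>R frechet_derivative p (at x) (R (axis l 1)))"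
        using Ma[OF x] by (simp add: vec_eq_iff matrix_vector_mult_def M_def mult.commute)
      then have "D (p x) v = D (p x) (\<Sum>l\<in>UNIV. a x $ l *\<^sub>R frechet_derivative p (at x) (R (axis l 1)))"
        by simp
      then show ?thesis using chain[OF xS] by (simp add: linear_sum[OF lD] linear_scale[OF lD])
    qed
    have e2: "Ck_on k W (\<lambda>x. \<Sum>l\<in>UNIV. a x $ l *\<^sub>R frechet_derivative (\<lambda>x. \<eta> (p x)) (at x) (R (axis l 1)))"
      by (intro Ck_on_sum[OF W(1)] Ck_on_bilinear[OF W(1) bounded_bilinear_scaleR] ak)
        (use Suc.prems Ck_on_subset[OF _ W(2)] in auto)
    have "Ck_on k W (\<lambda>x. D (p x) v)"
      by (rule Ck_on_cong[OF W(1) e1[symmetric] e2])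
    then show "\<exists>T. open T \<and> x0 \<in> T \<and> Ck_on k T (\<lambda>x. D (p x) v)"
      using W(1) \<open>x0 \<in> W\<close> by blast
  qed
  then have "Ck_on k (p ` S) (\<lambda>y. frechet_derivative \<eta> (at y) v)" for v
    unfolding D_def by (rule Suc.IH)
  moreover have "\<eta> differentiable (at y)" if "y \<in> p ` S" for y
    using that diff unfolding differentiable_def by blast
  ultimately show ?case by simp
qed

section \<open>Smooth maps between manifolds\<close>

text \<open>Compatibility of charts is left out, so that products of atlases qualify without further
  proof. The empty atlas that stands for a discrete space is excluded as soon as the space is
  nonempty.\<close>

definition atlas_on :: "'a topology \<Rightarrow> ('a, 'e::euclidean_space) chart set \<Rightarrow> bool" where
  "atlas_on X A \<longleftrightarrow> (\<forall>c\<in>A. is_chart X c) \<and> (\<Union>(U, \<phi>)\<in>A. U) = topspace X"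

lemma chart_subset: "is_chart X (U, \<phi>) \<Longrightarrow> U \<subseteq> topspace X"
  by (auto simp: is_chart_def dest: openin_subset)

lemma chart_openin: "is_chart X (U, \<phi>) \<Longrightarrow> openin X U"
  by (auto simp: is_chart_def)

lemma chart_open: "is_chart X (U, \<phi>) \<Longrightarrow> open (\<phi> ` U)"
  by (auto simp: is_chart_def)

lemma chart_homeomorphic:
  "is_chart X (U, \<phi>) \<Longrightarrow> homeomorphic_map (subtopology X U) (top_of_set (\<phi> ` U)) \<phi>"
  by (simp add: is_chart_def)

lemma topspace_chart: "is_chart X (U, \<phi>) \<Longrightarrow> topspace (subtopology X U) = U"
  using chart_subset[of X U \<phi>] by (simp add: inf.absorb2)

lemma chart_inj: "is_chart X (U, \<phi>) \<Longrightarrow> inj_on \<phi> U"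
  using homeomorphic_imp_injective_map[OF chart_homeomorphic, of X U \<phi>] topspace_chart[of X U \<phi>]
  by simp

lemma chart_inv: "is_chart X (U, \<phi>) \<Longrightarrow> a \<in> U \<Longrightarrow> inv_into U \<phi> (\<phi> a) = a"
  using chart_inj inv_into_f_f by metis

lemma chart_continuous: "is_chart X (U, \<phi>) \<Longrightarrow> continuous_map (subtopology X U) euclidean \<phi>"
  using homeomorphic_imp_continuous_map[OF chart_homeomorphic, of X U \<phi>]
  by (simp add: continuous_map_in_subtopology)

lemma chart_preimage_open:
  assumes "is_chart X (U, \<phi>)" "open S"
  shows "openin X {a \<in> U. \<phi> a \<in> S}"
proof -
  have "openin (subtopology X U) {a \<in> topspace (subtopology X U). \<phi> a \<in> S}"
    by (rule openin_continuous_map_preimage[OF chart_continuous[OF assms(1)]]) (use assms(2) in simp)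
  then have "openin (subtopology X U) {a \<in> U. \<phi> a \<in> S}"
    unfolding topspace_chart[OF assms(1)] .
  then show ?thesis
    using openin_trans_full[OF _ chart_openin[OF assms(1)]] by blast
qed

lemma chart_image_open:
  assumes "is_chart X (U, \<phi>)" "openin X W" "W \<subseteq> U"
  shows "open (\<phi> ` W)"
proof -
  have "open_map (subtopology X U) (top_of_set (\<phi> ` U)) \<phi>"
    by (rule homeomorphic_imp_open_map[OF chart_homeomorphic[OF assms(1)]])
  moreover have "openin (subtopology X U) W"
    using assms(2,3) by (auto simp: openin_subtopology)
  ultimately have "openin (top_of_set (\<phi> ` U)) (\<phi> ` W)" by (simp add: open_map_def)
  then show ?thesis using chart_open[OF assms(1)] openin_open_eq by blast
qed

lemma chart_inv_continuous:
  assumes "is_chart X (U, \<phi>)"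
  shows "continuous_map (top_of_set (\<phi> ` U)) X (inv_into U \<phi>)"
  unfolding continuous_map_def
proof (intro conjI ballI allI impI)
  show "inv_into U \<phi> \<in> topspace (top_of_set (\<phi> ` U)) \<rightarrow> topspace X"
    using chart_subset[OF assms] chart_inv[OF assms] by auto
  fix W assume W: "openin X W"
  have "{x \<in> \<phi> ` U. inv_into U \<phi> x \<in> W} = \<phi> ` (U \<inter> W)"
    using chart_inv[OF assms] by auto
  moreover have "open (\<phi> ` (U \<inter> W))"
    using chart_image_open[OF assms] W chart_openin[OF assms] by auto
  ultimately show "openin (top_of_set (\<phi> ` U)) {x \<in> topspace (top_of_set (\<phi> ` U)). inv_into U \<phi> x \<in> W}"
    using openin_open_eq[OF chart_open[OF assms]] by auto
qed

lemma smooth_manifold_atlas_on: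
  "smooth_manifold X A \<Longrightarrow> A \<noteq> {} \<Longrightarrow> atlas_on X A"
  unfolding smooth_manifold_def atlas_on_def by blast

lemma atlas_onE:
  assumes "atlas_on X A" "x \<in> topspace X"
  obtains U \<phi> where "(U, \<phi>) \<in> A" "is_chart X (U, \<phi>)" "x \<in> U"
  using assms unfolding atlas_on_def by blast

lemma smooth_mapI:
  assumes "continuous_map X Y F"
    and "\<And>U \<phi> V \<psi>. (U, \<phi>) \<in> A \<Longrightarrow> (V, \<psi>) \<in> B \<Longrightarrow>
      smooth_on (\<phi> ` {a \<in> U. F a \<in> V}) (\<lambda>x. \<psi> (F (inv_into U \<phi> x)))"
  shows "smooth_map X A Y B F"
  using assms by (auto simp: smooth_map_def)

lemma smooth_map_chart:
  assumes "smooth_map X A Y B F" "(U, \<phi>) \<in> A" "is_chart X (U, \<phi>)" "(V, \<psi>) \<in> B" "is_chart Y (V, \<psi>)"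
  shows "openin X {a \<in> U. F a \<in> V}" "open (\<phi> ` {a \<in> U. F a \<in> V})"
    "smooth_on (\<phi> ` {a \<in> U. F a \<in> V}) (\<lambda>x. \<psi> (F (inv_into U \<phi> x)))"
proof -
  have c: "continuous_map X Y F" using assms(1) by (simp add: smooth_map_def)
  have "openin X (U \<inter> {a \<in> topspace X. F a \<in> V})"
    using openin_continuous_map_preimage[OF c chart_openin[OF assms(5)]] chart_openin[OF assms(3)] by blast
  moreover have "U \<inter> {a \<in> topspace X. F a \<in> V} = {a \<in> U. F a \<in> V}"
    using chart_subset[OF assms(3)] by auto
  ultimately show o: "openin X {a \<in> U. F a \<in> V}" by simp
  show "open (\<phi> ` {a \<in> U. F a \<in> V})" by (rule chart_image_open[OF assms(3) o]) auto
  show "smooth_on (\<phi> ` {a \<in> U. F a \<in> V}) (\<lambda>x. \<psi> (F (inv_into U \<phi> x)))"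
    using assms(1,2,4) by (auto simp: smooth_map_def)
qed

lemma smooth_map_compose:
  assumes X: "atlas_on X A" and Y: "atlas_on Y B" and Z: "atlas_on Z C"
    and F: "smooth_map X A Y B F" and G: "smooth_map Y B Z C G"
  shows "smooth_map X A Z C (\<lambda>x. G (F x))"
  unfolding smooth_map_def
proof safe
  have cF: "continuous_map X Y F" and cG: "continuous_map Y Z G"
    using F G by (auto simp: smooth_map_def)
  then show cGF: "continuous_map X Z (\<lambda>x. G (F x))"
    using continuous_map_compose by (fastforce simp: o_def)
  fix U \<phi> W \<xi> assume U: "(U, \<phi>) \<in> A" and W: "(W, \<xi>) \<in> C"
  then have Uc: "is_chart X (U, \<phi>)" and Wc: "is_chart Z (W, \<xi>)"
    using X Z by (auto simp: atlas_on_def)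
  show "smooth_on (\<phi> ` {a \<in> U. G (F a) \<in> W}) (\<lambda>x. \<xi> (G (F (inv_into U \<phi> x))))"
  proof (rule smooth_on_local)
    fix x assume "x \<in> \<phi> ` {a \<in> U. G (F a) \<in> W}"
    then obtain a where a: "a \<in> U" "G (F a) \<in> W" "x = \<phi> a" by blast
    have "F a \<in> topspace Y"
      using cF a(1) chart_subset[OF Uc] by (meson continuous_map_def funcset_mem subsetD)
    then obtain V \<psi> where V: "(V, \<psi>) \<in> B" "is_chart Y (V, \<psi>)" "F a \<in> V"
      using atlas_onE[OF Y] by metis
    note f = smooth_map_chart[OF F U Uc V(1,2)]
    note g = smooth_map_chart[OF G V(1,2) W Wc]
    let ?T = "\<phi> ` {a \<in> U. F a \<in> V \<and> G (F a) \<in> W}"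
    have "openin X ({a \<in> U. F a \<in> V} \<inter> {a \<in> topspace X. G (F a) \<in> W})"
      using openin_continuous_map_preimage[OF cGF chart_openin[OF Wc]] f(1) by blast
    moreover have "{a \<in> U. F a \<in> V} \<inter> {a \<in> topspace X. G (F a) \<in> W} = {a \<in> U. F a \<in> V \<and> G (F a) \<in> W}"
      using chart_subset[OF Uc] by auto
    ultimately have oT: "open ?T" by (intro chart_image_open[OF Uc]) auto
    have "smooth_on ?T (\<lambda>x. \<xi> (G (inv_into V \<psi> (\<psi> (F (inv_into U \<phi> x))))))"
      by (rule smooth_on_compose[OF oT g(2) _ smooth_on_subset[OF f(3)] g(3)])
        (use chart_inv[OF Uc] in auto)
    then have "smooth_on ?T (\<lambda>x. \<xi> (G (F (inv_into U \<phi> x))))"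
      by (rule smooth_on_cong[OF oT, rotated])
        (use chart_inv[OF Uc] chart_inv[OF V(2)] in auto)
    then show "\<exists>T. open T \<and> x \<in> T \<and> smooth_on T (\<lambda>x. \<xi> (G (F (inv_into U \<phi> x))))"
      using oT a V(3) by blast
  qed
qed

lemma inv_into_map_prod:
  assumes "inj_on \<phi> U" "inj_on \<psi> V" "a \<in> U" "b \<in> V"
  shows "inv_into (U \<times> V) (map_prod \<phi> \<psi>) (\<phi> a, \<psi> b) = (a, b)"
  using inv_into_f_f[OF map_prod_inj_on[OF assms(1,2)], of "(a, b)"] assms(3,4) by simp

lemma is_chart_prod:
  assumes "is_chart X (U, \<phi>)" "is_chart Y (V, \<psi>)"
  shows "is_chart (prod_topology X Y) (U \<times> V, map_prod \<phi> \<psi>)"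
proof -
  obtain g h where "homeomorphic_maps (subtopology X U) (top_of_set (\<phi> ` U)) \<phi> g"
    "homeomorphic_maps (subtopology Y V) (top_of_set (\<psi> ` V)) \<psi> h"
    using assms by (auto simp: is_chart_def homeomorphic_map_maps)
  then have "homeomorphic_maps (prod_topology (subtopology X U) (subtopology Y V))
      (prod_topology (top_of_set (\<phi> ` U)) (top_of_set (\<psi> ` V)))
      (\<lambda>(x, y). (\<phi> x, \<psi> y)) (\<lambda>(x, y). (g x, h y))"
    by (simp add: homeomorphic_maps_prod del: prod_topology_subtopology_eu)
  moreover have "map_prod \<phi> \<psi> = (\<lambda>(x, y). (\<phi> x, \<psi> y))" by auto
  moreover have "map_prod \<phi> \<psi> ` (U \<times> V) = \<phi> ` U \<times> \<psi> ` V" by (auto simp: map_prod_def image_iff) 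
  ultimately show ?thesis
    using assms unfolding is_chart_def
    by (auto simp: homeomorphic_map_maps subtopology_Times openin_prod_Times_iff open_Times)
qed

lemma atlas_on_prod:
  assumes "atlas_on X A" "atlas_on Y B"
  shows "atlas_on (prod_topology X Y) (prod_atlas A B)"
  unfolding atlas_on_def
proof
  show "\<forall>c\<in>prod_atlas A B. is_chart (prod_topology X Y) c"
    using assms is_chart_prod unfolding atlas_on_def prod_atlas_def by fast
  have "(\<Union>(U, \<phi>)\<in>prod_atlas A B. U) = (\<Union>(U, \<phi>)\<in>A. U) \<times> (\<Union>(U, \<phi>)\<in>B. U)"
    unfolding prod_atlas_def by (auto; force)
  then show "(\<Union>(U, \<phi>)\<in>prod_atlas A B. U) = topspace (prod_topology X Y)"
    using assms unfolding atlas_on_def by simp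
qed

lemma smooth_map_Pair:
  assumes X: "atlas_on X A" and Y: "atlas_on Y B" and Z: "atlas_on Z C"
    and F: "smooth_map X A Y B F" and G: "smooth_map X A Z C G"
  shows "smooth_map X A (prod_topology Y Z) (prod_atlas B C) (\<lambda>x. (F x, G x))"
proof (rule smooth_mapI)
  show "continuous_map X (prod_topology Y Z) (\<lambda>x. (F x, G x))"
    using F G by (auto simp: smooth_map_def continuous_map_paired)
  fix U \<phi> VW \<psi>\<xi> assume cA: "(U, \<phi>) \<in> A" and d: "(VW, \<psi>\<xi>) \<in> prod_atlas B C"
  have Uc: "is_chart X (U, \<phi>)" using X cA by (auto simp: atlas_on_def)
  from d obtain V \<psi> W \<xi> where V: "(V, \<psi>) \<in> B" and W: "(W, \<xi>) \<in> C" and d: "VW = V \<times> W" "\<psi>\<xi> = map_prod \<psi> \<xi>"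
    unfolding prod_atlas_def by auto
  have Vc: "is_chart Y (V, \<psi>)" and Wc: "is_chart Z (W, \<xi>)"
    using V W Y Z by (auto simp: atlas_on_def)
  note f = smooth_map_chart[OF F cA Uc V Vc]
  note g = smooth_map_chart[OF G cA Uc W Wc]
  let ?T = "\<phi> ` {a \<in> U. (F a, G a) \<in> V \<times> W}"
  have "openin X ({a \<in> U. F a \<in> V} \<inter> {a \<in> U. G a \<in> W})" using f(1) g(1) by blast
  moreover have "{a \<in> U. F a \<in> V} \<inter> {a \<in> U. G a \<in> W} = {a \<in> U. (F a, G a) \<in> V \<times> W}" by auto
  ultimately have oT: "open ?T" by (intro chart_image_open[OF Uc]) auto
  have "smooth_on ?T (\<lambda>x. (\<psi> (F (inv_into U \<phi> x)), \<xi> (G (inv_into U \<phi> x))))"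
    by (intro smooth_on_Pair[OF oT] smooth_on_subset[OF f(3)] smooth_on_subset[OF g(3)]) auto
  then show "smooth_on (\<phi> ` {a \<in> U. (F a, G a) \<in> VW}) (\<lambda>x. \<psi>\<xi> (F (inv_into U \<phi> x), G (inv_into U \<phi> x)))"
    by (simp add: d)
qed

lemma smooth_map_id:
  assumes "smooth_manifold X A"
  shows "smooth_map X A X A (\<lambda>x. x)"
proof -
  have "{a \<in> U. a \<in> V} = U \<inter> V" for U V :: "'a set" by auto
  then show ?thesis using assms unfolding smooth_map_def smooth_manifold_def by auto
qed

lemma smooth_map_const:
  assumes "c \<in> topspace Y" "atlas_on X A"
  shows "smooth_map X A Y B (\<lambda>x. c)"
  unfolding smooth_map_def
proof safe
  fix U V \<phi> \<psi> assume U: "(U, \<phi>) \<in> A"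
  then have Uc: "is_chart X (U, \<phi>)" using assms by (auto simp: atlas_on_def)
  have "open (\<phi> ` {a \<in> U. c \<in> V})"
    using chart_open[OF Uc] by (cases "c \<in> V") auto
  then show "smooth_on (\<phi> ` {a \<in> U. c \<in> V}) (\<lambda>x. \<psi> c)" by (rule smooth_on_const)
qed (use assms in auto)

lemma smooth_map_fst_snd:
  assumes X: "smooth_manifold X A" "A \<noteq> {}" and Y: "smooth_manifold Y B" "B \<noteq> {}"
  shows "smooth_map (prod_topology X Y) (prod_atlas A B) X A fst"
    and "smooth_map (prod_topology X Y) (prod_atlas A B) Y B snd"
proof -
  have aX: "atlas_on X A" and aY: "atlas_on Y B"
    using X Y smooth_manifold_atlas_on by auto
  show "smooth_map (prod_topology X Y) (prod_atlas A B) X A fst"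
  proof (rule smooth_mapI)
    fix UV \<phi>\<psi> W \<xi> assume c: "(UV, \<phi>\<psi>) \<in> prod_atlas A B" and d: "(W, \<xi>) \<in> A"
    from c obtain U \<phi> V \<psi> where U: "(U, \<phi>) \<in> A" and V: "(V, \<psi>) \<in> B" and c: "UV = U \<times> V" "\<phi>\<psi> = map_prod \<phi> \<psi>"
      unfolding prod_atlas_def by auto
    have Uc: "is_chart X (U, \<phi>)" and Vc: "is_chart Y (V, \<psi>)" and Wc: "is_chart X (W, \<xi>)"
      using U V d aX aY by (auto simp: atlas_on_def)
    note f = smooth_map_chart[OF smooth_map_id[OF X(1)] U Uc d Wc]
    have eq: "map_prod \<phi> \<psi> ` {a \<in> U \<times> V. fst a \<in> W} = \<phi> ` {a \<in> U. a \<in> W} \<times> \<psi> ` V"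
      by (auto simp: map_prod_def image_iff split: prod.splits)
    have o: "open (\<phi> ` {a \<in> U. a \<in> W} \<times> \<psi> ` V)"
      using f(2) chart_open[OF Vc] by (rule open_Times)
    have "smooth_on (\<phi> ` {a \<in> U. a \<in> W} \<times> \<psi> ` V) (\<lambda>x. \<xi> (inv_into U \<phi> (fst x)))"
      by (rule smooth_on_compose[OF o f(2) _ smooth_on_bounded_linear_id[OF bounded_linear_fst o] f(3)]) auto
    then have "smooth_on (\<phi> ` {a \<in> U. a \<in> W} \<times> \<psi> ` V) (\<lambda>x. \<xi> (fst (inv_into (U \<times> V) (map_prod \<phi> \<psi>) x)))"
      by (rule smooth_on_cong[OF o, rotated])
        (auto simp: inv_into_map_prod[OF chart_inj[OF Uc] chart_inj[OF Vc]] chart_inv[OF Uc])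
    then show "smooth_on (\<phi>\<psi> ` {a \<in> UV. fst a \<in> W}) (\<lambda>x. \<xi> (fst (inv_into UV \<phi>\<psi> x)))"
      by (simp add: c eq)
  qed (simp add: continuous_map_fst)
  show "smooth_map (prod_topology X Y) (prod_atlas A B) Y B snd"
  proof (rule smooth_mapI)
    fix UV \<phi>\<psi> W \<xi> assume c: "(UV, \<phi>\<psi>) \<in> prod_atlas A B" and d: "(W, \<xi>) \<in> B"
    from c obtain U \<phi> V \<psi> where U: "(U, \<phi>) \<in> A" and V: "(V, \<psi>) \<in> B" and c: "UV = U \<times> V" "\<phi>\<psi> = map_prod \<phi> \<psi>"
      unfolding prod_atlas_def by auto
    have Uc: "is_chart X (U, \<phi>)" and Vc: "is_chart Y (V, \<psi>)" and Wc: "is_chart Y (W, \<xi>)"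
      using U V d aX aY by (auto simp: atlas_on_def)
    note f = smooth_map_chart[OF smooth_map_id[OF Y(1)] V Vc d Wc]
    have eq: "map_prod \<phi> \<psi> ` {a \<in> U \<times> V. snd a \<in> W} = \<phi> ` U \<times> \<psi> ` {a \<in> V. a \<in> W}"
      by (auto simp: map_prod_def image_iff split: prod.splits)
    have o: "open (\<phi> ` U \<times> \<psi> ` {a \<in> V. a \<in> W})"
      using chart_open[OF Uc] f(2) by (rule open_Times)
    have "smooth_on (\<phi> ` U \<times> \<psi> ` {a \<in> V. a \<in> W}) (\<lambda>x. \<xi> (inv_into V \<psi> (snd x)))"
      by (rule smooth_on_compose[OF o f(2) _ smooth_on_bounded_linear_id[OF bounded_linear_snd o] f(3)]) auto
    then have "smooth_on (\<phi> ` U \<times> \<psi> ` {a \<in> V. a \<in> W}) (\<lambda>x. \<xi> (snd (inv_into (U \<times> V) (map_prod \<phi> \<psi>) x)))"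
      by (rule smooth_on_cong[OF o, rotated])
        (auto simp: inv_into_map_prod[OF chart_inj[OF Uc] chart_inj[OF Vc]] chart_inv[OF Vc])
    then show "smooth_on (\<phi>\<psi> ` {a \<in> UV. snd a \<in> W}) (\<lambda>x. \<xi> (snd (inv_into UV \<phi>\<psi> x)))"
      by (simp add: c eq)
  qed (simp add: continuous_map_snd)
qed

section \<open>Lie groups\<close>

locale lie = group G for G (structure) +
  fixes T :: "'a topology" and A :: "('a, 'e::euclidean_space) chart set"
  assumes lie: "lie_group G T A" and A_nonempty: "A \<noteq> {}"
begin

lemma topspace_T [simp]: "topspace T = carrier G" using lie by (simp add: lie_group_def)

lemma manifold_T: "smooth_manifold T A" using lie by (simp add: lie_group_def)

lemma atlas_T: "atlas_on T A" using smooth_manifold_atlas_on[OF manifold_T A_nonempty] .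

lemma atlas_TT: "atlas_on (prod_topology T T) (prod_atlas A A)"
  using atlas_on_prod[OF atlas_T atlas_T] .

lemmas smooth_fst = smooth_map_fst_snd(1)[OF manifold_T A_nonempty manifold_T A_nonempty]
lemmas smooth_snd = smooth_map_fst_snd(2)[OF manifold_T A_nonempty manifold_T A_nonempty]
lemmas smooth_id = smooth_map_id[OF manifold_T]

lemma smooth_mult:
  assumes "atlas_on X C" "smooth_map X C T A f" "smooth_map X C T A g"
  shows "smooth_map X C T A (\<lambda>x. f x \<otimes> g x)"
  using smooth_map_compose[OF assms(1) atlas_TT atlas_T
      smooth_map_Pair[OF assms(1) atlas_T atlas_T assms(2,3)], of "\<lambda>(x, y). x \<otimes> y"] lie
  by (simp add: lie_group_def)

lemma smooth_inv:
  assumes "atlas_on X C" "smooth_map X C T A f"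
  shows "smooth_map X C T A (\<lambda>x. inv (f x))"
  using smooth_map_compose[OF assms(1) atlas_T atlas_T assms(2), of "\<lambda>x. inv x"] lie
  by (simp add: lie_group_def)

lemma smooth_const: "atlas_on X C \<Longrightarrow> c \<in> carrier G \<Longrightarrow> smooth_map X C T A (\<lambda>x. c)"
  by (rule smooth_map_const) auto

end

section \<open>The spaces \<open>L\<^sup>p\<close>\<close>

text \<open>If one argument is zero, the claim is \<open>t powr p \<le> t\<close> for
  \<open>t\<close> between 0 and 1; otherwise it is convexity on the positive half-line.\<close>

lemma powr_convex_nonneg:
  fixes a b s p :: real
  assumes "1 \<le> p" "0 \<le> a" "0 \<le> b" "0 < s" "s < 1"
  shows "(s * a + (1 - s) * b) powr p \<le> s * a powr p + (1 - s) * b powr p"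
proof -
  have aux: "(t * c) powr p \<le> t * c powr p" if "0 \<le> c" "0 < t" "t < 1" for t c :: real
  proof -
    have "t powr p \<le> t powr 1" using that assms(1) by (intro powr_mono') auto
    then show ?thesis using that by (simp add: powr_mult mult_right_mono)
  qed
  show ?thesis
  proof (cases "a = 0 \<or> b = 0")
    case True
    then show ?thesis using aux[of b "1 - s"] aux[of a s] assms by auto
  next
    case False
    then show ?thesis
      using convex_onD[OF powr_convex[OF assms(1)], of "1 - s" a b] assms by simp
  qed
qed

locale Lp =
  fixes M :: "'y measure" and p :: real
  assumes p: "1 \<le> p"
begin

abbreviation "L \<equiv> Lp_space M p"
abbreviation "N \<equiv> Lp_norm M p"

lemma L_measurable: "f \<in> L \<Longrightarrow> f \<in> borel_measurable M" by (simp add: Lp_space_def)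
lemma L_integrable: "f \<in> L \<Longrightarrow> integrable M (\<lambda>y. cmod (f y) powr p)" by (simp add: Lp_space_def)
lemma N_nonneg: "0 \<le> N f" by (simp add: Lp_norm_def)

lemma N_powr: "N f powr p = (LINT y|M. cmod (f y) powr p)"
  using p by (simp add: Lp_norm_def powr_powr)

lemma N_le_iff:
  assumes "0 \<le> A" shows "N f \<le> A \<longleftrightarrow> (LINT y|M. cmod (f y) powr p) \<le> A powr p"
  using N_powr[of f] N_nonneg[of f] assms p
  by (smt (verit) powr_less_mono2 powr_mono2)

lemma L_mono:
  assumes "g \<in> L" "f \<in> borel_measurable M" "AE y in M. cmod (f y) \<le> cmod (g y)"
  shows "f \<in> L" "N f \<le> N g"
proof -
  have le: "AE y in M. cmod (f y) powr p \<le> cmod (g y) powr p"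
    using assms(3) by eventually_elim (use p in \<open>auto intro: powr_mono2\<close>)
  have i: "integrable M (\<lambda>y. cmod (f y) powr p)"
    by (rule Bochner_Integration.integrable_bound[OF L_integrable[OF assms(1)]])
      (use assms(2) le in auto)
  then show "f \<in> L" using assms(2) by (simp add: Lp_space_def)
  have "(LINT y|M. cmod (f y) powr p) \<le> (LINT y|M. cmod (g y) powr p)"
    by (rule integral_mono_AE[OF i L_integrable[OF assms(1)] le])
  then show "N f \<le> N g" using N_le_iff[OF N_nonneg[of g], of f] N_powr[of g] by simp
qed

lemma L_cong_AE:
  assumes "g \<in> L" "f \<in> borel_measurable M" "AE y in M. f y = g y"
  shows "f \<in> L" "N f = N g"
proof -
  show f: "f \<in> L" by (rule L_mono(1)[OF assms(1,2)]) (use assms(3) in auto)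
  show "N f = N g"
    by (intro antisym L_mono(2)[OF assms(1,2)] L_mono(2)[OF f L_measurable[OF assms(1)]])
      (use assms(3) in auto)
qed

lemma L_zero: "(\<lambda>y. 0) \<in> L" by (simp add: Lp_space_def)
lemma N_zero: "N (\<lambda>y. 0) = 0" by (simp add: Lp_norm_def)

text \<open>Minkowski's inequality by convexity: f + g is (A + B) times the convex combination of f
  / A and g / B with weights A / (A + B) and B / (A + B). Taking \<open>A\<close> and
  \<open>B\<close> strictly positive and at least the norms avoids division by a zero norm; they
  decrease to the norms at the end.\<close>

lemma L_add:
  assumes f: "f \<in> L" and g: "g \<in> L"
  shows "(\<lambda>y. f y + g y) \<in> L" "N (\<lambda>y. f y + g y) \<le> N f + N g"
proof -
  have meas: "(\<lambda>y. f y + g y) \<in> borel_measurable M"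
    using L_measurable[OF f] L_measurable[OF g] by simp
  let ?I = "\<lambda>f. (LINT y|M. cmod (f y) powr p)"
  have key: "integrable M (\<lambda>y. cmod (f y + g y) powr p) \<and> N (\<lambda>y. f y + g y) \<le> A + B"
    if A: "A > 0" "N f \<le> A" and B: "B > 0" "N g \<le> B" for A B
  proof -
    define s where "s = A / (A + B)"
    have s: "0 < s" "s < 1" "1 - s = B / (A + B)" using A B by (auto simp: s_def field_simps)
    define h where "h = (\<lambda>y. (A + B) powr p * (s * (cmod (f y) powr p / A powr p) + (1 - s) * (cmod (g y) powr p / B powr p)))"
    have hi: "integrable M h" unfolding h_def using L_integrable[OF f] L_integrable[OF g] by simp
    have le: "cmod (f y + g y) powr p \<le> h y" for y
    proof -
      have "cmod (f y + g y) \<le> (A + B) * (s * (cmod (f y) / A) + (1 - s) * (cmod (g y) / B))"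
      proof -
        have "(A + B) * (s * (cmod (f y) / A) + (1 - s) * (cmod (g y) / B))
            = ((A + B) * s) * (cmod (f y) / A) + ((A + B) * (1 - s)) * (cmod (g y) / B)"
          by (simp only: distrib_left mult.assoc)
        also have "(A + B) * s = A" using A B by (simp add: s_def)
        also have "(A + B) * (1 - s) = B" using A B unfolding s(3) by simp
        finally show ?thesis using A B norm_triangle_ineq[of "f y" "g y"] by simp
      qed
      then have "cmod (f y + g y) powr p \<le> ((A + B) * (s * (cmod (f y) / A) + (1 - s) * (cmod (g y) / B))) powr p"
        using p by (intro powr_mono2) auto
      also have "\<dots> = (A + B) powr p * (s * (cmod (f y) / A) + (1 - s) * (cmod (g y) / B)) powr p"
        by (rule powr_mult)
      also have "\<dots> \<le> (A + B) powr p * (s * (cmod (f y) / A) powr p + (1 - s) * (cmod (g y) / B) powr p)"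
        using A B s by (intro mult_left_mono powr_convex_nonneg[OF p]) auto
      finally show ?thesis using A B by (simp add: h_def powr_divide)
    qed
    have i: "integrable M (\<lambda>y. cmod (f y + g y) powr p)"
      by (rule Bochner_Integration.integrable_bound[OF hi]) (use meas in simp, rule AE_I2, simp, rule order_trans[OF le abs_ge_self])
    have "?I (\<lambda>y. f y + g y) \<le> (LINT y|M. h y)" by (rule integral_mono[OF i hi]) (rule le)
    also have "\<dots> = (A + B) powr p * (s * (?I f / A powr p) + (1 - s) * (?I g / B powr p))"
      unfolding h_def using L_integrable[OF f] L_integrable[OF g] by simp
    also have "\<dots> \<le> (A + B) powr p * (s * 1 + (1 - s) * 1)"
      using N_le_iff[of A f] N_le_iff[of B g] A B s
      by (intro mult_left_mono add_mono) auto
    finally show ?thesis using N_le_iff[of "A + B" "\<lambda>y. f y + g y"] A B i by simp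
  qed
  show "(\<lambda>y. f y + g y) \<in> L"
    using key[of "N f + 1" "N g + 1"] N_nonneg meas by (simp add: Lp_space_def add_nonneg_pos)
  show "N (\<lambda>y. f y + g y) \<le> N f + N g"
  proof (rule field_le_epsilon)
    fix e :: real assume "e > 0"
    then show "N (\<lambda>y. f y + g y) \<le> N f + N g + e"
      using key[of "N f + e / 2" "N g + e / 2"] N_nonneg[of f] N_nonneg[of g] by simp
  qed
qed

lemma L_cmult:
  assumes "f \<in> L"
  shows "(\<lambda>y. c * f y) \<in> L" "N (\<lambda>y. c * f y) = cmod c * N f"
proof -
  have eq: "cmod (c * f y) powr p = cmod c powr p * cmod (f y) powr p" for y
    by (simp add: norm_mult powr_mult)
  show "(\<lambda>y. c * f y) \<in> L"
    using L_measurable[OF assms] L_integrable[OF assms] by (simp add: Lp_space_def eq)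
  show "N (\<lambda>y. c * f y) = cmod c * N f"
    using p by (simp add: Lp_norm_def eq powr_mult powr_powr integral_nonneg_AE)
qed

lemma L_scaleR:
  assumes "f \<in> L"
  shows "(\<lambda>y. c *\<^sub>R f y) \<in> L" "N (\<lambda>y. c *\<^sub>R f y) = \<bar>c\<bar> * N f"
  using L_cmult[OF assms, of "of_real c"] by (simp_all add: scaleR_conv_of_real)

lemma L_uminus:
  assumes "f \<in> L" shows "(\<lambda>y. - f y) \<in> L" "N (\<lambda>y. - f y) = N f"
  using L_cmult[OF assms, of "-1"] by simp_all

lemma L_diff:
  assumes "f \<in> L" "g \<in> L"
  shows "(\<lambda>y. f y - g y) \<in> L" "N (\<lambda>y. f y - g y) \<le> N f + N g"
  using L_add[OF assms(1) L_uminus(1)[OF assms(2)]] L_uminus(2)[OF assms(2)] by simp_all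

lemma N_minus_commute: "N (\<lambda>y. f y - g y) = N (\<lambda>y. g y - f y)"
  by (simp add: Lp_norm_def norm_minus_commute)

lemma L_triangle:
  assumes "f \<in> L" "g \<in> L" "h \<in> L"
  shows "N (\<lambda>y. f y - h y) \<le> N (\<lambda>y. f y - g y) + N (\<lambda>y. g y - h y)"
  using L_add(2)[OF L_diff(1)[OF assms(1,2)] L_diff(1)[OF assms(2,3)]] by simp

lemma L_sum:
  assumes "finite I" "\<And>i. i \<in> I \<Longrightarrow> f i \<in> L"
  shows "(\<lambda>y. \<Sum>i\<in>I. f i y) \<in> L" "N (\<lambda>y. \<Sum>i\<in>I. f i y) \<le> (\<Sum>i\<in>I. N (f i))"
proof -
  have "(\<lambda>y. \<Sum>i\<in>I. f i y) \<in> L \<and> N (\<lambda>y. \<Sum>i\<in>I. f i y) \<le> (\<Sum>i\<in>I. N (f i))"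
    using assms
  proof (induction I rule: finite_induct)
    case (insert i I)
    then have IH: "(\<lambda>y. \<Sum>i\<in>I. f i y) \<in> L" "N (\<lambda>y. \<Sum>i\<in>I. f i y) \<le> (\<Sum>i\<in>I. N (f i))" by auto
    show ?case
      using L_add[OF insert.prems[OF insertI1] IH(1)] IH(2) insert.hyps by simp
  qed (simp add: L_zero N_zero)
  then show "(\<lambda>y. \<Sum>i\<in>I. f i y) \<in> L" "N (\<lambda>y. \<Sum>i\<in>I. f i y) \<le> (\<Sum>i\<in>I. N (f i))" by auto
qed

lemma L_cmod:
  assumes "f \<in> L"
  shows "(\<lambda>y. complex_of_real (cmod (f y))) \<in> L" "N (\<lambda>y. complex_of_real (cmod (f y))) = N f"
  using assms by (auto simp: Lp_space_def Lp_norm_def)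

text \<open>The argument behind completeness of \<open>L\<^sup>p\<close>: the p-th powers of the
  partial sums increase and have integrals at most \<open>suminf a powr p\<close>, so by monotone
  convergence their supremum is finite almost everywhere, and it dominates the p-th power of the
  full sum.\<close>

lemma L_summable:
  fixes v :: "nat \<Rightarrow> 'y \<Rightarrow> complex"
  assumes v: "\<And>j. v j \<in> L" and a: "\<And>j. N (v j) \<le> a j" and s: "summable a"
  shows "AE y in M. summable (\<lambda>j. cmod (v j y))"
    "(\<lambda>y. complex_of_real (\<Sum>j. cmod (v j y))) \<in> L"
proof -
  have [measurable]: "v j \<in> borel_measurable M" for j using L_measurable[OF v] .
  define S where "S = (\<lambda>J y. \<Sum>j<J. cmod (v j y))"
  have S0: "0 \<le> S J y" for J y by (simp add: S_def sum_nonneg)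
  have a0: "0 \<le> a j" for j using a[of j] N_nonneg[of "v j"] by linarith
  have SL: "(\<lambda>y. complex_of_real (S J y)) \<in> L \<and> N (\<lambda>y. complex_of_real (S J y)) \<le> suminf a" for J
  proof -
    have "(\<lambda>y. complex_of_real (S J y)) = (\<lambda>y. \<Sum>j<J. complex_of_real (cmod (v j y)))"
      by (simp add: S_def)
    moreover have "(\<Sum>j<J. N (\<lambda>y. complex_of_real (cmod (v j y)))) \<le> suminf a"
    proof -
      have "(\<Sum>j<J. N (\<lambda>y. complex_of_real (cmod (v j y)))) \<le> (\<Sum>j<J. a j)"
        by (rule sum_mono) (simp add: L_cmod(2)[OF v] a)
      then show ?thesis using sum_le_suminf[OF s, of "{..<J}"] a0 by fastforce
    qed
    ultimately show ?thesis
      using L_sum[of "{..<J}" "\<lambda>j y. complex_of_real (cmod (v j y))"] L_cmod(1)[OF v] by auto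
  qed
  have mono: "incseq (\<lambda>J y. ennreal (S J y powr p))"
  proof (intro incseq_SucI le_funI ennreal_leI)
    fix J y
    have "S J y \<le> S (Suc J) y" by (simp add: S_def)
    then show "S J y powr p \<le> S (Suc J) y powr p" using p S0 by (intro powr_mono2) auto
  qed
  have "(\<integral>\<^sup>+y. ennreal (S J y powr p) \<partial>M) \<le> ennreal (suminf a powr p)" for J
  proof -
    have "(\<integral>\<^sup>+y. ennreal (S J y powr p) \<partial>M) = ennreal (LINT y|M. S J y powr p)"
      using L_integrable[of "\<lambda>y. complex_of_real (S J y)"] SL[of J] S0[of J]
      by (intro nn_integral_eq_integral) auto
    also have "(LINT y|M. S J y powr p) \<le> suminf a powr p"
      using N_le_iff[of "suminf a" "\<lambda>y. complex_of_real (S J y)"] SL[of J] S0[of J]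
        suminf_nonneg[OF s] a0 by simp
    finally show ?thesis by (simp add: ennreal_leI)
  qed
  then have "(\<integral>\<^sup>+y. (SUP J. ennreal (S J y powr p)) \<partial>M) \<le> ennreal (suminf a powr p)"
    using nn_integral_monotone_convergence_SUP[OF mono] by (simp add: S_def SUP_least)
  then have fin: "(\<integral>\<^sup>+y. (SUP J. ennreal (S J y powr p)) \<partial>M) < \<infinity>"
    by (rule le_less_trans) simp
  have "AE y in M. (SUP J. ennreal (S J y powr p)) \<noteq> \<infinity>"
    by (rule nn_integral_PInf_AE) (use fin in \<open>auto simp: S_def\<close>)
  moreover have "summable (\<lambda>j. cmod (v j y)) \<and>
      ennreal (cmod (complex_of_real (\<Sum>j. cmod (v j y))) powr p) \<le> (SUP J. ennreal (S J y powr p))"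
    if y: "(SUP J. ennreal (S J y powr p)) \<noteq> \<infinity>" for y
  proof -
    obtain C where C: "C \<ge> 0" "(SUP J. ennreal (S J y powr p)) = ennreal C"
      using y by (metis ennreal_cases infinity_ennreal_def)
    have SC: "S J y powr p \<le> C" for J
      using C SUP_upper[of J UNIV "\<lambda>J. ennreal (S J y powr p)"] ennreal_le_iff by (metis UNIV_I)
    have "S J y \<le> C powr (1 / p)" for J
    proof -
      have "S J y = (S J y powr p) powr (1 / p)" using S0 p by (simp add: powr_powr)
      also have "\<dots> \<le> C powr (1 / p)" using SC p by (intro powr_mono2) auto
      finally show ?thesis .
    qed
    then have sm: "summable (\<lambda>j. cmod (v j y))"
      by (intro summableI_nonneg_bounded[where x = "C powr (1 / p)"]) (auto simp: S_def)
    then have "(\<lambda>J. S J y) \<longlonglongrightarrow> (\<Sum>j. cmod (v j y))"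
      using summable_LIMSEQ unfolding S_def by blast
    then have "(\<lambda>J. S J y powr p) \<longlonglongrightarrow> (\<Sum>j. cmod (v j y)) powr p"
      using p S0 by (intro tendsto_powr') auto
    then have "(\<Sum>j. cmod (v j y)) powr p \<le> C"
      using SC by (intro LIMSEQ_le_const2) auto
    then show ?thesis using sm C by (simp add: suminf_nonneg)
  qed
  ultimately have ae: "AE y in M. summable (\<lambda>j. cmod (v j y)) \<and>
      ennreal (cmod (complex_of_real (\<Sum>j. cmod (v j y))) powr p) \<le> (SUP J. ennreal (S J y powr p))"
    by auto
  then show "AE y in M. summable (\<lambda>j. cmod (v j y))" by auto
  have m: "(\<lambda>y. complex_of_real (\<Sum>j. cmod (v j y))) \<in> borel_measurable M" by measurable
  have "(\<integral>\<^sup>+y. ennreal (norm (cmod (complex_of_real (\<Sum>j. cmod (v j y))) powr p)) \<partial>M)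
      \<le> (\<integral>\<^sup>+y. (SUP J. ennreal (S J y powr p)) \<partial>M)"
    by (rule nn_integral_mono_AE) (use ae in auto)
  then have "integrable M (\<lambda>y. cmod (complex_of_real (\<Sum>j. cmod (v j y))) powr p)"
    using fin m by (intro integrableI_bounded) auto
  then show "(\<lambda>y. complex_of_real (\<Sum>j. cmod (v j y))) \<in> L" using m by (simp add: Lp_space_def)
qed

text \<open>Summable norms give almost everywhere convergence of the sequence itself and not just of
  a subsequence. For this reason all approximations below are arranged with geometric rates.\<close>

lemma AE_tendsto_of_summable:
  fixes g :: "nat \<Rightarrow> 'y \<Rightarrow> complex"
  assumes "\<And>j. g j \<in> L" "\<And>j. N (g j) \<le> a j" "summable a"
  shows "AE y in M. (\<lambda>j. g j y) \<longlonglongrightarrow> 0"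
  using L_summable(1)[OF assms]
proof eventually_elim
  case (elim y)
  then show ?case using summable_LIMSEQ_zero tendsto_norm_zero_iff by blast
qed

text \<open>The bound with \<open>C + e\<close> in place of \<open>C\<close> is additive over
  adjacent intervals and holds on short intervals around each point by differentiability there, so
  bisection (\<open>Bolzano\<close>) gives it on the whole interval. Elements of
  \<open>L\<^sup>p\<close> are plain functions here and not points of a normed type, so only the
  triangle inequality for \<open>N\<close> is used.\<close>

lemma L_mean_value:
  fixes H H' :: "real \<Rightarrow> 'y \<Rightarrow> complex"
  assumes ab: "a \<le> b" and C: "0 \<le> C"
    and H: "\<And>s. s \<in> {a..b} \<Longrightarrow> H s \<in> L" and H': "\<And>s. s \<in> {a..b} \<Longrightarrow> H' s \<in> L"
    and d: "\<And>s e. s \<in> {a..b} \<Longrightarrow> e > 0 \<Longrightarrow> \<exists>\<delta>>0. \<forall>s'\<in>{a..b}. \<bar>s' - s\<bar> < \<delta> \<longrightarrow>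
      N (\<lambda>y. H s' y - H s y - (s' - s) *\<^sub>R H' s y) \<le> e * \<bar>s' - s\<bar>"
    and bd: "\<And>s. s \<in> {a..b} \<Longrightarrow> N (H' s) \<le> C"
  shows "N (\<lambda>y. H b y - H a y) \<le> C * (b - a)"
proof -
  have key: "N (\<lambda>y. H b y - H a y) \<le> (C + e) * (b - a)" if e: "e > 0" for e
  proof -
  define Q where "Q = (\<lambda>a' b'. a \<le> a' \<and> b' \<le> b \<longrightarrow> N (\<lambda>y. H b' y - H a' y) \<le> (C + e) * (b' - a'))"
  have "Q a b" using ab
  proof (induct rule: Bolzano)
    case (trans x y z)
    show ?case unfolding Q_def
    proof
      assume xz: "a \<le> x \<and> z \<le> b"
      then have "N (\<lambda>w. H z w - H x w) \<le> N (\<lambda>w. H z w - H y w) + N (\<lambda>w. H y w - H x w)"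
        using trans by (intro L_triangle H) auto
      also have "\<dots> \<le> (C + e) * (z - y) + (C + e) * (y - x)"
        using trans xz unfolding Q_def by (intro add_mono) auto
      finally show "N (\<lambda>w. H z w - H x w) \<le> (C + e) * (z - x)" by (simp add: algebra_simps)
    qed
  next
    case (local x)
    then have x: "x \<in> {a..b}" by auto
    obtain \<delta> where \<delta>: "\<delta> > 0" "\<And>s'. s' \<in> {a..b} \<Longrightarrow> \<bar>s' - x\<bar> < \<delta> \<Longrightarrow>
        N (\<lambda>y. H s' y - H x y - (s' - x) *\<^sub>R H' x y) \<le> e * \<bar>s' - x\<bar>"
      using d[OF x e] by blast
    have step: "N (\<lambda>y. H s' y - H x y) \<le> (C + e) * \<bar>s' - x\<bar>" if s': "s' \<in> {a..b}" "\<bar>s' - x\<bar> < \<delta>" for s'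
    proof -
      have "N (\<lambda>y. H s' y - H x y) = N (\<lambda>y. (H s' y - H x y - (s' - x) *\<^sub>R H' x y) + (s' - x) *\<^sub>R H' x y)" by simp
      also have "\<dots> \<le> N (\<lambda>y. H s' y - H x y - (s' - x) *\<^sub>R H' x y) + N (\<lambda>y. (s' - x) *\<^sub>R H' x y)"
        using H[OF s'(1)] H[OF x] H'[OF x] by (intro L_add L_diff L_scaleR)
      also have "\<dots> \<le> e * \<bar>s' - x\<bar> + \<bar>s' - x\<bar> * C"
        using \<delta>(2)[OF s'] bd[OF x] L_scaleR(2)[OF H'[OF x]]
        by (intro add_mono) (auto intro: mult_left_mono)
      finally show ?thesis by (simp add: algebra_simps)
    qed
    show ?case unfolding Q_def
    proof (intro exI conjI allI impI)
      show "\<delta> > 0" by fact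
      fix a' b' assume *: "a' \<le> x \<and> x \<le> b' \<and> b' - a' < \<delta>" and **: "a \<le> a' \<and> b' \<le> b"
      have m: "a' \<in> {a..b}" "b' \<in> {a..b}" using * ** x by auto
      have "N (\<lambda>y. H b' y - H a' y) \<le> N (\<lambda>y. H b' y - H x y) + N (\<lambda>y. H x y - H a' y)"
        by (intro L_triangle H x m)
      also have "\<dots> \<le> (C + e) * \<bar>b' - x\<bar> + (C + e) * \<bar>a' - x\<bar>"
        using step[OF m(1)] step[OF m(2)] * N_minus_commute[of "H x" "H a'"] by (intro add_mono) auto
      finally show "N (\<lambda>y. H b' y - H a' y) \<le> (C + e) * (b' - a')"
        using * by (simp add: algebra_simps)
    qed
  qed
  then show ?thesis by (simp add: Q_def)
  qed
  show ?thesis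
  proof (rule field_le_epsilon)
    fix e :: real assume e: "e > 0"
    have "N (\<lambda>y. H b y - H a y) \<le> (C + e / (b - a + 1)) * (b - a)"
      using ab e by (intro key) (auto intro: divide_pos_pos)
    also have "\<dots> \<le> C * (b - a) + e"
      using ab e by (simp add: field_simps)
    finally show "N (\<lambda>y. H b y - H a y) \<le> C * (b - a) + e" .
  qed
qed

end

section \<open>Bounded mixed differences\<close>

lemma axis_nth_eq: "axis i (x::real) $ j = (if j = i then x else 0)"
  by (simp add: axis_def)

lemma convex_shift_Int:
  fixes Q :: "'a::real_vector set"
  assumes "convex Q" shows "convex {x \<in> Q. x + w \<in> Q}"
proof -
  have "{x \<in> Q. x + w \<in> Q} = Q \<inter> (\<lambda>x. x - w) ` Q"
    by (auto simp: image_iff) (metis add_diff_cancel_right')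
  moreover have "convex ((\<lambda>x. x - w) ` Q)" using convex_translation_subtract[OF assms] .
  ultimately show ?thesis using assms convex_Int by metis
qed

context Lp
begin

text \<open>All mixed differences of order up to \<open>k\<close> are bounded in \<open>L\<^sup>p\<close> by \<open>C\<close> times the product of the
  step lengths.  Unlike derivatives, differences can be evaluated pointwise on representatives.\<close>

primrec Bd :: "nat \<Rightarrow> real \<Rightarrow> (real^'n) set \<Rightarrow> (real^'n \<Rightarrow> 'y \<Rightarrow> complex) \<Rightarrow> bool" where
  "Bd 0 C Q F \<longleftrightarrow> (\<forall>x\<in>Q. F x \<in> L \<and> N (F x) \<le> C)"
| "Bd (Suc k) C Q F \<longleftrightarrow> Bd k C Q F \<and>
    (\<forall>i t. Bd k (C * \<bar>t\<bar>) {x \<in> Q. x + t *\<^sub>R axis i 1 \<in> Q} (\<lambda>x y. F (x + t *\<^sub>R axis i 1) y - F x y))"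

lemma Bd_D: "Bd k C Q F \<Longrightarrow> x \<in> Q \<Longrightarrow> F x \<in> L \<and> N (F x) \<le> C"
  by (induction k arbitrary: C Q F) auto

lemma Bd_mono: "Bd k C Q F \<Longrightarrow> C \<le> C' \<Longrightarrow> Q' \<subseteq> Q \<Longrightarrow> Bd k C' Q' F"
proof (induction k arbitrary: C C' Q Q' F)
  case 0 then show ?case by fastforce
next
  case (Suc k)
  have "Bd k C' Q' F" using Suc by auto
  moreover have "Bd k (C' * \<bar>t\<bar>) {x \<in> Q'. x + t *\<^sub>R axis i 1 \<in> Q'} (\<lambda>x y. F (x + t *\<^sub>R axis i 1) y - F x y)" for i t
    by (rule Suc.IH[of "C * \<bar>t\<bar>" "{x \<in> Q. x + t *\<^sub>R axis i 1 \<in> Q}"])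
      (use Suc.prems in \<open>auto simp: mult_right_mono\<close>)
  ultimately show ?case by simp
qed

lemma Bd_le: "Bd k C Q F \<Longrightarrow> j \<le> k \<Longrightarrow> Bd j C Q F"
proof (induction k)
  case (Suc k) then show ?case by (cases "j = Suc k") auto
qed auto

text \<open>Derivative along the single direction \<open>v\<close>, tested only on steps that stay
  in \<open>Q\<close>. The domain may thus be an intersection of shifted sets, which need not be
  open.\<close>

definition Lder :: "(real^'n) set \<Rightarrow> real^'n \<Rightarrow> (real^'n \<Rightarrow> 'y \<Rightarrow> complex) \<Rightarrow> (real^'n \<Rightarrow> 'y \<Rightarrow> complex) \<Rightarrow> bool" where
  "Lder Q v F D \<longleftrightarrow> (\<forall>x\<in>Q. F x \<in> L \<and> D x \<in> L \<and> (\<forall>e>0. \<exists>d>0. \<forall>t. \<bar>t\<bar> < d \<and> x + t *\<^sub>R v \<in> Q \<longrightarrow>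
     N (\<lambda>y. F (x + t *\<^sub>R v) y - F x y - t *\<^sub>R D x y) \<le> e * \<bar>t\<bar>))"

lemma Lder_shift:
  assumes "Lder Q v F D"
  shows "Lder {x \<in> Q. x + w \<in> Q} v (\<lambda>x y. F (x + w) y - F x y) (\<lambda>x y. D (x + w) y - D x y)"
  unfolding Lder_def
proof safe
  fix x assume x: "x \<in> Q" "x + w \<in> Q"
  have FL: "F z \<in> L" "D z \<in> L" if "z \<in> Q" for z using assms that by (auto simp: Lder_def)
  show "(\<lambda>y. F (x + w) y - F x y) \<in> L" "(\<lambda>y. D (x + w) y - D x y) \<in> L"
    using FL x L_diff(1) by auto
  fix e :: real assume "e > 0"
  then have e: "e / 2 > 0" by simp
  have lim: "\<exists>d>0. \<forall>t. \<bar>t\<bar> < d \<and> z + t *\<^sub>R v \<in> Q \<longrightarrow>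
     N (\<lambda>y. F (z + t *\<^sub>R v) y - F z y - t *\<^sub>R D z y) \<le> e / 2 * \<bar>t\<bar>" if "z \<in> Q" for z
    using assms that e unfolding Lder_def by blast
  obtain d1 where d1: "d1 > 0" "\<And>t. \<bar>t\<bar> < d1 \<Longrightarrow> x + t *\<^sub>R v \<in> Q \<Longrightarrow>
     N (\<lambda>y. F (x + t *\<^sub>R v) y - F x y - t *\<^sub>R D x y) \<le> e / 2 * \<bar>t\<bar>"
    using lim[OF x(1)] by blast
  obtain d2 where d2: "d2 > 0" "\<And>t. \<bar>t\<bar> < d2 \<Longrightarrow> x + w + t *\<^sub>R v \<in> Q \<Longrightarrow>
     N (\<lambda>y. F (x + w + t *\<^sub>R v) y - F (x + w) y - t *\<^sub>R D (x + w) y) \<le> e / 2 * \<bar>t\<bar>"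
    using lim[OF x(2)] by blast
  show "\<exists>d>0. \<forall>t. \<bar>t\<bar> < d \<and> x + t *\<^sub>R v \<in> {x \<in> Q. x + w \<in> Q} \<longrightarrow>
     N (\<lambda>y. F (x + t *\<^sub>R v + w) y - F (x + t *\<^sub>R v) y - (F (x + w) y - F x y)
        - t *\<^sub>R (D (x + w) y - D x y)) \<le> e * \<bar>t\<bar>"
  proof (intro exI[of _ "min d1 d2"] conjI allI impI)
    fix t assume t: "\<bar>t\<bar> < min d1 d2 \<and> x + t *\<^sub>R v \<in> {x \<in> Q. x + w \<in> Q}"
    then have q: "x + t *\<^sub>R v \<in> Q" "x + w + t *\<^sub>R v \<in> Q" by (auto simp: add_ac)
    have "N (\<lambda>y. F (x + t *\<^sub>R v + w) y - F (x + t *\<^sub>R v) y - (F (x + w) y - F x y)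
        - t *\<^sub>R (D (x + w) y - D x y))
      = N (\<lambda>y. (F (x + w + t *\<^sub>R v) y - F (x + w) y - t *\<^sub>R D (x + w) y)
          - (F (x + t *\<^sub>R v) y - F x y - t *\<^sub>R D x y))"
      by (simp add: algebra_simps)
    also have "\<dots> \<le> N (\<lambda>y. F (x + w + t *\<^sub>R v) y - F (x + w) y - t *\<^sub>R D (x + w) y)
          + N (\<lambda>y. F (x + t *\<^sub>R v) y - F x y - t *\<^sub>R D x y)"
      using FL[OF x(1)] FL[OF x(2)] FL[OF q(1)] FL[OF q(2)] by (intro L_diff L_scaleR)
    also have "\<dots> \<le> e / 2 * \<bar>t\<bar> + e / 2 * \<bar>t\<bar>"
      using t q d1 d2 by (intro add_mono) auto
    finally show "N (\<lambda>y. F (x + t *\<^sub>R v + w) y - F (x + t *\<^sub>R v) y - (F (x + w) y - F x y)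
        - t *\<^sub>R (D (x + w) y - D x y)) \<le> e * \<bar>t\<bar>" by simp
  qed (use d1 d2 in auto)
qed

text \<open>The mean value inequality for \<open>F\<close> minus a linear function with slope
  \<open>E\<close>. With E = 0 it bounds differences of \<open>F\<close>; with \<open>E\<close> the
  derivative at the left end point it bounds the error of one term of a Riemann sum.\<close>

lemma Lder_curve:
  assumes Q: "convex Q" and d: "Lder Q v F D" and x: "x \<in> Q" "x + b *\<^sub>R v \<in> Q" "x + a *\<^sub>R v \<in> Q" and ab: "a \<le> b"
    and C: "0 \<le> C" and bd: "\<And>s. s \<in> {a..b} \<Longrightarrow> N (\<lambda>y. D (x + s *\<^sub>R v) y - E y) \<le> C" and E: "E \<in> L"
  shows "N (\<lambda>y. F (x + b *\<^sub>R v) y - F (x + a *\<^sub>R v) y - (b - a) *\<^sub>R E y) \<le> C * (b - a)"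
proof -
  have inQ: "x + s *\<^sub>R v \<in> Q" if s: "s \<in> {a..b}" for s
  proof (cases "a = b")
    case True then show ?thesis using s x by simp
  next
    case False
    define u where "u = (s - a) / (b - a)"
    have u: "0 \<le> u" "0 \<le> 1 - u" using s False ab by (auto simp: u_def field_simps)
    have ub: "u * (b - a) = s - a" using False by (simp add: u_def)
    have "x + s *\<^sub>R v = (1 - u) *\<^sub>R (x + a *\<^sub>R v) + u *\<^sub>R (x + b *\<^sub>R v)"
    proof -
      have "s = (1 - u) * a + u * b" using ub by (simp add: algebra_simps)
      moreover have "(1 - u) *\<^sub>R (x + a *\<^sub>R v) + u *\<^sub>R (x + b *\<^sub>R v) = x + ((1 - u) * a + u * b) *\<^sub>R v"
        by (simp add: algebra_simps)
      ultimately show ?thesis by (simp only:)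
    qed
    then show ?thesis using Q x u unfolding convex_def by (metis diff_add_cancel add.commute)
  qed
  have FL: "F z \<in> L" "D z \<in> L" if "z \<in> Q" for z using d that by (auto simp: Lder_def)
  have "N (\<lambda>y. (F (x + b *\<^sub>R v) y - b *\<^sub>R E y) - (F (x + a *\<^sub>R v) y - a *\<^sub>R E y)) \<le> C * (b - a)"
  proof (rule L_mean_value[where H = "\<lambda>s y. F (x + s *\<^sub>R v) y - s *\<^sub>R E y" and H' = "\<lambda>s y. D (x + s *\<^sub>R v) y - E y", OF ab C _ _ _ bd])
    fix s e :: real assume s: "s \<in> {a..b}" and e: "e > 0"
    obtain \<delta> where \<delta>: "\<delta> > 0" "\<And>t. \<bar>t\<bar> < \<delta> \<Longrightarrow> x + s *\<^sub>R v + t *\<^sub>R v \<in> Q \<Longrightarrow>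
       N (\<lambda>y. F (x + s *\<^sub>R v + t *\<^sub>R v) y - F (x + s *\<^sub>R v) y - t *\<^sub>R D (x + s *\<^sub>R v) y) \<le> e * \<bar>t\<bar>"
      using d inQ[OF s] e unfolding Lder_def by meson
    show "\<exists>\<delta>>0. \<forall>s'\<in>{a..b}. \<bar>s' - s\<bar> < \<delta> \<longrightarrow> N (\<lambda>y. F (x + s' *\<^sub>R v) y - s' *\<^sub>R E y -
        (F (x + s *\<^sub>R v) y - s *\<^sub>R E y) - (s' - s) *\<^sub>R (D (x + s *\<^sub>R v) y - E y)) \<le> e * \<bar>s' - s\<bar>"
    proof (intro exI conjI ballI impI)
      fix s' assume s': "s' \<in> {a..b}" "\<bar>s' - s\<bar> < \<delta>"
      have eq: "x + s *\<^sub>R v + (s' - s) *\<^sub>R v = x + s' *\<^sub>R v" by (simp add: algebra_simps)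
      have "(\<lambda>y. F (x + s' *\<^sub>R v) y - s' *\<^sub>R E y - (F (x + s *\<^sub>R v) y - s *\<^sub>R E y) - (s' - s) *\<^sub>R (D (x + s *\<^sub>R v) y - E y))
         = (\<lambda>y. F (x + s' *\<^sub>R v) y - F (x + s *\<^sub>R v) y - (s' - s) *\<^sub>R D (x + s *\<^sub>R v) y)"
        by (simp add: algebra_simps)
      then show "N (\<lambda>y. F (x + s' *\<^sub>R v) y - s' *\<^sub>R E y -
        (F (x + s *\<^sub>R v) y - s *\<^sub>R E y) - (s' - s) *\<^sub>R (D (x + s *\<^sub>R v) y - E y)) \<le> e * \<bar>s' - s\<bar>"
        using \<delta>(2)[OF s'(2)] inQ[OF s'(1)] by (simp add: eq)
    qed (rule \<delta>(1))
  qed (use inQ FL E in \<open>auto intro!: L_diff L_scaleR\<close>)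
  then show ?thesis by (simp add: algebra_simps)
qed

lemma Lder_MVT:
  assumes Q: "convex Q" and d: "Lder Q v F D" and x: "x \<in> Q" "x + t *\<^sub>R v \<in> Q"
    and C: "0 \<le> C" and bd: "\<And>x. x \<in> Q \<Longrightarrow> N (D x) \<le> C"
  shows "N (\<lambda>y. F (x + t *\<^sub>R v) y - F x y) \<le> C * \<bar>t\<bar>"
proof -
  have seg: "x + s *\<^sub>R v \<in> Q" if "0 \<le> s \<and> s \<le> t \<or> t \<le> s \<and> s \<le> 0" for s
  proof (cases "t = 0")
    case True then show ?thesis using that x by auto
  next
    case False
    have "x + s *\<^sub>R v = (1 - s / t) *\<^sub>R x + (s / t) *\<^sub>R (x + t *\<^sub>R v)"
      using False by (simp add: algebra_simps)
    moreover have "0 \<le> s / t" "0 \<le> 1 - s / t"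
      using that False by (auto simp: divide_simps)
    ultimately show ?thesis using Q x unfolding convex_def by (metis diff_add_cancel add.commute)
  qed
  show ?thesis
  proof (cases "0 \<le> t")
    case True
    have "N (\<lambda>y. F (x + t *\<^sub>R v) y - F (x + 0 *\<^sub>R v) y - (t - 0) *\<^sub>R 0) \<le> C * (t - 0)"
      by (rule Lder_curve[OF Q d x(1,2) _ True C _ L_zero]) (use x seg bd in auto)
    then show ?thesis using True by simp
  next
    case False
    then have t: "t \<le> 0" by simp
    have "N (\<lambda>y. F (x + 0 *\<^sub>R v) y - F (x + t *\<^sub>R v) y - (0 - t) *\<^sub>R 0) \<le> C * (0 - t)"
      by (rule Lder_curve[OF Q d x(1) _ x(2) t C _ L_zero]) (use x seg bd in auto)
    then show ?thesis using t N_minus_commute[of "F x" "F (x + t *\<^sub>R v)"] by simp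
  qed
qed

text \<open>Differences commute with each other and with the derivative, so the step along
  \<open>v\<close> can be taken last, where the mean value inequality turns it into the factor
  \<bar>t\<bar>.\<close>

lemma Bd_of_Lder:
  fixes F :: "real^'n \<Rightarrow> 'y \<Rightarrow> complex"
  assumes "convex Q" "Lder Q v F D" "Bd k C Q D" "0 \<le> C"
  shows "Bd k (C * \<bar>t\<bar>) {x \<in> Q. x + t *\<^sub>R v \<in> Q} (\<lambda>x y. F (x + t *\<^sub>R v) y - F x y)"
  using assms
proof (induction k arbitrary: Q F D C)
  case 0
  then show ?case using Lder_MVT[OF 0(1,2) _ _ 0(4)] by (auto simp: Lder_def intro!: L_diff)
next
  case (Suc k)
  have "Bd k (C * \<bar>t\<bar> * \<bar>s\<bar>) {x \<in> {x \<in> Q. x + t *\<^sub>R v \<in> Q}. x + s *\<^sub>R axis i 1 \<in> {x \<in> Q. x + t *\<^sub>R v \<in> Q}}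
      (\<lambda>x y. F (x + s *\<^sub>R axis i 1 + t *\<^sub>R v) y - F (x + s *\<^sub>R axis i 1) y - (F (x + t *\<^sub>R v) y - F x y))" for i s
  proof -
    let ?w = "s *\<^sub>R axis i 1 :: real^'n"
    let ?Q = "{x \<in> Q. x + ?w \<in> Q}"
    have "Bd k (C * \<bar>s\<bar> * \<bar>t\<bar>) {x \<in> ?Q. x + t *\<^sub>R v \<in> ?Q}
        (\<lambda>x y. F (x + t *\<^sub>R v + ?w) y - F (x + t *\<^sub>R v) y - (F (x + ?w) y - F x y))"
      by (rule Suc.IH[OF convex_shift_Int[OF Suc.prems(1)] Lder_shift[OF Suc.prems(2)]])
        (use Suc.prems in auto)
    moreover have "{x \<in> ?Q. x + t *\<^sub>R v \<in> ?Q} = {x \<in> {x \<in> Q. x + t *\<^sub>R v \<in> Q}. x + ?w \<in> {x \<in> Q. x + t *\<^sub>R v \<in> Q}}"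
      by (auto simp: add_ac)
    moreover have "(\<lambda>x y. F (x + t *\<^sub>R v + ?w) y - F (x + t *\<^sub>R v) y - (F (x + ?w) y - F x y))
        = (\<lambda>x y. F (x + ?w + t *\<^sub>R v) y - F (x + ?w) y - (F (x + t *\<^sub>R v) y - F x y))"
      by (simp add: algebra_simps)
    ultimately show ?thesis by (simp add: mult_ac)
  qed
  moreover have "Bd k (C * \<bar>t\<bar>) {x \<in> Q. x + t *\<^sub>R v \<in> Q} (\<lambda>x y. F (x + t *\<^sub>R v) y - F x y)"
    using Suc by auto
  ultimately show ?case by simp
qed

section \<open>From Frechet derivatives in \<open>L\<^sup>p\<close> to bounded differences\<close>

lemma has_Lp_derivative_sum:
  assumes d: "has_Lp_derivative M p F D x" and I: "finite I"
  shows "AE y in M. D (\<Sum>i\<in>I. c i *\<^sub>R u i) y = (\<Sum>i\<in>I. c i *\<^sub>R D (u i) y)"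
  using I
proof (induction I rule: finite_induct)
  case empty
  have "AE y in M. D (0 *\<^sub>R 0 + 0 *\<^sub>R 0) y = 0 *\<^sub>R D 0 y + 0 *\<^sub>R D 0 y"
    using d unfolding has_Lp_derivative_def by blast
  then show ?case by simp
next
  case (insert i I)
  have "AE y in M. D (c i *\<^sub>R u i + 1 *\<^sub>R (\<Sum>i\<in>I. c i *\<^sub>R u i)) y = c i *\<^sub>R D (u i) y + 1 *\<^sub>R D (\<Sum>i\<in>I. c i *\<^sub>R u i) y"
    using d unfolding has_Lp_derivative_def by blast
  with insert.IH show ?case
    by eventually_elim (use insert.hyps in simp)
qed

lemma has_Lp_derivative_axis:
  fixes v :: "real^'n"
  assumes "has_Lp_derivative M p F D x"
  shows "AE y in M. D v y = (\<Sum>i\<in>UNIV. v $ i *\<^sub>R D (axis i 1) y)"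
proof -
  have "(\<Sum>i\<in>UNIV. v $ i *\<^sub>R axis i (1::real)) = v"
    using basis_expansion[of v] by (simp add: scalar_mult_eq_scaleR)
  then show ?thesis
    using has_Lp_derivative_sum[OF assms, of UNIV "\<lambda>i. v $ i" "\<lambda>i. axis i 1"] by simp
qed

lemma Lder_of_has_Lp_derivative:
  fixes F :: "real^'n \<Rightarrow> 'y \<Rightarrow> complex"
  assumes F: "\<And>x. x \<in> Q \<Longrightarrow> F x \<in> L" and d: "\<And>x. x \<in> Q \<Longrightarrow> has_Lp_derivative M p F (D x) x"
  shows "Lder Q v F (\<lambda>x. D x v)"
  unfolding Lder_def
proof (intro ballI conjI allI impI)
  fix x assume x: "x \<in> Q"
  show "F x \<in> L" using F x .
  have DL: "D x w \<in> L" for w using d[OF x] by (simp add: has_Lp_derivative_def)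
  then show "D x v \<in> L" .
  fix e :: real assume e: "e > 0"
  \<comment> \<open>The summand 1 admits v = 0.\<close>
  define e' where "e' = e / (norm v + 1)"
  have e': "e' > 0" using e by (simp add: e'_def add_nonneg_pos)
  have "eventually (\<lambda>w. N (\<lambda>y. F (x + w) y - F x y - D x w y) / norm w < e') (at 0)"
    using d[OF x] e' unfolding has_Lp_derivative_def by (auto elim: order_tendstoD)
  then obtain \<delta> where \<delta>: "\<delta> > 0" "\<And>w. w \<noteq> 0 \<Longrightarrow> norm w < \<delta> \<Longrightarrow> N (\<lambda>y. F (x + w) y - F x y - D x w y) / norm w < e'"
    unfolding eventually_at by (auto simp: dist_norm)
  show "\<exists>d>0. \<forall>t. \<bar>t\<bar> < d \<and> x + t *\<^sub>R v \<in> Q \<longrightarrow>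
     N (\<lambda>y. F (x + t *\<^sub>R v) y - F x y - t *\<^sub>R D x v y) \<le> e * \<bar>t\<bar>"
  proof (intro exI[of _ "\<delta> / (norm v + 1)"] conjI allI impI)
    show "\<delta> / (norm v + 1) > 0" using \<delta>(1) by (simp add: add_nonneg_pos)
    fix t assume t: "\<bar>t\<bar> < \<delta> / (norm v + 1) \<and> x + t *\<^sub>R v \<in> Q"
    have L1: "(\<lambda>y. F (x + t *\<^sub>R v) y - F x y - D x (t *\<^sub>R v) y) \<in> L"
      using F x t DL by (intro L_diff) auto
    have L2: "(\<lambda>y. F (x + t *\<^sub>R v) y - F x y - t *\<^sub>R D x v y) \<in> L"
      using F x t DL by (intro L_diff L_scaleR) auto
    have "AE y in M. D x (t *\<^sub>R v + 0 *\<^sub>R 0) y = t *\<^sub>R D x v y + 0 *\<^sub>R D x 0 y"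
      using d[OF x] unfolding has_Lp_derivative_def by blast
    then have "N (\<lambda>y. F (x + t *\<^sub>R v) y - F x y - t *\<^sub>R D x v y) = N (\<lambda>y. F (x + t *\<^sub>R v) y - F x y - D x (t *\<^sub>R v) y)"
      by (intro L_cong_AE(2)[OF L1 L_measurable[OF L2]]) (simp, elim AE_mp, simp)
    also have "\<dots> \<le> e * \<bar>t\<bar>"
    proof (cases "t *\<^sub>R v = 0")
      case True
      have "AE y in M. D x (0 *\<^sub>R 0 + 0 *\<^sub>R 0) y = 0 *\<^sub>R D x 0 y + 0 *\<^sub>R D x 0 y"
        using d[OF x] unfolding has_Lp_derivative_def by blast
      then have "N (\<lambda>y. F (x + t *\<^sub>R v) y - F x y - D x (t *\<^sub>R v) y) = N (\<lambda>y. 0)"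
        unfolding True by (intro L_cong_AE(2)[OF L_zero]) (use L1 True L_measurable L_measurable[OF DL] in auto)
      then show ?thesis using e N_zero by simp
    next
      case False
      have "norm (t *\<^sub>R v) \<le> \<bar>t\<bar> * (norm v + 1)" by (simp add: mult_left_mono)
      also have "\<dots> < \<delta>" using t by (simp add: pos_less_divide_eq add_nonneg_pos)
      finally have "N (\<lambda>y. F (x + t *\<^sub>R v) y - F x y - D x (t *\<^sub>R v) y) / norm (t *\<^sub>R v) < e'"
        using \<delta>(2)[OF False] by blast
      then have "N (\<lambda>y. F (x + t *\<^sub>R v) y - F x y - D x (t *\<^sub>R v) y) \<le> e' * norm (t *\<^sub>R v)"
        using False by (simp add: pos_divide_less_eq)
      also have "\<dots> = (e * \<bar>t\<bar>) * (norm v / (norm v + 1))" by (simp add: e'_def)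
      also have "\<dots> \<le> (e * \<bar>t\<bar>) * 1" using e norm_ge_zero[of v]
          by (intro mult_left_mono) (auto simp: divide_simps simp del: norm_ge_zero)
      finally show ?thesis by simp
    qed
    finally show "N (\<lambda>y. F (x + t *\<^sub>R v) y - F x y - t *\<^sub>R D x v y) \<le> e * \<bar>t\<bar>" .
  qed
qed

lemma Lp_Ck_on_pred:
  fixes F :: "real^'n \<Rightarrow> 'y \<Rightarrow> complex"
  shows "Lp_Ck_on M p (Suc k) S F \<Longrightarrow> Lp_Ck_on M p k S F"
proof (induction k arbitrary: F)
  case 0
  then obtain D where D: "\<And>x. x \<in> S \<Longrightarrow> has_Lp_derivative M p F (D x) x" and F: "\<And>x. x \<in> S \<Longrightarrow> F x \<in> L"
    by auto
  have "((\<lambda>x'. N (\<lambda>y. F x' y - F x y)) \<longlongrightarrow> 0) (at x within S)" if x: "x \<in> S" for x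
  proof -
    have DL: "D x w \<in> L" for w using D[OF x] by (simp add: has_Lp_derivative_def)
    define K where "K = (\<Sum>i\<in>UNIV. N (D x (axis i 1)))"
    have K: "N (D x w) \<le> norm w * K" for w
    proof -
      have "N (D x w) = N (\<lambda>y. \<Sum>i\<in>UNIV. w $ i *\<^sub>R D x (axis i 1) y)"
        by (rule L_cong_AE(2)[OF L_sum(1) L_measurable[OF DL] has_Lp_derivative_axis[OF D[OF x]]])
          (use DL L_scaleR in auto)
      also have "\<dots> \<le> (\<Sum>i\<in>UNIV. N (\<lambda>y. w $ i *\<^sub>R D x (axis i 1) y))"
        using DL L_scaleR by (intro L_sum) auto
      also have "\<dots> \<le> (\<Sum>i\<in>UNIV. norm w * N (D x (axis i 1)))"
        using L_scaleR(2)[OF DL] N_nonneg component_le_norm_cart[of w]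
        by (intro sum_mono) (auto intro: mult_right_mono)
      finally show ?thesis by (simp add: K_def sum_distrib_left)
    qed
    have "((\<lambda>w. N (\<lambda>y. F (x + w) y - F x y - D x w y) / norm w) \<longlongrightarrow> 0) (at 0)"
      using D[OF x] by (simp add: has_Lp_derivative_def)
    then have "((\<lambda>w. norm w * (N (\<lambda>y. F (x + w) y - F x y - D x w y) / norm w) + norm w * K) \<longlongrightarrow> 0 * 0 + 0 * K) (at 0)"
      by (intro tendsto_intros tendsto_norm_zero)
    then have "((\<lambda>w. norm w * (N (\<lambda>y. F (x + w) y - F x y - D x w y) / norm w) + norm w * K) \<longlongrightarrow> 0) (at 0)"
      by simp
    then have "((\<lambda>z. norm (z - x) * (N (\<lambda>y. F (x + (z - x)) y - F x y - D x (z - x) y) / norm (z - x)) + norm (z - x) * K) \<longlongrightarrow> 0) (at x)"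
      using LIM_offset_zero_iff[of x "\<lambda>z. norm (z - x) * (N (\<lambda>y. F (x + (z - x)) y - F x y - D x (z - x) y) / norm (z - x)) + norm (z - x) * K" 0] by simp
    then have lim: "((\<lambda>z. norm (z - x) * (N (\<lambda>y. F z y - F x y - D x (z - x) y) / norm (z - x)) + norm (z - x) * K) \<longlongrightarrow> 0) (at x within S)"
      using tendsto_within_subset[of _ _ x UNIV S] by simp
    show ?thesis
    proof (rule tendsto_sandwich[OF _ _ tendsto_const lim])
      show "\<forall>\<^sub>F z in at x within S. N (\<lambda>y. F z y - F x y) \<le>
          norm (z - x) * (N (\<lambda>y. F z y - F x y - D x (z - x) y) / norm (z - x)) + norm (z - x) * K"
        unfolding eventually_at
      proof (intro exI[of _ 1] conjI ballI impI)
        fix z assume z: "z \<in> S" "z \<noteq> x \<and> dist z x < 1"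
        have "N (\<lambda>y. F z y - F x y) = N (\<lambda>y. (F z y - F x y - D x (z - x) y) + D x (z - x) y)" by simp
        also have "\<dots> \<le> N (\<lambda>y. F z y - F x y - D x (z - x) y) + N (D x (z - x))"
          using F x z DL by (intro L_add L_diff)
        finally show "N (\<lambda>y. F z y - F x y) \<le>
          norm (z - x) * (N (\<lambda>y. F z y - F x y - D x (z - x) y) / norm (z - x)) + norm (z - x) * K"
          using K[of "z - x"] z by simp
      qed simp
    qed (simp add: N_nonneg)
  qed
  then show ?case using F by simp
next
  case (Suc k)
  then obtain D where D: "\<And>x. x \<in> S \<Longrightarrow> F x \<in> L" "\<And>x. x \<in> S \<Longrightarrow> has_Lp_derivative M p F (D x) x" "\<And>v. Lp_Ck_on M p (Suc k) S (\<lambda>x. D x v)"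
    unfolding Lp_Ck_on.simps(2)[of M p "Suc k"] by blast
  then show ?case using Suc.IH[OF D(3)] by auto
qed

lemma Lp_Ck_on_le: 
  fixes F :: "real^'n \<Rightarrow> 'y \<Rightarrow> complex"
  shows "Lp_Ck_on M p k S F \<Longrightarrow> j \<le> k \<Longrightarrow> Lp_Ck_on M p j S F"
proof (induction k)
  case (Suc k) then show ?case using Lp_Ck_on_pred by (cases "j = Suc k") auto
qed auto

text \<open>Norms of continuous maps are bounded on the compact \<open>Q\<close>, and convexity of
  \<open>Q\<close> lets the mean value inequality trade each derivative for a difference.\<close>

lemma Bd_of_Lp_Ck_on:
  fixes F :: "real^'n \<Rightarrow> 'y \<Rightarrow> complex"
  assumes "compact Q" "convex Q" "Q \<subseteq> S" "Lp_Ck_on M p k S F"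
  shows "\<exists>C\<ge>0. Bd k C Q F"
  using assms(4)
proof (induction k arbitrary: F)
  case 0
  have F: "F x \<in> L" if "x \<in> Q" for x using 0 that assms(3) by auto
  have "continuous_on Q (\<lambda>x. N (F x))"
    unfolding continuous_on_def
  proof
    fix x assume x: "x \<in> Q"
    have "((\<lambda>x'. N (\<lambda>y. F x' y - F x y)) \<longlongrightarrow> 0) (at x within Q)"
    proof (rule tendsto_within_subset[OF _ assms(3)])
      show "((\<lambda>x'. N (\<lambda>y. F x' y - F x y)) \<longlongrightarrow> 0) (at x within S)" using 0 x assms(3) by auto
    qed
    moreover have "norm (N (F z) - N (F x)) \<le> N (\<lambda>y. F z y - F x y)" if "z \<in> Q" for z
      using L_add(2)[OF L_diff(1)[OF F[OF that] F[OF x]] F[OF x]]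
        L_add(2)[OF L_diff(1)[OF F[OF x] F[OF that]] F[OF that]] N_minus_commute[of "F x" "F z"]
      by simp
    ultimately have "((\<lambda>z. N (F z) - N (F x)) \<longlongrightarrow> 0) (at x within Q)"
      using Lim_null_comparison[of "\<lambda>z. N (F z) - N (F x)" "\<lambda>x'. N (\<lambda>y. F x' y - F x y)" "at x within Q"]
      by (simp add: eventually_at_filter)
    then show "((\<lambda>x. N (F x)) \<longlongrightarrow> N (F x)) (at x within Q)" by (rule LIM_zero_cancel)
  qed
  then have "bounded ((\<lambda>x. N (F x)) ` Q)"
    using assms(1) compact_continuous_image compact_imp_bounded by blast
  then obtain C where C: "\<forall>z\<in>(\<lambda>x. N (F x)) ` Q. norm z \<le> C"
    unfolding bounded_iff by blast
  have "N (F x) \<le> C" if "x \<in> Q" for x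
  proof -
    have "norm (N (F x)) \<le> C" using C that by blast
    then show ?thesis by simp
  qed
  then show ?case using F by (intro exI[of _ "max C 0"]) (auto intro: max.coboundedI1)
next
  case (Suc k)
  from Suc.prems obtain D where D: "\<And>x. x \<in> S \<Longrightarrow> F x \<in> L" "\<And>x. x \<in> S \<Longrightarrow> has_Lp_derivative M p F (D x) x" "\<And>v. Lp_Ck_on M p k S (\<lambda>x. D x v)"
    by auto
  obtain C0 where C0: "C0 \<ge> 0" "Bd k C0 Q F" using Suc.IH[OF Lp_Ck_on_pred[OF Suc.prems]] by blast
  have "\<forall>i. \<exists>C\<ge>0. Bd k C Q (\<lambda>x. D x (axis i 1))" using Suc.IH[OF D(3)] by blast
  then obtain C where C: "\<And>i. C i \<ge> 0" "\<And>i. Bd k (C i) Q (\<lambda>x. D x (axis i 1))" by metis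
  define K where "K = C0 + sum C UNIV"
  have K: "C0 \<le> K" "\<And>i. C i \<le> K" "0 \<le> K"
    using C0 C by (auto simp: K_def sum_nonneg add_increasing intro!: add_increasing member_le_sum)
  have "Bd k (K * \<bar>t\<bar>) {x \<in> Q. x + t *\<^sub>R axis i 1 \<in> Q} (\<lambda>x y. F (x + t *\<^sub>R axis i 1) y - F x y)" for i t
  proof -
    have "Lder Q (axis i 1) F (\<lambda>x. D x (axis i 1))"
      using D assms(3) by (intro Lder_of_has_Lp_derivative) auto
    then have "Bd k (C i * \<bar>t\<bar>) {x \<in> Q. x + t *\<^sub>R axis i 1 \<in> Q} (\<lambda>x y. F (x + t *\<^sub>R axis i 1) y - F x y)"
      by (rule Bd_of_Lder[OF assms(2) _ C(2) C(1)])
    then show ?thesis by (rule Bd_mono) (use K in \<open>auto simp: mult_right_mono\<close>)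
  qed
  then show ?case using Bd_mono[OF C0(2) K(1)] K(3) by auto
qed

text \<open>Coordinates are changed one at a time; the mixed points stay in \<open>cbox a b\<close>
  because it is a product of intervals.\<close>

lemma Bd_box_Lipschitz:
  fixes F :: "real^'n \<Rightarrow> 'y \<Rightarrow> complex"
  assumes B: "Bd (Suc 0) C (cbox a b) F" and C: "0 \<le> C"
    and I: "finite I" and x: "x \<in> cbox a b" "z \<in> cbox a b" "\<And>i. i \<notin> I \<Longrightarrow> x $ i = z $ i"
  shows "N (\<lambda>y. F z y - F x y) \<le> C * (\<Sum>i\<in>I. \<bar>z $ i - x $ i\<bar>)"
  using I x
proof (induction I arbitrary: z rule: finite_induct)
  case empty
  then have "x = z" by (simp add: vec_eq_iff)
  then show ?case by (simp add: N_zero)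
next
  case (insert i I)
  define w where "w = (\<chi> j. if j = i then x $ i else z $ j)"
  have w: "w \<in> cbox a b" using insert.prems by (auto simp: w_def mem_box_cart)
  have zw: "z = w + (z $ i - x $ i) *\<^sub>R axis i 1" by (auto simp: vec_eq_iff w_def axis_nth_eq)
  have FL: "F z \<in> L" "F w \<in> L" "F x \<in> L" using Bd_D[OF B] w insert.prems by auto
  have "N (\<lambda>y. F z y - F x y) \<le> N (\<lambda>y. F z y - F w y) + N (\<lambda>y. F w y - F x y)"
    by (rule L_triangle[OF FL])
  also have "N (\<lambda>y. F w y - F x y) \<le> C * (\<Sum>j\<in>I. \<bar>w $ j - x $ j\<bar>)"
    by (rule insert.IH[OF insert.prems(1) w]) (use insert.prems in \<open>auto simp: w_def\<close>)
  also have "(\<Sum>j\<in>I. \<bar>w $ j - x $ j\<bar>) = (\<Sum>j\<in>I. \<bar>z $ j - x $ j\<bar>)"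
    by (rule sum.cong) (use insert.hyps in \<open>auto simp: w_def\<close>)
  also have "N (\<lambda>y. F z y - F w y) \<le> C * \<bar>z $ i - x $ i\<bar>"
  proof -
    have "Bd 0 (C * \<bar>z $ i - x $ i\<bar>) {x' \<in> cbox a b. x' + (z $ i - x $ i) *\<^sub>R axis i 1 \<in> cbox a b}
       (\<lambda>x' y. F (x' + (z $ i - x $ i) *\<^sub>R axis i 1) y - F x' y)" using B by simp
    then show ?thesis using w insert.prems(2) zw by auto
  qed
  finally show ?case using insert.hyps by (simp add: algebra_simps)
qed

text \<open>The Sobolev inequality in discrete form: a sum over a line of differences bounds the values on
  that line, and one mixed derivative in each coordinate suffices.\<close>

lemma Bd_grid:
  fixes F :: "real^'n \<Rightarrow> 'y \<Rightarrow> complex"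
  assumes "finite I" "Bd (card I) C Q F" "0 \<le> C" "0 \<le> h"
    and "\<And>k. (\<And>i. k i \<le> K) \<Longrightarrow> a + (\<Sum>i\<in>I. (h * real (k i)) *\<^sub>R axis i 1) \<in> Q"
  shows "\<exists>v. (\<forall>y. 0 \<le> v y) \<and> (\<lambda>y. complex_of_real (v y)) \<in> L \<and>
    N (\<lambda>y. complex_of_real (v y)) \<le> C * (1 + real K * h) ^ card I \<and>
    (\<forall>k y. (\<forall>i. k i \<le> K) \<longrightarrow> cmod (F (a + (\<Sum>i\<in>I. (h * real (k i)) *\<^sub>R axis i 1)) y) \<le> v y)"
  using assms
proof (induction I arbitrary: F Q C a rule: finite_induct)
  case empty
  have "a \<in> Q" using empty(4)[of "\<lambda>i. 0"] by simp
  then have "F a \<in> L" "N (F a) \<le> C" using empty(1) by auto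
  then show ?case by (intro exI[of _ "\<lambda>y. cmod (F a y)"]) (auto simp: L_cmod)
next
  case (insert j I)
  have card: "card (insert j I) = Suc (card I)" using insert.hyps by simp
  have sum_ins: "a + (\<Sum>i\<in>insert j I. (h * real (k i)) *\<^sub>R axis i 1)
      = (a + (h * real (k j)) *\<^sub>R axis j 1) + (\<Sum>i\<in>I. (h * real (k i)) *\<^sub>R axis i (1::real))" for k
    using insert.hyps by (simp add: add_ac)
  have cong: "(\<Sum>i\<in>I. (h * real ((k(j := m)) i)) *\<^sub>R axis i (1::real)) = (\<Sum>i\<in>I. (h * real (k i)) *\<^sub>R axis i 1)" for k m
    by (rule sum.cong) (use insert.hyps in auto)
  have mem: "(a + (h * real m) *\<^sub>R axis j 1) + (\<Sum>i\<in>I. (h * real (k i)) *\<^sub>R axis i (1::real)) \<in> Q"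
    if "\<And>i. k i \<le> K" "m \<le> K" for k m
    using insert.prems(4)[of "k(j := m)"] that unfolding sum_ins cong by simp
  have B: "Bd (card I) C Q F"
    "Bd (card I) (C * \<bar>h\<bar>) {x \<in> Q. x + h *\<^sub>R axis j 1 \<in> Q} (\<lambda>x y. F (x + h *\<^sub>R axis j 1) y - F x y)"
    using insert.prems(1) unfolding card by auto
  let ?P = "\<lambda>v C F a. (\<forall>y. 0 \<le> v y) \<and> (\<lambda>y. complex_of_real (v y)) \<in> L \<and>
    N (\<lambda>y. complex_of_real (v y)) \<le> C * (1 + real K * h) ^ card I \<and>
    (\<forall>k y. (\<forall>i. k i \<le> K) \<longrightarrow> cmod (F (a + (\<Sum>i\<in>I. (h * real (k i)) *\<^sub>R axis i 1)) y) \<le> v y)"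
  obtain v0 where v0: "?P v0 C F a"
    using insert.IH[OF B(1) insert.prems(2,3), of a] mem[of _ 0] by auto
  define R where "R = (\<lambda>m v. ?P v (C * \<bar>h\<bar>) (\<lambda>x y. F (x + h *\<^sub>R axis j 1) y - F x y) (a + (h * real m) *\<^sub>R axis j 1))"
  have "\<exists>v. R m v" if m: "m < K" for m
    unfolding R_def
  proof (rule insert.IH[OF B(2) _ insert.prems(3)])
    fix k :: "'n \<Rightarrow> nat" assume k: "\<And>i. k i \<le> K"
    have "(a + (h * real m) *\<^sub>R axis j 1) + (\<Sum>i\<in>I. (h * real (k i)) *\<^sub>R axis i (1::real)) + h *\<^sub>R axis j 1
      = (a + (h * real (Suc m)) *\<^sub>R axis j 1) + (\<Sum>i\<in>I. (h * real (k i)) *\<^sub>R axis i (1::real))"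
      by (simp add: algebra_simps)
    moreover have "(a + (h * real (Suc m)) *\<^sub>R axis j 1) + (\<Sum>i\<in>I. (h * real (k i)) *\<^sub>R axis i (1::real)) \<in> Q"
      using mem[of k "Suc m"] m k by simp
    moreover have "(a + (h * real m) *\<^sub>R axis j 1) + (\<Sum>i\<in>I. (h * real (k i)) *\<^sub>R axis i (1::real)) \<in> Q"
      using mem[of k m] m k by simp
    ultimately show "a + (h * real m) *\<^sub>R axis j 1 + (\<Sum>i\<in>I. (h * real (k i)) *\<^sub>R axis i 1) \<in> {x \<in> Q. x + h *\<^sub>R axis j 1 \<in> Q}"
      by (simp only: mem_Collect_eq)
  qed (use insert.prems in auto)
  then obtain w where "\<And>m. m < K \<Longrightarrow> R m (w m)" by metis
  note w = this[unfolded R_def]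
  \<comment> \<open>Telescoping along axis \<open>j\<close>: the value at index \<open>k j\<close>
    is the value at index 0, majorized by \<open>v0\<close>, plus differences majorized by the
    \<open>w m\<close>. Their norms are at most C and K times C h, each times the factor that comes
    from \<open>I\<close>; this is the source of one more factor 1 + K h.\<close>
  define v where "v = (\<lambda>y. v0 y + (\<Sum>m<K. w m y))"
  have vL: "(\<lambda>y. complex_of_real (v y)) = (\<lambda>y. complex_of_real (v0 y) + (\<Sum>m<K. complex_of_real (w m y)))"
    by (simp add: v_def)
  have Lw: "(\<lambda>y. \<Sum>m<K. complex_of_real (w m y)) \<in> L"
    using w by (intro L_sum) auto
  show ?case
  proof (intro exI[of _ v] conjI allI impI)
    show "0 \<le> v y" for y using v0 w by (auto simp: v_def intro!: add_nonneg_nonneg sum_nonneg)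
    show "(\<lambda>y. complex_of_real (v y)) \<in> L" unfolding vL using v0 Lw by (intro L_add) auto
    have "N (\<lambda>y. complex_of_real (v y)) \<le> N (\<lambda>y. complex_of_real (v0 y)) + (\<Sum>m<K. N (\<lambda>y. complex_of_real (w m y)))"
      unfolding vL using v0 Lw w L_add(2)[of "\<lambda>y. complex_of_real (v0 y)" "\<lambda>y. \<Sum>m<K. complex_of_real (w m y)"]
        L_sum(2)[of "{..<K}" "\<lambda>m y. complex_of_real (w m y)"] by fastforce
    also have "\<dots> \<le> C * (1 + real K * h) ^ card I + (\<Sum>m<K. C * \<bar>h\<bar> * (1 + real K * h) ^ card I)"
      using v0 w by (intro add_mono sum_mono) auto
    also have "\<dots> = C * (1 + real K * h) ^ card (insert j I)"
      using insert.prems(3) unfolding card by (simp add: algebra_simps)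
    finally show "N (\<lambda>y. complex_of_real (v y)) \<le> C * (1 + real K * h) ^ card (insert j I)" .
    fix k :: "'n \<Rightarrow> nat" and y assume k: "\<forall>i. k i \<le> K"
    define b where "b = (\<Sum>i\<in>I. (h * real (k i)) *\<^sub>R axis i (1::real))"
    have "cmod (F (a + (h * real l) *\<^sub>R axis j 1 + b) y) \<le> v0 y + (\<Sum>m<l. w m y)" if "l \<le> K" for l
      using that
    proof (induction l)
      case 0 show ?case using v0 k unfolding b_def by auto
    next
      case (Suc l)
      have e1: "a + (h * real (Suc l)) *\<^sub>R axis j 1 + b = a + (h * real l) *\<^sub>R axis j 1 + b + h *\<^sub>R axis j 1"
        by (simp add: algebra_simps)
      have "cmod (F (a + (h * real l) *\<^sub>R axis j 1 + b + h *\<^sub>R axis j 1) y - F (a + (h * real l) *\<^sub>R axis j 1 + b) y) \<le> w l y"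
        using w[of l] Suc.prems k unfolding b_def by auto
      then have "cmod (F (a + (h * real (Suc l)) *\<^sub>R axis j 1 + b) y - F (a + (h * real l) *\<^sub>R axis j 1 + b) y) \<le> w l y"
        unfolding e1 .
      then show ?case using Suc norm_triangle_sub[of "F (a + (h * real (Suc l)) *\<^sub>R axis j 1 + b) y" "F (a + (h * real l) *\<^sub>R axis j 1 + b) y"]
        by simp
    qed
    then have "cmod (F (a + (h * real (k j)) *\<^sub>R axis j 1 + b) y) \<le> v0 y + (\<Sum>m<k j. w m y)" using k by blast
    also have "\<dots> \<le> v y" unfolding v_def
      using k w by (intro add_left_mono sum_mono2) auto
    finally show "cmod (F (a + (\<Sum>i\<in>insert j I. (h * real (k i)) *\<^sub>R axis i 1)) y) \<le> v y"
      unfolding sum_ins b_def .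
  qed
qed

end

section \<open>Continuous versions of smooth \<open>L\<^sup>p\<close>-valued maps\<close>

definition grid_point :: "real^'n \<Rightarrow> real \<Rightarrow> ('n \<Rightarrow> nat) \<Rightarrow> real^'n" where
  "grid_point c h k = c + (\<Sum>i\<in>UNIV. (h * real (k i)) *\<^sub>R axis i 1)"

text \<open>The truncation by \<open>2 ^ j\<close> keeps all grid points in the cube; it is inactive for \<open>x\<close> in the cube.\<close>

definition grid_index :: "real^'n \<Rightarrow> real \<Rightarrow> nat \<Rightarrow> real^'n \<Rightarrow> 'n \<Rightarrow> nat" where
  "grid_index c r j x = (\<lambda>i. min (2 ^ j) (nat \<lfloor>2 ^ j * ((x $ i - c $ i) / r)\<rfloor>))"

abbreviation cube :: "real^'n \<Rightarrow> real \<Rightarrow> (real^'n) set" where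
  "cube c r \<equiv> cbox c (c + r *\<^sub>R (\<chi> i. 1))"

lemma grid_point_nth [simp]: "grid_point c h k $ i = c $ i + h * real (k i)"
  by (simp add: grid_point_def axis_nth_eq if_distrib cong: if_cong)

lemma cube_iff: "x \<in> cube c r \<longleftrightarrow> (\<forall>i. c $ i \<le> x $ i \<and> x $ i \<le> c $ i + r)"
  by (simp add: mem_box_cart)

lemma grid_index_le: "grid_index c r j x i \<le> 2 ^ j" by (simp add: grid_index_def)

lemma grid_index_bounds:
  assumes "x \<in> cube c r" "0 < r"
  shows "real (grid_index c r j x i) \<le> 2 ^ j * ((x $ i - c $ i) / r)"
    "2 ^ j * ((x $ i - c $ i) / r) < real (grid_index c r j x i) + 1"
proof -
  define s where "s = (x $ i - c $ i) / r"
  have s: "0 \<le> s" "s \<le> 1"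
    using assms(1)[unfolded cube_iff, rule_format, of i] assms(2) by (auto simp: s_def divide_simps)
  then have "2 ^ j * s < 2 ^ j + 1" 
  proof -
    have "2 ^ j * s \<le> 2 ^ j" using s by simp
    then show ?thesis by linarith
  qed
  then have "\<lfloor>2 ^ j * s\<rfloor> \<le> 2 ^ j" by (simp add: floor_le_iff)
  then have "nat \<lfloor>2 ^ j * s\<rfloor> \<le> 2 ^ j" by (simp add: nat_le_iff)
  then have eq: "grid_index c r j x i = nat \<lfloor>2 ^ j * s\<rfloor>" by (simp add: grid_index_def s_def)
  have "0 \<le> \<lfloor>2 ^ j * s\<rfloor>" using s by simp
  then have "real (nat \<lfloor>2 ^ j * s\<rfloor>) = of_int \<lfloor>2 ^ j * s\<rfloor>" by simp
  then show "real (grid_index c r j x i) \<le> 2 ^ j * ((x $ i - c $ i) / r)"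
    "2 ^ j * ((x $ i - c $ i) / r) < real (grid_index c r j x i) + 1"
    unfolding eq s_def[symmetric] by linarith+
qed

text \<open>A grid point of level j is the grid point of level j + 1 with doubled index, so
  refinement moves each coordinate by at most one step of the finer grid.\<close>

lemma grid_index_Suc:
  assumes "x \<in> cube c r" "0 < r"
  shows "2 * grid_index c r j x i \<le> grid_index c r (Suc j) x i"
    "grid_index c r (Suc j) x i \<le> Suc (2 * grid_index c r j x i)"
  using grid_index_bounds[OF assms, of j i] grid_index_bounds[OF assms, of "Suc j" i] by auto

lemma grid_index_close:
  assumes "x \<in> cube c r" "z \<in> cube c r" "0 < r" "\<bar>x $ i - z $ i\<bar> < r / 2 ^ j"
  shows "grid_index c r j x i \<le> Suc (grid_index c r j z i)"
proof -
  have "2 ^ j * ((x $ i - c $ i) / r) - 2 ^ j * ((z $ i - c $ i) / r) = 2 ^ j * ((x $ i - z $ i) / r)"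
    by (simp add: right_diff_distrib[symmetric] diff_divide_distrib[symmetric])
  also have "\<dots> < 1" using assms(3,4) by (simp add: field_simps abs_less_iff)
  finally show ?thesis
    using grid_index_bounds[OF assms(1,3), of j i] grid_index_bounds[OF assms(2,3), of j i] by linarith
qed

lemma grid_point_index_close:
  assumes "x \<in> cube c r" "0 < r"
  shows "\<bar>grid_point c (r / 2 ^ j) (grid_index c r j x) $ i - x $ i\<bar> \<le> r / 2 ^ j"
proof -
  define k s P where "k = real (grid_index c r j x i)" and "s = (x $ i - c $ i) / r" and "P = (2 :: real) ^ j"
  have P: "P > 0" by (simp add: P_def)
  have "k \<le> P * s" "P * s \<le> k + 1"
    using grid_index_bounds[OF assms, of j i] by (simp_all add: k_def s_def P_def)
  then have "r / P * k \<le> r / P * (P * s)" "r / P * (P * s) \<le> r / P * (k + 1)"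
    using P assms(2) by (intro mult_left_mono; simp)+
  moreover have "r / P * (P * s) = x $ i - c $ i" using P assms(2) by (simp add: s_def)
  moreover have "r / P * (k + 1) = r / P * k + r / P" by (simp add: distrib_left)
  ultimately show ?thesis by (simp add: k_def P_def abs_le_iff)
qed

lemma grid_point_in_cube:
  assumes "\<And>i. k i \<le> 2 ^ j" "0 < r" shows "grid_point c (r / 2 ^ j) k \<in> cube c r"
  unfolding cube_iff
proof (intro allI conjI)
  fix i
  have "r / 2 ^ j * real (k i) \<le> r / 2 ^ j * 2 ^ j"
    using assms by (intro mult_left_mono) (auto simp: of_nat_le_iff[symmetric] simp del: of_nat_le_iff)
  then show "grid_point c (r / 2 ^ j) k $ i \<le> c $ i + r" by simp
qed (use assms in simp)

lemma measurable_grid_index: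
  "(\<lambda>z. grid_index c r j (fst z)) \<in> measurable (borel \<Otimes>\<^sub>M M) (count_space (UNIV :: ('n::finite \<Rightarrow> nat) set))"
unfolding measurable_count_space_eq2_countable
proof (intro conjI ballI)
  fix k :: "'n \<Rightarrow> nat"
  have [measurable]: "(\<lambda>z. grid_index c r j (fst z) i) \<in> measurable (borel \<Otimes>\<^sub>M M) (count_space UNIV)" for i
  proof -
    have [measurable]: "(\<lambda>x :: real^'n. x $ i) \<in> borel_measurable borel"
      by (intro borel_measurable_continuous_onI continuous_intros)
    show ?thesis unfolding grid_index_def by measurable
  qed
  have "(\<lambda>z. grid_index c r j (fst z)) -` {k} \<inter> space (borel \<Otimes>\<^sub>M M)
      = {z \<in> space (borel \<Otimes>\<^sub>M M). \<forall>i\<in>UNIV. grid_index c r j (fst z) i = k i}"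
    by auto
  also have "\<dots> \<in> sets (borel \<Otimes>\<^sub>M M)" by measurable
  finally show "(\<lambda>z. grid_index c r j (fst z)) -` {k} \<inter> space (borel \<Otimes>\<^sub>M M) \<in> sets (borel \<Otimes>\<^sub>M M)" .
qed auto

lemma uniform_limit_telescope:
  fixes f :: "nat \<Rightarrow> 'a \<Rightarrow> 'b::banach"
  assumes "\<And>n x. x \<in> X \<Longrightarrow> norm (f (Suc n) x - f n x) \<le> m n" "summable m"
  shows "uniform_limit X f (\<lambda>x. lim (\<lambda>n. f n x)) sequentially"
proof -
  have ul: "uniform_limit X (\<lambda>n x. \<Sum>i<n. f (Suc i) x - f i x) (\<lambda>x. suminf (\<lambda>i. f (Suc i) x - f i x)) sequentially"
    by (rule Weierstrass_m_test[OF assms])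
  have sum: "(\<Sum>i<n. f (Suc i) x - f i x) = f n x - f 0 x" for n x
    by (induction n) auto
  have "uniform_limit X (\<lambda>n x. (f n x - f 0 x) + f 0 x) (\<lambda>x. suminf (\<lambda>i. f (Suc i) x - f i x) + f 0 x) sequentially"
    using uniform_limit_add[OF ul, of "\<lambda>n. f 0" "f 0"] unfolding sum by (simp add: uniform_limit_iff)
  then have ul': "uniform_limit X f (\<lambda>x. suminf (\<lambda>i. f (Suc i) x - f i x) + f 0 x) sequentially" by simp
  have "lim (\<lambda>n. f n x) = suminf (\<lambda>i. f (Suc i) x - f i x) + f 0 x" if "x \<in> X" for x
    using tendsto_uniform_limitI[OF ul' that] by (rule limI)
  then show ?thesis using ul' by (simp cong: uniform_limit_cong')
qed

context Lp
begin

text \<open>\<open>u\<close> is the limit of \<open>F\<close> evaluated at the dyadic truncations of \<open>x\<close>.  By \<open>Bd_grid\<close> the suprema over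
  all grid points of consecutive differences are summable in \<open>L\<^sup>p\<close>, whence uniform convergence for almost
  every \<open>y\<close>.\<close>

lemma continuous_version:
  fixes F :: "real^'n \<Rightarrow> 'y \<Rightarrow> complex"
  assumes r: "0 < r" "r \<le> 1" and QS: "cube c (2 * r) \<subseteq> S" and F: "Lp_Ck_on M p (Suc CARD('n)) S F"
  obtains u v where "case_prod u \<in> borel_measurable (borel \<Otimes>\<^sub>M M)"
    "\<And>y. 0 \<le> v y" "(\<lambda>y. complex_of_real (v y)) \<in> L"
    "AE y in M. continuous_on (cube c r) (\<lambda>x. u x y) \<and> (\<forall>x\<in>cube c r. cmod (u x y) \<le> v y)"
    "\<And>x. x \<in> cube c r \<Longrightarrow> AE y in M. u x y = F x y"
proof -
  define n where "n = CARD('n)"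
  \<comment> \<open>The doubled cube leaves room for one more step \<open>h j\<close>, at most
    \<open>r\<close>, from every grid point of the small cube.\<close>
  define Q where "Q = cube c (2 * r)"
  have sub: "cube c r \<subseteq> Q" using r by (auto simp: cube_iff Q_def; smt (verit))
  obtain C where C: "C \<ge> 0" "Bd (Suc n) C Q F"
    using Bd_of_Lp_Ck_on[OF compact_cbox convex_box(1) QS F] unfolding n_def Q_def by blast
  define h where "h = (\<lambda>j::nat. r / 2 ^ j)"
  have h: "0 < h j" "h j \<le> r" for j using r by (auto simp: h_def field_simps)
  have hK: "1 + real (2 ^ j) * h j = 1 + r" for j using r by (simp add: h_def)
  define gp where "gp = (\<lambda>j k. grid_point c (h j) k)"
  have gp_in: "gp j k \<in> cube c r" if "\<And>i. k i \<le> 2 ^ j" for j k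
    using grid_point_in_cube[of k j r c] that r by (simp add: gp_def h_def)
  have gp_eq: "gp j k = c + (\<Sum>i\<in>UNIV. (h j * real (k i)) *\<^sub>R axis i 1)" for j k
    by (simp add: gp_def grid_point_def)
  have gp_shift_in: "gp j k + h j *\<^sub>R axis i 1 \<in> Q" if "\<And>i. k i \<le> 2 ^ j" for j k i
    unfolding Q_def cube_iff
  proof
    fix l
    have "c $ l \<le> gp j k $ l \<and> gp j k $ l \<le> c $ l + r" using gp_in[of k j] that unfolding cube_iff by blast
    then show "c $ l \<le> (gp j k + h j *\<^sub>R axis i 1) $ l \<and> (gp j k + h j *\<^sub>R axis i 1) $ l \<le> c $ l + 2 * r"
      using h[of j] by (auto simp: axis_nth_eq)
  qed
  \<comment> \<open>\<open>w i j\<close> majorizes the steps in direction \<open>i\<close> at all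
    grid points of level \<open>j\<close> at once. Its norm carries the factor \<open>h j\<close>,
    paid for by one derivative beyond the dimension, and so the series over \<open>j\<close>
    converges geometrically.\<close>
  define PW where "PW = (\<lambda>i j w. (\<forall>y. 0 \<le> w y) \<and> (\<lambda>y. complex_of_real (w y)) \<in> L \<and>
    N (\<lambda>y. complex_of_real (w y)) \<le> C * \<bar>h j\<bar> * (1 + real (2 ^ j) * h j) ^ CARD('n) \<and>
    (\<forall>k y. (\<forall>l. k l \<le> 2 ^ j) \<longrightarrow> cmod (F (gp j k + h j *\<^sub>R axis i 1) y - F (gp j k) y) \<le> w y))"
  have "\<exists>w. PW i j w" for i j
    unfolding PW_def
    unfolding gp_eq
  proof (rule Bd_grid[where Q = "{x \<in> Q. x + h j *\<^sub>R axis i 1 \<in> Q}" and F = "\<lambda>x y. F (x + h j *\<^sub>R axis i 1) y - F x y"])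
    show "Bd CARD('n) (C * \<bar>h j\<bar>) {x \<in> Q. x + h j *\<^sub>R axis i 1 \<in> Q} (\<lambda>x y. F (x + h j *\<^sub>R axis i 1) y - F x y)"
      using C(2) by (simp add: n_def)
    show "c + (\<Sum>l\<in>UNIV. (h j * real (k l)) *\<^sub>R axis l 1) \<in> {x \<in> Q. x + h j *\<^sub>R axis i 1 \<in> Q}"
      if "\<And>i. k i \<le> 2 ^ j" for k
      using gp_in[of k j] gp_shift_in[of k j] sub that unfolding gp_eq by blast
  qed (use C h in \<open>auto simp: less_imp_le\<close>)
  then obtain w where "\<And>i j. PW i j (w i j)" by metis
  note PWw = this[unfolded PW_def]
  have w: "\<And>i j y. 0 \<le> w i j y" "\<And>i j. (\<lambda>y. complex_of_real (w i j y)) \<in> L"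
    "\<And>i j. N (\<lambda>y. complex_of_real (w i j y)) \<le> C * \<bar>h j\<bar> * (1 + real (2 ^ j) * h j) ^ CARD('n)"
    "\<And>i j k y. (\<And>l. k l \<le> 2 ^ j) \<Longrightarrow> cmod (F (gp j k + h j *\<^sub>R axis i 1) y - F (gp j k) y) \<le> w i j y"
    using PWw by auto
  have "\<exists>w. (\<forall>y. 0 \<le> w y) \<and> (\<lambda>y. complex_of_real (w y)) \<in> L \<and>
    N (\<lambda>y. complex_of_real (w y)) \<le> C * (1 + real (2 ^ 0) * h 0) ^ CARD('n) \<and>
    (\<forall>k y. (\<forall>l. k l \<le> 2 ^ 0) \<longrightarrow> cmod (F (gp 0 k) y) \<le> w y)"
    unfolding gp_eq
  proof (rule Bd_grid)
    show "Bd CARD('n) C Q F" using C(2) by (simp add: n_def)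
    show "c + (\<Sum>l\<in>UNIV. (h 0 * real (k l)) *\<^sub>R axis l 1) \<in> Q" if "\<And>i. k i \<le> 2 ^ 0" for k
      using gp_in[of k 0] sub that unfolding gp_eq by auto
  qed (use C h in \<open>auto simp: less_imp_le\<close>)
  then obtain w0 where w0: "\<And>y. 0 \<le> w0 y" "(\<lambda>y. complex_of_real (w0 y)) \<in> L"
    "\<And>k y. (\<And>l. k l \<le> 2 ^ 0) \<Longrightarrow> cmod (F (gp 0 k) y) \<le> w0 y"
    by metis
  define m where "m = (\<lambda>j y. \<Sum>i\<in>UNIV. w i j y)"
  have m0: "0 \<le> m j y" for j y using w(1) by (simp add: m_def sum_nonneg)
  have mL: "(\<lambda>y. complex_of_real (m j y)) \<in> L" for j
    using L_sum(1)[of UNIV "\<lambda>i y. complex_of_real (w i j y)"] w(2) by (simp add: m_def)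
  define a where "a = (\<lambda>j::nat. real n * (C * r * (1 + r) ^ n) * (1 / 2) ^ j)"
  have mN: "N (\<lambda>y. complex_of_real (m j y)) \<le> a j" for j
  proof -
    have "N (\<lambda>y. complex_of_real (m j y)) \<le> (\<Sum>i\<in>(UNIV::'n set). N (\<lambda>y. complex_of_real (w i j y)))"
      using L_sum(2)[of UNIV "\<lambda>i y. complex_of_real (w i j y)"] w(2) by (simp add: m_def)
    also have "\<dots> \<le> (\<Sum>i\<in>(UNIV::'n set). C * h j * (1 + r) ^ n)"
      using w(3)[of _ j] h[of j] unfolding hK n_def by (intro sum_mono) simp
    also have "\<dots> = a j" by (simp add: a_def n_def h_def field_simps)
    finally show ?thesis .
  qed
  have sa: "summable a" unfolding a_def by (intro summable_mult summable_geometric) simp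
  \<comment> \<open>Points whose indices differ by at most one in each coordinate are joined by
    changing one coordinate at a time, each change costing one \<open>w i j\<close>.\<close>
  have neighbours: "cmod (F (gp j k) y - F (gp j k') y) \<le> (\<Sum>i\<in>I. w i j y)"
    if "finite I" "\<And>i. i \<notin> I \<Longrightarrow> k i = k' i" "\<And>i. k i \<le> 2 ^ j" "\<And>i. k' i \<le> 2 ^ j"
      "\<And>i. k i \<le> Suc (k' i)" "\<And>i. k' i \<le> Suc (k i)" for I j k k' y
    using that
  proof (induction I arbitrary: k rule: finite_induct)
    case empty
    then have "k = k'" by auto
    then show ?case by simp
  next
    case (insert i I)
    define l where "l = k(i := k' i)"
    have IH: "cmod (F (gp j l) y - F (gp j k') y) \<le> (\<Sum>i\<in>I. w i j y)"
      by (rule insert.IH) (use insert.prems in \<open>auto simp: l_def\<close>)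
    have "cmod (F (gp j k) y - F (gp j l) y) \<le> w i j y"
    proof -
      consider "k i = k' i" | "k i = Suc (k' i)" | "k' i = Suc (k i)"
        using insert.prems(4)[of i] insert.prems(5)[of i] by linarith
      then show ?thesis
      proof cases
        case 1 then have "l = k" by (auto simp: l_def)
        then show ?thesis using w(1) by simp
      next
        case 2
        have "gp j k = gp j l + h j *\<^sub>R axis i 1"
          using 2 by (auto simp: vec_eq_iff gp_def l_def axis_nth_eq algebra_simps)
        then show ?thesis using w(4)[of l j i y] insert.prems by (auto simp: l_def)
      next
        case 3
        have "gp j l = gp j k + h j *\<^sub>R axis i 1"
          using 3 by (auto simp: vec_eq_iff gp_def l_def axis_nth_eq algebra_simps)
        then show ?thesis using w(4)[of k j i y] insert.prems by (simp add: norm_minus_commute)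
      qed
    qed
    then show ?case
      using IH insert.hyps norm_triangle_ineq[of "F (gp j k) y - F (gp j l) y" "F (gp j l) y - F (gp j k') y"] by simp
  qed
  define un where "un = (\<lambda>j x y. F (gp j (grid_index c r j x)) y)"
  have step: "cmod (un (Suc j) x y - un j x y) \<le> m (Suc j) y" if x: "x \<in> cube c r" for j x y
  proof -
    have "gp j (grid_index c r j x) = gp (Suc j) (\<lambda>i. 2 * grid_index c r j x i)"
      by (auto simp: vec_eq_iff gp_def h_def)
    then show ?thesis unfolding un_def m_def
      using neighbours[of UNIV "grid_index c r (Suc j) x" "\<lambda>i. 2 * grid_index c r j x i" "Suc j" y]
        grid_index_Suc[OF x r(1)] grid_index_le[of c r j x] grid_index_le[of c r "Suc j" x]
      by (simp add: le_SucI)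
  qed
  define u where "u = (\<lambda>x y. lim (\<lambda>j. un j x y))"
  \<comment> \<open>The absolute value keeps \<open>v\<close> nonnegative also at those
    \<open>y\<close> where the series diverges and its \<open>suminf\<close> has no meaning.\<close>
  define v where "v = (\<lambda>y. w0 y + \<bar>\<Sum>j. cmod (complex_of_real (m j y))\<bar>)"
  have FL: "F x \<in> L" if "x \<in> Q" for x using Bd_D[OF C(2) that] by simp
  have un_meas: "case_prod (un j) \<in> borel_measurable (borel \<Otimes>\<^sub>M M)" for j
  proof -
    have 1: "(\<lambda>z. F (gp j (\<lambda>i. min (2 ^ j) (k i))) (snd z)) \<in> borel_measurable (borel \<Otimes>\<^sub>M M)" for k
    proof -
      have "F (gp j (\<lambda>i. min (2 ^ j) (k i))) \<in> borel_measurable M"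
        using FL gp_in sub by (intro L_measurable) (meson min.cobounded1 subsetD)
      then show ?thesis using measurable_compose[OF measurable_snd] by blast
    qed
    have "(\<lambda>z. F (gp j (\<lambda>i. min (2 ^ j) (grid_index c r j (fst z) i))) (snd z)) \<in> borel_measurable (borel \<Otimes>\<^sub>M M)"
      by (rule measurable_compose_countable[where f = "\<lambda>k z. F (gp j (\<lambda>i. min (2 ^ j) (k i))) (snd z)", OF 1 measurable_grid_index])
    then show ?thesis
      by (simp add: un_def case_prod_beta' grid_index_le min.absorb2 del: min.bounded_iff)
  qed
  have u_meas: "case_prod u \<in> borel_measurable (borel \<Otimes>\<^sub>M M)"
  proof -
    have "case_prod u = (\<lambda>z. lim (\<lambda>j. case_prod (un j) z))" by (auto simp: u_def)
    then show ?thesis using borel_measurable_lim_metric[OF un_meas] by simp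
  qed
  have sums: "AE y in M. summable (\<lambda>j. cmod (complex_of_real (m j y)))"
    and sumL: "(\<lambda>y. complex_of_real (\<Sum>j. cmod (complex_of_real (m j y)))) \<in> L"
    using L_summable[OF mL mN sa] by auto
  have ul: "uniform_limit (cube c r) (\<lambda>j x. un j x y) (\<lambda>x. u x y) sequentially"
    if y: "summable (\<lambda>j. cmod (complex_of_real (m j y)))" for y
  proof -
    have "summable (\<lambda>j. m (Suc j) y)" using y m0 summable_Suc_iff[of "\<lambda>j. m j y"] by simp
    then show ?thesis unfolding u_def
      by (intro uniform_limit_telescope[where m = "\<lambda>j. m (Suc j) y"]) (use step in auto)
  qed
  show ?thesis
  proof (rule that[OF u_meas])
    show "0 \<le> v y" for y using w0(1) by (simp add: v_def)
    show "(\<lambda>y. complex_of_real (v y)) \<in> L"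
      using L_add(1)[OF w0(2) L_cmod(1)[OF sumL]] by (simp add: v_def)
    show "AE y in M. continuous_on (cube c r) (\<lambda>x. u x y) \<and> (\<forall>x\<in>cube c r. cmod (u x y) \<le> v y)"
      using sums
    proof eventually_elim
      case (elim y)
      have sm: "summable (\<lambda>j. m j y)" using elim m0 by simp
      have b1: "cmod (un j x y) \<le> w0 y + (\<Sum>l<j. m (Suc l) y)" if x: "x \<in> cube c r" for j x
      proof (induction j)
        case 0
        show ?case using w0(3)[of "grid_index c r 0 x" y] grid_index_le[of c r 0 x] by (simp add: un_def)
      next
        case (Suc j)
        then show ?case using step[OF x, of j y] norm_triangle_sub[of "un (Suc j) x y" "un j x y"] by simp
      qed
      have b2: "(\<Sum>l<j. m (Suc l) y) \<le> (\<Sum>l. m l y)" for j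
      proof -
        have "(\<Sum>l<j. m (Suc l) y) \<le> (\<Sum>l<Suc j. m l y)" unfolding sum.lessThan_Suc_shift using m0 by simp
        also have "\<dots> \<le> (\<Sum>l. m l y)" using sum_le_suminf[OF sm] m0 by blast
        finally show ?thesis .
      qed
      have bound: "cmod (un j x y) \<le> v y" if "x \<in> cube c r" for j x
      proof -
        have "(\<Sum>l. m l y) = (\<Sum>l. cmod (complex_of_real (m l y)))" using m0 by simp
        then show ?thesis
          using b1[OF that, of j] b2[of j] unfolding v_def by linarith
      qed
      have "cmod (u x y) \<le> v y" if x: "x \<in> cube c r" for x
        using tendsto_norm[OF tendsto_uniform_limitI[OF ul[OF elim] x]] bound[OF x] LIMSEQ_le_const2 by blast
      \<comment> \<open>The approximations \<open>un j\<close> are step functions, but between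
        points closer than \<open>h j\<close> they vary by at most \<open>m j y\<close>, which tends
        to 0. Together with uniform convergence this makes the limit continuous.\<close>
      moreover have "continuous_on (cube c r) (\<lambda>x. u x y)"
        unfolding continuous_on_iff
      proof (intro ballI allI impI)
        fix x and e :: real assume x: "x \<in> cube c r" and e: "e > 0"
        have "\<forall>\<^sub>F j in sequentially. \<forall>x\<in>cube c r. dist (un j x y) (u x y) < e / 3"
          by (rule uniform_limitD[OF ul[OF elim]]) (use e in simp)
        moreover have "\<forall>\<^sub>F j in sequentially. m j y < e / 3"
          by (rule order_tendstoD(2)[OF summable_LIMSEQ_zero[OF sm]]) (use e in simp)
        ultimately obtain j where j: "\<And>x. x \<in> cube c r \<Longrightarrow> dist (un j x y) (u x y) < e / 3" "m j y < e / 3"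
          using eventually_happens'[OF sequentially_bot] eventually_conj by (metis (mono_tags, lifting))
        show "\<exists>d>0. \<forall>x'\<in>cube c r. dist x' x < d \<longrightarrow> dist (u x' y) (u x y) < e"
        proof (intro exI conjI ballI impI)
          show "h j > 0" by (rule h)
          fix x' assume x': "x' \<in> cube c r" "dist x' x < h j"
          have cl: "\<bar>x' $ i - x $ i\<bar> < r / 2 ^ j" "\<bar>x $ i - x' $ i\<bar> < r / 2 ^ j" for i
            using x'(2) component_le_norm_cart[of "x' - x" i] by (simp_all add: dist_norm h_def)
          have "cmod (un j x' y - un j x y) \<le> m j y"
            unfolding un_def m_def
            by (rule neighbours) (use grid_index_le grid_index_close[OF x'(1) x r(1) cl(1)]
              grid_index_close[OF x x'(1) r(1) cl(2)] in auto)
          then have "dist (un j x' y) (un j x y) < e / 3" using j(2) by (simp add: dist_norm)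
          then show "dist (u x' y) (u x y) < e"
            using j(1)[OF x'(1)] j(1)[OF x] dist_triangle_third[of "u x' y" "un j x' y" e "un j x y" "u x y"]
            by (simp add: dist_commute)
        qed
      qed
      ultimately show ?case by blast
    qed
    \<comment> \<open>The dyadic truncations of \<open>x\<close> converge geometrically and
      \<open>F\<close> is Lipschitz into \<open>L\<^sup>p\<close>, so \<open>un j x\<close> tends to
      \<open>F x\<close> almost everywhere.\<close>
    show "AE y in M. u x y = F x y" if x: "x \<in> cube c r" for x
    proof -
      have B1: "Bd (Suc 0) C (cbox c (c + (2 * r) *\<^sub>R (\<chi> i. 1))) F"
        using Bd_le[OF C(2), of "Suc 0"] unfolding Q_def by (simp del: Bd.simps)
      have xQ: "x \<in> Q" using x sub by blast
      have gQ: "gp j (grid_index c r j x) \<in> Q" for j using gp_in[of "grid_index c r j x" j] grid_index_le sub by blast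
      have "N (\<lambda>y. un j x y - F x y) \<le> (C * real n * r) * (1 / 2) ^ j" for j
      proof -
        have "N (\<lambda>y. un j x y - F x y) \<le> C * (\<Sum>i\<in>UNIV. \<bar>gp j (grid_index c r j x) $ i - x $ i\<bar>)"
          unfolding un_def using gQ xQ unfolding Q_def by (intro Bd_box_Lipschitz[OF B1 C(1)]) auto
        also have "\<dots> \<le> C * (\<Sum>i\<in>(UNIV::'n set). r / 2 ^ j)"
          using C(1) grid_point_index_close[OF x r(1), of j] unfolding gp_def h_def
          by (intro mult_left_mono sum_mono) auto
        finally show ?thesis by (simp add: n_def field_simps)
      qed
      moreover have "(\<lambda>y. un j x y - F x y) \<in> L" for j unfolding un_def by (rule L_diff(1)[OF FL[OF gQ] FL[OF xQ]])
      ultimately have "AE y in M. (\<lambda>j. un j x y - F x y) \<longlonglongrightarrow> 0"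
        by (intro AE_tendsto_of_summable[where a = "\<lambda>j. (C * real n * r) * (1 / 2) ^ j"])
          (auto intro!: summable_mult summable_geometric)
      with sums show ?thesis
      proof eventually_elim
        case (elim y)
        have "(\<lambda>j. un j x y) \<longlonglongrightarrow> F x y" using elim(2) by (rule LIM_zero_cancel)
        moreover have "(\<lambda>j. un j x y) \<longlonglongrightarrow> u x y" using tendsto_uniform_limitI[OF ul[OF elim(1)] x] .
        ultimately show ?case using LIMSEQ_unique by blast
      qed
    qed
  qed
qed

end

section \<open>Derivatives of the continuous versions\<close>

lemma sum_abs_nth_le: "(\<Sum>i\<in>UNIV. \<bar>(v :: real^'n) $ i\<bar>) \<le> real CARD('n) * norm v"
  using sum_bounded_above[of UNIV "\<lambda>i. \<bar>v $ i\<bar>" "norm v"] component_le_norm_cart[of v] by simp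

context Lp
begin

text \<open>The derivative along the segment is Lipschitz with a constant \<open>K\<close>, so the
  Riemann sum of mesh 2^-j misses the increment by at most K 2^-j in norm, and summability of these
  errors gives pointwise convergence. Only countably many points of the segment occur, hence
  \<open>F\<close> and its derivatives may be replaced by the versions \<open>u\<close> and
  \<open>w\<close> off one null set.\<close>

lemma Lp_derivative_Riemann_sums:
  fixes F :: "real^'n \<Rightarrow> 'y \<Rightarrow> complex"
  assumes R: "compact R" "R = cbox a b" "R \<subseteq> S" and F: "\<And>x. x \<in> S \<Longrightarrow> F x \<in> L"
    and D: "\<And>x. x \<in> S \<Longrightarrow> has_Lp_derivative M p F (D x) x"
    and D1: "\<And>i. Lp_Ck_on M p (Suc 0) S (\<lambda>x. D x (axis i 1))"
    and u: "\<And>x. x \<in> R \<Longrightarrow> AE y in M. u x y = F x y"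
    and w: "\<And>i x. x \<in> R \<Longrightarrow> AE y in M. w i x y = D x (axis i 1) y"
    and xz: "x \<in> R" "z \<in> R"
  shows "AE y in M. (\<lambda>j. u z y - u x y - (1 / 2 ^ j) *\<^sub>R
    (\<Sum>l<2 ^ j. \<Sum>i\<in>UNIV. (z - x) $ i *\<^sub>R w i (x + (real l / 2 ^ j) *\<^sub>R (z - x)) y)) \<longlonglongrightarrow> 0"
proof -
  define v where "v = z - x"
  have cR: "convex R" using R(2) by simp
  have DL: "D \<xi> h \<in> L" if "\<xi> \<in> S" for \<xi> h using D[OF that] by (simp add: has_Lp_derivative_def)
  have seg: "x + t *\<^sub>R v \<in> R" if "0 \<le> t" "t \<le> 1" for t
  proof -
    have "x + t *\<^sub>R v = (1 - t) *\<^sub>R x + t *\<^sub>R z" by (simp add: v_def algebra_simps)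
    moreover have "(1 - t) *\<^sub>R x + t *\<^sub>R z \<in> R" by (rule convexD[OF cR xz]) (use that in auto)
    ultimately show ?thesis by simp
  qed
  have "\<forall>i. \<exists>C\<ge>0. Bd (Suc 0) C R (\<lambda>x. D x (axis i 1))"
    using Bd_of_Lp_Ck_on[OF R(1) cR R(3) D1] by blast
  then obtain C where C: "\<And>i. C i \<ge> 0" "\<And>i. Bd (Suc 0) (C i) R (\<lambda>x. D x (axis i 1))" by metis
  define K where "K = (\<Sum>i\<in>UNIV. norm v * (C i * (real CARD('n) * norm v)))"
  have K0: "K \<ge> 0" unfolding K_def using C(1) by (intro sum_nonneg) auto
  have lip: "N (\<lambda>y. D (x + s *\<^sub>R v) v y - D (x + t *\<^sub>R v) v y) \<le> K * \<bar>s - t\<bar>"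
    if st: "0 \<le> s" "s \<le> 1" "0 \<le> t" "t \<le> 1" for s t
  proof -
    let ?s = "x + s *\<^sub>R v" and ?t = "x + t *\<^sub>R v"
    have m: "?s \<in> R" "?t \<in> R" using seg st by auto
    then have mS: "?s \<in> S" "?t \<in> S" using R(3) by auto
    have "AE y in M. D ?s v y - D ?t v y = (\<Sum>i\<in>UNIV. v $ i *\<^sub>R (D ?s (axis i 1) y - D ?t (axis i 1) y))"
      using has_Lp_derivative_axis[OF D[OF mS(1)], of v] has_Lp_derivative_axis[OF D[OF mS(2)], of v]
      by eventually_elim (simp add: scaleR_diff_right sum_subtractf)
    then have "N (\<lambda>y. D ?s v y - D ?t v y) = N (\<lambda>y. \<Sum>i\<in>UNIV. v $ i *\<^sub>R (D ?s (axis i 1) y - D ?t (axis i 1) y))"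
      by (intro L_cong_AE(2) L_sum L_scaleR L_diff DL mS L_measurable) auto
    also have "\<dots> \<le> (\<Sum>i\<in>UNIV. N (\<lambda>y. v $ i *\<^sub>R (D ?s (axis i 1) y - D ?t (axis i 1) y)))"
      by (intro L_sum L_scaleR L_diff DL mS) auto
    also have "\<dots> \<le> (\<Sum>i\<in>UNIV. (norm v * (C i * (real CARD('n) * norm v))) * \<bar>s - t\<bar>)"
    proof (rule sum_mono)
      fix i :: 'n
      have "N (\<lambda>y. D ?s (axis i 1) y - D ?t (axis i 1) y) \<le> C i * (\<Sum>l\<in>UNIV. \<bar>?s $ l - ?t $ l\<bar>)"
        using C(2)[of i] m unfolding R(2) by (intro Bd_box_Lipschitz[OF _ C(1)]) auto
      also have "(\<Sum>l\<in>UNIV. \<bar>?s $ l - ?t $ l\<bar>) = (\<Sum>l\<in>UNIV. \<bar>((s - t) *\<^sub>R v) $ l\<bar>)"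
        by (simp add: algebra_simps)
      also have "\<dots> \<le> real CARD('n) * norm ((s - t) *\<^sub>R v)" by (rule sum_abs_nth_le)
      finally have b: "N (\<lambda>y. D ?s (axis i 1) y - D ?t (axis i 1) y) \<le> C i * (real CARD('n) * (\<bar>s - t\<bar> * norm v))"
        using C(1)[of i] by (simp add: mult_left_mono)
      have "N (\<lambda>y. v $ i *\<^sub>R (D ?s (axis i 1) y - D ?t (axis i 1) y)) = \<bar>v $ i\<bar> * N (\<lambda>y. D ?s (axis i 1) y - D ?t (axis i 1) y)"
        by (intro L_scaleR L_diff DL mS)
      also have "\<dots> \<le> norm v * (C i * (real CARD('n) * (\<bar>s - t\<bar> * norm v)))"
        using b component_le_norm_cart[of v i] N_nonneg by (intro mult_mono) auto
      finally show "N (\<lambda>y. v $ i *\<^sub>R (D ?s (axis i 1) y - D ?t (axis i 1) y))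
          \<le> (norm v * (C i * (real CARD('n) * norm v))) * \<bar>s - t\<bar>" by (simp add: mult_ac)
    qed
    finally show ?thesis by (simp add: K_def sum_distrib_right)
  qed
  have Ld: "Lder R v F (\<lambda>x. D x v)"
    by (rule Lder_of_has_Lp_derivative) (use F D R(3) in auto)
  define E where "E = (\<lambda>j y. F z y - F x y - (1 / 2 ^ j) *\<^sub>R (\<Sum>l<2 ^ j. D (x + (real l / 2 ^ j) *\<^sub>R v) v y))"
  have xS: "x \<in> S" "z \<in> S" using xz R(3) by auto
  have gS: "x + (real l / 2 ^ j) *\<^sub>R v \<in> S" if "l < 2 ^ j" for l j
    using seg[of "real l / 2 ^ j"] that R(3) by (auto simp: divide_simps of_nat_le_iff[symmetric] simp del: of_nat_le_iff)
  have E_L: "E j \<in> L" for j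
    unfolding E_def by (intro L_diff L_scaleR L_sum F xS DL gS) auto
  have E_N: "N (E j) \<le> K * (1 / 2) ^ j" for j
  proof -
    define P where "P = (2 :: real) ^ j"
    have P: "P > 0" by (simp add: P_def)
    define T where "T = (\<lambda>l y. F (x + (real (Suc l) / P) *\<^sub>R v) y - F (x + (real l / P) *\<^sub>R v) y
        - (real (Suc l) / P - real l / P) *\<^sub>R D (x + (real l / P) *\<^sub>R v) v y)"
    have range: "0 \<le> real l / P" "real (Suc l) / P \<le> 1" "real l / P \<le> real (Suc l) / P" if "l < 2 ^ j" for l
    proof -
      have "Suc l \<le> 2 ^ j" using that by simp
      then have "real (Suc l) \<le> P" unfolding P_def by (metis of_nat_le_iff of_nat_numeral of_nat_power)
      then show "0 \<le> real l / P" "real (Suc l) / P \<le> 1" "real l / P \<le> real (Suc l) / P"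
        using P by (auto simp: divide_simps)
    qed
    have T_L: "T l \<in> L" if "l < 2 ^ j" for l
      unfolding T_def using range[OF that] R(3) seg[of "real l / P"] seg[of "real (Suc l) / P"]
      by (intro L_diff L_scaleR F DL) auto
    have T_N: "N (T l) \<le> K / P * (1 / P)" if l: "l < 2 ^ j" for l
    proof -
      have diff: "real (Suc l) / P - real l / P = 1 / P" by (simp add: add_divide_distrib)
      have "N (T l) \<le> K / P * (real (Suc l) / P - real l / P)"
        unfolding T_def
      proof (rule Lder_curve[OF cR Ld])
        show "N (\<lambda>y. D (x + s *\<^sub>R v) v y - D (x + (real l / P) *\<^sub>R v) v y) \<le> K / P"
          if s: "s \<in> {real l / P..real (Suc l) / P}" for s
        proof -
          have "N (\<lambda>y. D (x + s *\<^sub>R v) v y - D (x + (real l / P) *\<^sub>R v) v y) \<le> K * \<bar>s - real l / P\<bar>"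
            using s range[OF l] by (intro lip) auto
          also have "\<dots> \<le> K * (1 / P)" using s diff K0 by (intro mult_left_mono) auto
          finally show ?thesis by simp
        qed
        show "D (x + (real l / P) *\<^sub>R v) v \<in> L"
          using range[OF l] R(3) seg[of "real l / P"] by (intro DL) auto
      qed (use range[OF l] seg xz K0 P in auto)
      then show ?thesis unfolding diff .
    qed
    have tele: "(\<Sum>l<m. F (x + (real (Suc l) / P) *\<^sub>R v) y - F (x + (real l / P) *\<^sub>R v) y) = F (x + (real m / P) *\<^sub>R v) y - F x y" for m y
      by (induction m) auto
    have "E j = (\<lambda>y. \<Sum>l<2 ^ j. T l y)"
    proof
      fix y
      have "(\<Sum>l<2 ^ j. T l y) = (\<Sum>l<2 ^ j. F (x + (real (Suc l) / P) *\<^sub>R v) y - F (x + (real l / P) *\<^sub>R v) y)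
          - (\<Sum>l<2 ^ j. (1 / P) *\<^sub>R D (x + (real l / P) *\<^sub>R v) v y)"
        unfolding T_def sum_subtractf[symmetric] by (simp add: add_divide_distrib)
      also have "\<dots> = E j y" unfolding tele by (simp add: E_def P_def v_def scaleR_sum_right)
      finally show "E j y = (\<Sum>l<2 ^ j. T l y)" by simp
    qed
    then have "N (E j) \<le> (\<Sum>l<2 ^ j. N (T l))" using L_sum(2)[of "{..<2 ^ j}" T] T_L by simp
    also have "\<dots> \<le> (\<Sum>l<(2::nat) ^ j. K / P * (1 / P))" using T_N by (intro sum_mono) auto
    also have "\<dots> = K * (1 / 2) ^ j" using P by (simp add: P_def power_one_over field_simps)
    finally show ?thesis .
  qed
  have "AE y in M. (\<lambda>j. E j y) \<longlonglongrightarrow> 0"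
    by (rule AE_tendsto_of_summable[OF E_L E_N]) (auto intro!: summable_mult summable_geometric)
  moreover have "AE y in M. \<forall>j l. l < 2 ^ j \<longrightarrow> D (x + (real l / 2 ^ j) *\<^sub>R v) v y
      = (\<Sum>i\<in>UNIV. v $ i *\<^sub>R w i (x + (real l / 2 ^ j) *\<^sub>R v) y)"
    unfolding AE_all_countable
  proof (intro allI)
    fix j l :: nat
    show "AE y in M. l < 2 ^ j \<longrightarrow> D (x + (real l / 2 ^ j) *\<^sub>R v) v y
      = (\<Sum>i\<in>UNIV. v $ i *\<^sub>R w i (x + (real l / 2 ^ j) *\<^sub>R v) y)"
    proof (cases "l < 2 ^ j")
      case True
      let ?g = "x + (real l / 2 ^ j) *\<^sub>R v"
      have "?g \<in> R"
        using seg[of "real l / 2 ^ j"] True by (auto simp: divide_simps of_nat_le_iff[symmetric] simp del: of_nat_le_iff)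
      then have "AE y in M. \<forall>i\<in>UNIV. w i ?g y = D ?g (axis i 1) y"
        by (intro AE_finite_allI) (use w in auto)
      then show ?thesis using has_Lp_derivative_axis[OF D[OF gS[OF True]], of v]
        by eventually_elim simp
    qed simp
  qed
  ultimately show ?thesis using u[OF xz(1)] u[OF xz(2)]
  proof eventually_elim
    case (elim y)
    have "E j y = u z y - u x y - (1 / 2 ^ j) *\<^sub>R
      (\<Sum>l<2 ^ j. \<Sum>i\<in>UNIV. (z - x) $ i *\<^sub>R w i (x + (real l / 2 ^ j) *\<^sub>R (z - x)) y)" for j
      using elim(2-4) by (simp add: E_def v_def)
    then show ?case using elim(1) by simp
  qed
qed

text \<open>Riemann sums along segments with rational end points, of which there are countably many, show that
  almost every \<open>u(\<cdot>, y)\<close> satisfies the fundamental theorem of calculus.\<close>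

lemma version_has_derivative:
  fixes F :: "real^'n \<Rightarrow> 'y \<Rightarrow> complex"
  assumes R: "cube c r \<subseteq> S" "0 < r" and F: "\<And>x. x \<in> S \<Longrightarrow> F x \<in> L"
    and D: "\<And>x. x \<in> S \<Longrightarrow> has_Lp_derivative M p F (D x) x"
    and D1: "\<And>i. Lp_Ck_on M p (Suc 0) S (\<lambda>x. D x (axis i 1))"
    and u: "\<And>x. x \<in> cube c r \<Longrightarrow> AE y in M. u x y = F x y"
    and cu: "AE y in M. continuous_on (cube c r) (\<lambda>x. u x y)"
    and w: "\<And>i x. x \<in> cube c r \<Longrightarrow> AE y in M. w i x y = D x (axis i 1) y"
    and cw: "\<And>i. AE y in M. continuous_on (cube c r) (\<lambda>x. w i x y)"
  shows "AE y in M. \<forall>x\<in>box c (c + r *\<^sub>R (\<chi> i. 1)).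
    ((\<lambda>x. u x y) has_derivative (\<lambda>h. \<Sum>i\<in>UNIV. h $ i *\<^sub>R w i x y)) (at x)"
proof -
  let ?R = "cube c r" and ?B = "box c (c + r *\<^sub>R (\<chi> i. 1))"
  obtain Dn :: "(real^'n) set" where Dn: "countable Dn" "\<And>X. open X \<Longrightarrow> X \<noteq> {} \<Longrightarrow> \<exists>d\<in>Dn. d \<in> X"
    using countable_dense_exists by blast
  have "AE y in M. \<forall>x\<in>Dn \<inter> ?B. \<forall>z\<in>Dn \<inter> ?B. (\<lambda>j. u z y - u x y - (1 / 2 ^ j) *\<^sub>R
    (\<Sum>l<2 ^ j. \<Sum>i\<in>UNIV. (z - x) $ i *\<^sub>R w i (x + (real l / 2 ^ j) *\<^sub>R (z - x)) y)) \<longlonglongrightarrow> 0"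
  proof -
    have BR: "?B \<subseteq> ?R" by (rule box_subset_cbox)
    have cnt: "countable (Dn \<inter> ?B)" using Dn(1) by blast
    show ?thesis
      unfolding AE_ball_countable[OF cnt]
      by (intro ballI Lp_derivative_Riemann_sums[OF compact_cbox refl R(1) F D D1 u w]) (use BR in auto)
  qed
  moreover have "AE y in M. \<forall>i. continuous_on ?R (\<lambda>x. w i x y)"
  proof -
    have "AE y in M. \<forall>i\<in>UNIV. continuous_on ?R (\<lambda>x. w i x y)"
      by (rule AE_finite_allI) (use cw in auto)
    then show ?thesis by simp
  qed
  ultimately show ?thesis using cu
  proof eventually_elim
    case (elim y)
    show ?case
    proof
      fix z0 assume z0: "z0 \<in> ?B"
      have bl: "bounded_linear (\<lambda>h. \<Sum>i\<in>UNIV. h $ i *\<^sub>R w i z0 y)"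
        by (intro bounded_linear_sum bounded_linear_scaleR_const bounded_linear_vec_nth)
      show "((\<lambda>x. u x y) has_derivative (\<lambda>h. \<Sum>i\<in>UNIV. h $ i *\<^sub>R w i z0 y)) (at z0)"
        unfolding has_derivative_at_alt
      proof (intro conjI bl allI impI)
        fix e :: real assume e: "e > 0"
        \<comment> \<open>The dimension compensates for bounding the sum of the coordinates of
          \<open>z - z0\<close> by its norm.\<close>
        define \<epsilon> where "\<epsilon> = e / (real CARD('n) + 1)"
        have \<epsilon>: "\<epsilon> > 0" using e by (simp add: \<epsilon>_def add_nonneg_pos)
        have "\<exists>d>0. \<forall>x\<in>?B. dist x z0 < d \<longrightarrow> dist (w i x y) (w i z0 y) < \<epsilon>" for i
        proof -
          have "continuous_on ?B (\<lambda>x. w i x y)"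
            using elim(2) box_subset_cbox continuous_on_subset by blast
          then show ?thesis using z0 \<epsilon> unfolding continuous_on_iff by blast
        qed
        then obtain d where d: "\<And>i. d i > 0" "\<And>i x. x \<in> ?B \<Longrightarrow> dist x z0 < d i \<Longrightarrow> dist (w i x y) (w i z0 y) < \<epsilon>"
          by metis
        obtain d0 where d0: "d0 > 0" "cball z0 d0 \<subseteq> ?B"
          using open_contains_cball[of ?B] z0 open_box by blast
        define \<delta> where "\<delta> = Min (insert d0 (range (\<lambda>i. d i / 2)))"
        have \<delta>: "\<delta> > 0" using d(1) d0(1) by (simp add: \<delta>_def)
        have \<delta>d: "\<delta> < d i" for i
        proof -
          have "\<delta> \<le> d i / 2" unfolding \<delta>_def by (rule Min_le) auto
          then show ?thesis using d(1)[of i] by linarith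
        qed
        have \<delta>0: "cball z0 \<delta> \<subseteq> ?B"
        proof -
          have "\<delta> \<le> d0" unfolding \<delta>_def by (rule Min_le) auto
          then show ?thesis using d0(2) by auto
        qed
        have wz: "norm (w i \<xi> y - w i z0 y) \<le> \<epsilon>" if "\<xi> \<in> cball z0 \<delta>" for \<xi> i
          using d(2)[of \<xi> i] \<delta>d[of i] \<delta>0 that by (force simp: dist_norm dist_commute norm_minus_commute)
        \<comment> \<open>\<open>?g (x, z) \<le> 0\<close> is the derivative estimate for the
          increment from \<open>x\<close> to \<open>z\<close>, with the derivative frozen at
          \<open>z0\<close>. It holds for \<open>x\<close> and \<open>z\<close> in the dense set and
          passes to the closure because \<open>u\<close> is continuous; there \<open>x\<close> may
          be set to \<open>z0\<close>.\<close>
        let ?g = "\<lambda>q. norm (u (snd q) y - u (fst q) y - (\<Sum>i\<in>UNIV. (snd q - fst q) $ i *\<^sub>R w i z0 y))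
            - \<epsilon> * (\<Sum>i\<in>UNIV. \<bar>(snd q - fst q) $ i\<bar>)"
        let ?X = "Dn \<inter> ball z0 \<delta>"
        have dense: "?g (x, z) \<le> 0" if x: "x \<in> ?X" and z: "z \<in> ?X" for x z
        proof -
          let ?s = "\<lambda>j. (1 / 2 ^ j) *\<^sub>R
            (\<Sum>l<(2::nat) ^ j. \<Sum>i\<in>UNIV. (z - x) $ i *\<^sub>R w i (x + (real l / 2 ^ j) *\<^sub>R (z - x)) y)"
          let ?A = "\<Sum>i\<in>UNIV. (z - x) $ i *\<^sub>R w i z0 y" and ?V = "\<Sum>i\<in>UNIV. \<bar>(z - x) $ i\<bar>"
          have "x \<in> ?B" "z \<in> ?B" using x z \<delta>0 by (auto simp: subset_iff)
          then have lim: "(\<lambda>j. u z y - u x y - ?s j) \<longlonglongrightarrow> 0" using elim(1) x z by blast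
          have sA: "norm (?s j - ?A) \<le> \<epsilon> * ?V" for j
          proof -
            have "?s j - ?A = (1 / 2 ^ j) *\<^sub>R (\<Sum>l<(2::nat) ^ j. \<Sum>i\<in>UNIV. (z - x) $ i *\<^sub>R
                (w i (x + (real l / 2 ^ j) *\<^sub>R (z - x)) y - w i z0 y))"
              by (simp add: scaleR_diff_right sum_subtractf) (simp add: scaleR_conv_of_real)
            also have "norm \<dots> \<le> (1 / 2 ^ j) * (\<Sum>l<(2::nat) ^ j. \<epsilon> * ?V)"
              unfolding norm_scaleR
            proof (intro mult_mono)
              show "norm (\<Sum>l<(2::nat) ^ j. \<Sum>i\<in>UNIV. (z - x) $ i *\<^sub>R
                (w i (x + (real l / 2 ^ j) *\<^sub>R (z - x)) y - w i z0 y)) \<le> (\<Sum>l<(2::nat) ^ j. \<epsilon> * ?V)"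
              proof (rule sum_norm_le)
                fix l :: nat assume "l \<in> {..<2 ^ j}"
                then have t: "0 \<le> real l / 2 ^ j" "real l / 2 ^ j \<le> 1"
                  by (auto simp: divide_simps of_nat_le_iff[symmetric] simp del: of_nat_le_iff)
                have "x + (real l / 2 ^ j) *\<^sub>R (z - x) = (1 - real l / 2 ^ j) *\<^sub>R x + (real l / 2 ^ j) *\<^sub>R z"
                  by (simp add: algebra_simps)
                also have "\<dots> \<in> cball z0 \<delta>"
                  by (rule convexD[OF convex_cball]) (use x z t in auto)
                finally have m: "x + (real l / 2 ^ j) *\<^sub>R (z - x) \<in> cball z0 \<delta>" .
                have "norm (\<Sum>i\<in>UNIV. (z - x) $ i *\<^sub>R (w i (x + (real l / 2 ^ j) *\<^sub>R (z - x)) y - w i z0 y))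
                    \<le> (\<Sum>i\<in>UNIV. \<bar>(z - x) $ i\<bar> * \<epsilon>)"
                  by (rule sum_norm_le) (use wz[OF m] in \<open>auto intro: mult_left_mono\<close>)
                also have "\<dots> = \<epsilon> * ?V" by (simp add: sum_distrib_left mult.commute)
                finally show "norm (\<Sum>i\<in>UNIV. (z - x) $ i *\<^sub>R (w i (x + (real l / 2 ^ j) *\<^sub>R (z - x)) y - w i z0 y)) \<le> \<epsilon> * ?V" .
              qed
            qed auto
            also have "\<dots> = \<epsilon> * ?V" by simp
            finally show ?thesis .
          qed
          have tri: "norm (a1 - a3) \<le> norm (a1 - a2) + norm (a2 - a3)" for a1 a2 a3 :: complex
            using norm_triangle_ineq[of "a1 - a2" "a2 - a3"] by simp
          have b: "norm (u z y - u x y - ?A) \<le> norm (u z y - u x y - ?s j) + \<epsilon> * ?V" for j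
            by (rule order_trans[OF tri add_left_mono[OF sA]])
          have "(\<lambda>j. norm (u z y - u x y - ?s j) + \<epsilon> * ?V) \<longlonglongrightarrow> 0 + \<epsilon> * ?V"
            by (intro tendsto_add tendsto_norm_zero lim tendsto_const)
          then have "norm (u z y - u x y - ?A) \<le> 0 + \<epsilon> * ?V"
            by (rule LIMSEQ_le_const) (use b in blast)
          then show ?thesis by simp
        qed
        have clX: "closure (?X \<times> ?X) \<subseteq> cball z0 \<delta> \<times> cball z0 \<delta>"
          by (intro closure_minimal closed_Times) auto
        have ballX: "ball z0 \<delta> \<subseteq> closure ?X"
        proof
          fix q assume q: "q \<in> ball z0 \<delta>"
          show "q \<in> closure ?X"
            unfolding closure_approachable
          proof (intro allI impI)
            fix e' :: real assume "e' > 0"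
            then have "ball q e' \<inter> ball z0 \<delta> \<noteq> {}" using q by (metis IntI centre_in_ball empty_iff)
            then obtain d where "d \<in> Dn" "d \<in> ball q e' \<inter> ball z0 \<delta>"
              using Dn(2)[of "ball q e' \<inter> ball z0 \<delta>"] by blast
            then show "\<exists>y\<in>?X. dist y q < e'" by (auto simp: dist_commute)
          qed
        qed
        have ucont: "continuous_on (cball z0 \<delta>) (\<lambda>x. u x y)"
          by (rule continuous_on_subset[OF elim(3) order_trans[OF \<delta>0 box_subset_cbox]])
        have gcont: "continuous_on (closure (?X \<times> ?X)) ?g"
        proof (rule continuous_on_subset[OF _ clX])
          have "continuous_on (cball z0 \<delta> \<times> cball z0 \<delta>) (\<lambda>q. u (snd q) y)"
            "continuous_on (cball z0 \<delta> \<times> cball z0 \<delta>) (\<lambda>q. u (fst q) y)"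
            by (rule continuous_on_compose2[OF ucont]; force intro: continuous_intros)+
          then show "continuous_on (cball z0 \<delta> \<times> cball z0 \<delta>) ?g" by (intro continuous_intros)
        qed
        have all: "?g (z0, z) \<le> 0" if "z \<in> ball z0 \<delta>" for z
        proof (rule continuous_le_on_closure[OF gcont])
          show "(z0, z) \<in> closure (?X \<times> ?X)"
            unfolding closure_Times using ballX that \<delta> by auto
        qed (use dense in auto)
        show "\<exists>d>0. \<forall>z. norm (z - z0) < d \<longrightarrow>
          norm (u z y - u z0 y - (\<Sum>i\<in>UNIV. (z - z0) $ i *\<^sub>R w i z0 y)) \<le> e * norm (z - z0)"
        proof (intro exI conjI allI impI)
          fix z assume "norm (z - z0) < \<delta>"
          then have "z \<in> ball z0 \<delta>" by (simp add: dist_norm norm_minus_commute)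
          from all[OF this] have "norm (u z y - u z0 y - (\<Sum>i\<in>UNIV. (z - z0) $ i *\<^sub>R w i z0 y))
              \<le> \<epsilon> * (\<Sum>i\<in>UNIV. \<bar>(z - z0) $ i\<bar>)" by simp
          also have "\<dots> \<le> \<epsilon> * (real CARD('n) * norm (z - z0))"
            using \<epsilon> sum_abs_nth_le[of "z - z0"] by (intro mult_left_mono) auto
          also have "\<dots> = e * norm (z - z0) * (real CARD('n) / (real CARD('n) + 1))"
            by (simp add: \<epsilon>_def)
          also have "\<dots> \<le> e * norm (z - z0) * 1"
            using e by (intro mult_left_mono) auto
          finally show "norm (u z y - u z0 y - (\<Sum>i\<in>UNIV. (z - z0) $ i *\<^sub>R w i z0 y)) \<le> e * norm (z - z0)" by simp
        qed (rule \<delta>)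
      qed
    qed
  qed
qed

lemma version_Ck_on:
  fixes F :: "real^'n \<Rightarrow> 'y \<Rightarrow> complex"
  assumes r: "0 < r" "r \<le> 1" and QS: "cube c (2 * r) \<subseteq> S"
    and F: "Lp_Ck_on M p (k + Suc CARD('n)) S F"
    and u: "\<And>x. x \<in> cube c r \<Longrightarrow> AE y in M. u x y = F x y"
    and cu: "AE y in M. continuous_on (cube c r) (\<lambda>x. u x y)"
  shows "AE y in M. Ck_on k (box c (c + r *\<^sub>R (\<chi> i. 1))) (\<lambda>x. u x y)"
  using F u cu
proof (induction k arbitrary: F u)
  case 0
  show ?case using "0.prems"(3)
    by eventually_elim (use continuous_on_subset[OF _ box_subset_cbox] in auto)
next
  case (Suc k)
  let ?B = "box c (c + r *\<^sub>R (\<chi> i. 1))"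
  from Suc.prems(1) obtain D where F: "\<And>x. x \<in> S \<Longrightarrow> F x \<in> L"
    and D: "\<And>x. x \<in> S \<Longrightarrow> has_Lp_derivative M p F (D x) x"
    and Dk: "\<And>v. Lp_Ck_on M p (k + Suc CARD('n)) S (\<lambda>x. D x v)"
    by auto
  have cs: "cube c r \<subseteq> S"
  proof -
    have "cube c r \<subseteq> cube c (2 * r)" using r by (auto simp: cube_iff; smt (verit))
    then show ?thesis using QS by blast
  qed
  have "\<exists>w. (AE y in M. continuous_on (cube c r) (\<lambda>x. w x y)) \<and> (\<forall>x\<in>cube c r. AE y in M. w x y = D x (axis i 1) y)" for i
  proof -
    have "Lp_Ck_on M p (Suc CARD('n)) S (\<lambda>x. D x (axis i 1))" by (rule Lp_Ck_on_le[OF Dk]) simp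
    then obtain w :: "real^'n \<Rightarrow> 'y \<Rightarrow> complex" and v where
      "case_prod w \<in> borel_measurable (borel \<Otimes>\<^sub>M M)" "\<And>y. 0 \<le> v y" "(\<lambda>y. complex_of_real (v y)) \<in> L"
      "AE y in M. continuous_on (cube c r) (\<lambda>x. w x y) \<and> (\<forall>x\<in>cube c r. cmod (w x y) \<le> v y)"
      "\<And>x. x \<in> cube c r \<Longrightarrow> AE y in M. w x y = D x (axis i 1) y"
      by (rule continuous_version[OF r QS]) (rule that)
    then show ?thesis by (intro exI[of _ w] conjI ballI) (auto elim!: AE_mp)
  qed
  then have "\<exists>w. \<forall>i. (AE y in M. continuous_on (cube c r) (\<lambda>x. w i x y)) \<and> (\<forall>x\<in>cube c r. AE y in M. w i x y = D x (axis i 1) y)"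
    by (intro choice allI)
  then obtain w where w: "\<And>i. AE y in M. continuous_on (cube c r) (\<lambda>x. w i x y)"
    "\<And>i x. x \<in> cube c r \<Longrightarrow> AE y in M. w i x y = D x (axis i 1) y" by blast
  have "AE y in M. Ck_on k ?B (\<lambda>x. w i x y)" for i
    by (rule Suc.IH[OF Dk w(2) w(1)])
  then have "AE y in M. \<forall>i\<in>UNIV. Ck_on k ?B (\<lambda>x. w i x y)" by (intro AE_finite_allI) auto
  moreover have "AE y in M. \<forall>x\<in>?B. ((\<lambda>x. u x y) has_derivative (\<lambda>h. \<Sum>i\<in>UNIV. h $ i *\<^sub>R w i x y)) (at x)"
  proof (rule version_has_derivative[OF cs r(1) F D _ Suc.prems(2,3) w(2) w(1)])
    show "Lp_Ck_on M p (Suc 0) S (\<lambda>x. D x (axis i 1))" for i by (rule Lp_Ck_on_le[OF Dk]) simp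
  qed
  ultimately show ?case
  proof eventually_elim
    case (elim y)
    show ?case
    proof (rule Ck_on_SucI[OF open_box])
      show "((\<lambda>x. u x y) has_derivative (\<lambda>h. \<Sum>i\<in>UNIV. h $ i *\<^sub>R w i x y)) (at x)" if "x \<in> ?B" for x
        using elim that by blast
      show "Ck_on k ?B (\<lambda>x. \<Sum>i\<in>UNIV. v $ i *\<^sub>R w i x y)" for v
        by (intro Ck_on_sum[OF open_box] Ck_on_bounded_linear[OF open_box bounded_linear_scaleR_right]) (use elim in auto)
    qed
  qed
qed

text \<open>One \<open>u\<close> serves all orders of differentiability because the preceding lemma
  applies to every continuous version; the countably many exceptional sets are united.\<close>

theorem smooth_version:
  fixes F :: "real^'n \<Rightarrow> 'y \<Rightarrow> complex"
  assumes r: "0 < r" "r \<le> 1" and QS: "cube c (2 * r) \<subseteq> S" and F: "Lp_smooth_on M p S F"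
  obtains u v where "case_prod u \<in> borel_measurable (borel \<Otimes>\<^sub>M M)"
    "(\<lambda>y. complex_of_real (v y)) \<in> L"
    "AE y in M. smooth_on (box c (c + r *\<^sub>R (\<chi> i. 1))) (\<lambda>x. u x y) \<and> (\<forall>x\<in>cube c r. cmod (u x y) \<le> v y)"
    "\<And>x. x \<in> cube c r \<Longrightarrow> AE y in M. u x y = F x y"
proof -
  have Fk: "Lp_Ck_on M p k S F" for k using F by (simp add: Lp_smooth_on_def)
  obtain u v where u: "case_prod u \<in> borel_measurable (borel \<Otimes>\<^sub>M M)" "\<And>y. 0 \<le> v y" "(\<lambda>y. complex_of_real (v y)) \<in> L"
    "AE y in M. continuous_on (cube c r) (\<lambda>x. u x y) \<and> (\<forall>x\<in>cube c r. cmod (u x y) \<le> v y)"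
    "\<And>x. x \<in> cube c r \<Longrightarrow> AE y in M. u x y = F x y"
    by (rule continuous_version[OF r QS Fk]) (rule that)
  have "AE y in M. Ck_on k (box c (c + r *\<^sub>R (\<chi> i. 1))) (\<lambda>x. u x y)" for k
    by (rule version_Ck_on[OF r QS Fk u(5)]) (use u(4) in auto)
  then have "AE y in M. smooth_on (box c (c + r *\<^sub>R (\<chi> i. 1))) (\<lambda>x. u x y)"
    unfolding smooth_on_def AE_all_countable by (rule allI)
  with u(4) have "AE y in M. smooth_on (box c (c + r *\<^sub>R (\<chi> i. 1))) (\<lambda>x. u x y) \<and> (\<forall>x\<in>cube c r. cmod (u x y) \<le> v y)"
    by eventually_elim blast
  then show ?thesis by (rule that[OF u(1,3) _ u(5)])
qed

end

section \<open>The homogeneous space as a measure space\<close>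

context lie
begin

lemma continuous_mult:
  assumes "continuous_map X T f" "continuous_map X T g"
  shows "continuous_map X T (\<lambda>x. f x \<otimes> g x)"
proof -
  have 1: "continuous_map (prod_topology T T) T (\<lambda>(x, y). x \<otimes> y)"
    using lie by (simp add: lie_group_def smooth_map_def)
  have 2: "continuous_map X (prod_topology T T) (\<lambda>x. (f x, g x))"
    using assms by (simp add: continuous_map_paired)
  show ?thesis using continuous_map_compose[OF 2 1] by (simp add: o_def)
qed

lemma continuous_inv:
  assumes "continuous_map X T f" shows "continuous_map X T (\<lambda>x. inv (f x))"
proof -
  have 1: "continuous_map T T (\<lambda>x. inv x)"
    using lie by (simp add: lie_group_def smooth_map_def)
  show ?thesis using continuous_map_compose[OF assms 1] by (simp add: o_def)
qed

lemma continuous_const: "c \<in> carrier G \<Longrightarrow> continuous_map X T (\<lambda>x. c)"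
  by (simp add: continuous_map_const)

lemma openin_preimage:
  assumes "continuous_map T T f" "openin T W"
  shows "openin T {a \<in> carrier G. f a \<in> W}"
  using openin_continuous_map_preimage[OF assms] by simp

lemma openin_right_translate:
  assumes "openin T W" "h \<in> carrier G" shows "openin T ((\<lambda>g. g \<otimes> h) ` W)"
proof -
  have "W \<subseteq> carrier G" using openin_subset[OF assms(1)] by simp
  then have "(\<lambda>g. g \<otimes> h) ` W = {a \<in> carrier G. a \<otimes> inv h \<in> W}"
  proof (intro equalityI subsetI)
    fix x assume "x \<in> {a \<in> carrier G. a \<otimes> inv h \<in> W}"
    then have "x = (x \<otimes> inv h) \<otimes> h" "x \<otimes> inv h \<in> W" using assms(2) by (auto simp: m_assoc)
    then show "x \<in> (\<lambda>g. g \<otimes> h) ` W" by blast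
  qed (use assms(2) in \<open>auto simp: m_assoc\<close>)
  then show ?thesis
    using openin_preimage[OF continuous_mult[OF continuous_map_id[unfolded id_def] continuous_const] assms(1)] assms(2) by simp
qed

end

text \<open>Cutting open sets into countably many open rectangles makes them measurable for the
  product of the Borel \<sigma>-algebras, the one for which Fubini is stated.\<close>

lemma openin_prod_in_sigma_sets:
  assumes "second_countable P" "second_countable Q" "openin (prod_topology P Q) S"
  shows "\<exists>C. countable C \<and> (\<forall>(U, V)\<in>C. openin P U \<and> openin Q V) \<and> S = (\<Union>(U, V)\<in>C. U \<times> V)"
proof -
  obtain \<B> where B: "countable \<B>" "\<And>V. V \<in> \<B> \<Longrightarrow> openin P V"
    "\<And>U x. openin P U \<Longrightarrow> x \<in> U \<Longrightarrow> \<exists>V\<in>\<B>. x \<in> V \<and> V \<subseteq> U"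
    using assms(1) unfolding second_countable_def by metis
  obtain \<C> where C: "countable \<C>" "\<And>V. V \<in> \<C> \<Longrightarrow> openin Q V"
    "\<And>U x. openin Q U \<Longrightarrow> x \<in> U \<Longrightarrow> \<exists>V\<in>\<C>. x \<in> V \<and> V \<subseteq> U"
    using assms(2) unfolding second_countable_def by metis
  let ?D = "{(U, V) \<in> \<B> \<times> \<C>. U \<times> V \<subseteq> S}"
  have "S \<subseteq> (\<Union>(U, V)\<in>?D. U \<times> V)"
  proof
    fix z assume z: "z \<in> S"
    obtain x y where xy: "z = (x, y)" by fastforce
    obtain U V where "openin P U" "openin Q V" "x \<in> U" "y \<in> V" "U \<times> V \<subseteq> S"
      using assms(3) z xy unfolding openin_prod_topology_alt by metis
    then obtain U' V' where "U' \<in> \<B>" "V' \<in> \<C>" "x \<in> U'" "y \<in> V'" "U' \<subseteq> U" "V' \<subseteq> V"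
      using B(3) C(3) by metis
    moreover have "U' \<times> V' \<subseteq> S" using calculation \<open>U \<times> V \<subseteq> S\<close> by blast
    ultimately show "z \<in> (\<Union>(U, V)\<in>?D. U \<times> V)" using xy by blast
  qed
  moreover have "countable ?D"
    by (rule countable_subset[of _ "\<B> \<times> \<C>"]) (use B(1) C(1) in auto)
  ultimately show ?thesis using B(2) C(2) by (intro exI[of _ ?D]) auto
qed

lemma atlas_compact_neighbourhood:
  assumes at: "atlas_on Y B" and y: "y \<in> topspace Y" and O: "openin Y S" "y \<in> S"
  obtains U K where "openin Y U" "compactin Y K" "y \<in> U" "U \<subseteq> K" "K \<subseteq> S"
proof -
  obtain V \<psi> where V: "(V, \<psi>) \<in> B" "is_chart Y (V, \<psi>)" "y \<in> V"
    using atlas_onE[OF at] y by auto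
  have oVS: "openin Y (V \<inter> S)" using chart_openin[OF V(2)] O by blast
  have "open (\<psi> ` (V \<inter> S))" "\<psi> y \<in> \<psi> ` (V \<inter> S)"
    using chart_image_open[OF V(2) oVS] V O by auto
  then obtain e where e: "e > 0" "cball (\<psi> y) e \<subseteq> \<psi> ` (V \<inter> S)"
    by (meson open_contains_cball)
  let ?U = "{b \<in> V. \<psi> b \<in> ball (\<psi> y) e}" and ?K = "inv_into V \<psi> ` cball (\<psi> y) e"
  show ?thesis
  proof (rule that[of ?U ?K])
    show "openin Y ?U" by (rule chart_preimage_open[OF V(2)]) simp
    have "compactin (top_of_set (\<psi> ` V)) (cball (\<psi> y) e)"
      using e(2) by (auto simp: compactin_subtopology)
    then show "compactin Y ?K" using image_compactin chart_inv_continuous[OF V(2)] by blast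
    show "y \<in> ?U" using V e by simp
    show "?U \<subseteq> ?K"
    proof
      fix b assume "b \<in> ?U"
      then show "b \<in> ?K" using chart_inv[OF V(2), of b] by (force intro: image_eqI[of _ _ "\<psi> b"])
    qed
    show "?K \<subseteq> S" using e(2) chart_inv[OF V(2)] by fastforce
  qed
qed

locale homspace = lie G T A
  for G (structure) and T :: "'a topology" and A :: "('a, real^'n) chart set" +
  fixes H :: "'a set" and B :: "('a set, 'f::euclidean_space) chart set" and \<mu> :: "'a set measure"
  assumes H: "subgroup H G" and q: "quotient_atlas G T A H B" and B_nonempty: "B \<noteq> {}"
    and mu: "invariant_radon_measure G T H \<mu>"
begin

abbreviation "Y \<equiv> coset_topology G T H"
abbreviation proj where "proj g \<equiv> g <# H"

lemma H_sub: "H \<subseteq> carrier G" using H by (rule subgroup.subset)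
lemma H_one: "\<one> \<in> H" using H by (rule subgroup.one_closed)

lemma quotient_proj: "quotient_map T Y (\<lambda>g. proj g)"
  by (rule quotient_map_coset_topology) simp

lemma topspace_Y [simp]: "topspace Y = lcosets H"
  using quotient_imp_surjective_map[OF quotient_proj] by (auto simp: LCOSETS_def)

lemma openin_Y: "openin Y S \<longleftrightarrow> S \<subseteq> lcosets H \<and> openin T {g \<in> carrier G. proj g \<in> S}"
  by (rule openin_coset_topology) simp

lemma manifold_Y: "smooth_manifold Y B" using q by (simp add: quotient_atlas_def)

lemma atlas_Y: "atlas_on Y B" using smooth_manifold_atlas_on[OF manifold_Y B_nonempty] .

lemma smooth_proj: "smooth_map T A Y B (\<lambda>g. proj g)"
  using q by (simp add: quotient_atlas_def submersion_def)

lemma continuous_proj: "continuous_map T Y (\<lambda>g. proj g)"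
  using smooth_proj by (simp add: smooth_map_def)

lemma second_countable_Y: "second_countable Y" and Hausdorff_Y: "Hausdorff_space Y"
  using manifold_Y by (simp_all add: smooth_manifold_def)

lemma lcosets_cases:
  assumes "y \<in> lcosets H" obtains g where "g \<in> carrier G" "y = proj g"
  using assms by (auto simp: LCOSETS_def)

lemma proj_in [simp]: "g \<in> carrier G \<Longrightarrow> proj g \<in> lcosets H"
  by (auto simp: LCOSETS_def)

lemma act_proj: "a \<in> carrier G \<Longrightarrow> g \<in> carrier G \<Longrightarrow> a <# proj g = proj (a \<otimes> g)"
  using lcos_m_assoc[OF H_sub] by simp

lemma act_in [simp]: "a \<in> carrier G \<Longrightarrow> y \<in> lcosets H \<Longrightarrow> a <# y \<in> lcosets H"
  by (metis act_proj lcosets_cases m_closed proj_in)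

lemma act_act: "a \<in> carrier G \<Longrightarrow> b \<in> carrier G \<Longrightarrow> y \<in> lcosets H \<Longrightarrow> a <# (b <# y) = (a \<otimes> b) <# y"
  by (metis act_proj lcosets_cases m_closed m_assoc)

lemma act_one [simp]: "y \<in> lcosets H \<Longrightarrow> \<one> <# y = y"
  by (metis act_proj lcosets_cases l_one one_closed)

lemma act_inv: "a \<in> carrier G \<Longrightarrow> y \<in> lcosets H \<Longrightarrow> inv a <# (a <# y) = y"
  "a \<in> carrier G \<Longrightarrow> y \<in> lcosets H \<Longrightarrow> a <# (inv a <# y) = y"
  by (simp_all add: act_act)

lemma proj_eq_H_iff: "g \<in> carrier G \<Longrightarrow> proj g = H \<longleftrightarrow> g \<in> H"
proof
  assume g: "g \<in> carrier G" and "proj g = H"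
  have "g \<otimes> \<one> \<in> proj g" using H_one unfolding l_coset_def by blast
  then show "g \<in> H" using g \<open>proj g = H\<close> by simp
next
  assume "g \<in> H" then show "proj g = H"
    using subgroup.lcos_module_rev[OF H] H lcos_m_assoc[OF H_sub]
    by (metis coset_join3 subgroup.mem_carrier)
qed

lemma H_in: "H \<in> lcosets H" using proj_in[OF one_closed] lcos_mult_one[OF H_sub] by simp

text \<open>The saturation of \<open>W\<close> is the union of its right translates by elements of
  \<open>H\<close>, each of them open.\<close>

lemma openin_proj:
  assumes W: "openin T W" shows "openin Y ((\<lambda>g. proj g) ` W)"
  unfolding openin_Y
proof
  have Wc: "W \<subseteq> carrier G" using openin_subset[OF W] by simp
  then show "(\<lambda>g. proj g) ` W \<subseteq> lcosets H" by auto
  have "{g \<in> carrier G. proj g \<in> (\<lambda>g. proj g) ` W} = (\<Union>h\<in>H. (\<lambda>g. g \<otimes> h) ` W)"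
  proof (intro equalityI subsetI)
    fix g assume "g \<in> {g \<in> carrier G. proj g \<in> (\<lambda>g. proj g) ` W}"
    then obtain w where w: "w \<in> W" "g \<in> carrier G" "proj g = proj w" by auto
    have "g \<otimes> \<one> \<in> proj g" using H_one unfolding l_coset_def by blast
    then have "g \<in> proj w" using w by simp
    then obtain h where "h \<in> H" "g = w \<otimes> h" unfolding l_coset_def by blast
    then show "g \<in> (\<Union>h\<in>H. (\<lambda>g. g \<otimes> h) ` W)" using w by blast
  next
    fix g assume "g \<in> (\<Union>h\<in>H. (\<lambda>g. g \<otimes> h) ` W)"
    then obtain h w where h: "h \<in> H" "w \<in> W" "g = w \<otimes> h" by blast
    then have c: "h \<in> carrier G" "w \<in> carrier G" using H_sub Wc by auto
    have "proj g = w <# proj h" using act_proj[OF c(2,1)] h by simp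
    also have "proj h = H" using proj_eq_H_iff[OF c(1)] h by simp
    finally show "g \<in> {g \<in> carrier G. proj g \<in> (\<lambda>g. proj g) ` W}" using h c by auto
  qed
  moreover have "openin T (\<Union>h\<in>H. (\<lambda>g. g \<otimes> h) ` W)"
    using openin_right_translate[OF W] H_sub by (intro openin_Union) auto
  ultimately show "openin T {g \<in> carrier G. proj g \<in> (\<lambda>g. proj g) ` W}" by simp
qed

text \<open>Continuity is checked on \<open>G\<close> times \<open>G\<close> and descends because
  the projection is open; a product of quotient maps need not be a quotient map in general.\<close>

lemma continuous_act: "continuous_map (prod_topology T Y) Y (\<lambda>(a, y). a <# y)"
  unfolding continuous_map_def
proof (intro conjI allI impI)
  show "(\<lambda>(a, y). a <# y) \<in> topspace (prod_topology T Y) \<rightarrow> topspace Y" by auto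
  fix S assume S: "openin Y S"
  let ?P = "{z \<in> topspace (prod_topology T Y). (case z of (a, y) \<Rightarrow> a <# y) \<in> S}"
  have c: "continuous_map (prod_topology T T) Y (\<lambda>z. proj (fst z \<otimes> snd z))"
    using continuous_map_compose[OF continuous_mult[OF continuous_map_fst continuous_map_snd] continuous_proj]
    by (simp add: o_def)
  have o: "openin (prod_topology T T) {z \<in> carrier G \<times> carrier G. proj (fst z \<otimes> snd z) \<in> S}"
    using openin_continuous_map_preimage[OF c S] by simp
  show "openin (prod_topology T Y) ?P"
    unfolding openin_prod_topology_alt
  proof (intro allI impI)
    fix a y assume "(a, y) \<in> ?P"
    then have a: "a \<in> carrier G" "y \<in> lcosets H" "a <# y \<in> S" by auto
    obtain g where g: "g \<in> carrier G" "y = proj g" using lcosets_cases[OF a(2)] .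
    have "(a, g) \<in> {z \<in> carrier G \<times> carrier G. proj (fst z \<otimes> snd z) \<in> S}"
      using a g act_proj by auto
    then obtain U V where UV: "openin T U" "openin T V" "a \<in> U" "g \<in> V"
      "U \<times> V \<subseteq> {z \<in> carrier G \<times> carrier G. proj (fst z \<otimes> snd z) \<in> S}"
      using o unfolding openin_prod_topology_alt by meson
    have "U \<times> (\<lambda>g. proj g) ` V \<subseteq> ?P"
    proof safe
      fix b k assume bk: "b \<in> U" "k \<in> V"
      then have "b \<in> carrier G" "k \<in> carrier G" "proj (b \<otimes> k) \<in> S" using UV(5) by auto
      then show "(b, proj k) \<in> topspace (prod_topology T Y)" "b <# proj k \<in> S" using act_proj by auto
    qed
    then show "\<exists>U V. openin T U \<and> openin Y V \<and> a \<in> U \<and> y \<in> V \<and> U \<times> V \<subseteq> ?P"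
      using UV g openin_proj by blast
  qed
qed

lemma continuous_act_fixed: "a \<in> carrier G \<Longrightarrow> continuous_map Y Y (\<lambda>y. a <# y)"
proof -
  assume a: "a \<in> carrier G"
  have 1: "continuous_map Y (prod_topology T Y) (\<lambda>y. (a, y))"
    using a by (simp add: continuous_map_paired continuous_map_id[unfolded id_def])
  show ?thesis using continuous_map_compose[OF 1 continuous_act] by (simp add: o_def)
qed

section \<open>Measurability of the action and positivity of the invariant measure\<close>

lemma space_mu: "space \<mu> = lcosets H"
  and sets_mu: "sets \<mu> = sigma_sets (lcosets H) {S. openin Y S}"
  and compact_finite: "compactin Y K \<Longrightarrow> emeasure \<mu> K < \<infinity>"
  and mu_nonzero: "emeasure \<mu> (space \<mu>) \<noteq> 0"
  and mu_inv: "g \<in> carrier G \<Longrightarrow> S \<in> sets \<mu> \<Longrightarrow> emeasure \<mu> ((\<lambda>y. g <# y) ` S) = emeasure \<mu> S"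
  using mu by (auto simp: invariant_radon_measure_def)

lemma open_in_sets: "openin Y S \<Longrightarrow> S \<in> sets \<mu>"
  unfolding sets_mu by (auto intro: sigma_sets.Basic)

lemma compact_in_sets:
  assumes "compactin Y K" shows "K \<in> sets \<mu>"
proof -
  have "closedin Y K" using assms Hausdorff_Y compactin_imp_closedin by blast
  then have "openin Y (lcosets H - K)" "K \<subseteq> lcosets H" by (auto simp: closedin_def)
  then show ?thesis using open_in_sets sets.compl_sets[of "lcosets H - K" \<mu>]
    by (simp add: space_mu double_diff)
qed

lemma measurable_into_mu:
  assumes "f \<in> space N \<rightarrow> lcosets H" "\<And>S. openin Y S \<Longrightarrow> f -` S \<inter> space N \<in> sets N"
  shows "f \<in> measurable N \<mu>"
  by (rule measurable_sigma_sets[OF sets_mu _ assms(1)]) (use assms(2) openin_subset[of Y] in auto)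

lemma measurable_act:
  fixes \<beta> :: "'b::euclidean_space \<Rightarrow> 'a"
  assumes X: "X \<in> sets borel" and \<beta>: "continuous_map (top_of_set X) T \<beta>"
  shows "(\<lambda>(x, y). \<beta> x <# y) \<in> measurable (restrict_space lborel X \<Otimes>\<^sub>M \<mu>) \<mu>"
proof (rule measurable_into_mu)
  have sp: "space (restrict_space lborel X \<Otimes>\<^sub>M \<mu>) = X \<times> lcosets H"
    by (simp add: space_pair_measure space_mu space_restrict_space)
  have bc: "\<beta> x \<in> carrier G" if "x \<in> X" for x
    using \<beta> that by (auto simp: continuous_map_def)
  then show "(\<lambda>(x, y). \<beta> x <# y) \<in> space (restrict_space lborel X \<Otimes>\<^sub>M \<mu>) \<rightarrow> lcosets H"
    by (auto simp: sp)
  fix S assume S: "openin Y S"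
  let ?P = "prod_topology (top_of_set X) Y"
  have c1: "continuous_map ?P (prod_topology T Y) (\<lambda>z. (\<beta> (fst z), snd z))"
    using continuous_map_compose[OF continuous_map_fst \<beta>]
    by (simp add: continuous_map_paired continuous_map_snd o_def)
  have c2: "continuous_map ?P Y (\<lambda>z. \<beta> (fst z) <# snd z)"
    using continuous_map_compose[OF c1 continuous_act] by (simp add: o_def)
  have "openin ?P {z \<in> X \<times> lcosets H. \<beta> (fst z) <# snd z \<in> S}"
    using openin_continuous_map_preimage[OF c2 S] by simp
  moreover have "(\<lambda>(x, y). \<beta> x <# y) -` S \<inter> space (restrict_space lborel X \<Otimes>\<^sub>M \<mu>)
      = {z \<in> X \<times> lcosets H. \<beta> (fst z) <# snd z \<in> S}"
    unfolding sp by (rule Set.set_eqI) (simp add: case_prod_beta' conj_commute)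
  ultimately have oP: "openin ?P ((\<lambda>(x, y). \<beta> x <# y) -` S \<inter> space (restrict_space lborel X \<Otimes>\<^sub>M \<mu>))" by simp
  have sc: "second_countable (top_of_set X)"
  proof (rule second_countable_subtopology)
    obtain \<D> :: "'b set set" where "countable \<D>" "topological_basis \<D>" using ex_countable_basis by blast
    then show "second_countable (euclidean :: 'b topology)"
      unfolding second_countable_def
    proof (intro exI[of _ \<D>] conjI allI impI ballI)
      fix U and x :: 'b assume "openin euclidean U \<and> x \<in> U"
      then have "open U" "x \<in> U" by simp_all
      then obtain V where "V \<in> \<D>" "x \<in> V" "V \<subseteq> U" by (rule topological_basisE[OF \<open>topological_basis \<D>\<close>])
      then show "\<exists>V\<in>\<D>. x \<in> V \<and> V \<subseteq> U" by (intro bexI[of _ V] conjI)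
    qed (use \<open>countable \<D>\<close> topological_basis_open[OF \<open>topological_basis \<D>\<close>] in simp_all)
  qed
  obtain C where C: "countable C \<and> (\<forall>(U, V)\<in>C. openin (top_of_set X) U \<and> openin Y V) \<and>
    (\<lambda>(x, y). \<beta> x <# y) -` S \<inter> space (restrict_space lborel X \<Otimes>\<^sub>M \<mu>) = (\<Union>(U, V)\<in>C. U \<times> V)"
    using openin_prod_in_sigma_sets[OF sc second_countable_Y oP] by (rule exE)
  have C1: "countable C" and C3: "(\<lambda>(x, y). \<beta> x <# y) -` S \<inter> space (restrict_space lborel X \<Otimes>\<^sub>M \<mu>) = (\<Union>(U, V)\<in>C. U \<times> V)"
    using C by simp_all
  have C2: "openin (top_of_set X) U \<and> openin Y V" if "(U, V) \<in> C" for U V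
    using C that by auto
  have "U \<times> V \<in> sets (restrict_space lborel X \<Otimes>\<^sub>M \<mu>)" if UV: "(U, V) \<in> C" for U V
  proof (rule pair_measureI)
    obtain U' where "open U'" "U = X \<inter> U'" using C2[OF UV] openin_open by metis
    then show "U \<in> sets (restrict_space lborel X)"
      using X by (auto simp: sets_restrict_space)
    show "V \<in> sets \<mu>" using C2[OF UV] open_in_sets by simp
  qed
  then show "(\<lambda>(x, y). \<beta> x <# y) -` S \<inter> space (restrict_space lborel X \<Otimes>\<^sub>M \<mu>)
      \<in> sets (restrict_space lborel X \<Otimes>\<^sub>M \<mu>)"
    unfolding C3 by (intro sets.countable_UN'[OF C1]) auto
qed

lemma act_measurable: "a \<in> carrier G \<Longrightarrow> (\<lambda>y. a <# y) \<in> measurable \<mu> \<mu>"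
proof (rule measurable_into_mu)
  assume a: "a \<in> carrier G"
  show "(\<lambda>y. a <# y) \<in> space \<mu> \<rightarrow> lcosets H" using a by (auto simp: space_mu)
  fix S assume "openin Y S"
  then have "openin Y {y \<in> topspace Y. a <# y \<in> S}"
    by (rule openin_continuous_map_preimage[OF continuous_act_fixed[OF a]])
  then have "{y \<in> lcosets H. a <# y \<in> S} \<in> sets \<mu>" using open_in_sets by simp
  moreover have "(\<lambda>y. a <# y) -` S \<inter> space \<mu> = {y \<in> lcosets H. a <# y \<in> S}" by (auto simp: space_mu)
  ultimately show "(\<lambda>y. a <# y) -` S \<inter> space \<mu> \<in> sets \<mu>" by simp
qed

lemma act_image_eq:
  assumes "a \<in> carrier G" "S \<subseteq> lcosets H"
  shows "(\<lambda>y. a <# y) ` S = (\<lambda>y. inv a <# y) -` S \<inter> lcosets H"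
proof (intro equalityI subsetI)
  fix y assume "y \<in> (\<lambda>y. a <# y) ` S"
  then show "y \<in> (\<lambda>y. inv a <# y) -` S \<inter> lcosets H" using assms act_inv by auto
next
  fix y assume y: "y \<in> (\<lambda>y. inv a <# y) -` S \<inter> lcosets H"
  then have "a <# (inv a <# y) = y" using assms act_inv by auto
  then show "y \<in> (\<lambda>y. a <# y) ` S" using y by (metis IntD1 image_eqI vimage_eq)
qed

lemma act_in_sets:
  assumes "a \<in> carrier G" "S \<in> sets \<mu>" shows "(\<lambda>y. a <# y) ` S \<in> sets \<mu>"
  using act_image_eq[OF assms(1), of S] measurable_sets[OF act_measurable assms(2), of "inv a"]
    sets.sets_into_space[OF assms(2)] assms(1) by (simp add: space_mu)

lemma openin_act: "a \<in> carrier G \<Longrightarrow> openin Y S \<Longrightarrow> openin Y ((\<lambda>y. a <# y) ` S)"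
  using openin_continuous_map_preimage[OF continuous_act_fixed, of "inv a" S] act_image_eq[of a S] openin_subset[of Y S]
  by (simp add: vimage_def Int_def conj_commute)

lemma countable_subcover:
  assumes "\<And>y. y \<in> lcosets H \<Longrightarrow> \<exists>U\<in>\<U>. y \<in> U" "\<And>U. U \<in> \<U> \<Longrightarrow> openin Y U"
  obtains \<V> where "countable \<V>" "\<V> \<subseteq> \<U>" "\<Union>\<V> = lcosets H"
proof -
  have "Lindelof_space Y" by (rule second_countable_imp_Lindelof_space[OF second_countable_Y])
  moreover have "\<Union>\<U> = lcosets H" using assms openin_subset by fastforce
  ultimately show ?thesis using assms(2) that unfolding Lindelof_space_def by (metis topspace_Y)
qed

text \<open>If \<open>S\<close> were null, countably many of its translates would cover
  \<open>Y\<close> by the Lindelof property, and each of them would be null by invariance.\<close>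

lemma open_positive:
  assumes S: "openin Y S" "S \<noteq> {}" shows "emeasure \<mu> S > 0"
proof (rule ccontr)
  assume "\<not> emeasure \<mu> S > 0"
  then have 0: "emeasure \<mu> S = 0" by simp
  obtain s where s: "s \<in> S" "s \<in> lcosets H" using S openin_subset by fastforce
  obtain k where k: "k \<in> carrier G" "s = proj k" using lcosets_cases[OF s(2)] .
  let ?U = "(\<lambda>a. (\<lambda>y. a <# y) ` S) ` carrier G"
  obtain \<V> where V: "countable \<V>" "\<V> \<subseteq> ?U" "\<Union>\<V> = lcosets H"
  proof (rule countable_subcover[of ?U])
    fix y assume "y \<in> lcosets H"
    then obtain g where g: "g \<in> carrier G" "y = proj g" by (rule lcosets_cases)
    have "(g \<otimes> inv k) <# s = y" using g k act_proj by (simp add: m_assoc)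
    then show "\<exists>U\<in>?U. y \<in> U" using s g k by blast
  qed (use openin_act S in auto)
  have "\<V> \<subseteq> null_sets \<mu>"
  proof
    fix X assume "X \<in> \<V>"
    then obtain a where "a \<in> carrier G" "X = (\<lambda>y. a <# y) ` S" using V by blast
    then show "X \<in> null_sets \<mu>"
      using mu_inv[of a S] act_in_sets open_in_sets[OF S(1)] 0 by (simp add: null_sets_def)
  qed
  then have "(\<Union>X\<in>\<V>. X) \<in> null_sets \<mu>" by (intro null_sets_UN'[OF V(1)]) auto
  then show False using mu_nonzero V(3) by (simp add: space_mu null_sets_def)
qed

lemma AE_open_ex:
  assumes "AE y in \<mu>. P y" "openin Y S" "S \<noteq> {}" shows "\<exists>y\<in>S. P y"
proof (rule ccontr)
  assume n: "\<not> (\<exists>y\<in>S. P y)"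
  obtain N where N0: "{y \<in> space \<mu>. \<not> P y} \<subseteq> N" "emeasure \<mu> N = 0" "N \<in> sets \<mu>"
    by (rule AE_E[OF assms(1)])
  then have N: "N \<in> null_sets \<mu>" "{y \<in> space \<mu>. \<not> P y} \<subseteq> N" by (auto simp: null_sets_def)
  have "S \<subseteq> N" using n N(2) openin_subset[OF assms(2)] by (auto simp: space_mu)
  then have "emeasure \<mu> S \<le> emeasure \<mu> N" using N(1) by (intro emeasure_mono) auto
  then show False using open_positive[OF assms(2,3)] N(1) by (simp add: null_sets_def)
qed

lemma sigma_finite: "sigma_finite_measure \<mu>"
proof
  let ?U = "{U. openin Y U \<and> emeasure \<mu> U \<noteq> \<infinity>}"
  obtain \<V> where V: "countable \<V>" "\<V> \<subseteq> ?U" "\<Union>\<V> = lcosets H"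
  proof (rule countable_subcover[of ?U])
    fix y assume y: "y \<in> lcosets H"
    obtain U K where U: "openin Y U" "compactin Y K" "y \<in> U" "U \<subseteq> K"
      using atlas_compact_neighbourhood[OF atlas_Y, of y "lcosets H"] openin_topspace[of Y] y by (metis topspace_Y)
    have "emeasure \<mu> U \<le> emeasure \<mu> K" using U compact_in_sets by (intro emeasure_mono) auto
    then have "emeasure \<mu> U \<noteq> \<infinity>" using compact_finite[OF U(2)] by (auto simp: top_unique)
    then show "\<exists>U\<in>?U. y \<in> U" using U by blast
  qed auto
  show "\<exists>A. countable A \<and> A \<subseteq> sets \<mu> \<and> \<Union> A = space \<mu> \<and> (\<forall>a\<in>A. emeasure \<mu> a \<noteq> \<infinity>)"
    using V open_in_sets by (intro exI[of _ \<V>]) (auto simp: space_mu)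
qed

end

section \<open>Smooth vectors are smooth functions\<close>

lemma small_cube:
  fixes x :: "real^'n"
  assumes "open S" "x \<in> S"
  obtains c r where "0 < r" "r \<le> 1" "x \<in> box c (c + r *\<^sub>R (\<chi> i. 1))" "cube c (2 * r) \<subseteq> S"
proof -
  obtain e where e: "e > 0" "ball x e \<subseteq> S" using assms open_contains_ball by blast
  define n where "n = real CARD('n)"
  have n: "n \<ge> 1" by (simp add: n_def Suc_leI)
  define r where "r = min 1 (e / (4 * n))"
  have r: "0 < r" "r \<le> 1" "r \<le> e / (4 * n)" using e n by (auto simp: r_def)
  define c where "c = x - (r / 2) *\<^sub>R (\<chi> i. 1)"
  have "x \<in> box c (c + r *\<^sub>R (\<chi> i. 1))" using r by (simp add: mem_box_cart c_def)
  moreover have "cube c (2 * r) \<subseteq> ball x e"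
  proof
    fix z assume z: "z \<in> cube c (2 * r)"
    have "\<bar>(z - x) $ i\<bar> \<le> 2 * r" for i
    proof -
      have "c $ i \<le> z $ i \<and> z $ i \<le> c $ i + 2 * r" using z unfolding cube_iff by blast
      then show ?thesis using r(1) by (simp add: c_def abs_le_iff)
    qed
    then have "(\<Sum>i\<in>UNIV. \<bar>(z - x) $ i\<bar>) \<le> n * (2 * r)"
      using sum_bounded_above[of UNIV "\<lambda>i. \<bar>(z - x) $ i\<bar>" "2 * r"] by (simp add: n_def)
    then have "norm (z - x) \<le> n * (2 * r)" using norm_le_l1_cart[of "z - x"] by linarith
    also have "\<dots> \<le> n * (2 * (e / (4 * n)))" using r(3) n by (intro mult_left_mono) auto
    also have "\<dots> < e" using e n by simp
    finally show "z \<in> ball x e" by (simp add: dist_norm norm_minus_commute)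
  qed
  ultimately show ?thesis using that[of r c] r e(2) by blast
qed

context lie
begin

text \<open>The left inverse \<open>k'\<close> makes the derivative injective, and source and target
  have the same dimension.\<close>

lemma diffeo_chart_derivative_surj:
  assumes k: "smooth_map T A T A k" and k': "smooth_map T A T A k'"
    and inv: "\<And>a. a \<in> carrier G \<Longrightarrow> k' (k a) = a"
    and U: "(U, \<phi>) \<in> A" and U': "(U', \<phi>') \<in> A" and a: "a \<in> U" "k a \<in> U'"
  shows "surj (frechet_derivative (\<lambda>x. \<phi>' (k (inv_into U \<phi> x))) (at (\<phi> a)))"
proof -
  have Uc: "is_chart T (U, \<phi>)" and Uc': "is_chart T (U', \<phi>')"
    using atlas_T U U' by (auto simp: atlas_on_def)
  have aG: "a \<in> carrier G" using chart_subset[OF Uc] a(1) by auto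
  note c = smooth_map_chart[OF k U Uc U' Uc']
  note c' = smooth_map_chart[OF k' U' Uc' U Uc]
  let ?f = "\<lambda>x. \<phi>' (k (inv_into U \<phi> x))" and ?g = "\<lambda>x. \<phi> (k' (inv_into U' \<phi>' x))"
  have Df: "(?f has_derivative frechet_derivative ?f (at (\<phi> a))) (at (\<phi> a))"
    by (rule smooth_on_has_derivative[OF c(3)]) (use a in auto)
  have fa: "?f (\<phi> a) = \<phi>' (k a)" using chart_inv[OF Uc a(1)] by simp
  have "(?g has_derivative frechet_derivative ?g (at (?f (\<phi> a)))) (at (?f (\<phi> a)))"
    by (rule smooth_on_has_derivative[OF c'(3)]) (use a inv[OF aG] fa in auto)
  from has_derivative_compose[OF Df this]
  have "((\<lambda>x. ?g (?f x)) has_derivative (\<lambda>v. frechet_derivative ?g (at (?f (\<phi> a))) (frechet_derivative ?f (at (\<phi> a)) v))) (at (\<phi> a))" .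
  moreover have "((\<lambda>x. ?g (?f x)) has_derivative (\<lambda>v. v)) (at (\<phi> a))"
  proof (rule has_derivative_transform_within_open[OF has_derivative_ident c(2)])
    show "\<phi> a \<in> \<phi> ` {a \<in> U. k a \<in> U'}" using a by auto
    fix x assume "x \<in> \<phi> ` {a \<in> U. k a \<in> U'}"
    then obtain b where b: "b \<in> U" "k b \<in> U'" "x = \<phi> b" by blast
    then have "b \<in> carrier G" using chart_subset[OF Uc] by auto
    then show "x = ?g (?f x)" using b chart_inv[OF Uc] chart_inv[OF Uc'] inv by simp
  qed
  ultimately have "(\<lambda>v. frechet_derivative ?g (at (?f (\<phi> a))) (frechet_derivative ?f (at (\<phi> a)) v)) = (\<lambda>v. v)"
    by (rule has_derivative_unique)
  then have "inj (frechet_derivative ?f (at (\<phi> a)))"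
    by (metis injI)
  then show ?thesis using Df has_derivative_linear linear_injective_imp_surjective by blast
qed

lemma continuous_chart_inverse:
  assumes "is_chart T (U, \<phi>)" "X \<subseteq> \<phi> ` U"
  shows "continuous_map (top_of_set X) T (inv_into U \<phi>)"
  using continuous_map_from_subtopology_mono[OF chart_inv_continuous[OF assms(1)] assms(2)] .

end

locale smooth_homspace = homspace G T A H B \<mu>
  for G (structure) and T :: "'a topology" and A :: "('a, real^'n) chart set" and H
    and B :: "('a set, real^'m) chart set" and \<mu>
begin

text \<open>For almost every \<open>y\<close>, the map \<open>a \<mapsto> f(a\<^sup>-\<^sup>1 y)\<close> has a smooth version near \<open>\<one>\<close>; these versions are
  glued to \<open>h\<close>, which is smooth because it is so after composition with submersions \<open>a \<mapsto> a\<^sup>-\<^sup>1 y\<close>.\<close>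

theorem smooth_vector_version:
  assumes p: "1 \<le> p" and f: "f \<in> smooth_vectors G A \<mu> p"
  obtains h v W where "smooth_function B h" "AE y in \<mu>. f y = h y" "openin T W" "\<one> \<in> W"
    "(\<lambda>y. complex_of_real (v y)) \<in> Lp_space \<mu> p"
    "AE y in \<mu>. \<forall>a\<in>W. cmod (h (inv a <# y)) \<le> v y"
proof -
  interpret Lp \<mu> p by unfold_locales (rule p)
  obtain U \<phi> where U: "(U, \<phi>) \<in> A" and Uc: "is_chart T (U, \<phi>)" and U1: "\<one> \<in> U"
    using atlas_onE[OF atlas_T, of \<one>] by auto
  define \<phi>i where "\<phi>i = inv_into U \<phi>"
  have \<phi>i: "\<phi>i (\<phi> a) = a" if "a \<in> U" for a using chart_inv[OF Uc that] by (simp add: \<phi>i_def)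
  have UG: "U \<subseteq> carrier G" using chart_subset[OF Uc] by simp
  define Om where "Om = \<phi> ` U"
  have Om: "open Om" "\<phi> \<one> \<in> Om" using chart_open[OF Uc] U1 by (auto simp: Om_def)
  obtain c r where r: "0 < r" "r \<le> 1" and o: "\<phi> \<one> \<in> box c (c + r *\<^sub>R (\<chi> i. 1))" and QO: "cube c (2 * r) \<subseteq> Om"
    using small_cube[OF Om] by metis
  define Bx where "Bx = box c (c + r *\<^sub>R (\<chi> i. 1))"
  have Bx: "open Bx" "\<phi> \<one> \<in> Bx" "Bx \<subseteq> cube c r" by (auto simp: Bx_def o box_subset_cbox)
  have "cube c r \<subseteq> cube c (2 * r)" using r by (auto simp: cube_iff; smt (verit))
  then have BxO: "Bx \<subseteq> Om" using Bx(3) QO by blast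
  define F where "F = (\<lambda>x. left_regular G (\<phi>i x) f)"
  have F: "Lp_smooth_on \<mu> p Om F" using f U unfolding smooth_vectors_def F_def \<phi>i_def Om_def by blast
  have F_eq: "F x y = f (inv (\<phi>i x) <# y)" for x y by (simp add: F_def left_regular_def)
  have fm: "f \<in> borel_measurable \<mu>" using f by (auto simp: smooth_vectors_def Lp_space_def)
  obtain u v where u: "case_prod u \<in> borel_measurable (borel \<Otimes>\<^sub>M \<mu>)"
    "(\<lambda>y. complex_of_real (v y)) \<in> L"
    "AE y in \<mu>. smooth_on (box c (c + r *\<^sub>R (\<chi> i. 1))) (\<lambda>x. u x y) \<and> (\<forall>x\<in>cube c r. cmod (u x y) \<le> v y)"
    "\<And>x. x \<in> cube c r \<Longrightarrow> AE y in \<mu>. u x y = F x y"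
    by (rule smooth_version[OF r QO F]) (rule that)
  let ?R = "restrict_space lborel Bx"
  have Bxs: "Bx \<in> sets borel" using Bx(1) by simp
  have spR: "space ?R = Bx" by (simp add: space_restrict_space)
  interpret mu: sigma_finite_measure \<mu> by (rule sigma_finite)
  interpret R: sigma_finite_measure ?R
    by (rule sigma_finite_measure_restrict_space) (use Bxs in \<open>auto intro: sigma_finite_lborel\<close>)
  interpret P: pair_sigma_finite ?R \<mu> ..
  have cont_inv: "continuous_map (top_of_set Bx) T (\<lambda>x. inv (\<phi>i x))"
    unfolding \<phi>i_def by (rule continuous_inv[OF continuous_chart_inverse[OF Uc]]) (use BxO Om_def in auto)
  have "(\<lambda>z. f ((\<lambda>(x, y). inv (\<phi>i x) <# y) z)) \<in> borel_measurable (?R \<Otimes>\<^sub>M \<mu>)"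
    by (rule measurable_compose[OF measurable_act[OF Bxs cont_inv] fm])
  then have Fm: "(\<lambda>z. F (fst z) (snd z)) \<in> borel_measurable (?R \<Otimes>\<^sub>M \<mu>)"
    by (simp add: F_eq case_prod_beta')
  have "(\<lambda>z. z) \<in> measurable (?R \<Otimes>\<^sub>M \<mu>) (borel \<Otimes>\<^sub>M \<mu>)"
    by (auto intro!: measurable_Pair measurable_fst'' simp: measurable_pair_iff measurable_restrict_space1 comp_def)
  then have um: "(\<lambda>z. u (fst z) (snd z)) \<in> borel_measurable (?R \<Otimes>\<^sub>M \<mu>)"
    using measurable_compose[OF _ u(1)] by (simp add: case_prod_beta')
  have "{z \<in> space (?R \<Otimes>\<^sub>M \<mu>). u (fst z) (snd z) = F (fst z) (snd z)} \<in> sets (?R \<Otimes>\<^sub>M \<mu>)"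
    using um Fm by measurable
  moreover have "AE x in ?R. AE y in \<mu>. u x y = F x y"
    by (rule AE_I2) (use u(4) Bx(3) in \<open>auto simp: spR\<close>)
  \<comment> \<open>Fubini exchanges the quantifiers: from almost every \<open>y\<close> for each
    \<open>x\<close> to almost every \<open>x\<close> for almost every \<open>y\<close>. Only the
    second form compares \<open>u\<close> and \<open>F\<close> along a single orbit.\<close>
  ultimately have ae: "AE y in \<mu>. AE x in ?R. u x y = F x y"
    using P.AE_commute[of "\<lambda>x y. u x y = F x y"] by blast
  define good where "good = (\<lambda>y. y \<in> lcosets H \<and> smooth_on Bx (\<lambda>x. u x y) \<and> (\<forall>x\<in>cube c r. cmod (u x y) \<le> v y)
    \<and> negligible {x \<in> Bx. u x y \<noteq> F x y})"
  have good_AE: "AE y in \<mu>. good y"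
  proof -
    have "AE y in \<mu>. y \<in> space \<mu>" by (rule AE_space)
    with u(3) ae show ?thesis
    proof eventually_elim
      case (elim y)
      have "AE x in lborel. x \<in> Bx \<longrightarrow> u x y = F x y"
        using elim(2) AE_restrict_space_iff[of Bx lborel] Bxs by simp
      then obtain N where N: "{x \<in> space lborel. \<not> (x \<in> Bx \<longrightarrow> u x y = F x y)} \<subseteq> N" "emeasure lborel N = 0" "N \<in> sets lborel"
        by (rule AE_E)
      then have "N \<in> null_sets lebesgue" by (intro null_sets_completionI) (auto simp: null_sets_def)
      then have "negligible N" by (simp add: negligible_iff_null_sets)
      then have "negligible {x \<in> Bx. u x y \<noteq> F x y}"
        by (rule negligible_subset) (use N(1) in auto)
      then show ?case using elim by (simp add: good_def Bx_def space_mu)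
    qed
  qed
  define W where "W = {a \<in> U. \<phi> a \<in> Bx}"
  have W: "openin T W" "\<one> \<in> W" "W \<subseteq> U"
    using chart_preimage_open[OF Uc Bx(1)] U1 Bx(2) by (auto simp: W_def)
  have WG: "W \<subseteq> carrier G" using W(3) UG by blast
  \<comment> \<open>Near the identity
    \<open>\<xi> \<mapsto> u (\<phi> (b \<otimes> \<phi>i \<xi>)) w\<close> is continuous and equals
    almost everywhere the function
    \<open>\<xi> \<mapsto> f (inv (\<phi>i \<xi>) <# (inv b <# w))\<close>, which depends on
    \<open>b\<close> and \<open>w\<close> only through the point \<open>inv b <# w\<close>. Two such
    continuous functions for the same point agree, in particular at the identity.\<close>
  have consistent: "u (\<phi> a) y = u (\<phi> a') y'"
    if g: "good y" "good y'" and a: "a \<in> W" "a' \<in> W" and eq: "inv a <# y = inv a' <# y'" for a a' y y'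
  proof (rule ccontr)
    assume neq: "u (\<phi> a) y \<noteq> u (\<phi> a') y'"
    have aG: "a \<in> carrier G" "a' \<in> carrier G" using a WG by auto
    have yl: "y \<in> lcosets H" "y' \<in> lcosets H" using g by (auto simp: good_def)
    have shifted: "\<exists>D. open D \<and> \<phi> \<one> \<in> D \<and> D \<subseteq> Om \<and> (\<forall>\<xi>\<in>D. b \<otimes> \<phi>i \<xi> \<in> W) \<and> continuous_on D (\<lambda>\<xi>. u (\<phi> (b \<otimes> \<phi>i \<xi>)) w) \<and>
        negligible {\<xi> \<in> D. u (\<phi> (b \<otimes> \<phi>i \<xi>)) w \<noteq> f (inv (\<phi>i \<xi>) <# (inv b <# w))}"
      if b: "b \<in> W" and w: "good w" for b w
    proof -
      have bG: "b \<in> carrier G" using b WG by blast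
      have wl: "w \<in> lcosets H" using w by (simp add: good_def)
      have sm: "smooth_map T A T A (\<lambda>x. b \<otimes> x)" "smooth_map T A T A (\<lambda>x. inv b \<otimes> x)"
        using bG by (auto intro!: smooth_mult[OF atlas_T] smooth_const[OF atlas_T] smooth_id)
      note c1 = smooth_map_chart[OF sm(1) U Uc U Uc, folded \<phi>i_def]
      note c2 = smooth_map_chart[OF sm(2) U Uc U Uc, folded \<phi>i_def]
      define D where "D = \<phi> ` {x \<in> U. b \<otimes> x \<in> W}"
      have op: "openin T ({x \<in> U. b \<otimes> x \<in> U} \<inter> {x \<in> carrier G. b \<otimes> x \<in> W})"
        using openin_preimage[OF continuous_mult[OF continuous_const continuous_map_id[unfolded id_def]] W(1)] c1(1) bG by blast
      have "{x \<in> U. b \<otimes> x \<in> U} \<inter> {x \<in> carrier G. b \<otimes> x \<in> W} = {x \<in> U. b \<otimes> x \<in> W}"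
        using W(3) UG by blast
      then have D: "open D" unfolding D_def using chart_image_open[OF Uc] op by auto
      have D1: "\<phi> \<one> \<in> D" "D \<subseteq> Om" using U1 bG b by (auto simp: D_def Om_def)
      have DW: "b \<otimes> \<phi>i \<xi> \<in> W" if "\<xi> \<in> D" for \<xi> using that \<phi>i by (auto simp: D_def)
      have cl: "continuous_on D (\<lambda>\<xi>. \<phi> (b \<otimes> \<phi>i \<xi>))"
        by (rule continuous_on_subset[OF smooth_on_imp_continuous_on[OF c1(3)]]) (use W(3) in \<open>auto simp: D_def\<close>)
      have cu: "continuous_on Bx (\<lambda>x. u x w)"
        using w by (auto simp: good_def intro: smooth_on_imp_continuous_on)
      have "continuous_on D (\<lambda>\<xi>. u (\<phi> (b \<otimes> \<phi>i \<xi>)) w)"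
        by (rule continuous_on_compose2[OF cu cl]) (use DW in \<open>auto simp: W_def\<close>)
      moreover have "negligible {\<xi> \<in> D. u (\<phi> (b \<otimes> \<phi>i \<xi>)) w \<noteq> f (inv (\<phi>i \<xi>) <# (inv b <# w))}"
      proof -
        \<comment> \<open>The exceptional set in the variable of \<open>u\<close>. Left translation
          by \<open>inv b\<close> is smooth in the chart, so the corresponding set in the variable
          \<xi> is again negligible.\<close>
        let ?N = "{x \<in> Bx. u x w \<noteq> F x w} \<inter> \<phi> ` {x \<in> U. inv b \<otimes> x \<in> U}"
        have "negligible ?N" using w by (auto simp: good_def intro: negligible_subset)
        then have "negligible ((\<lambda>x. \<phi> (inv b \<otimes> \<phi>i x)) ` ?N)"
        proof (rule negligible_differentiable_image_negligible[OF order_refl])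
          show "(\<lambda>x. \<phi> (inv b \<otimes> \<phi>i x)) differentiable_on ?N"
            unfolding differentiable_on_def
            using smooth_on_has_derivative[OF c2(3)] has_derivative_at_withinI
            by (meson IntD2 differentiable_def)
        qed
        then show ?thesis
        proof (rule negligible_subset)
          show "{\<xi> \<in> D. u (\<phi> (b \<otimes> \<phi>i \<xi>)) w \<noteq> f (inv (\<phi>i \<xi>) <# (inv b <# w))} \<subseteq> (\<lambda>x. \<phi> (inv b \<otimes> \<phi>i x)) ` ?N"
          proof
            fix \<xi> assume "\<xi> \<in> {\<xi> \<in> D. u (\<phi> (b \<otimes> \<phi>i \<xi>)) w \<noteq> f (inv (\<phi>i \<xi>) <# (inv b <# w))}"
            then have \<xi>: "\<xi> \<in> D" "u (\<phi> (b \<otimes> \<phi>i \<xi>)) w \<noteq> f (inv (\<phi>i \<xi>) <# (inv b <# w))" by auto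
            then obtain x where x: "x \<in> U" "b \<otimes> x \<in> W" "\<xi> = \<phi> x" by (auto simp: D_def)
            then have xG: "x \<in> carrier G" and bxU: "b \<otimes> x \<in> U" using UG W(3) by auto
            have "inv (b \<otimes> x) <# w = inv x <# (inv b <# w)"
              using act_act[of "inv x" "inv b" w] xG bG wl by (simp add: inv_mult_group)
            then have ne: "u (\<phi> (b \<otimes> x)) w \<noteq> F (\<phi> (b \<otimes> x)) w"
              using \<xi>(2) x \<phi>i[OF x(1)] \<phi>i[OF bxU] by (simp add: F_eq)
            have bk: "inv b \<otimes> (b \<otimes> x) = x" using bG xG by (simp add: m_assoc[symmetric])
            show "\<xi> \<in> (\<lambda>x. \<phi> (inv b \<otimes> \<phi>i x)) ` ?N"
            proof (rule image_eqI[of _ _ "\<phi> (b \<otimes> x)"])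
              show "\<xi> = \<phi> (inv b \<otimes> \<phi>i (\<phi> (b \<otimes> x)))" using x \<phi>i[OF bxU] bk by simp
              show "\<phi> (b \<otimes> x) \<in> ?N" using ne x(1,2) bxU bk by (auto simp: W_def)
            qed
          qed
        qed
      qed
      ultimately show ?thesis using D D1 DW by blast
    qed
    obtain D where D: "open D" "\<phi> \<one> \<in> D" "D \<subseteq> Om" "\<forall>\<xi>\<in>D. a \<otimes> \<phi>i \<xi> \<in> W" "continuous_on D (\<lambda>\<xi>. u (\<phi> (a \<otimes> \<phi>i \<xi>)) y)"
        "negligible {\<xi> \<in> D. u (\<phi> (a \<otimes> \<phi>i \<xi>)) y \<noteq> f (inv (\<phi>i \<xi>) <# (inv a <# y))}"
      using shifted[OF a(1) g(1)] by blast
    obtain D' where D': "open D'" "\<phi> \<one> \<in> D'" "D' \<subseteq> Om" "\<forall>\<xi>\<in>D'. a' \<otimes> \<phi>i \<xi> \<in> W" "continuous_on D' (\<lambda>\<xi>. u (\<phi> (a' \<otimes> \<phi>i \<xi>)) y')"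
        "negligible {\<xi> \<in> D'. u (\<phi> (a' \<otimes> \<phi>i \<xi>)) y' \<noteq> f (inv (\<phi>i \<xi>) <# (inv a' <# y'))}"
      using shifted[OF a(2) g(2)] by blast
    let ?g = "\<lambda>\<xi>. u (\<phi> (a \<otimes> \<phi>i \<xi>)) y - u (\<phi> (a' \<otimes> \<phi>i \<xi>)) y'"
    let ?P = "(D \<inter> D') \<inter> ?g -` (- {0})"
    have "continuous_on (D \<inter> D') ?g"
      by (intro continuous_on_diff continuous_on_subset[OF D(5)] continuous_on_subset[OF D'(5)]) auto
    then have oP: "open ?P"
      by (rule continuous_open_preimage) (use D(1) D'(1) in auto)
    have "\<phi> \<one> \<in> ?P" using neq D(2) D'(2) \<phi>i[OF U1] aG by simp
    then have nP: "\<not> negligible ?P" using open_not_negligible[OF oP] by blast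
    have "?P \<subseteq> {\<xi> \<in> D. u (\<phi> (a \<otimes> \<phi>i \<xi>)) y \<noteq> f (inv (\<phi>i \<xi>) <# (inv a <# y))}
        \<union> {\<xi> \<in> D'. u (\<phi> (a' \<otimes> \<phi>i \<xi>)) y' \<noteq> f (inv (\<phi>i \<xi>) <# (inv a' <# y'))}"
      using eq by auto
    then show False using nP negligible_Un[OF D(6) D'(6)] negligible_subset by blast
  qed
  define h where "h = (\<lambda>y0. let (a, y) = (SOME (a, y). good y \<and> a \<in> W \<and> inv a <# y = y0) in u (\<phi> a) y)"
  have h: "h (inv a <# y) = u (\<phi> a) y" if "good y" "a \<in> W" for a y
  proof -
    define P where "P = (\<lambda>q. case q of (b, w) \<Rightarrow> good w \<and> b \<in> W \<and> inv b <# w = inv a <# y)"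
    have "P (a, y)" using that by (simp add: P_def)
    then have "P (Eps P)" by (rule someI)
    then obtain b w where bw: "Eps P = (b, w)" "good w" "b \<in> W" "inv b <# w = inv a <# y"
      by (auto simp: P_def)
    have "h (inv a <# y) = u (\<phi> b) w" using bw(1) by (simp add: h_def P_def)
    then show ?thesis using consistent[OF bw(2) that(1) bw(3) that(2) bw(4)] by simp
  qed
  \<comment> \<open>\<open>W y0\<close> is open and nonempty, so it contains a good point, although
    \<open>y0\<close> itself need not be good.\<close>
  have reach: "\<exists>a\<in>W. \<exists>y. good y \<and> y0 = inv a <# y" if y0: "y0 \<in> lcosets H" for y0
  proof -
    obtain g where g: "g \<in> carrier G" "y0 = proj g" using lcosets_cases[OF y0] .
    have "openin Y ((\<lambda>g. proj g) ` (\<lambda>a. a \<otimes> g) ` W)"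
      by (rule openin_proj[OF openin_right_translate[OF W(1) g(1)]])
    then obtain y where y: "y \<in> (\<lambda>g. proj g) ` (\<lambda>a. a \<otimes> g) ` W" "good y"
      using AE_open_ex[OF good_AE] W(2) by blast
    then obtain a where a: "a \<in> W" "y = proj (a \<otimes> g)" by blast
    then have "y = a <# y0" using g act_proj WG by auto
    then show ?thesis using a y(2) act_inv(1)[of a y0] y0 WG by (metis subsetD)
  qed
  show ?thesis
  proof (rule that[of h W v])
    show "openin T W" "\<one> \<in> W" by (rule W)+
    show "(\<lambda>y. complex_of_real (v y)) \<in> L" by (rule u(2))
    show "AE y in \<mu>. f y = h y"
      using good_AE u(4)[OF subsetD[OF Bx(3,2)]]
    proof eventually_elim
      case (elim y)
      then have yl: "y \<in> lcosets H" by (simp add: good_def)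
      have "h y = u (\<phi> \<one>) y" using h[OF elim(1) W(2)] yl by simp
      also have "\<dots> = f y" using elim(2) yl \<phi>i[OF U1] by (simp add: F_eq)
      finally show ?case by simp
    qed
    show "AE y in \<mu>. \<forall>a\<in>W. cmod (h (inv a <# y)) \<le> v y"
      using good_AE
    proof eventually_elim
      case (elim y)
      then show ?case using h[OF elim] Bx(3) by (auto simp: good_def W_def)
    qed
    show "smooth_function B h"
      unfolding smooth_function_def
    proof (intro ballI, clarify)
      fix V \<psi> assume V: "(V, \<psi>) \<in> B"
      then have Vc: "is_chart Y (V, \<psi>)" using atlas_Y by (auto simp: atlas_on_def)
      show "smooth_on (\<psi> ` V) (\<lambda>x. h (inv_into V \<psi> x))"
      proof (rule smooth_on_local)
        fix z assume "z \<in> \<psi> ` V"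
        then obtain y0 where y0: "y0 \<in> V" "z = \<psi> y0" by blast
        then have y0l: "y0 \<in> lcosets H" using chart_subset[OF Vc] by auto
        obtain a0 y where a0: "a0 \<in> W" "good y" "y0 = inv a0 <# y" using reach[OF y0l] by blast
        have yl: "y \<in> lcosets H" using a0(2) by (simp add: good_def)
        obtain g where g: "g \<in> carrier G" "y = proj g" using lcosets_cases[OF yl] .
        \<comment> \<open>\<open>a \<mapsto> proj (k a)\<close> is the orbit map
          \<open>a \<mapsto> inv a <# y\<close>. Along it \<open>h\<close> becomes the smooth
          function \<open>u (\<phi> a) y\<close>; smoothness descends because inversion followed by
          a right translation is a diffeomorphism of \<open>G\<close> and the projection is a
          submersion.\<close>
        define k where "k = (\<lambda>a. inv a \<otimes> g)"
        have sk: "smooth_map T A T A k" unfolding k_def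
          by (intro smooth_mult[OF atlas_T] smooth_inv[OF atlas_T] smooth_id smooth_const[OF atlas_T] g)
        have sk': "smooth_map T A T A (\<lambda>b. g \<otimes> inv b)"
          by (intro smooth_mult[OF atlas_T] smooth_inv[OF atlas_T] smooth_id smooth_const[OF atlas_T] g)
        have kk: "g \<otimes> inv (k a) = a" if "a \<in> carrier G" for a
          using that g by (simp add: k_def inv_mult_group m_assoc[symmetric])
        have kk': "k (g \<otimes> inv b) = b" if "b \<in> carrier G" for b
          using that g by (simp add: k_def inv_mult_group m_assoc)
        have sm: "smooth_map T A Y B (\<lambda>a. proj (k a))"
          by (rule smooth_map_compose[OF atlas_T atlas_T atlas_Y sk smooth_proj])
        note cm = smooth_map_chart[OF sm U Uc V Vc, folded \<phi>i_def]
        have hk: "h (proj (k a)) = u (\<phi> a) y" if "a \<in> W" for a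
          using h[OF a0(2) that] that WG g act_proj[of "inv a" g] by (auto simp: k_def)
        define P where "P = (\<lambda>x. \<psi> (proj (k (\<phi>i x))))"
        define Ox where "Ox = \<phi> ` {a \<in> W. proj (k a) \<in> V}"
        have "openin T ({a \<in> U. proj (k a) \<in> V} \<inter> W)" using cm(1) W(1) by blast
        moreover have "{a \<in> U. proj (k a) \<in> V} \<inter> W = {a \<in> W. proj (k a) \<in> V}" using W(3) by blast
        ultimately have oWV: "openin T {a \<in> W. proj (k a) \<in> V}" by simp
        have oO: "open Ox" unfolding Ox_def
          by (rule chart_image_open[OF Uc oWV]) (use W(3) in auto)
        have sP: "smooth_on Ox P" unfolding P_def
          by (rule smooth_on_subset[OF cm(3)]) (use W(3) in \<open>auto simp: Ox_def\<close>)
        have surjP: "surj (frechet_derivative P (at x))" if x: "x \<in> Ox" for x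
        proof -
          obtain a where a: "a \<in> W" "proj (k a) \<in> V" "x = \<phi> a" using x by (auto simp: Ox_def)
          then have aU: "a \<in> U" and aG: "a \<in> carrier G" using W(3) UG by auto
          have kG: "k a \<in> carrier G" using aG g by (simp add: k_def)
          obtain U' \<phi>' where U': "(U', \<phi>') \<in> A" "is_chart T (U', \<phi>')" "k a \<in> U'"
            using atlas_onE[OF atlas_T, of "k a"] kG by auto
          note ck = smooth_map_chart[OF sk U Uc U'(1,2), folded \<phi>i_def]
          note cp = smooth_map_chart[OF smooth_proj U'(1,2) V Vc]
          let ?q = "\<lambda>x. \<psi> (proj (inv_into U' \<phi>' x))" and ?k = "\<lambda>x. \<phi>' (k (\<phi>i x))"
          have s1: "surj (frechet_derivative ?q (at (\<phi>' (k a))))"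
            using q U'(1,3) V a(2) unfolding quotient_atlas_def submersion_def by blast
          have s2: "surj (frechet_derivative ?k (at x))"
            using diffeo_chart_derivative_surj[OF sk sk' kk U U'(1) aU U'(3)] a(3) by (simp add: \<phi>i_def)
          have Dk: "(?k has_derivative frechet_derivative ?k (at x)) (at x)"
            by (rule smooth_on_has_derivative[OF ck(3)]) (use a aU U'(3) in auto)
          have kx: "?k x = \<phi>' (k a)" using a(3) \<phi>i[OF aU] by simp
          have "(?q has_derivative frechet_derivative ?q (at (?k x))) (at (?k x))"
            unfolding kx by (rule smooth_on_has_derivative[OF cp(3)]) (use a U'(3) in auto)
          from has_derivative_compose[OF Dk this]
          have "((\<lambda>x. ?q (?k x)) has_derivative (\<lambda>w. frechet_derivative ?q (at (?k x)) (frechet_derivative ?k (at x) w))) (at x)" .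
          then have "(P has_derivative (\<lambda>w. frechet_derivative ?q (at (?k x)) (frechet_derivative ?k (at x) w))) (at x)"
          proof (rule has_derivative_transform_within_open[OF _ ck(2)])
            show "x \<in> \<phi> ` {a \<in> U. k a \<in> U'}" using a aU U'(3) by auto
            fix x' assume "x' \<in> \<phi> ` {a \<in> U. k a \<in> U'}"
            then show "?q (?k x') = P x'" using \<phi>i chart_inv[OF U'(2)] by (auto simp: P_def)
          qed
          then have "frechet_derivative P (at x) = (\<lambda>w. frechet_derivative ?q (at (?k x)) (frechet_derivative ?k (at x) w))"
            using frechet_derivative_at by metis
          then have "frechet_derivative P (at x) = frechet_derivative ?q (at (?k x)) \<circ> frechet_derivative ?k (at x)"
            by (simp add: comp_def)
          then show ?thesis using comp_surj[OF s2 s1] unfolding kx by simp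
        qed
        have hP: "u x y = h (inv_into V \<psi> (P x))" if xO: "x \<in> Ox" for x
        proof -
          obtain a where a: "a \<in> W" "proj (k a) \<in> V" "x = \<phi> a" using xO by (auto simp: Ox_def)
          then show ?thesis using hk[OF a(1)] \<phi>i[of a] W(3) chart_inv[OF Vc a(2)] by (auto simp: P_def)
        qed
        have su: "smooth_on Ox (\<lambda>x. u x y)"
          by (rule smooth_on_subset[of Bx]) (use a0(2) in \<open>auto simp: good_def Ox_def W_def\<close>)
        have "smooth_on Ox (\<lambda>x. h (inv_into V \<psi> (P x)))"
          by (rule smooth_on_cong[OF oO hP su])
        then have "smooth_on (P ` Ox) (\<lambda>x. h (inv_into V \<psi> x))"
          unfolding smooth_on_def by (intro allI Ck_on_descend_submersion[OF oO sP surjP]) simp_all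
        moreover have "open (P ` Ox)"
        proof -
          have eqk: "k ` {a \<in> W. proj (k a) \<in> V} = {b \<in> carrier G. g \<otimes> inv b \<in> {a \<in> W. proj (k a) \<in> V}}"
          proof (intro equalityI subsetI)
            fix b assume "b \<in> k ` {a \<in> W. proj (k a) \<in> V}"
            then show "b \<in> {b \<in> carrier G. g \<otimes> inv b \<in> {a \<in> W. proj (k a) \<in> V}}"
              using kk WG g by (auto simp: k_def)
          next
            fix b assume b: "b \<in> {b \<in> carrier G. g \<otimes> inv b \<in> {a \<in> W. proj (k a) \<in> V}}"
            then show "b \<in> k ` {a \<in> W. proj (k a) \<in> V}" using kk'[of b] by (auto intro!: image_eqI[of _ _ "g \<otimes> inv b"])
          qed
          have "openin T (k ` {a \<in> W. proj (k a) \<in> V})"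
            unfolding eqk
            by (rule openin_preimage[OF _ oWV])
              (use g in \<open>auto intro!: continuous_mult continuous_inv continuous_const continuous_map_id[unfolded id_def]\<close>)
          then have "openin Y ((\<lambda>g. proj g) ` k ` {a \<in> W. proj (k a) \<in> V})" by (rule openin_proj)
          then have "open (\<psi> ` (\<lambda>g. proj g) ` k ` {a \<in> W. proj (k a) \<in> V})"
            by (rule chart_image_open[OF Vc]) auto
          moreover have "P ` Ox = \<psi> ` (\<lambda>g. proj g) ` k ` {a \<in> W. proj (k a) \<in> V}"
            using \<phi>i W(3) by (force simp: P_def Ox_def image_image)
          ultimately show ?thesis by simp
        qed
        moreover have "z \<in> P ` Ox"
        proof (rule image_eqI[of _ _ "\<phi> a0"])
          have "proj (k a0) = y0" using a0 g act_proj[of "inv a0" g] WG by (auto simp: k_def)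
          then show "z = P (\<phi> a0)" "\<phi> a0 \<in> Ox" using y0 a0(1) W(3) \<phi>i by (auto simp: P_def Ox_def)
        qed
        ultimately show "\<exists>S. open S \<and> z \<in> S \<and> smooth_on S (\<lambda>x. h (inv_into V \<psi> x))" by blast
      qed
    qed
  qed
qed

end

section \<open>The adjoint representation and the Killing form\<close>

text \<open>The mean value inequality is applied to \<open>f\<close> minus its linearization at
  \<open>z0\<close>, whose derivative is small near \<open>z0\<close> by continuity.\<close>

lemma smooth_on_strict_derivative:
  fixes f :: "'a::euclidean_space \<Rightarrow> 'b::real_normed_vector"
  assumes S: "open S" "smooth_on S f" "z0 \<in> S" and e: "0 < e"
  obtains d where "0 < d" "ball z0 d \<subseteq> S"
    "\<And>z z'. z \<in> ball z0 d \<Longrightarrow> z' \<in> ball z0 d \<Longrightarrow>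
      norm (f z - f z' - frechet_derivative f (at z0) (z - z')) \<le> e * norm (z - z')"
    "\<And>z v. z \<in> ball z0 d \<Longrightarrow> norm (frechet_derivative f (at z) v - frechet_derivative f (at z0) v) \<le> e * norm v"
proof -
  let ?D = "\<lambda>z. frechet_derivative f (at z)"
  have bl: "bounded_linear (?D z)" if "z \<in> S" for z
    using smooth_on_has_derivative[OF S(2) that] has_derivative_bounded_linear by blast
  have "continuous_on S (\<lambda>z. Blinfun (?D z))" by (rule continuous_on_Blinfun_frechet_derivative[OF S(2)])
  then have "isCont (\<lambda>z. Blinfun (?D z)) z0" using S by (simp add: continuous_on_eq_continuous_at)
  then obtain d1 where d1: "d1 > 0" "\<And>z. dist z z0 < d1 \<Longrightarrow> dist (Blinfun (?D z)) (Blinfun (?D z0)) < e"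
    unfolding continuous_at_eps_delta using e by blast
  obtain d2 where d2: "d2 > 0" "ball z0 d2 \<subseteq> S" using S(1,3) open_contains_ball by blast
  define d where "d = min d1 d2"
  have d: "d > 0" "ball z0 d \<subseteq> S" using d1 d2 by (auto simp: d_def)
  have close: "norm (?D z v - ?D z0 v) \<le> e * norm v" if z: "z \<in> ball z0 d" for z v
  proof -
    have zS: "z \<in> S" using z d by blast
    have "norm (Blinfun (?D z) - Blinfun (?D z0)) \<le> e"
      using d1(2)[of z] z by (simp add: d_def dist_commute dist_norm norm_minus_commute)
    moreover have "?D z v - ?D z0 v = blinfun_apply (Blinfun (?D z) - Blinfun (?D z0)) v"
      using bl zS S(3) by (simp add: blinfun.diff_left bounded_linear_Blinfun_apply)
    ultimately show ?thesis
      using order_trans[OF norm_blinfun mult_right_mono[OF _ norm_ge_zero]] by simp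
  qed
  have "norm (f z - f z' - ?D z0 (z - z')) \<le> e * norm (z - z')" if z: "z \<in> ball z0 d" "z' \<in> ball z0 d" for z z'
  proof -
    have "norm ((f z - ?D z0 z) - (f z' - ?D z0 z')) \<le> e * norm (z - z')"
    proof (rule differentiable_bound[OF convex_ball, where f' = "\<lambda>z v. ?D z v - ?D z0 v"])
      fix w assume w: "w \<in> ball z0 d"
      then have wS: "w \<in> S" using d by blast
      have "((\<lambda>z. f z - ?D z0 z) has_derivative (\<lambda>v. ?D w v - ?D z0 v)) (at w)"
        by (intro has_derivative_diff smooth_on_has_derivative[OF S(2) wS]
          bounded_linear_imp_has_derivative[OF bl[OF S(3)]])
      then show "((\<lambda>z. f z - ?D z0 z) has_derivative (\<lambda>v. ?D w v - ?D z0 v)) (at w within ball z0 d)"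
        by (rule has_derivative_at_withinI)
      show "onorm (\<lambda>v. ?D w v - ?D z0 v) \<le> e"
        by (rule onorm_bound) (use close[OF w] e in auto)
    qed (use z in auto)
    then show ?thesis using bounded_linear.linear[OF bl[OF S(3)]] by (simp add: linear_diff algebra_simps)
  qed
  then show ?thesis using that[OF d] close by blast
qed

locale lie_chart = lie G T A
  for G (structure) and T :: "'a topology" and A :: "('a, real^'n) chart set" +
  fixes U :: "'a set" and \<phi> :: "'a \<Rightarrow> real^'n"
  assumes U_in: "(U, \<phi>) \<in> A" and one_U: "\<one> \<in> U"
begin

definition "\<phi>i = inv_into U \<phi>"
definition "pt = \<phi> \<one>"
definition "Ad g v = Ad_chart G (U, \<phi>) g v"
definition "br u v = lie_bracket G (U, \<phi>) u v"
definition "adm u = matrix (br u)"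
definition "kf u v = killing_form G (U, \<phi>) u v"

lemma U_chart: "is_chart T (U, \<phi>)" using atlas_T U_in by (auto simp: atlas_on_def)
lemma U_G: "U \<subseteq> carrier G" using chart_subset[OF U_chart] by simp
lemma \<phi>i_\<phi>: "a \<in> U \<Longrightarrow> \<phi>i (\<phi> a) = a" using chart_inv[OF U_chart] by (simp add: \<phi>i_def)
lemma \<phi>i_U: "x \<in> \<phi> ` U \<Longrightarrow> \<phi>i x \<in> U" using \<phi>i_\<phi> by auto
lemma \<phi>_\<phi>i: "x \<in> \<phi> ` U \<Longrightarrow> \<phi> (\<phi>i x) = x" using \<phi>i_\<phi> by auto
lemma \<phi>i_pt: "\<phi>i pt = \<one>" using \<phi>i_\<phi>[OF one_U] by (simp add: pt_def)
lemma pt_U: "pt \<in> \<phi> ` U" using one_U by (auto simp: pt_def)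

lemma chart_map1:
  assumes "smooth_map T A T A F"
  shows "open (\<phi> ` {a \<in> U. F a \<in> U})" "smooth_on (\<phi> ` {a \<in> U. F a \<in> U}) (\<lambda>x. \<phi> (F (\<phi>i x)))"
  using smooth_map_chart[OF assms U_in U_chart U_in U_chart] by (auto simp: \<phi>i_def)

lemma chart_map2:
  assumes F: "smooth_map (prod_topology T T) (prod_atlas A A) X C F" and V: "(V, \<psi>) \<in> C" "is_chart X (V, \<psi>)"
  shows "open (map_prod \<phi> \<phi> ` {z \<in> U \<times> U. F z \<in> V})"
    "smooth_on (map_prod \<phi> \<phi> ` {z \<in> U \<times> U. F z \<in> V}) (\<lambda>x. \<psi> (F (\<phi>i (fst x), \<phi>i (snd x))))"
proof -
  have UU: "(U \<times> U, map_prod \<phi> \<phi>) \<in> prod_atlas A A" using U_in by (force simp: prod_atlas_def)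
  note c = smooth_map_chart[OF F UU is_chart_prod[OF U_chart U_chart] V]
  show o: "open (map_prod \<phi> \<phi> ` {z \<in> U \<times> U. F z \<in> V})" by (rule c)
  show "smooth_on (map_prod \<phi> \<phi> ` {z \<in> U \<times> U. F z \<in> V}) (\<lambda>x. \<psi> (F (\<phi>i (fst x), \<phi>i (snd x))))"
    by (rule smooth_on_cong[OF o _ c(3)])
      (auto simp: inv_into_map_prod[OF chart_inj[OF U_chart] chart_inj[OF U_chart]] \<phi>i_\<phi>)
qed

lemma has_derivative_chart_map1:
  assumes F: "smooth_map T A T A F" and 1: "F \<one> = \<one>"
  shows "((\<lambda>x. \<phi> (F (\<phi>i x))) has_derivative frechet_derivative (\<lambda>x. \<phi> (F (\<phi>i x))) (at pt)) (at pt)"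
  by (rule smooth_on_has_derivative[OF chart_map1(2)[OF F]]) (use 1 one_U in \<open>auto simp: pt_def\<close>)

lemma eventually_chart:
  assumes F: "continuous_map T T F" and 1: "F \<one> = \<one>"
  shows "\<exists>S. open S \<and> pt \<in> S \<and> S \<subseteq> \<phi> ` U \<and> (\<forall>x\<in>S. F (\<phi>i x) \<in> U)"
proof -
  have "openin T ({a \<in> topspace T. F a \<in> U} \<inter> U)"
    using openin_continuous_map_preimage[OF F chart_openin[OF U_chart]] chart_openin[OF U_chart] by blast
  moreover have "{a \<in> topspace T. F a \<in> U} \<inter> U = {a \<in> U. F a \<in> U}" using U_G by auto
  ultimately have "open (\<phi> ` {a \<in> U. F a \<in> U})" by (intro chart_image_open[OF U_chart]) auto
  then show ?thesis
    using 1 one_U \<phi>i_\<phi> by (intro exI[of _ "\<phi> ` {a \<in> U. F a \<in> U}"]) (auto simp: pt_def)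
qed

lemma smooth_conj: "g \<in> carrier G \<Longrightarrow> smooth_map T A T A (\<lambda>a. g \<otimes> a \<otimes> inv g)"
  by (intro smooth_mult[OF atlas_T] smooth_const[OF atlas_T] smooth_id) auto

lemma conj_one: "g \<in> carrier G \<Longrightarrow> g \<otimes> \<one> \<otimes> inv g = \<one>" by simp

lemma Ad_has_derivative:
  assumes "g \<in> carrier G"
  shows "((\<lambda>x. \<phi> (g \<otimes> \<phi>i x \<otimes> inv g)) has_derivative Ad g) (at pt)"
proof -
  have "Ad g = frechet_derivative (\<lambda>x. \<phi> (g \<otimes> \<phi>i x \<otimes> inv g)) (at pt)"
    by (rule ext) (simp add: Ad_def Ad_chart_def \<phi>i_def pt_def)
  then show ?thesis
    using has_derivative_chart_map1[OF smooth_conj[OF assms] conj_one[OF assms]] by simp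
qed

lemma Ad_linear: "g \<in> carrier G \<Longrightarrow> linear (Ad g)"
  using Ad_has_derivative has_derivative_linear by blast

text \<open>Chart expressions compose only where the inner map stays in \<open>U\<close>, which
  suffices for a derivative at \<open>pt\<close>.\<close>

lemma derivative_of_composite:
  assumes F: "smooth_map T A T A F" "F \<one> = \<one>" and K: "smooth_map T A T A K" "K \<one> = \<one>"
    and DF: "((\<lambda>x. \<phi> (F (\<phi>i x))) has_derivative F') (at pt)"
    and DK: "((\<lambda>x. \<phi> (K (\<phi>i x))) has_derivative K') (at pt)"
  shows "((\<lambda>x. \<phi> (F (K (\<phi>i x)))) has_derivative (\<lambda>v. F' (K' v))) (at pt)"
proof -
  have cK: "continuous_map T T K" using K by (simp add: smooth_map_def)
  obtain S where S: "open S" "pt \<in> S" "S \<subseteq> \<phi> ` U" "\<forall>x\<in>S. K (\<phi>i x) \<in> U"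
    using eventually_chart[OF cK K(2)] by blast
  have K0: "\<phi> (K (\<phi>i pt)) = pt" using K(2) \<phi>i_pt by (simp add: pt_def)
  have "((\<lambda>x. \<phi> (F (\<phi>i (\<phi> (K (\<phi>i x)))))) has_derivative (\<lambda>v. F' (K' v))) (at pt)"
    using has_derivative_compose[OF DK, of "\<lambda>x. \<phi> (F (\<phi>i x))" F'] DF K0 by simp
  then show ?thesis
    by (rule has_derivative_transform_within_open[OF _ S(1,2)]) (use S(4) \<phi>i_\<phi> in auto)
qed

lemma Ad_mult:
  assumes g: "g \<in> carrier G" and h: "h \<in> carrier G"
  shows "Ad (g \<otimes> h) v = Ad g (Ad h v)"
proof -
  have "((\<lambda>x. \<phi> (g \<otimes> (h \<otimes> \<phi>i x \<otimes> inv h) \<otimes> inv g)) has_derivative (\<lambda>v. Ad g (Ad h v))) (at pt)"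
    by (rule derivative_of_composite[OF smooth_conj[OF g] conj_one[OF g] smooth_conj[OF h] conj_one[OF h]
      Ad_has_derivative[OF g] Ad_has_derivative[OF h]])
  moreover have "((\<lambda>x. \<phi> (g \<otimes> (h \<otimes> \<phi>i x \<otimes> inv h) \<otimes> inv g)) has_derivative Ad (g \<otimes> h)) (at pt)"
  proof (rule has_derivative_transform_within_open[OF Ad_has_derivative[OF m_closed[OF g h]] chart_open[OF U_chart] pt_U])
    fix x assume "x \<in> \<phi> ` U"
    then have "\<phi>i x \<in> carrier G" using \<phi>i_U U_G by blast
    then show "\<phi> (g \<otimes> h \<otimes> \<phi>i x \<otimes> inv (g \<otimes> h)) = \<phi> (g \<otimes> (h \<otimes> \<phi>i x \<otimes> inv h) \<otimes> inv g)"
      using g h by (simp add: inv_mult_group m_assoc)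
  qed
  ultimately have "(\<lambda>v. Ad g (Ad h v)) = Ad (g \<otimes> h)" by (rule has_derivative_unique)
  then show ?thesis by (rule fun_cong[symmetric])
qed

lemma Ad_one: "Ad \<one> v = v"
proof -
  have "((\<lambda>x. x) has_derivative Ad \<one>) (at pt)"
  proof (rule has_derivative_transform_within_open[OF Ad_has_derivative[OF one_closed] chart_open[OF U_chart] pt_U])
    fix x assume x: "x \<in> \<phi> ` U"
    then have "\<phi>i x \<in> carrier G" using \<phi>i_U U_G by blast
    then show "\<phi> (\<one> \<otimes> \<phi>i x \<otimes> inv \<one>) = x" using \<phi>_\<phi>i[OF x] by simp
  qed
  then have "Ad \<one> = (\<lambda>v. v)" by (rule has_derivative_unique) simp
  then show ?thesis by (rule fun_cong)
qed

lemma Ad_inv: "g \<in> carrier G \<Longrightarrow> Ad (inv g) (Ad g v) = v" "g \<in> carrier G \<Longrightarrow> Ad g (Ad (inv g) v) = v"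
  using Ad_mult[of "inv g" g v] Ad_mult[of g "inv g" v] by (simp_all add: Ad_one)

text \<open>\<open>Ad (\<phi>i x) v\<close> is the partial derivative at \<open>(x, pt)\<close>, in
  the second variable, of the chart expression of the smooth map that conjugates the second group
  element by the first. So it inherits smoothness in \<open>x\<close>.\<close>

lemma smooth_Ad: "\<exists>S. open S \<and> pt \<in> S \<and> S \<subseteq> \<phi> ` U \<and> (\<forall>v. smooth_on S (\<lambda>x. Ad (\<phi>i x) v))"
proof -
  let ?F = "\<lambda>z. fst z \<otimes> snd z \<otimes> inv (fst z)"
  have F: "smooth_map (prod_topology T T) (prod_atlas A A) T A ?F"
    by (intro smooth_mult[OF atlas_TT] smooth_inv[OF atlas_TT] smooth_fst smooth_snd)
  let ?E = "map_prod \<phi> \<phi> ` {z \<in> U \<times> U. ?F z \<in> U}"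
  let ?w = "\<lambda>x. \<phi> (?F (\<phi>i (fst x), \<phi>i (snd x)))"
  note E = chart_map2[OF F U_in U_chart]
  let ?S = "(\<lambda>x. (x, pt)) -` ?E"
  have oS: "open ?S" by (rule open_vimage[OF E(1)]) (intro continuous_intros)
  have ptS: "pt \<in> ?S" using one_U by (auto simp: pt_def intro!: image_eqI[of _ _ "(\<one>, \<one>)"])
  have SU: "?S \<subseteq> \<phi> ` U" by auto
  have eq: "frechet_derivative ?w (at (x, pt)) (0, v) = Ad (\<phi>i x) v" if x: "x \<in> ?S" for x v
  proof -
    have xU: "x \<in> \<phi> ` U" using x SU by blast
    have gx: "\<phi>i x \<in> carrier G" using \<phi>i_U[OF xU] U_G by blast
    have "(?w has_derivative frechet_derivative ?w (at (x, pt))) (at (x, pt))"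
      using smooth_on_has_derivative[OF E(2)] x by simp
    moreover have "((\<lambda>y. (x, y)) has_derivative (\<lambda>v. (0, v))) (at pt)"
      by (auto intro!: derivative_eq_intros)
    ultimately have "((\<lambda>y. ?w (x, y)) has_derivative (\<lambda>v. frechet_derivative ?w (at (x, pt)) (0, v))) (at pt)"
      using has_derivative_compose[of "\<lambda>y. (x, y)" "\<lambda>v. (0, v)" pt UNIV ?w] by simp
    then have "((\<lambda>y. \<phi> (\<phi>i x \<otimes> \<phi>i y \<otimes> inv (\<phi>i x))) has_derivative (\<lambda>v. frechet_derivative ?w (at (x, pt)) (0, v))) (at pt)"
      by simp
    then have "(\<lambda>v. frechet_derivative ?w (at (x, pt)) (0, v)) = Ad (\<phi>i x)"
      by (rule has_derivative_unique[OF _ Ad_has_derivative[OF gx]])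
    then show ?thesis by (rule fun_cong)
  qed
  have "smooth_on ?S (\<lambda>x. Ad (\<phi>i x) v)" for v
  proof -
    have "smooth_on ?S (\<lambda>x. (x, pt))"
      by (intro smooth_on_Pair[OF oS] smooth_on_const[OF oS] smooth_on_bounded_linear_id[OF bounded_linear_ident oS])
    then have "smooth_on ?S (\<lambda>x. frechet_derivative ?w (at (x, pt)) (0, v))"
      using smooth_on_compose[OF oS E(1) _ _ smooth_on_frechet_derivative[OF E(2), of "(0, v)"], of "\<lambda>x. (x, pt)"] by simp
    then show ?thesis by (rule smooth_on_cong[OF oS eq, rotated])
  qed
  then show ?thesis using oS ptS SU by blast
qed

lemma br_has_derivative: "((\<lambda>x. Ad (\<phi>i x) v) has_derivative (\<lambda>u. br u v)) (at pt)"
proof -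
  obtain S where "open S" "pt \<in> S" "\<forall>v. smooth_on S (\<lambda>x. Ad (\<phi>i x) v)" using smooth_Ad by blast
  then have "((\<lambda>x. Ad (\<phi>i x) v) has_derivative frechet_derivative (\<lambda>x. Ad (\<phi>i x) v) (at pt)) (at pt)"
    using smooth_on_has_derivative by blast
  moreover have "(\<lambda>u. br u v) = frechet_derivative (\<lambda>x. Ad (\<phi>i x) v) (at pt)"
    by (rule ext) (simp add: br_def lie_bracket_def Ad_def \<phi>i_def pt_def)
  ultimately show ?thesis by simp
qed

lemma br_linear_left: "linear (\<lambda>u. br u v)"
  using br_has_derivative has_derivative_linear by blast

lemma br_linear_right: "linear (br u)"
proof (rule linearI)
  fix v w :: "real^'n" and c :: real
  have "((\<lambda>x. Ad (\<phi>i x) v + Ad (\<phi>i x) w) has_derivative (\<lambda>u. br u v + br u w)) (at pt)"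
    by (intro has_derivative_add br_has_derivative)
  then have "((\<lambda>x. Ad (\<phi>i x) (v + w)) has_derivative (\<lambda>u. br u v + br u w)) (at pt)"
    by (rule has_derivative_transform_within_open[OF _ chart_open[OF U_chart] pt_U])
      (use linear_add[OF Ad_linear] \<phi>i_U U_G in \<open>simp add: subset_iff\<close>)
  from has_derivative_unique[OF br_has_derivative this]
  show "br u (v + w) = br u v + br u w" by (rule fun_cong)
  have "((\<lambda>x. c *\<^sub>R Ad (\<phi>i x) v) has_derivative (\<lambda>u. c *\<^sub>R br u v)) (at pt)"
    by (intro has_derivative_scaleR_right br_has_derivative)
  then have "((\<lambda>x. Ad (\<phi>i x) (c *\<^sub>R v)) has_derivative (\<lambda>u. c *\<^sub>R br u v)) (at pt)"
    by (rule has_derivative_transform_within_open[OF _ chart_open[OF U_chart] pt_U])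
      (use linear_scale[OF Ad_linear] \<phi>i_U U_G in \<open>simp add: subset_iff\<close>)
  from has_derivative_unique[OF br_has_derivative this]
  show "br u (c *\<^sub>R v) = c *\<^sub>R br u v" by (rule fun_cong)
qed

text \<open>Differentiate the relation \<open>Ad (F a) (M v) = M (Ad a v)\<close> at the identity.
  Conjugation by \<open>g\<close> and the involution \<open>\<tau>\<close> are both
  instances.\<close>

lemma br_intertwine:
  assumes F: "smooth_map T A T A F" "F \<one> = \<one>" and DF: "((\<lambda>x. \<phi> (F (\<phi>i x))) has_derivative L) (at pt)"
    and M: "linear M" and eq: "\<And>a v. a \<in> carrier G \<Longrightarrow> Ad (F a) (M v) = M (Ad a v)"
  shows "br (L u) (M v) = M (br u v)"
proof -
  have cF: "continuous_map T T F" using F by (simp add: smooth_map_def)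
  obtain S where S: "open S" "pt \<in> S" "S \<subseteq> \<phi> ` U" "\<forall>x\<in>S. F (\<phi>i x) \<in> U"
    using eventually_chart[OF cF F(2)] by blast
  have F0: "\<phi> (F (\<phi>i pt)) = pt" using F(2) \<phi>i_pt by (simp add: pt_def)
  have "((\<lambda>x. Ad (\<phi>i (\<phi> (F (\<phi>i x)))) (M v)) has_derivative (\<lambda>u. br (L u) (M v))) (at pt)"
    using has_derivative_compose[OF DF, of "\<lambda>x. Ad (\<phi>i x) (M v)" "\<lambda>u. br u (M v)"] br_has_derivative F0 by simp
  then have "((\<lambda>x. M (Ad (\<phi>i x) v)) has_derivative (\<lambda>u. br (L u) (M v))) (at pt)"
    by (rule has_derivative_transform_within_open[OF _ S(1,2)])
      (use S(3,4) \<phi>i_\<phi> eq \<phi>i_U U_G in \<open>auto simp: subset_iff\<close>)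
  moreover have "((\<lambda>x. M (Ad (\<phi>i x) v)) has_derivative (\<lambda>u. M (br u v))) (at pt)"
    using M by (intro bounded_linear.has_derivative[OF _ br_has_derivative]) (simp add: linear_conv_bounded_linear)
  ultimately have "(\<lambda>u. br (L u) (M v)) = (\<lambda>u. M (br u v))" by (rule has_derivative_unique)
  then show ?thesis by (rule fun_cong)
qed

lemma Ad_br:
  assumes g: "g \<in> carrier G" shows "br (Ad g u) (Ad g v) = Ad g (br u v)"
proof (rule br_intertwine[OF smooth_conj[OF g] conj_one[OF g] Ad_has_derivative[OF g] Ad_linear[OF g]])
  fix a v assume a: "a \<in> carrier G"
  have "Ad (g \<otimes> a \<otimes> inv g) (Ad g v) = Ad (g \<otimes> a \<otimes> inv g \<otimes> g) v" using a g Ad_mult by simp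
  also have "g \<otimes> a \<otimes> inv g \<otimes> g = g \<otimes> a" using a g by (simp add: m_assoc)
  finally show "Ad (g \<otimes> a \<otimes> inv g) (Ad g v) = Ad g (Ad a v)" using a g Ad_mult by simp
qed

section \<open>The Killing form, its invariance, and a function on the group that integrates
  it\<close>

lemma kf_eq: "kf u v = trace (adm u ** adm v)"
proof -
  have "matrix (br u \<circ> br v) = adm u ** adm v"
    unfolding adm_def by (rule matrix_compose[OF br_linear_right br_linear_right])
  then show ?thesis by (simp add: kf_def killing_form_def br_def[abs_def] comp_def)
qed

lemma adm_linear: "linear adm"
  by (rule linearI) (simp_all add: adm_def matrix_def vec_eq_iff linear_add[OF br_linear_left] linear_scale[OF br_linear_left])

lemma kf_sym: "kf u v = kf v u"
  unfolding kf_eq by (rule trace_mul_sym)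

lemma trace_mult_scaleR: "trace (X ** (c *\<^sub>R (Z :: real^'k^'k))) = c * trace (X ** Z)"
  by (simp add: trace_def matrix_matrix_mult_def sum_distrib_left mult_ac)

lemma kf_linear_right: "linear (kf u)"
proof (rule linearI)
  show "kf u (v + w) = kf u v + kf u w" for v w
    by (simp add: kf_eq linear_add[OF adm_linear] matrix_add_ldistrib trace_add)
  show "kf u (c *\<^sub>R v) = c *\<^sub>R kf u v" for c v
    by (simp add: kf_eq linear_scale[OF adm_linear] trace_mult_scaleR)
qed

lemma kf_linear_left: "linear (\<lambda>u. kf u v)"
  using kf_linear_right[of v] by (simp add: kf_sym[of _ v])

lemma adm_conj:
  assumes M: "linear M" "linear M'" "\<And>v. M' (M v) = v" "\<And>v. M (M' v) = v"
    and br: "\<And>u v. br (M u) (M v) = M (br u v)"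
  shows "adm (M u) = matrix M ** adm u ** matrix M'"
proof -
  have "br (M u) = M \<circ> br u \<circ> M'" using br[of u "M' _"] M(4) by (auto simp: fun_eq_iff)
  then show ?thesis
    unfolding adm_def
    by (simp add: matrix_compose linear_compose M(1,2) br_linear_right)
qed

lemma matrix_inverse_pair:
  assumes M: "linear M" "linear M'" "\<And>v. M' (M v) = v"
  shows "matrix M' ** matrix M = (mat 1 :: real^'k^'k)"
proof -
  have "matrix M' ** matrix M = matrix (M' \<circ> M)" using matrix_compose[OF M(1,2)] by simp
  also have "M' \<circ> M = (\<lambda>x. x)" using M(3) by auto
  finally show ?thesis by (simp add: matrix_id_mat_1[unfolded id_def])
qed

text \<open>Compatibility with the bracket makes \<open>adm (M u)\<close> a conjugate of
  \<open>adm u\<close>, and the trace is cyclic.\<close>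

lemma kf_invariant:
  assumes M: "linear M" "linear M'" "\<And>v. M' (M v) = v" "\<And>v. M (M' v) = v"
    and br: "\<And>u v. br (M u) (M v) = M (br u v)"
  shows "kf (M u) (M v) = kf u v"
proof -
  let ?m = "matrix M" and ?m' = "matrix M'"
  have mm: "?m' ** ?m = mat 1" by (rule matrix_inverse_pair[OF M(1,2,3)])
  have "kf (M u) (M v) = trace ((?m ** adm u ** ?m') ** (?m ** adm v ** ?m'))"
    unfolding kf_eq adm_conj[OF assms] by simp
  also have "(?m ** adm u ** ?m') ** (?m ** adm v ** ?m') = ?m ** (adm u ** (?m' ** ?m) ** adm v ** ?m')"
    by (simp only: matrix_mul_assoc)
  also have "trace \<dots> = trace ((adm u ** (?m' ** ?m) ** adm v ** ?m') ** ?m)" by (rule trace_mul_sym)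
  also have "(adm u ** (?m' ** ?m) ** adm v ** ?m') ** ?m = adm u ** (?m' ** ?m) ** adm v ** (?m' ** ?m)"
    by (simp only: matrix_mul_assoc)
  finally show ?thesis by (simp add: mm kf_eq)
qed

lemma kf_Ad: "g \<in> carrier G \<Longrightarrow> kf (Ad g u) (Ad g v) = kf u v"
  by (rule kf_invariant[of _ "Ad (inv g)"]) (auto simp: Ad_linear Ad_inv Ad_br)

text \<open>The trace of Ad(x) ad(e) as a function of the coordinates \<open>x\<close>. Its
  differential at \<open>pt\<close> is the Killing pairing with \<open>e\<close>, so that
  orthogonality to \<open>e\<close>, an infinitesimal condition, can be read off from the vanishing
  of a function on the group.\<close>

definition "ch x e = trace (matrix (Ad (\<phi>i x)) ** adm e)"

lemma ch_linear: "linear (ch x)"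
proof (rule linearI)
  show "ch x (v + w) = ch x v + ch x w" for v w
    by (simp add: ch_def linear_add[OF adm_linear] matrix_add_ldistrib trace_add)
  show "ch x (c *\<^sub>R v) = c *\<^sub>R ch x v" for c v
    by (simp add: ch_def linear_scale[OF adm_linear] trace_mult_scaleR)
qed

lemma ch_has_derivative: "((\<lambda>x. ch x e) has_derivative (\<lambda>u. kf u e)) (at pt)"
proof -
  have "((\<lambda>x. \<Sum>i\<in>UNIV. \<Sum>k\<in>UNIV. Ad (\<phi>i x) (axis k 1) $ i * adm e $ k $ i) has_derivative
      (\<lambda>u. \<Sum>i\<in>UNIV. \<Sum>k\<in>UNIV. br u (axis k 1) $ i * adm e $ k $ i)) (at pt)"
    by (intro has_derivative_sum has_derivative_mult_left
      bounded_linear.has_derivative[OF bounded_linear_vec_nth br_has_derivative])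
  then show ?thesis
    by (simp add: ch_def kf_eq trace_def matrix_matrix_mult_def matrix_def adm_def)
qed

text \<open>An element of \<open>G\<close> near the identity whose adjoint action commutes with an involution \<open>\<sigma>\<close> is, to first
  order, orthogonal to the (-1)-eigenspace of \<open>\<sigma>\<close>.  The estimate is uniform in \<open>\<sigma>\<close>.\<close>

lemma ch_bound:
  assumes "0 < \<epsilon>"
  obtains d where "0 < d" "\<And>x e. x \<in> ball pt d \<Longrightarrow> ch x e = 0 \<Longrightarrow> ch pt e = 0 \<Longrightarrow>
    \<bar>kf (x - pt) e\<bar> \<le> \<epsilon> * norm (x - pt) * norm e"
proof -
  define n where "n = real CARD('n)"
  have n: "n > 0" by (simp add: n_def)
  have e': "\<epsilon> / n > 0" using assms n by simp
  have "\<exists>d>0. \<forall>x. norm (x - pt) < d \<longrightarrow> norm (ch x (axis i 1) - ch pt (axis i 1) - kf (x - pt) (axis i 1)) \<le> \<epsilon> / n * norm (x - pt)" for i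
    using ch_has_derivative[of "axis i 1"] e' unfolding has_derivative_at_alt by blast
  then obtain d where d: "\<And>i. d i > 0" "\<And>i x. norm (x - pt) < d i \<Longrightarrow> norm (ch x (axis i 1) - ch pt (axis i 1) - kf (x - pt) (axis i 1)) \<le> \<epsilon> / n * norm (x - pt)"
    by metis
  show ?thesis
  proof (rule that[of "Min (range d)"])
    show "0 < Min (range d)" using d(1) by simp
    fix x e assume x: "x \<in> ball pt (Min (range d))" and 0: "ch x e = 0" "ch pt e = 0"
    have xd: "norm (x - pt) < d i" for i
    proof -
      have "norm (x - pt) < Min (range d)" using x by (simp add: dist_norm norm_minus_commute)
      also have "\<dots> \<le> d i" by (rule Min_le) auto
      finally show ?thesis .
    qed
    define R where "R = (\<lambda>e. ch x e - ch pt e - kf (x - pt) e)"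
    have "linear R" unfolding R_def
      by (intro linear_compose_sub ch_linear kf_linear_right)
    moreover have "e = (\<Sum>i\<in>UNIV. e $ i *\<^sub>R axis i 1)"
      using basis_expansion[of e] by (simp add: scalar_mult_eq_scaleR)
    ultimately have "R e = (\<Sum>i\<in>UNIV. e $ i * R (axis i 1))"
      by (metis (mono_tags, lifting) linear_sum linear_scale real_scaleR_def sum.cong)
    then have "\<bar>R e\<bar> \<le> (\<Sum>i\<in>UNIV. \<bar>e $ i * R (axis i 1)\<bar>)" by (simp add: sum_abs)
    also have "\<dots> \<le> (\<Sum>i\<in>(UNIV::'n set). norm e * (\<epsilon> / n * norm (x - pt)))"
      unfolding abs_mult using d(2)[OF xd] component_le_norm_cart[of e]
      by (intro sum_mono mult_mono) (auto simp: R_def)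
    also have "\<dots> = \<epsilon> * norm (x - pt) * norm e" using n by (simp add: n_def)
    finally show "\<bar>kf (x - pt) e\<bar> \<le> \<epsilon> * norm (x - pt) * norm e" by (simp add: R_def 0)
  qed
qed

text \<open>\<open>Ad (\<phi>i x)\<close> commutes with \<open>S\<close>, while \<open>adm e\<close>
  changes sign under conjugation by \<open>S\<close>; cyclicity of the trace then makes the value
  equal to its negative.\<close>

lemma ch_zero:
  assumes x: "\<phi>i x \<in> carrier G" and S: "linear S" "\<And>v. S (S v) = v" "\<And>u v. br (S u) (S v) = S (br u v)"
    and comm: "\<And>v. Ad (\<phi>i x) (S v) = S (Ad (\<phi>i x) v)" and e: "S e = - e"
  shows "ch x e = 0"
proof -
  let ?X = "matrix (Ad (\<phi>i x))" and ?S = "matrix S" and ?E = "adm e"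
  have SS: "?S ** ?S = mat 1" by (rule matrix_inverse_pair[OF S(1,1,2)])
  have "Ad (\<phi>i x) \<circ> S = S \<circ> Ad (\<phi>i x)" using comm by auto
  then have XS: "?X ** ?S = ?S ** ?X"
    using matrix_compose[OF S(1) Ad_linear[OF x]] matrix_compose[OF Ad_linear[OF x] S(1)] by simp
  have "?E = adm (S (- e))" using e linear_neg[OF S(1), of e] by simp
  also have "\<dots> = ?S ** adm (- e) ** ?S" by (rule adm_conj[OF S(1,1,2,2,3)])
  also have "adm (- e) = - 1 *\<^sub>R ?E" using linear_neg[OF adm_linear, of e] by simp
  also have "?S ** (- 1 *\<^sub>R ?E) ** ?S = - 1 *\<^sub>R (?S ** ?E ** ?S)"
    by (simp only: matrix_scalar_ac scalar_matrix_assoc)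
  finally have E: "?E = - 1 *\<^sub>R (?S ** ?E ** ?S)" .
  have "trace (?X ** ?E) = trace (?X ** (- 1 *\<^sub>R (?S ** ?E ** ?S)))" using E by (rule arg_cong)
  also have "\<dots> = - trace (?X ** (?S ** ?E ** ?S))" unfolding trace_mult_scaleR by simp
  also have "?X ** (?S ** ?E ** ?S) = ?S ** (?X ** ?E ** ?S)"
    using XS by (metis matrix_mul_assoc)
  also have "trace \<dots> = trace ((?X ** ?E ** ?S) ** ?S)" by (rule trace_mul_sym)
  also have "(?X ** ?E ** ?S) ** ?S = ?X ** ?E" using SS by (metis matrix_mul_assoc matrix_mul_rid)
  finally show ?thesis by (simp add: ch_def)
qed

end

section \<open>The tangent space of a symmetric space\<close>

lemma smooth_on_bounded_linear:
  "open S \<Longrightarrow> bounded_linear L \<Longrightarrow> smooth_on S f \<Longrightarrow> smooth_on S (\<lambda>x. L (f x))"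
  by (simp add: smooth_on_def Ck_on_bounded_linear)

lemma continuous_on_det: "continuous_on S (det :: real^'m^'m \<Rightarrow> real)"
  unfolding det_def by (intro continuous_intros)

lemma norm_matrix_le: "norm (X :: real^'m^'k) \<le> (\<Sum>i\<in>UNIV. \<Sum>j\<in>UNIV. \<bar>X $ i $ j\<bar>)"
proof -
  have "norm X \<le> (\<Sum>i\<in>UNIV. norm (X $ i))" by (simp add: norm_vec_def L2_set_le_sum)
  also have "\<dots> \<le> (\<Sum>i\<in>UNIV. \<Sum>j\<in>UNIV. \<bar>X $ i $ j\<bar>)" by (intro sum_mono norm_le_l1_cart)
  finally show ?thesis .
qed

lemma det_near_one:
  obtains \<eta> where "0 < \<eta>" "\<And>N :: real^'m^'m. (\<And>i j. \<bar>N $ i $ j - (if i = j then 1 else 0)\<bar> \<le> \<eta>) \<Longrightarrow> 1 / 2 \<le> det N"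
proof -
  have "isCont (det :: real^'m^'m \<Rightarrow> real) (mat 1)"
    using continuous_on_det[of "UNIV :: (real^'m^'m) set"] by (simp add: continuous_on_eq_continuous_at)
  then obtain d where d: "d > 0" "\<And>N :: real^'m^'m. dist N (mat 1) < d \<Longrightarrow> dist (det N) (det (mat 1 :: real^'m^'m)) < 1 / 2"
    using half_gt_zero[OF zero_less_one] unfolding continuous_at_eps_delta by blast
  define n where "n = real CARD('m)"
  have n: "n > 0" by (simp add: n_def)
  show ?thesis
  proof (rule that[of "d / (2 * n * n)"])
    show "0 < d / (2 * n * n)" using d n by simp
    fix N :: "real^'m^'m" assume N: "\<And>i j. \<bar>N $ i $ j - (if i = j then 1 else 0)\<bar> \<le> d / (2 * n * n)"
    have "norm (N - mat 1) \<le> (\<Sum>i\<in>UNIV. \<Sum>j\<in>UNIV. \<bar>(N - mat 1) $ i $ j\<bar>)" by (rule norm_matrix_le)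
    also have "\<dots> \<le> (\<Sum>i\<in>(UNIV::'m set). \<Sum>j\<in>(UNIV::'m set). d / (2 * n * n))"
      using N by (intro sum_mono) (simp add: mat_def)
    also have "\<dots> = d / 2" using n by (simp add: n_def)
    finally have "dist N (mat 1) < d" using d by (simp add: dist_norm)
    then have "dist (det N) 1 < 1 / 2" using d(2) by fastforce
    then have "\<bar>det N - 1\<bar> < 1 / 2" by (simp only: dist_real_def)
    then show "1 / 2 \<le> det N" by linarith
  qed
qed

lemma det_uniformly_continuous:
  assumes "0 < \<gamma>"
  obtains \<rho> where "0 < \<rho>" "\<And>X Z :: real^'m^'m. norm X \<le> R \<Longrightarrow> norm Z \<le> R \<Longrightarrow> norm (X - Z) < \<rho> \<Longrightarrow> \<bar>det X - det Z\<bar> < \<gamma>"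
proof -
  have "uniformly_continuous_on (cball 0 R) (det :: real^'m^'m \<Rightarrow> real)"
    by (rule compact_uniformly_continuous[OF continuous_on_det compact_cball])
  then obtain d where "d > 0" "\<And>X Z :: real^'m^'m. X \<in> cball 0 R \<Longrightarrow> Z \<in> cball 0 R \<Longrightarrow> dist Z X < d \<Longrightarrow> dist (det Z) (det X) < \<gamma>"
    unfolding uniformly_continuous_on_def using assms by metis
  then show ?thesis by (intro that[of d]) (auto simp: dist_norm norm_minus_commute)
qed

lemma det_bound:
  assumes "0 \<le> K" "\<And>i j. \<bar>(X :: real^'m^'m) $ i $ j\<bar> \<le> K"
  shows "\<bar>det X\<bar> \<le> fact CARD('m) * K ^ CARD('m)"
proof -
  have "\<bar>det X\<bar> \<le> (\<Sum>p | p permutes (UNIV::'m set). \<bar>of_int (sign p) * (\<Prod>i\<in>UNIV. X $ i $ p i)\<bar>)"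
    unfolding det_def by (rule sum_abs)
  also have "\<dots> \<le> (\<Sum>p | p permutes (UNIV::'m set). K ^ CARD('m))"
  proof (rule sum_mono)
    fix p
    have "\<bar>\<Prod>i\<in>UNIV. X $ i $ p i\<bar> \<le> (\<Prod>i\<in>(UNIV::'m set). K)"
      unfolding abs_prod by (rule prod_mono) (use assms in auto)
    then show "\<bar>of_int (sign p) * (\<Prod>i\<in>UNIV. X $ i $ p i)\<bar> \<le> K ^ CARD('m)"
      by (simp add: abs_mult sign_def)
  qed
  also have "\<dots> = fact CARD('m) * K ^ CARD('m)" by (simp add: card_permutations)
  finally show ?thesis .
qed

locale symspace = smooth_homspace G T A H B \<mu> + lie_chart G T A U \<phi>
  for G (structure) and T :: "'a topology" and A :: "('a, real^'n) chart set" and H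
    and B :: "('a set, real^'m) chart set" and \<mu> and U \<phi> +
  fixes \<tau> :: "'a \<Rightarrow> 'a" and V :: "'a set set" and \<psi> :: "'a set \<Rightarrow> real^'m"
  assumes semisimple: "semisimple_lie_group G T A"
    and involutive: "involutive_automorphism G T A \<tau>"
    and H_open: "openin (subtopology T (fixed_group G \<tau>)) H"
    and V_in: "(V, \<psi>) \<in> B" and H_V: "H \<in> V"
begin

definition "\<theta> = frechet_derivative (\<lambda>x. \<phi> (\<tau> (\<phi>i x))) (at pt)"

lemma \<tau>_smooth: "smooth_map T A T A \<tau>" and \<tau>_\<tau>: "g \<in> carrier G \<Longrightarrow> \<tau> (\<tau> g) = g"
  and \<tau>_iso: "\<tau> \<in> iso G G"
  using involutive by (auto simp: involutive_automorphism_def)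

lemma \<tau>_mult: "a \<in> carrier G \<Longrightarrow> b \<in> carrier G \<Longrightarrow> \<tau> (a \<otimes> b) = \<tau> a \<otimes> \<tau> b"
  using \<tau>_iso by (auto simp: iso_def hom_def)

lemma \<tau>_in: "a \<in> carrier G \<Longrightarrow> \<tau> a \<in> carrier G"
  using \<tau>_iso by (auto simp: iso_def hom_def)

lemma \<tau>_group_hom: "group_hom G G \<tau>"
  using \<tau>_iso by (simp add: group_hom_def group_hom_axioms_def iso_def is_group)

lemma \<tau>_one: "\<tau> \<one> = \<one>" using group_hom.hom_one[OF \<tau>_group_hom] .
lemma \<tau>_inv: "a \<in> carrier G \<Longrightarrow> \<tau> (inv a) = inv (\<tau> a)" using group_hom.hom_inv[OF \<tau>_group_hom] .

lemma \<theta>_has_derivative: "((\<lambda>x. \<phi> (\<tau> (\<phi>i x))) has_derivative \<theta>) (at pt)"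
  unfolding \<theta>_def by (rule has_derivative_chart_map1[OF \<tau>_smooth \<tau>_one])

lemma \<theta>_linear: "linear \<theta>" using \<theta>_has_derivative has_derivative_linear by blast

lemma \<theta>_\<theta>: "\<theta> (\<theta> v) = v"
proof -
  have "((\<lambda>x. \<phi> (\<tau> (\<tau> (\<phi>i x)))) has_derivative (\<lambda>v. \<theta> (\<theta> v))) (at pt)"
    by (rule derivative_of_composite[OF \<tau>_smooth \<tau>_one \<tau>_smooth \<tau>_one \<theta>_has_derivative \<theta>_has_derivative])
  then have "((\<lambda>x. x) has_derivative (\<lambda>v. \<theta> (\<theta> v))) (at pt)"
    by (rule has_derivative_transform_within_open[OF _ chart_open[OF U_chart] pt_U])
      (use \<phi>i_U U_G \<tau>_\<tau> \<phi>_\<phi>i in \<open>simp add: subset_iff\<close>)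
  then have "(\<lambda>v. \<theta> (\<theta> v)) = (\<lambda>v. v)" by (rule has_derivative_unique) simp
  then show ?thesis by (rule fun_cong)
qed

lemma Ad_\<tau>:
  assumes a: "a \<in> carrier G" shows "Ad (\<tau> a) (\<theta> v) = \<theta> (Ad a v)"
proof -
  have ta: "\<tau> a \<in> carrier G" using \<tau>_in[OF a] .
  have "((\<lambda>x. \<phi> (\<tau> (a \<otimes> \<phi>i x \<otimes> inv a))) has_derivative (\<lambda>v. \<theta> (Ad a v))) (at pt)"
    by (rule derivative_of_composite[OF \<tau>_smooth \<tau>_one smooth_conj[OF a] conj_one[OF a] \<theta>_has_derivative Ad_has_derivative[OF a]])
  moreover have "((\<lambda>x. \<phi> (\<tau> a \<otimes> \<tau> (\<phi>i x) \<otimes> inv (\<tau> a))) has_derivative (\<lambda>v. Ad (\<tau> a) (\<theta> v))) (at pt)"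
    by (rule derivative_of_composite[OF smooth_conj[OF ta] conj_one[OF ta] \<tau>_smooth \<tau>_one Ad_has_derivative[OF ta] \<theta>_has_derivative])
  then have "((\<lambda>x. \<phi> (\<tau> (a \<otimes> \<phi>i x \<otimes> inv a))) has_derivative (\<lambda>v. Ad (\<tau> a) (\<theta> v))) (at pt)"
  proof (rule has_derivative_transform_within_open[OF _ chart_open[OF U_chart] pt_U])
    fix x assume "x \<in> \<phi> ` U"
    then have "\<phi>i x \<in> carrier G" using \<phi>i_U U_G by blast
    then show "\<phi> (\<tau> a \<otimes> \<tau> (\<phi>i x) \<otimes> inv (\<tau> a)) = \<phi> (\<tau> (a \<otimes> \<phi>i x \<otimes> inv a))"
      using a by (simp add: \<tau>_mult \<tau>_inv)
  qed
  ultimately have "(\<lambda>v. \<theta> (Ad a v)) = (\<lambda>v. Ad (\<tau> a) (\<theta> v))" by (rule has_derivative_unique)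
  then show ?thesis by (rule fun_cong[symmetric])
qed

lemma \<theta>_br: "br (\<theta> u) (\<theta> v) = \<theta> (br u v)"
  by (rule br_intertwine[OF \<tau>_smooth \<tau>_one \<theta>_has_derivative \<theta>_linear Ad_\<tau>])

lemma kf_\<theta>: "kf (\<theta> u) (\<theta> v) = kf u v"
  by (rule kf_invariant[OF \<theta>_linear \<theta>_linear \<theta>_\<theta> \<theta>_\<theta> \<theta>_br])

lemma kf_orthogonal: "\<theta> u = u \<Longrightarrow> \<theta> v = - v \<Longrightarrow> kf u v = 0"
  using kf_\<theta>[of u v] linear_neg[OF kf_linear_right, of u v] by simp

lemma kf_nondegenerate: "(\<And>v. kf u v = 0) \<Longrightarrow> u = 0"
  using semisimple U_in one_U unfolding semisimple_lie_group_def kf_def by fastforce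

section \<open>The projection in charts and the tangent space at the base point\<close>

lemma V_chart: "is_chart Y (V, \<psi>)" using atlas_Y V_in by (auto simp: atlas_on_def)

lemma V_lcosets: "V \<subseteq> lcosets H" using chart_subset[OF V_chart] by simp

definition "pm x = \<psi> (proj (\<phi>i x))"
definition "Dp = \<phi> ` {a \<in> U. proj a \<in> V}"
text \<open>The differential of the projection to \<open>G/H\<close> at the identity. Its kernel,
  the Lie algebra of \<open>H\<close>, turns out to be the fixed space of
  \<open>\<theta>\<close>.\<close>

definition "P = frechet_derivative pm (at pt)"

lemma pm_chart: "open Dp" "smooth_on Dp pm"
  using smooth_map_chart[OF smooth_proj U_in U_chart V_in V_chart] by (auto simp: Dp_def pm_def[abs_def] \<phi>i_def)

lemma proj_one: "proj \<one> = H" using lcos_mult_one[OF H_sub] .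

lemma pt_Dp: "pt \<in> Dp" using one_U H_V proj_one by (auto simp: Dp_def pt_def)

lemma pm_pt: "pm pt = \<psi> H" by (simp add: pm_def \<phi>i_pt proj_one)

lemma P_has_derivative: "(pm has_derivative P) (at pt)"
  unfolding P_def by (rule smooth_on_has_derivative[OF pm_chart(2) pt_Dp])

lemma P_linear: "linear P" using P_has_derivative has_derivative_linear by blast

lemma P_surj: "surj P"
proof -
  have "proj \<one> \<in> V" using H_V proj_one by simp
  then have "surj (frechet_derivative (\<lambda>x. \<psi> (proj (inv_into U \<phi> x))) (at (\<phi> \<one>)))"
    using q U_in V_in one_U unfolding quotient_atlas_def submersion_def by blast
  then show ?thesis by (simp add: P_def pm_def[abs_def] \<phi>i_def pt_def)
qed

lemma H_fixed: "h \<in> H \<Longrightarrow> \<tau> h = h"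
  using openin_subset[OF H_open] by (auto simp: fixed_group_def)

lemma curve_derivative:
  assumes "(g has_derivative (\<lambda>v. v)) (at pt)" "g pt = pt" "(f has_derivative f') (at pt)"
  shows "((\<lambda>t::real. f (g (pt + t *\<^sub>R u))) has_derivative (\<lambda>t. f' (t *\<^sub>R u))) (at 0)"
proof -
  have 1: "((\<lambda>t::real. pt + t *\<^sub>R u) has_derivative (\<lambda>t. t *\<^sub>R u)) (at 0)"
    by (auto intro!: derivative_eq_intros)
  have 2: "((\<lambda>t::real. g (pt + t *\<^sub>R u)) has_derivative (\<lambda>t. t *\<^sub>R u)) (at 0)"
    using has_derivative_compose[OF 1, of g "\<lambda>v. v"] assms(1) by simp
  show ?thesis using has_derivative_compose[OF 2, of f f'] assms(2,3) by simp
qed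

lemma eventually_curve:
  fixes S :: "(real^'n) set"
  assumes "open S" "pt \<in> S"
  obtains d where "0 < d" "\<And>t::real. \<bar>t\<bar> < d \<Longrightarrow> pt + t *\<^sub>R u \<in> S"
proof -
  have "open ((\<lambda>t::real. pt + t *\<^sub>R u) -` S)"
    by (rule open_vimage[OF assms(1)]) (intro continuous_intros)
  moreover have "0 \<in> (\<lambda>t::real. pt + t *\<^sub>R u) -` S" using assms(2) by simp
  ultimately obtain d where "d > 0" "ball 0 d \<subseteq> (\<lambda>t::real. pt + t *\<^sub>R u) -` S"
    using open_contains_ball by blast
  then show ?thesis by (intro that[of d]) (auto simp: subset_iff dist_norm)
qed

text \<open>After straightening the projection, the line through \<open>pt\<close> in direction
  \<open>u\<close> becomes a curve in the fibre \<open>H\<close>, on which \<open>\<tau>\<close> is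
  the identity. Differentiating this relation at 0 gives the claim.\<close>

lemma P_kernel_fixed:
  assumes u: "P u = 0" shows "\<theta> u = u"
proof -
  obtain W g where g: "open W" "pt \<in> W" "g pt = pt" "(g has_derivative (\<lambda>v. v)) (at pt)"
    "\<And>\<xi>. \<xi> \<in> W \<Longrightarrow> g \<xi> \<in> Dp \<and> pm (g \<xi>) = pm pt + P (\<xi> - pt)" "continuous_on W g"
    using submersion_straighten[OF pm_chart pt_Dp] P_surj unfolding P_def by metis
  obtain d where d: "0 < d" "\<And>t::real. \<bar>t\<bar> < d \<Longrightarrow> pt + t *\<^sub>R u \<in> W"
    using eventually_curve[OF g(1,2)] by metis
  have stays: "\<phi> (\<tau> (\<phi>i (g (pt + t *\<^sub>R u)))) = g (pt + t *\<^sub>R u)" if t: "\<bar>t\<bar> < d" for t :: real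
  proof -
    let ?x = "g (pt + t *\<^sub>R u)"
    have x: "?x \<in> Dp" "pm ?x = \<psi> H"
      using g(5)[OF d(2)[OF t]] u linear_scale[OF P_linear] pm_pt by auto
    then obtain a where a: "a \<in> U" "proj a \<in> V" "?x = \<phi> a" by (auto simp: Dp_def)
    then have "\<psi> (proj a) = \<psi> H" using x(2) \<phi>i_\<phi>[OF a(1)] by (simp add: pm_def)
    then have "proj a = H" using chart_inj[OF V_chart] a(2) H_V by (auto dest: inj_onD)
    then have "a \<in> H" using proj_eq_H_iff a(1) U_G by blast
    then show ?thesis using H_fixed a(1,3) \<phi>i_\<phi> by simp
  qed
  have "((\<lambda>t::real. g (pt + t *\<^sub>R u)) has_derivative (\<lambda>t. \<theta> (t *\<^sub>R u))) (at 0)"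
    by (rule has_derivative_transform_within_open[OF curve_derivative[OF g(4,3) \<theta>_has_derivative], of "ball 0 d"])
      (use stays d in \<open>auto simp: dist_norm\<close>)
  moreover have "((\<lambda>t::real. g (pt + t *\<^sub>R u)) has_derivative (\<lambda>t. t *\<^sub>R u)) (at 0)"
    using curve_derivative[OF g(4,3) has_derivative_ident] .
  ultimately have "(\<lambda>t::real. \<theta> (t *\<^sub>R u)) = (\<lambda>t. t *\<^sub>R u)" by (rule has_derivative_unique)
  from fun_cong[OF this, of 1] show ?thesis by simp
qed

text \<open>In the chart \<open>(\<phi> + \<theta> \<phi> \<tau>) / 2\<close> the involution is linear, so that its fixed points form a
  submanifold whose tangent space is the fixed space of \<open>\<theta>\<close>.\<close>

lemma fixed_P_kernel:
  assumes u: "\<theta> u = u" shows "P u = 0"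
proof -
  have c\<tau>: "continuous_map T T \<tau>" using \<tau>_smooth by (simp add: smooth_map_def)
  define S where "S = \<phi> ` {a \<in> U. \<tau> a \<in> U}"
  define t\<tau> where "t\<tau> = (\<lambda>x. \<phi> (\<tau> (\<phi>i x)))"
  have S: "open S" "smooth_on S t\<tau>" using chart_map1[OF \<tau>_smooth] by (auto simp: S_def t\<tau>_def)
  have ptS: "pt \<in> S" using one_U \<tau>_one by (auto simp: S_def pt_def)
  have t\<tau>pt: "t\<tau> pt = pt" using \<tau>_one by (simp add: t\<tau>_def \<phi>i_pt) (simp add: pt_def)
  \<comment> \<open>The averaged chart. In it \<open>\<tau>\<close> acts as
    \<open>pt + w \<mapsto> pt + \<theta> w\<close>, and its derivative at \<open>pt\<close> is the
    identity because \<open>\<theta>\<close> is an involution.\<close>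
  define xx where "xx = (\<lambda>x. pt + (1 / 2) *\<^sub>R ((x - pt) + \<theta> (t\<tau> x - pt)))"
  have bl\<theta>: "bounded_linear \<theta>" using \<theta>_linear by (simp add: linear_conv_bounded_linear)
  have sxx: "smooth_on S xx"
  proof -
    have sx: "smooth_on S (\<lambda>x. x + \<theta> (t\<tau> x))"
      by (intro smooth_on_add[OF S(1)] smooth_on_bounded_linear_id[OF bounded_linear_ident S(1)]
        smooth_on_bounded_linear[OF S(1) bl\<theta> S(2)])
    have "smooth_on S (\<lambda>x. (pt - (1 / 2) *\<^sub>R (pt + \<theta> pt)) + (1 / 2) *\<^sub>R (x + \<theta> (t\<tau> x)))"
      by (rule smooth_on_add[OF S(1) smooth_on_const[OF S(1)] smooth_on_bounded_linear[OF S(1) bounded_linear_scaleR_right sx]])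
    moreover have "(\<lambda>x. (pt - (1 / 2) *\<^sub>R (pt + \<theta> pt)) + (1 / 2) *\<^sub>R (x + \<theta> (t\<tau> x))) = xx"
      by (auto simp: xx_def linear_diff[OF \<theta>_linear] algebra_simps)
    ultimately show ?thesis by simp
  qed
  have xxpt: "xx pt = pt" using linear_0[OF \<theta>_linear] by (simp add: xx_def t\<tau>pt)
  have dxx: "(xx has_derivative (\<lambda>v. v)) (at pt)"
  proof -
    have "(xx has_derivative (\<lambda>v. 0 + (1 / 2) *\<^sub>R ((v - 0) + \<theta> (\<theta> v - 0)))) (at pt)"
      unfolding xx_def t\<tau>_def
      by (intro has_derivative_add has_derivative_const has_derivative_scaleR_right has_derivative_diff has_derivative_ident
        bounded_linear.has_derivative[OF bl\<theta>] \<theta>_has_derivative)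
    then show ?thesis by (simp add: \<theta>_\<theta> scaleR_2[symmetric])
  qed
  have fxx: "frechet_derivative xx (at pt) = (\<lambda>v. v)" using frechet_derivative_at[OF dxx] by simp
  have sfxx: "surj (frechet_derivative xx (at pt))" by (simp add: fxx surj_def)
  obtain W g where g: "open W" "pt \<in> W" "g pt = pt" "(g has_derivative (\<lambda>v. v)) (at pt)"
    "\<And>\<xi>. \<xi> \<in> W \<Longrightarrow> g \<xi> \<in> S \<and> xx (g \<xi>) = xx pt + (\<xi> - pt)" "continuous_on W g"
    by (rule submersion_straighten[OF S(1) sxx ptS sfxx, unfolded fxx]) (rule that)
  \<comment> \<open>Strict differentiability with constant 1/2 makes \<open>xx\<close> injective
    near \<open>pt\<close>: equal values would give
    \<open>norm (z - z') \<le> norm (z - z') / 2\<close>.\<close>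
  obtain r where r: "0 < r" "ball pt r \<subseteq> S"
    "\<And>z z'. z \<in> ball pt r \<Longrightarrow> z' \<in> ball pt r \<Longrightarrow> norm (xx z - xx z' - frechet_derivative xx (at pt) (z - z')) \<le> (1 / 2) * norm (z - z')"
    by (rule smooth_on_strict_derivative[OF S(1) sxx ptS half_gt_zero[OF zero_less_one]]) (rule that)
  have inj: "z = z'" if "z \<in> ball pt r" "z' \<in> ball pt r" "xx z = xx z'" for z z'
    using r(3)[OF that(1,2)] that(3) by (simp add: fxx norm_minus_commute)
  obtain Ot where Ot: "openin T Ot" "H = Ot \<inter> fixed_group G \<tau>"
    using H_open by (auto simp: openin_subtopology)
  have oneO: "\<one> \<in> Ot" using H_one Ot(2) by blast
  have oO: "open (\<phi> ` (U \<inter> Ot))"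
    using chart_image_open[OF U_chart] chart_openin[OF U_chart] Ot(1) by blast
  \<comment> \<open>The two balls make \<open>xx\<close> injective on the pair formed by
    \<open>x\<close> and its image under \<open>\<tau>\<close>. As \<open>H\<close> is the
    intersection of \<open>Ot\<close> with the fixed group, points of \<open>Q\<close> fixed by
    \<open>\<tau>\<close> lie in \<open>H\<close>.\<close>
  define Q where "Q = {x \<in> S. x \<in> ball pt r \<and> t\<tau> x \<in> ball pt r \<and> x \<in> \<phi> ` (U \<inter> Ot)}"
  have "Q = (S \<inter> t\<tau> -` ball pt r) \<inter> ball pt r \<inter> \<phi> ` (U \<inter> Ot)" by (auto simp: Q_def)
  then have oQ: "open Q"
    using continuous_open_preimage[OF smooth_on_imp_continuous_on[OF S(2)] S(1) open_ball] oO by auto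
  have ptQ: "pt \<in> Q" using ptS r(1) t\<tau>pt one_U oneO by (auto simp: Q_def pt_def)
  have "open (W \<inter> g -` Q)" by (rule continuous_open_preimage[OF g(6,1) oQ])
  then obtain d where d: "0 < d" "\<And>t::real. \<bar>t\<bar> < d \<Longrightarrow> pt + t *\<^sub>R u \<in> W \<inter> g -` Q"
    using eventually_curve[of "W \<inter> g -` Q"] g(2,3) ptQ by (metis IntI vimageI)
  have const: "pm (g (pt + t *\<^sub>R u)) = \<psi> H" if t: "\<bar>t\<bar> < d" for t :: real
  proof -
    let ?x = "g (pt + t *\<^sub>R u)"
    have xQ: "?x \<in> Q" and xW: "pt + t *\<^sub>R u \<in> W" using d(2)[OF t] by auto
    then obtain a where a: "a \<in> U" "\<tau> a \<in> U" "?x = \<phi> a" by (auto simp: Q_def S_def)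
    have aG: "a \<in> carrier G" using a U_G by blast
    have aO: "a \<in> Ot" using xQ a chart_inj[OF U_chart] by (auto simp: Q_def inj_on_def)
    have t1: "t\<tau> ?x = \<phi> (\<tau> a)" using a \<phi>i_\<phi> by (simp add: t\<tau>_def)
    have t2: "t\<tau> (\<phi> (\<tau> a)) = ?x" using a \<phi>i_\<phi> \<tau>_\<tau>[OF aG] by (simp add: t\<tau>_def)
    have "xx ?x = pt + t *\<^sub>R u" using g(5)[OF xW] xxpt by simp
    then have e1: "(1 / 2) *\<^sub>R ((?x - pt) + \<theta> (\<phi> (\<tau> a) - pt)) = t *\<^sub>R u" by (simp add: xx_def t1)
    have "xx (\<phi> (\<tau> a)) = pt + (1 / 2) *\<^sub>R ((\<phi> (\<tau> a) - pt) + \<theta> (?x - pt))" by (simp add: xx_def t2)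
    also have "(1 / 2) *\<^sub>R ((\<phi> (\<tau> a) - pt) + \<theta> (?x - pt)) = \<theta> ((1 / 2) *\<^sub>R ((?x - pt) + \<theta> (\<phi> (\<tau> a) - pt)))"
      by (simp add: linear_scale[OF \<theta>_linear] linear_add[OF \<theta>_linear] \<theta>_\<theta> add.commute)
    also have "\<dots> = t *\<^sub>R u" unfolding e1 by (simp add: linear_scale[OF \<theta>_linear] u)
    finally have "xx (\<phi> (\<tau> a)) = xx ?x" using g(5)[OF xW] xxpt by simp
    then have "\<phi> (\<tau> a) = ?x" using inj[of "\<phi> (\<tau> a)" ?x] xQ t1 by (simp add: Q_def)
    then have "\<tau> a = a" using a chart_inj[OF U_chart] by (auto dest: inj_onD)
    then have "a \<in> H" using Ot(2) aO aG by (simp add: fixed_group_def)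
    then show ?thesis using a \<phi>i_\<phi> proj_eq_H_iff[OF aG] by (simp add: pm_def)
  qed
  have "((\<lambda>t::real. \<psi> H) has_derivative (\<lambda>t. P (t *\<^sub>R u))) (at 0)"
    by (rule has_derivative_transform_within_open[OF curve_derivative[OF g(4,3) P_has_derivative], of "ball 0 d"])
      (use const d in \<open>auto simp: dist_norm\<close>)
  then have "(\<lambda>t::real. P (t *\<^sub>R u)) = (\<lambda>t. 0)" by (rule has_derivative_unique) simp
  from fun_cong[OF this, of 1] show ?thesis by simp
qed

text \<open>\<open>P\<close> kills the fixed part of \<open>u0 k\<close>, so its (-1)-part
  \<open>f k\<close> still maps to the k-th axis. The \<open>f k\<close> represent every vector
  modulo the fixed space, which is Killing orthogonal to the (-1)-eigenspace; a kernel vector of the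
  Gram matrix would therefore be orthogonal to everything, against nondegeneracy.\<close>

lemma minus_eigenbasis:
  obtains f :: "'m \<Rightarrow> real^'n" where "\<And>k. \<theta> (f k) = - f k" "\<And>k. P (f k) = axis k 1"
    "\<And>u l. kf u (f l) = (\<Sum>k\<in>UNIV. P u $ k * kf (f k) (f l))"
    "det (\<chi> k l. kf (f k) (f l)) \<noteq> 0"
proof -
  have "\<forall>k::'m. \<exists>u. P u = axis k 1" using P_surj by (metis surj_def)
  then obtain u0 where u0: "\<And>k::'m. P (u0 k) = axis k 1" by metis
  define f where "f = (\<lambda>k. (1 / 2) *\<^sub>R (u0 k - \<theta> (u0 k)))"
  have f1: "\<theta> (f k) = - f k" for k
    by (simp add: f_def linear_scale[OF \<theta>_linear] linear_diff[OF \<theta>_linear] \<theta>_\<theta> algebra_simps)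
  have f2: "P (f k) = axis k 1" for k
  proof -
    have "P (u0 k + \<theta> (u0 k)) = 0" by (rule fixed_P_kernel) (simp add: linear_add[OF \<theta>_linear] \<theta>_\<theta>)
    then have "P (\<theta> (u0 k)) = - P (u0 k)" by (simp add: linear_add[OF P_linear] add_eq_0_iff)
    then show ?thesis by (simp add: f_def linear_scale[OF P_linear] linear_diff[OF P_linear] u0)
  qed
  have decomp: "kf u w = (\<Sum>k\<in>UNIV. P u $ k * kf (f k) w)" if w: "\<theta> w = - w" for u w
  proof -
    define v where "v = u - (\<Sum>k\<in>UNIV. P u $ k *\<^sub>R f k)"
    have "(\<Sum>k\<in>UNIV. P u $ k *\<^sub>R axis k 1) = P u"
      using basis_expansion[of "P u"] by (simp add: scalar_mult_eq_scaleR)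
    then have "P v = 0"
      by (simp add: v_def linear_diff[OF P_linear] linear_sum[OF P_linear] linear_scale[OF P_linear] f2)
    then have "kf v w = 0" by (intro kf_orthogonal P_kernel_fixed w)
    then show ?thesis
      by (simp add: v_def linear_diff[OF kf_linear_left] linear_sum[OF kf_linear_left] linear_scale[OF kf_linear_left])
  qed
  let ?K = "\<chi> k l. kf (f k) (f l)"
  have "?K *v c = 0 \<longrightarrow> c = 0" for c :: "real^'m"
  proof
    assume c: "?K *v c = 0"
    define w where "w = (\<Sum>l\<in>UNIV. c $ l *\<^sub>R f l)"
    have w1: "\<theta> w = - w"
      by (simp add: w_def linear_sum[OF \<theta>_linear] linear_scale[OF \<theta>_linear] f1 sum_negf)
    have "kf (f k) w = 0" for k
    proof -
      have "kf (f k) w = (?K *v c) $ k"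
        by (simp add: w_def linear_sum[OF kf_linear_right] linear_scale[OF kf_linear_right] matrix_vector_mult_def mult.commute)
      then show ?thesis using c by simp
    qed
    then have "kf w v = 0" for v using decomp[OF w1, of v] by (simp add: kf_sym[of w])
    then have "w = 0" by (rule kf_nondegenerate)
    moreover have "P w = c"
      using basis_expansion[of c] by (simp add: w_def linear_sum[OF P_linear] linear_scale[OF P_linear] f2 scalar_mult_eq_scaleR)
    ultimately show "c = 0" using linear_0[OF P_linear] by simp
  qed
  then have "invertible ?K"
    using matrix_left_invertible_ker[of ?K] invertible_left_inverse by blast
  then have "det ?K \<noteq> 0" by (simp add: invertible_det_nz)
  then show ?thesis by (rule that[of f, OF f1 f2 decomp[OF f1]])
qed

section \<open>Frames adapted to translates of the (-1)-eigenspace\<close>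

lemma kf_bounded: "\<exists>K>0. \<forall>u v. \<bar>kf u v\<bar> \<le> K * norm u * norm v"
  using bilinear_bounded_pos[of kf] kf_linear_left kf_linear_right by (simp add: bilinear_def)

text \<open>\<open>\<kappa>\<close> inverts the map that sends \<open>v\<close> to the vector
  representing \<open>kf v\<close>. It carries every orthonormal system to a Killing-dual one of
  norm at most \<open>C\<close>, whatever the system.\<close>

lemma kf_dual:
  obtains \<kappa> C where "linear \<kappa>" "0 < C" "\<And>e. norm (\<kappa> e) \<le> C * norm e" "\<And>e w. kf (\<kappa> e) w = e \<bullet> w"
proof -
  define Km where "Km = (\<lambda>v. \<chi> i. kf v (axis i 1))"
  have Km: "kf v w = Km v \<bullet> w" for v w
  proof -
    have "w = (\<Sum>i\<in>UNIV. w $ i *\<^sub>R axis i 1)" using basis_expansion[of w] by (simp add: scalar_mult_eq_scaleR)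
    then have "kf v w = kf v (\<Sum>i\<in>UNIV. w $ i *\<^sub>R axis i 1)" by simp
    then show ?thesis
      by (simp add: linear_sum[OF kf_linear_right] linear_scale[OF kf_linear_right] Km_def inner_vec_def mult.commute)
  qed
  have lin: "linear Km"
    by (rule linearI) (simp_all add: Km_def vec_eq_iff linear_add[OF kf_linear_left] linear_scale[OF kf_linear_left])
  have "inj Km"
    unfolding linear_injective_0[OF lin] using Km kf_nondegenerate by (metis inner_zero_left)
  then obtain \<kappa> where \<kappa>: "linear \<kappa>" "\<And>v. Km (\<kappa> v) = v"
    using linear_injective_isomorphism[OF lin] by blast
  obtain C where "C > 0" "\<And>e. norm (\<kappa> e) \<le> C * norm e" using linear_bounded_pos[OF \<kappa>(1)] by blast
  moreover have "kf (\<kappa> e) w = e \<bullet> w" for e w using Km \<kappa>(2) by simp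
  ultimately show ?thesis by (rule that[OF \<kappa>(1)])
qed

text \<open>The constants do not depend on \<open>g\<close>: this is where nondegeneracy of the Killing form on the
  (-1)-eigenspace of \<open>\<theta>\<close> makes up for \<open>Ad g\<close> being unbounded.\<close>

lemma adapted_frame:
  obtains f :: "'m \<Rightarrow> real^'n" and C c1 where "0 < C" "0 < c1"
    "\<And>k. \<theta> (f k) = - f k"
    "\<And>u l. kf u (f l) = (\<Sum>k\<in>UNIV. P u $ k * kf (f k) (f l))"
    "det (\<chi> k l. kf (f k) (f l)) \<noteq> 0"
    "\<And>g. g \<in> carrier G \<Longrightarrow> \<exists>(e :: 'm \<Rightarrow> real^'n) (v :: 'm \<Rightarrow> real^'n) (M :: real^'m^'m).
      (\<forall>i. norm (e i) = 1) \<and> (\<forall>i. norm (v i) \<le> C) \<and> (\<forall>i j. kf (v i) (e j) = (if i = j then 1 else 0)) \<and>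
      (\<forall>k. Ad g (f k) = (\<Sum>i\<in>UNIV. M $ k $ i *\<^sub>R e i)) \<and> c1 \<le> \<bar>det M\<bar> \<and>
      (\<forall>i. \<exists>w. \<theta> w = - w \<and> e i = Ad g w)"
proof -
  obtain f :: "'m \<Rightarrow> real^'n" where f: "\<And>k. \<theta> (f k) = - f k" "\<And>k. P (f k) = axis k 1"
    "\<And>u l. kf u (f l) = (\<Sum>k\<in>UNIV. P u $ k * kf (f k) (f l))"
    "det (\<chi> k l. kf (f k) (f l)) \<noteq> 0" by (rule minus_eigenbasis) (rule that)
  obtain \<kappa> C where \<kappa>: "linear \<kappa>" "0 < C" "\<And>e. norm (\<kappa> e) \<le> C * norm e" "\<And>e w. kf (\<kappa> e) w = e \<bullet> w"
    by (rule kf_dual) (rule that)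
  obtain K where K: "K > 0" "\<And>u v. \<bar>kf u v\<bar> \<le> K * norm u * norm v" using kf_bounded by blast
  define D where "D = \<bar>det (\<chi> k l. kf (f k) (f l))\<bar>"
  define C1 where "C1 = fact CARD('m) * K ^ CARD('m)"
  have D: "D > 0" using f(4) by (simp add: D_def)
  have C1: "C1 > 0" using K by (simp add: C1_def)
  \<comment> \<open>The constant comes from
    \<open>D = (\<bar>det M\<bar>)\<^sup>2 * \<bar>det Ke\<bar>\<close> and
    \<open>\<bar>det Ke\<bar> \<le> C1\<close>, the Leibniz bound for the Gram matrix of unit
    vectors.\<close>
  define c1 where "c1 = sqrt (D / C1)"
  have c1: "c1 > 0" using D C1 by (simp add: c1_def)
  have "\<exists>(e :: 'm \<Rightarrow> real^'n) (v :: 'm \<Rightarrow> real^'n) (M :: real^'m^'m).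
      (\<forall>i. norm (e i) = 1) \<and> (\<forall>i. norm (v i) \<le> C) \<and> (\<forall>i j. kf (v i) (e j) = (if i = j then 1 else 0)) \<and>
      (\<forall>k. Ad g (f k) = (\<Sum>i\<in>UNIV. M $ k $ i *\<^sub>R e i)) \<and> c1 \<le> \<bar>det M\<bar> \<and>
      (\<forall>i. \<exists>w. \<theta> w = - w \<and> e i = Ad g w)" if g: "g \<in> carrier G" for g
  proof -
    \<comment> \<open>Parametrizes \<open>Ad g\<close> applied to the span of the
      \<open>f k\<close>. It is injective because \<open>P\<close> after \<open>Ad (inv g)\<close>
      recovers the coordinates, so an orthonormal basis of its range can be indexed by
      \<open>'m\<close>.\<close>
    define J where "J = (\<lambda>c :: real^'m. Ad g (\<Sum>k\<in>UNIV. c $ k *\<^sub>R f k))"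
    have linf: "linear (\<lambda>c :: real^'m. \<Sum>k\<in>UNIV. c $ k *\<^sub>R f k)"
      by (rule linearI) (simp_all add: scaleR_add_left sum.distrib scaleR_sum_right)
    have linJ: "linear J" unfolding J_def using linear_compose[OF linf Ad_linear[OF g]] by (simp add: comp_def)
    have "P (Ad (inv g) (J c)) = c" for c
      using basis_expansion[of c]
      by (simp add: J_def Ad_inv[OF g] linear_sum[OF P_linear] linear_scale[OF P_linear] f(2) scalar_mult_eq_scaleR)
    then have injJ: "inj J" by (metis injI)
    have dimJ: "dim (range J) = CARD('m)" using dim_image_eq[OF linJ, of UNIV] injJ by simp
    have "subspace (range J)" using linJ by (simp add: linear_subspace_image)
    then obtain Bs where Bs: "Bs \<subseteq> range J" "pairwise orthogonal Bs" "\<And>x. x \<in> Bs \<Longrightarrow> norm x = 1"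
      "independent Bs" "card Bs = dim (range J)" "span Bs = range J"
      using orthonormal_basis_subspace by metis
    have finB: "finite Bs" using Bs(4) independent_imp_finite by blast
    obtain e :: "'m \<Rightarrow> real^'n" where e: "bij_betw e UNIV Bs"
      using finite_same_card_bij[of "UNIV :: 'm set" Bs] finB Bs(5) dimJ by auto
    have eB: "e i \<in> Bs" for i using e by (auto simp: bij_betw_def)
    have e1: "norm (e i) = 1" for i using Bs(3) eB by blast
    have eo: "e i \<bullet> e j = (if i = j then 1 else 0)" for i j
    proof (cases "i = j")
      case True then show ?thesis using e1[of j] by (simp add: norm_eq_1)
    next
      case False
      then have "e i \<noteq> e j" using e by (auto simp: bij_betw_def inj_on_def)
      then show ?thesis using Bs(2) eB False by (auto simp: pairwise_def orthogonal_def)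
    qed
    define M where "M = (\<chi> k i. Ad g (f k) \<bullet> e i)"
    have AM: "Ad g (f k) = (\<Sum>i\<in>UNIV. M $ k $ i *\<^sub>R e i)" for k
    proof -
      have "J (axis k 1) = Ad g (f k)"
        by (simp add: J_def axis_nth_eq if_distrib[of "\<lambda>r. r *\<^sub>R _"] cong: if_cong)
      then have "Ad g (f k) \<in> span Bs" using Bs(6) by (metis rangeI)
      then have "(\<Sum>b\<in>Bs. (Ad g (f k) \<bullet> b) *\<^sub>R b) = Ad g (f k)"
        using orthonormal_basis_expand[OF Bs(2,3) _ finB] by blast
      moreover have "(\<Sum>b\<in>Bs. (Ad g (f k) \<bullet> b) *\<^sub>R b) = (\<Sum>i\<in>UNIV. (Ad g (f k) \<bullet> e i) *\<^sub>R e i)"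
        using sum.reindex_bij_betw[OF e, of "\<lambda>b. (Ad g (f k) \<bullet> b) *\<^sub>R b"] by simp
      ultimately show ?thesis by (simp add: M_def)
    qed
    define Ke where "Ke = (\<chi> i j. kf (e i) (e j))"
    have "(\<chi> k l. kf (f k) (f l)) = M ** Ke ** transpose M"
    proof -
      have "kf (f k) (f l) = (\<Sum>j\<in>UNIV. (\<Sum>i\<in>UNIV. M $ k $ i * kf (e i) (e j)) * M $ l $ j)" for k l
      proof -
        have "kf (f k) (f l) = kf (\<Sum>i\<in>UNIV. M $ k $ i *\<^sub>R e i) (\<Sum>j\<in>UNIV. M $ l $ j *\<^sub>R e j)"
          using kf_Ad[OF g, of "f k" "f l"] AM by simp
        also have "\<dots> = (\<Sum>j\<in>UNIV. M $ l $ j * (\<Sum>i\<in>UNIV. M $ k $ i * kf (e i) (e j)))"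
          by (simp add: linear_sum[OF kf_linear_right] linear_scale[OF kf_linear_right]
            linear_sum[OF kf_linear_left] linear_scale[OF kf_linear_left])
        finally show ?thesis by (simp add: mult.commute)
      qed
      then show ?thesis by (simp add: vec_eq_iff matrix_matrix_mult_def transpose_def Ke_def)
    qed
    then have "det (\<chi> k l. kf (f k) (f l)) = det M * det Ke * det M" by (simp add: det_mul)
    then have Deq: "D = (\<bar>det M\<bar>)\<^sup>2 * \<bar>det Ke\<bar>" by (simp add: D_def abs_mult power2_eq_square)
    have "\<bar>det Ke\<bar> \<le> C1"
      unfolding C1_def by (rule det_bound) (use K(1) K(2)[of "e _" "e _"] e1 in \<open>auto simp: Ke_def\<close>)
    then have "D \<le> (\<bar>det M\<bar>)\<^sup>2 * C1" unfolding Deq by (intro mult_left_mono) auto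
    then have "D / C1 \<le> (\<bar>det M\<bar>)\<^sup>2" using C1 by (simp add: pos_divide_le_eq)
    then have "c1 \<le> \<bar>det M\<bar>" unfolding c1_def by (simp add: real_le_lsqrt D C1 less_imp_le)
    moreover have "\<exists>w. \<theta> w = - w \<and> e i = Ad g w" for i
    proof -
      obtain c where "e i = J c" using Bs(1) eB by blast
      then show ?thesis
        by (intro exI[of _ "\<Sum>k\<in>UNIV. c $ k *\<^sub>R f k"])
          (simp add: J_def linear_sum[OF \<theta>_linear] linear_scale[OF \<theta>_linear] f(1) sum_negf)
    qed
    moreover have "norm (\<kappa> (e i)) \<le> C" for i using \<kappa>(3)[of "e i"] e1 by simp
    ultimately show ?thesis
      using e1 AM \<kappa>(4) eo by (intro exI[of _ e] exI[of _ "\<lambda>i. \<kappa> (e i)"] exI[of _ M]) auto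
  qed
  then show ?thesis by (rule that[OF \<kappa>(2) c1 f(1,3,4)])
qed

end

section \<open>Change of variables over arbitrary finite index types\<close>

text \<open>The library states the change of variables formula for well-ordered finite index types only.  The
  following copy of a finite type carries a well-order.\<close>

typedef 'a wo = "UNIV :: 'a set" by auto

lemma bij_Rep_wo: "bij (Rep_wo :: 'a wo \<Rightarrow> 'a)"
  by (metis Abs_wo_inverse Rep_wo_inverse UNIV_I bijI')

lemma Rep_Abs_wo [simp]: "Rep_wo (Abs_wo x) = x" by (simp add: Abs_wo_inverse)

instance wo :: (finite) finite
  by standard (rule finite_imageD[OF _ bij_is_inj[OF bij_Rep_wo]], simp)

instantiation wo :: (finite) wellorder
begin

definition "x \<le> y \<longleftrightarrow> to_nat (Rep_wo x) \<le> to_nat (Rep_wo y)"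
definition "x < y \<longleftrightarrow> to_nat (Rep_wo x) < to_nat (Rep_wo y)"

instance
proof
  fix Q :: "'a wo \<Rightarrow> bool" and a
  assume *: "\<And>x. (\<And>y. y < x \<Longrightarrow> Q y) \<Longrightarrow> Q x"
  show "Q a"
    by (rule measure_induct_rule[of "\<lambda>x. to_nat (Rep_wo x)" Q, OF *[unfolded less_wo_def]])
qed (auto simp: less_eq_wo_def less_wo_def Rep_wo_inject)

end

definition to_wo :: "real^'m \<Rightarrow> real^('m wo)" where "to_wo x = (\<chi> i. x $ Rep_wo i)"
definition of_wo :: "real^('m wo) \<Rightarrow> real^'m" where "of_wo x = (\<chi> i. x $ Abs_wo i)"

lemma to_of_wo [simp]: "to_wo (of_wo x) = x" "of_wo (to_wo y) = y"
  by (simp_all add: to_wo_def of_wo_def vec_eq_iff Rep_wo_inverse)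

lemma bounded_linear_to_wo: "bounded_linear (to_wo :: real^'m \<Rightarrow> _)"
  unfolding linear_conv_bounded_linear[symmetric] by (rule linearI) (simp_all add: to_wo_def vec_eq_iff)

lemma bounded_linear_of_wo: "bounded_linear (of_wo :: _ \<Rightarrow> real^'m)"
  unfolding linear_conv_bounded_linear[symmetric] by (rule linearI) (simp_all add: of_wo_def vec_eq_iff)

lemma prod_Rep_wo: "(\<Prod>i\<in>UNIV. g (Rep_wo i)) = (\<Prod>i\<in>(UNIV::'m::finite set). g i)"
  by (rule prod.reindex_bij_betw[OF bij_Rep_wo])

lemma prod_Basis_cart: "(\<Prod>b\<in>Basis. (x :: real^'m) \<bullet> b) = (\<Prod>i\<in>UNIV. x $ i)"
proof -
  have "(\<Prod>b\<in>range (\<lambda>i::'m. axis i (1::real)). x \<bullet> b) = (\<Prod>i\<in>UNIV. x \<bullet> axis i 1)"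
    by (subst prod.reindex) (auto simp: inj_on_def axis_eq_axis)
  moreover have "(Basis :: (real^'m) set) = range (\<lambda>i. axis i 1)" by (auto simp: Basis_vec_def)
  ultimately show ?thesis by (simp add: inner_axis)
qed

lemma distr_of_wo: "distr lborel borel of_wo = (lborel :: (real^'m) measure)"
proof (rule lborel_eqI[symmetric])
  have m: "of_wo \<in> borel_measurable borel"
    using bounded_linear.linear bounded_linear_of_wo linear_continuous_on borel_measurable_continuous_onI by blast
  fix l u :: "real^'m" assume "\<And>b. b \<in> Basis \<Longrightarrow> l \<bullet> b \<le> u \<bullet> b"
  then have lu: "l $ i \<le> u $ i" for i using axis_in_Basis_iff[of i "1::real"] by (fastforce simp: inner_axis)
  have "of_wo -` box l u = box (to_wo l) (to_wo u)"
  proof (rule Set.set_eqI)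
    fix x :: "real^('m wo)"
    have "(\<forall>i. l $ i < x $ Abs_wo i \<and> x $ Abs_wo i < u $ i) \<longleftrightarrow> (\<forall>i. l $ Rep_wo i < x $ i \<and> x $ i < u $ Rep_wo i)"
      by (metis Rep_Abs_wo Rep_wo_inverse)
    then show "x \<in> of_wo -` box l u \<longleftrightarrow> x \<in> box (to_wo l) (to_wo u)"
      by (simp add: mem_box_cart of_wo_def to_wo_def)
  qed
  then have "emeasure (distr lborel borel of_wo) (box l u) = emeasure lborel (box (to_wo l) (to_wo u))"
    using m by (subst emeasure_distr) auto
  also have "\<dots> = ennreal (\<Prod>b\<in>Basis. (to_wo u - to_wo l) \<bullet> b)"
    by (rule emeasure_lborel_box) (auto simp: Basis_vec_def inner_axis to_wo_def lu)
  also have "(\<Prod>b\<in>Basis. (to_wo u - to_wo l) \<bullet> b) = (\<Prod>b\<in>Basis. (u - l) \<bullet> b)"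
    using prod_Rep_wo[of "\<lambda>i. u $ i - l $ i"] by (simp only: prod_Basis_cart) (simp add: to_wo_def)
  finally show "emeasure (distr lborel borel of_wo) (box l u) = (\<Prod>b\<in>Basis. (u - l) \<bullet> b)" .
qed simp

lemma emeasure_to_wo:
  assumes "S \<in> sets borel" shows "to_wo ` S \<in> sets borel" "emeasure lborel (to_wo ` S) = emeasure lborel (S :: (real^'m) set)"
proof -
  have m: "of_wo \<in> borel_measurable (borel :: (real^('m wo)) measure)"
    using bounded_linear.linear bounded_linear_of_wo linear_continuous_on borel_measurable_continuous_onI by blast
  have e: "to_wo ` S = of_wo -` S" by (force intro: image_eqI[of _ _ "of_wo _"])
  show "to_wo ` S \<in> sets borel" unfolding e using measurable_sets[OF m assms] by simp
  have "emeasure lborel S = emeasure (distr lborel borel of_wo) S" by (simp add: distr_of_wo)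
  also have "\<dots> = emeasure lborel (of_wo -` S)" using m assms by (subst emeasure_distr) auto
  finally show "emeasure lborel (to_wo ` S) = emeasure lborel S" by (simp add: e)
qed

text \<open>Conjugation with the bijection of index types matches the permutations and preserves
  their signs.\<close>

lemma det_reindex_wo: "det (\<chi> i j. X $ Rep_wo i $ Rep_wo j) = det (X :: real^'m^'m)"
  unfolding det_def
proof (rule sum.reindex_bij_witness[where i = "map_permutation UNIV Abs_wo" and j = "map_permutation UNIV Rep_wo"])
  have bA: "bij (Abs_wo :: 'm \<Rightarrow> 'm wo)" by (metis Rep_Abs_wo Rep_wo_inverse bijI')
  have iA: "inj (Abs_wo :: 'm \<Rightarrow> 'm wo)" and iR: "inj (Rep_wo :: 'm wo \<Rightarrow> 'm)" using bA bij_Rep_wo bij_is_inj by auto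
  fix p assume p: "p \<in> {p. p permutes (UNIV :: 'm wo set)}"
  then have p': "p permutes UNIV" by simp
  show "map_permutation UNIV Abs_wo (map_permutation UNIV Rep_wo p) = p"
    by (rule map_permutation_compose_inv[OF bij_Rep_wo p']) (simp add: Rep_wo_inverse)
  show "map_permutation UNIV Rep_wo p \<in> {p. p permutes UNIV}"
    using map_permutation_permutes[OF bij_Rep_wo p'] by simp
  have s: "sign (map_permutation UNIV Rep_wo p) = sign p"
    by (rule sign_map_permutation[OF iR p']) simp
  have "(\<Prod>i\<in>UNIV. X $ i $ map_permutation UNIV Rep_wo p i)
      = (\<Prod>i\<in>UNIV. X $ Rep_wo i $ map_permutation UNIV Rep_wo p (Rep_wo i))"
    by (rule prod_Rep_wo[symmetric])
  also have "\<dots> = (\<Prod>i\<in>UNIV. X $ Rep_wo i $ Rep_wo (p i))"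
    by (simp add: map_permutation_apply[OF iR])
  finally show "of_int (sign (map_permutation UNIV Rep_wo p)) * (\<Prod>i\<in>UNIV. X $ i $ map_permutation UNIV Rep_wo p i)
      = of_int (sign p) * (\<Prod>i\<in>UNIV. (\<chi> i j. X $ Rep_wo i $ Rep_wo j) $ i $ p i)"
    by (simp add: s)
next
  have bA: "bij (Abs_wo :: 'm \<Rightarrow> 'm wo)" by (metis Rep_Abs_wo Rep_wo_inverse bijI')
  fix p assume p: "p \<in> {p. p permutes (UNIV :: 'm set)}"
  then have p': "p permutes UNIV" by simp
  show "map_permutation UNIV Rep_wo (map_permutation UNIV Abs_wo p) = p"
    by (rule map_permutation_compose_inv[OF bA p']) simp
  show "map_permutation UNIV Abs_wo p \<in> {p. p permutes UNIV}"
    using map_permutation_permutes[OF bA p'] by simp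
qed

lemma measure_le_of_det_wo:
  fixes q :: "real^'k::{finite,wellorder} \<Rightarrow> real^'k::_"
  assumes S: "S \<in> lmeasurable" and d: "\<And>x. x \<in> S \<Longrightarrow> (q has_derivative q' x) (at x within S)"
    and inj: "inj_on q S" and det: "\<And>x. x \<in> S \<Longrightarrow> c \<le> \<bar>det (matrix (q' x))\<bar>"
    and im: "q ` S \<subseteq> D" "D \<in> lmeasurable"
  shows "c * measure lebesgue S \<le> measure lebesgue D"
proof -
  have SL: "S \<in> sets lebesgue" using S by auto
  have "q differentiable_on S" using d by (auto simp: differentiable_on_def differentiable_def)
  then have "q ` S \<in> sets lebesgue"
    by (intro differentiable_image_in_sets_lebesgue[OF SL]) auto
  then have qS: "q ` S \<in> lmeasurable" using im lmeasurable_iff_integrable_on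
    by (metis fmeasurableI2)
  then have I: "(\<lambda>x. \<bar>det (matrix (q' x))\<bar>) integrable_on S"
    using measurable_differentiable_image_eq[OF SL d inj] by simp
  have "c * measure lebesgue S = integral S (\<lambda>x. c)" using integral_mult_right[of S c "\<lambda>x. 1"] lmeasure_integral[OF S] by simp
  also have "\<dots> \<le> integral S (\<lambda>x. \<bar>det (matrix (q' x))\<bar>)"
    by (rule integral_le[OF _ I]) (use det S integrable_on_const in auto)
  also have "\<dots> = measure lebesgue (q ` S)" by (rule measure_differentiable_image_eq[OF SL d inj I, symmetric])
  also have "\<dots> \<le> measure lebesgue D" by (rule measure_mono_fmeasurable) (use im qS in auto)
  finally show ?thesis .
qed

lemma emeasure_le_of_det:
  fixes q :: "real^'m \<Rightarrow> real^'m"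
  assumes S: "S \<in> sets borel" "bounded S" and d: "\<And>x. x \<in> S \<Longrightarrow> (q has_derivative q' x) (at x)"
    and inj: "inj_on q S" and det: "\<And>x. x \<in> S \<Longrightarrow> c \<le> \<bar>det (matrix (q' x))\<bar>" and c: "0 \<le> c"
    and im: "q ` S \<subseteq> D" "D \<in> sets borel" "bounded D"
  shows "ennreal c * emeasure lborel S \<le> emeasure lborel D"
proof -
  define q2 where "q2 = (\<lambda>x. to_wo (q (of_wo x)))"
  define q2' where "q2' = (\<lambda>x v. to_wo (q' (of_wo x) (of_wo v)))"
  have bb: "bounded (to_wo ` E)" if "bounded E" for E :: "(real^'m) set"
    using bounded_linear_image[OF that bounded_linear_to_wo] .
  have lm: "to_wo ` E \<in> lmeasurable" "measure lebesgue (to_wo ` E) = measure lborel E" if "E \<in> sets borel" "bounded E" for E :: "(real^'m) set"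
    using bounded_set_imp_lmeasurable[OF bb[OF that(2)]] emeasure_to_wo[OF that(1)]
    by (auto simp: measure_def measure_completion)
  have "c * measure lebesgue (to_wo ` S) \<le> measure lebesgue (to_wo ` D)"
  proof (rule measure_le_of_det_wo[where q = q2 and q' = q2'])
    show "to_wo ` S \<in> lmeasurable" "to_wo ` D \<in> lmeasurable" using lm S im by auto
    show "q2 ` to_wo ` S \<subseteq> to_wo ` D" using im(1) by (auto simp: q2_def)
    show "inj_on q2 (to_wo ` S)"
      using inj by (auto simp: inj_on_def q2_def) (metis to_of_wo(2))
    fix x assume "x \<in> to_wo ` S"
    then have x: "of_wo x \<in> S" by auto
    have "(q2 has_derivative q2' x) (at x)"
      unfolding q2_def q2'_def
      by (rule bounded_linear.has_derivative[OF bounded_linear_to_wo],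
        rule has_derivative_compose[OF bounded_linear_imp_has_derivative[OF bounded_linear_of_wo] d[OF x]])
    then show "(q2 has_derivative q2' x) (at x within to_wo ` S)" by (rule has_derivative_at_withinI)
    have "matrix (q2' x) = (\<chi> i j. matrix (q' (of_wo x)) $ Rep_wo i $ Rep_wo j)"
    proof -
      have ax: "of_wo (axis j 1) = axis (Rep_wo j) (1::real)" for j :: "'m wo"
        unfolding of_wo_def axis_def vec_eq_iff by simp (metis Rep_Abs_wo Rep_wo_inverse)
      show ?thesis unfolding matrix_def q2'_def ax by (simp add: vec_eq_iff to_wo_def)
    qed
    then show "c \<le> \<bar>det (matrix (q2' x))\<bar>" using det[OF x] by (simp add: det_reindex_wo)
  qed
  then have "c * measure lborel S \<le> measure lborel D" using lm S im by simp
  moreover have "emeasure lborel E = ennreal (measure lborel E)" if "bounded E" for E :: "(real^'m) set"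
    using emeasure_bounded_finite[OF that] by (intro emeasure_eq_ennreal_measure) auto
  ultimately show ?thesis using S(2) im(3) c by (simp add: ennreal_mult[symmetric] ennreal_leI)
qed

section \<open>Strict differentiability with a parameter\<close>

lemma has_derivative_close_to_linear:
  fixes f :: "'a::euclidean_space \<Rightarrow> 'b::real_normed_vector"
  assumes E: "(f has_derivative E) (at x)" and D: "linear D" and S: "open S" "x \<in> S"
    and b: "\<And>y. y \<in> S \<Longrightarrow> norm (f y - f x - D (y - x)) \<le> e * norm (y - x)"
  shows "norm (E v - D v) \<le> e * norm v"
proof (cases "v = 0")
  case True
  then show ?thesis using linear_0[OF has_derivative_linear[OF E]] linear_0[OF D] by simp
next
  case False
  then have v: "norm v > 0" by simp
  have lE: "linear E" using has_derivative_linear[OF E] .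
  show ?thesis
  proof (rule field_le_epsilon)
    fix \<eta> :: real assume "0 < \<eta>"
    then have \<eta>: "\<eta> / norm v > 0" using v by simp
    obtain d where d: "d > 0" "\<And>y. norm (y - x) < d \<Longrightarrow> norm (f y - f x - E (y - x)) \<le> \<eta> / norm v * norm (y - x)"
      using E \<eta> unfolding has_derivative_at_alt by blast
    obtain d' where d': "d' > 0" "ball x d' \<subseteq> S" using S open_contains_ball by blast
    define t where "t = min d d' / (2 * norm v)"
    have t: "t > 0" "t * norm v < d" "t * norm v < d'" using d d' v by (auto simp: t_def)
    let ?y = "x + t *\<^sub>R v"
    have "?y \<in> S" using d'(2) t by (auto simp: dist_norm subset_iff)
    then have 1: "norm (f ?y - f x - t *\<^sub>R D v) \<le> e * (t * norm v)"
      using b[of ?y] t by (simp add: linear_scale[OF D])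
    have 2: "norm (f ?y - f x - t *\<^sub>R E v) \<le> \<eta> / norm v * (t * norm v)"
      using d(2)[of ?y] t by (simp add: linear_scale[OF lE])
    have "t *\<^sub>R (E v - D v) = (f ?y - f x - t *\<^sub>R D v) - (f ?y - f x - t *\<^sub>R E v)"
      by (simp add: algebra_simps)
    then have "norm (t *\<^sub>R (E v - D v)) = norm ((f ?y - f x - t *\<^sub>R D v) - (f ?y - f x - t *\<^sub>R E v))" by (rule arg_cong)
    then have "norm (t *\<^sub>R (E v - D v)) \<le> e * (t * norm v) + \<eta> / norm v * (t * norm v)"
      using norm_triangle_ineq4[of "f ?y - f x - t *\<^sub>R D v" "f ?y - f x - t *\<^sub>R E v"] 1 2 by linarith
    then have "t * norm (E v - D v) \<le> e * (t * norm v) + \<eta> / norm v * (t * norm v)" using t(1) by simp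
    also have "\<dots> = t * (e * norm v + \<eta>)" using v by (simp add: field_simps)
    finally have "t * norm (E v - D v) \<le> t * (e * norm v + \<eta>)" .
    then show "norm (E v - D v) \<le> e * norm v + \<eta>" using t(1) by simp
  qed
qed

text \<open>Strict differentiability of \<open>F\<close> in both variables at
  \<open>(z0, w0)\<close>, restricted to increments in the first one. The estimates hold uniformly
  in the parameter \<open>w\<close>, and the derivatives at nearby points inherit them as limits of
  difference quotients.\<close>

lemma smooth_on_partial_strict:
  fixes F :: "'a::euclidean_space \<times> 'b::euclidean_space \<Rightarrow> 'c::real_normed_vector"
  assumes S: "open S" "smooth_on S F" "(z0, w0) \<in> S" and e: "0 < e"
    and D: "((\<lambda>z. F (z, w0)) has_derivative D) (at z0)"
  obtains d where "0 < d" "ball z0 d \<times> ball w0 d \<subseteq> S"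
    "\<And>z z' w. z \<in> ball z0 d \<Longrightarrow> z' \<in> ball z0 d \<Longrightarrow> w \<in> ball w0 d \<Longrightarrow>
      norm (F (z, w) - F (z', w) - D (z - z')) \<le> e * norm (z - z')"
    "\<And>z w. z \<in> ball z0 d \<Longrightarrow> w \<in> ball w0 d \<Longrightarrow>
      \<exists>E. ((\<lambda>z. F (z, w)) has_derivative E) (at z) \<and> (\<forall>v. norm (E v - D v) \<le> e * norm v)"
proof -
  obtain d where d: "0 < d" "ball (z0, w0) d \<subseteq> S"
    "\<And>z z'. z \<in> ball (z0, w0) d \<Longrightarrow> z' \<in> ball (z0, w0) d \<Longrightarrow>
      norm (F z - F z' - frechet_derivative F (at (z0, w0)) (z - z')) \<le> e * norm (z - z')"
    by (rule smooth_on_strict_derivative[OF S e]) (rule that)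
  have dP: "((\<lambda>z. F (z, w)) has_derivative (\<lambda>v. frechet_derivative F (at (z, w)) (v, 0))) (at z)" if "(z, w) \<in> S" for z w
  proof -
    have "((\<lambda>z. (z, w)) has_derivative (\<lambda>v. (v, 0))) (at z)" by (auto intro!: derivative_eq_intros)
    from has_derivative_compose[OF this smooth_on_has_derivative[OF S(2) that]] show ?thesis .
  qed
  have D_eq: "frechet_derivative F (at (z0, w0)) (v, 0) = D v" for v
    by (rule fun_cong[OF has_derivative_unique[OF dP[OF S(3)] D]])
  have lD: "linear D" using has_derivative_linear[OF D] .
  \<comment> \<open>The radius is halved so that a product of two balls fits into the ball of the
    product space.\<close>
  have b: "(z, w) \<in> ball (z0, w0) d" if "z \<in> ball z0 (d / 2)" "w \<in> ball w0 (d / 2)" for z w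
  proof -
    have "dist (z0, w0) (z, w) \<le> dist z0 z + dist w0 w"
      unfolding dist_Pair_Pair by (rule sqrt_sum_squares_le_sum) auto
    then show ?thesis using that by simp
  qed
  have st: "norm (F (z, w) - F (z', w) - D (z - z')) \<le> e * norm (z - z')"
    if "z \<in> ball z0 (d / 2)" "z' \<in> ball z0 (d / 2)" "w \<in> ball w0 (d / 2)" for z z' w
    using d(3)[OF b[OF that(1,3)] b[OF that(2,3)]] by (simp add: D_eq norm_Pair)
  show ?thesis
  proof (rule that[of "d / 2"])
    show "0 < d / 2" using d by simp
    show "ball z0 (d / 2) \<times> ball w0 (d / 2) \<subseteq> S" using b d(2) by blast
    fix z w assume z: "z \<in> ball z0 (d / 2)" and w: "w \<in> ball w0 (d / 2)"
    then have zS: "(z, w) \<in> S" using b d(2) by blast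
    show "\<exists>E. ((\<lambda>z. F (z, w)) has_derivative E) (at z) \<and> (\<forall>v. norm (E v - D v) \<le> e * norm v)"
    proof (intro exI conjI allI)
      show "((\<lambda>z. F (z, w)) has_derivative (\<lambda>v. frechet_derivative F (at (z, w)) (v, 0))) (at z)" by (rule dP[OF zS])
      show "norm (frechet_derivative F (at (z, w)) (v, 0) - D v) \<le> e * norm v" for v
        by (rule has_derivative_close_to_linear[OF dP[OF zS] lD open_ball z]) (rule st[OF _ z w])
    qed
  qed (rule st)
qed

section \<open>Time spent by orbits in open sets\<close>

context homspace
begin

text \<open>Fubini turns invariance of \<open>\<mu>\<close> into a comparison of \<open>\<mu>(O)\<close> with the time which orbits
  spend in \<open>O\<close>.\<close>

lemma orbit_time:
  fixes \<beta> :: "'b::euclidean_space \<Rightarrow> 'a"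
  assumes X: "open X" and \<beta>: "continuous_map (top_of_set X) T \<beta>" and S: "openin Y S"
  shows "(\<integral>\<^sup>+ y. emeasure lborel {t \<in> X. \<beta> t <# y \<in> S} \<partial>\<mu>) = emeasure lborel X * emeasure \<mu> S"
    and "y \<in> lcosets H \<Longrightarrow> open {t \<in> X. \<beta> t <# y \<in> S}"
proof -
  have Xs: "X \<in> sets borel" using X by simp
  have bc: "\<beta> t \<in> carrier G" if "t \<in> X" for t using \<beta> that by (auto simp: continuous_map_def)
  show o: "open {t \<in> X. \<beta> t <# y \<in> S}" if y: "y \<in> lcosets H" for y
  proof -
    have "continuous_map (top_of_set X) (prod_topology T Y) (\<lambda>t. (\<beta> t, y))"
      using \<beta> y by (simp add: continuous_map_paired)
    from continuous_map_compose[OF this continuous_act]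
    have "continuous_map (top_of_set X) Y (\<lambda>t. \<beta> t <# y)" by (simp add: o_def)
    from openin_continuous_map_preimage[OF this S]
    have "openin (top_of_set X) {t \<in> X. \<beta> t <# y \<in> S}" by simp
    then show ?thesis using X openin_open_trans by blast
  qed
  let ?R = "restrict_space lborel X"
  have spR: "space ?R = X" by (simp add: space_restrict_space)
  interpret mu: sigma_finite_measure \<mu> by (rule sigma_finite)
  interpret R: sigma_finite_measure ?R
    by (rule sigma_finite_measure_restrict_space) (use Xs in \<open>auto intro: sigma_finite_lborel\<close>)
  interpret P: pair_sigma_finite ?R \<mu> ..
  define F where "F = (\<lambda>z. indicator S (\<beta> (fst z) <# snd z) :: ennreal)"
  have Fm: "F \<in> borel_measurable (?R \<Otimes>\<^sub>M \<mu>)"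
  proof -
    have "indicator S \<in> borel_measurable \<mu>" using open_in_sets[OF S] by simp
    from measurable_compose[OF measurable_act[OF Xs \<beta>] this] show ?thesis
      by (simp add: F_def case_prod_beta')
  qed
  have "(\<integral>\<^sup>+ y. emeasure lborel {t \<in> X. \<beta> t <# y \<in> S} \<partial>\<mu>) = (\<integral>\<^sup>+ y. (\<integral>\<^sup>+ t. F (t, y) \<partial>?R) \<partial>\<mu>)"
  proof (rule nn_integral_cong)
    fix y assume "y \<in> space \<mu>"
    then have y: "open {t \<in> X. \<beta> t <# y \<in> S}" using o by (simp add: space_mu)
    have "(\<integral>\<^sup>+ t. F (t, y) \<partial>?R) = (\<integral>\<^sup>+ t. indicator {t \<in> X. \<beta> t <# y \<in> S} t \<partial>?R)"
      by (rule nn_integral_cong) (auto simp: F_def spR indicator_def)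
    also have "\<dots> = emeasure ?R {t \<in> X. \<beta> t <# y \<in> S}"
      by (rule nn_integral_indicator) (use y in \<open>auto simp: sets_restrict_space image_iff intro!: bexI[of _ "{t \<in> X. \<beta> t <# y \<in> S}"]\<close>)
    also have "\<dots> = emeasure lborel {t \<in> X. \<beta> t <# y \<in> S}"
      by (rule emeasure_restrict_space) (use Xs in auto)
    finally show "emeasure lborel {t \<in> X. \<beta> t <# y \<in> S} = (\<integral>\<^sup>+ t. F (t, y) \<partial>?R)" by simp
  qed
  also have "\<dots> = (\<integral>\<^sup>+ t. (\<integral>\<^sup>+ y. F (t, y) \<partial>\<mu>) \<partial>?R)" by (rule P.Fubini[OF Fm])
  \<comment> \<open>For fixed \<open>t\<close> the set of \<open>y\<close> with
    \<open>\<beta> t <# y\<close> in \<open>S\<close> is the translate of \<open>S\<close> by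
    \<open>inv (\<beta> t)\<close>, so its measure does not depend on \<open>t\<close>.\<close>
  also have "\<dots> = (\<integral>\<^sup>+ t. emeasure \<mu> S \<partial>?R)"
  proof (rule nn_integral_cong)
    fix t assume "t \<in> space ?R"
    then have b: "\<beta> t \<in> carrier G" using bc by (simp add: spR)
    have sl: "S \<subseteq> lcosets H" using openin_subset[OF S] by simp
    have st: "(\<lambda>y. inv (\<beta> t) <# y) ` S \<in> sets \<mu>" using act_in_sets b open_in_sets[OF S] by simp
    have im: "(\<lambda>y. inv (\<beta> t) <# y) ` S = (\<lambda>y. \<beta> t <# y) -` S \<inter> lcosets H"
      using act_image_eq[of "inv (\<beta> t)" S] b sl by simp
    have "(\<integral>\<^sup>+ y. F (t, y) \<partial>\<mu>) = (\<integral>\<^sup>+ y. indicator ((\<lambda>y. inv (\<beta> t) <# y) ` S) y \<partial>\<mu>)"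
      by (rule nn_integral_cong) (auto simp: F_def im space_mu indicator_def)
    also have "\<dots> = emeasure \<mu> ((\<lambda>y. inv (\<beta> t) <# y) ` S)" by (rule nn_integral_indicator[OF st])
    also have "\<dots> = emeasure \<mu> S" using mu_inv b open_in_sets[OF S] by simp
    finally show "(\<integral>\<^sup>+ y. F (t, y) \<partial>\<mu>) = emeasure \<mu> S" .
  qed
  also have "\<dots> = emeasure \<mu> S * emeasure ?R X" using nn_integral_const[of ?R "emeasure \<mu> S"] unfolding spR .
  also have "emeasure ?R X = emeasure lborel X" by (rule emeasure_restrict_space) (use Xs in auto)
  finally show "(\<integral>\<^sup>+ y. emeasure lborel {t \<in> X. \<beta> t <# y \<in> S} \<partial>\<mu>) = emeasure lborel X * emeasure \<mu> S"
    by (simp add: mult.commute)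
qed

end

section \<open>A lower bound for the volume of translates\<close>

lemma norm_sum_scaleR_le:
  fixes v :: "'m::finite \<Rightarrow> 'a::real_normed_vector"
  assumes "\<And>i. norm (v i) \<le> C"
  shows "norm (\<Sum>i\<in>UNIV. (s :: real^'m) $ i *\<^sub>R v i) \<le> C * (\<Sum>i\<in>UNIV. \<bar>s $ i\<bar>)"
proof -
  have "norm (\<Sum>i\<in>UNIV. s $ i *\<^sub>R v i) \<le> (\<Sum>i\<in>UNIV. \<bar>s $ i\<bar> * C)"
    by (rule sum_norm_le) (simp add: assms mult_left_mono)
  then show ?thesis by (simp add: sum_distrib_left mult.commute)
qed

section \<open>Uniform first-order estimates for products and quotients near the identity\<close>

context symspace
begin

lemma \<phi>i_G: "x \<in> \<phi> ` U \<Longrightarrow> \<phi>i x \<in> carrier G" using \<phi>i_U U_G by blast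

lemma chart_ball:
  assumes N: "openin T N" "\<one> \<in> N"
  obtains \<delta> where "0 < \<delta>" "ball pt \<delta> \<subseteq> \<phi> ` U" "\<And>x. x \<in> ball pt \<delta> \<Longrightarrow> \<phi>i x \<in> N"
proof -
  have "open (\<phi> ` (U \<inter> N))"
    using chart_image_open[OF U_chart, of "U \<inter> N"] chart_openin[OF U_chart] N(1) by blast
  moreover have "pt \<in> \<phi> ` (U \<inter> N)" using N(2) one_U by (auto simp: pt_def)
  ultimately obtain d where d: "d > 0" "ball pt d \<subseteq> \<phi> ` (U \<inter> N)" using open_contains_ball by blast
  show ?thesis
  proof (rule that[OF d(1)])
    show "ball pt d \<subseteq> \<phi> ` U" using d(2) by blast
    fix x assume "x \<in> ball pt d"
    then show "\<phi>i x \<in> N" using d(2) \<phi>i_\<phi> by auto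
  qed
qed

definition "HB r = {y \<in> V. \<psi> y \<in> ball (\<psi> H) r}"

lemma openin_HB: "openin Y (HB r)"
  unfolding HB_def by (rule chart_preimage_open[OF V_chart]) simp

lemma HB_in_proj:
  assumes N: "openin T N" "\<one> \<in> N"
  obtains r0 where "0 < r0" "\<And>r y. r \<le> r0 \<Longrightarrow> y \<in> HB r \<Longrightarrow> \<exists>k\<in>N. y = proj k"
proof -
  have "open (\<psi> ` (V \<inter> (\<lambda>g. proj g) ` N))"
    using chart_image_open[OF V_chart, of "V \<inter> (\<lambda>g. proj g) ` N"] chart_openin[OF V_chart] openin_proj[OF N(1)] by blast
  moreover have "H \<in> V \<inter> (\<lambda>g. proj g) ` N" using H_V N(2) proj_one by force
  then have "\<psi> H \<in> \<psi> ` (V \<inter> (\<lambda>g. proj g) ` N)" by (rule imageI)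
  ultimately obtain d where d: "d > 0" "ball (\<psi> H) d \<subseteq> \<psi> ` (V \<inter> (\<lambda>g. proj g) ` N)"
    using open_contains_ball by blast
  show ?thesis
  proof (rule that[OF d(1)])
    fix r y assume r: "r \<le> d" and y: "y \<in> HB r"
    then have yV: "y \<in> V" and "\<psi> y \<in> ball (\<psi> H) d" by (auto simp: HB_def)
    then obtain y' where y': "y' \<in> V" "y' \<in> (\<lambda>g. proj g) ` N" "\<psi> y = \<psi> y'" using d(2) by auto
    then have "y = y'" using chart_inj[OF V_chart] yV by (auto dest: inj_onD)
    then show "\<exists>k\<in>N. y = proj k" using y'(2) by blast
  qed
qed

text \<open>For x = pt the map that sends \<open>x'\<close> to the coordinates of
  \<open>\<phi>i x' \<otimes> inv (\<phi>i x)\<close> is the identity; strict differentiability in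
  \<open>x'\<close> with \<open>x\<close> as parameter extends this approximately to all
  \<open>x\<close> near \<open>pt\<close>.\<close>

lemma difference_strict:
  assumes "0 < \<epsilon>"
  obtains \<delta> where "0 < \<delta>" "ball pt \<delta> \<subseteq> \<phi> ` U"
    "\<And>x x'. x \<in> ball pt \<delta> \<Longrightarrow> x' \<in> ball pt \<delta> \<Longrightarrow> \<phi>i x' \<otimes> inv (\<phi>i x) \<in> U"
    "\<And>x x'. x \<in> ball pt \<delta> \<Longrightarrow> x' \<in> ball pt \<delta> \<Longrightarrow>
      norm (\<phi> (\<phi>i x' \<otimes> inv (\<phi>i x)) - pt - (x' - x)) \<le> \<epsilon> * norm (x' - x)"
    "\<And>x. x \<in> ball pt \<delta> \<Longrightarrow>
      \<exists>E. ((\<lambda>x'. \<phi> (\<phi>i x' \<otimes> inv (\<phi>i x))) has_derivative E) (at x) \<and> (\<forall>v. norm (E v - v) \<le> \<epsilon> * norm v)"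
proof -
  let ?F = "\<lambda>z. fst z \<otimes> inv (snd z)"
  have F: "smooth_map (prod_topology T T) (prod_atlas A A) T A ?F"
    by (intro smooth_mult[OF atlas_TT] smooth_inv[OF atlas_TT] smooth_fst smooth_snd)
  let ?S = "map_prod \<phi> \<phi> ` {z \<in> U \<times> U. ?F z \<in> U}"
  let ?d = "\<lambda>x. \<phi> (?F (\<phi>i (fst x), \<phi>i (snd x)))"
  note c = chart_map2[OF F U_in U_chart]
  have ptS: "(pt, pt) \<in> ?S"
    by (rule image_eqI[of _ _ "(\<one>, \<one>)"]) (use one_U in \<open>auto simp: pt_def\<close>)
  have D: "((\<lambda>z. ?d (z, pt)) has_derivative (\<lambda>v. v)) (at pt)"
    by (rule has_derivative_transform_within_open[OF has_derivative_ident chart_open[OF U_chart] pt_U])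
      (simp add: \<phi>i_pt \<phi>i_G \<phi>_\<phi>i)
  obtain d where d: "0 < d" "ball pt d \<times> ball pt d \<subseteq> ?S"
    "\<And>z z' w. z \<in> ball pt d \<Longrightarrow> z' \<in> ball pt d \<Longrightarrow> w \<in> ball pt d \<Longrightarrow>
      norm (?d (z, w) - ?d (z', w) - (z - z')) \<le> \<epsilon> * norm (z - z')"
    "\<And>z w. z \<in> ball pt d \<Longrightarrow> w \<in> ball pt d \<Longrightarrow>
      \<exists>E. ((\<lambda>z. ?d (z, w)) has_derivative E) (at z) \<and> (\<forall>v. norm (E v - v) \<le> \<epsilon> * norm v)"
    by (rule smooth_on_partial_strict[OF c ptS assms D]) (rule that)
  have in_S: "x' \<in> \<phi> ` U \<and> x \<in> \<phi> ` U \<and> \<phi>i x' \<otimes> inv (\<phi>i x) \<in> U" if "x' \<in> ball pt d" "x \<in> ball pt d" for x x'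
  proof -
    have "(x', x) \<in> ?S" using d(2) that by blast
    then show ?thesis using \<phi>i_\<phi> by auto
  qed
  show ?thesis
  proof (rule that[OF d(1)])
    show "ball pt d \<subseteq> \<phi> ` U" using in_S by blast
    fix x x' assume x: "x \<in> ball pt d" and x': "x' \<in> ball pt d"
    show "\<phi>i x' \<otimes> inv (\<phi>i x) \<in> U" using in_S[OF x' x] by blast
    have "\<phi>i x \<in> carrier G" using in_S[OF x x] \<phi>i_G by blast
    then have "\<phi> (\<phi>i x \<otimes> inv (\<phi>i x)) = pt" by (simp add: pt_def)
    then show "norm (\<phi> (\<phi>i x' \<otimes> inv (\<phi>i x)) - pt - (x' - x)) \<le> \<epsilon> * norm (x' - x)"
      using d(3)[OF x' x x] by simp
  next
    fix x assume x: "x \<in> ball pt d"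
    then show "\<exists>E. ((\<lambda>x'. \<phi> (\<phi>i x' \<otimes> inv (\<phi>i x))) has_derivative E) (at x) \<and> (\<forall>v. norm (E v - v) \<le> \<epsilon> * norm v)"
      using d(4)[OF x x] by simp
  qed
qed

lemma product_derivative:
  assumes "0 < \<epsilon>"
  obtains \<delta> where "0 < \<delta>" "ball pt \<delta> \<subseteq> \<phi> ` U"
    "\<And>\<kappa>. \<kappa> \<in> ball pt \<delta> \<Longrightarrow>
      \<exists>E. ((\<lambda>\<xi>. \<psi> (proj (\<phi>i \<xi> \<otimes> \<phi>i \<kappa>))) has_derivative E) (at pt) \<and> (\<forall>v. norm (E v - P v) \<le> \<epsilon> * norm v)"
proof -
  let ?F = "\<lambda>z. proj (fst z \<otimes> snd z)"
  have F: "smooth_map (prod_topology T T) (prod_atlas A A) Y B ?F"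
    by (rule smooth_map_compose[OF atlas_TT atlas_T atlas_Y _ smooth_proj])
      (intro smooth_mult[OF atlas_TT] smooth_fst smooth_snd)
  let ?S = "map_prod \<phi> \<phi> ` {z \<in> U \<times> U. ?F z \<in> V}"
  let ?d = "\<lambda>x. \<psi> (?F (\<phi>i (fst x), \<phi>i (snd x)))"
  note c = chart_map2[OF F V_in V_chart]
  have ptS: "(pt, pt) \<in> ?S"
    by (rule image_eqI[of _ _ "(\<one>, \<one>)"]) (use one_U H_V proj_one in \<open>auto simp: pt_def\<close>)
  have D: "((\<lambda>z. ?d (z, pt)) has_derivative P) (at pt)"
    by (rule has_derivative_transform_within_open[OF P_has_derivative chart_open[OF U_chart] pt_U])
      (simp add: \<phi>i_pt \<phi>i_G pm_def)
  obtain d where d: "0 < d" "ball pt d \<times> ball pt d \<subseteq> ?S"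
    "\<And>z z' w. z \<in> ball pt d \<Longrightarrow> z' \<in> ball pt d \<Longrightarrow> w \<in> ball pt d \<Longrightarrow>
      norm (?d (z, w) - ?d (z', w) - P (z - z')) \<le> \<epsilon> * norm (z - z')"
    "\<And>z w. z \<in> ball pt d \<Longrightarrow> w \<in> ball pt d \<Longrightarrow>
      \<exists>E. ((\<lambda>z. ?d (z, w)) has_derivative E) (at z) \<and> (\<forall>v. norm (E v - P v) \<le> \<epsilon> * norm v)"
    by (rule smooth_on_partial_strict[OF c ptS assms D]) (rule that)
  show ?thesis
  proof (rule that[OF d(1)])
    show "ball pt d \<subseteq> \<phi> ` U"
    proof
      fix x assume "x \<in> ball pt d"
      then have "(x, x) \<in> ?S" using d(2) by blast
      then show "x \<in> \<phi> ` U" by auto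
    qed
    fix \<kappa> assume "\<kappa> \<in> ball pt d"
    then show "\<exists>E. ((\<lambda>\<xi>. \<psi> (proj (\<phi>i \<xi> \<otimes> \<phi>i \<kappa>))) has_derivative E) (at pt) \<and> (\<forall>v. norm (E v - P v) \<le> \<epsilon> * norm v)"
      using d(4)[of pt \<kappa>] d(1) by simp
  qed
qed

lemma quotient_Lipschitz:
  obtains \<delta> C where "0 < \<delta>" "0 < C" "ball pt \<delta> \<subseteq> \<phi> ` U"
    "\<And>x x'. x \<in> ball pt \<delta> \<Longrightarrow> x' \<in> ball pt \<delta> \<Longrightarrow> proj (inv (\<phi>i x) \<otimes> \<phi>i x') \<in> V"
    "\<And>x x'. x \<in> ball pt \<delta> \<Longrightarrow> x' \<in> ball pt \<delta> \<Longrightarrow>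
      norm (\<psi> (proj (inv (\<phi>i x) \<otimes> \<phi>i x')) - \<psi> H) \<le> C * norm (x' - x)"
proof -
  let ?F = "\<lambda>z. proj (inv (snd z) \<otimes> fst z)"
  have F: "smooth_map (prod_topology T T) (prod_atlas A A) Y B ?F"
    by (rule smooth_map_compose[OF atlas_TT atlas_T atlas_Y _ smooth_proj])
      (intro smooth_mult[OF atlas_TT] smooth_inv[OF atlas_TT] smooth_fst smooth_snd)
  let ?S = "map_prod \<phi> \<phi> ` {z \<in> U \<times> U. ?F z \<in> V}"
  let ?d = "\<lambda>x. \<psi> (?F (\<phi>i (fst x), \<phi>i (snd x)))"
  note c = chart_map2[OF F V_in V_chart]
  have ptS: "(pt, pt) \<in> ?S"
    by (rule image_eqI[of _ _ "(\<one>, \<one>)"]) (use one_U H_V proj_one in \<open>auto simp: pt_def\<close>)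
  have D: "((\<lambda>z. ?d (z, pt)) has_derivative P) (at pt)"
    by (rule has_derivative_transform_within_open[OF P_has_derivative chart_open[OF U_chart] pt_U])
      (simp add: \<phi>i_pt \<phi>i_G pm_def)
  obtain d where d: "0 < d" "ball pt d \<times> ball pt d \<subseteq> ?S"
    "\<And>z z' w. z \<in> ball pt d \<Longrightarrow> z' \<in> ball pt d \<Longrightarrow> w \<in> ball pt d \<Longrightarrow>
      norm (?d (z, w) - ?d (z', w) - P (z - z')) \<le> 1 * norm (z - z')"
    "\<And>z w. z \<in> ball pt d \<Longrightarrow> w \<in> ball pt d \<Longrightarrow>
      \<exists>E. ((\<lambda>z. ?d (z, w)) has_derivative E) (at z) \<and> (\<forall>v. norm (E v - P v) \<le> 1 * norm v)"
    by (rule smooth_on_partial_strict[OF c ptS zero_less_one D]) (rule that)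
  have in_S: "x' \<in> \<phi> ` U \<and> x \<in> \<phi> ` U \<and> proj (inv (\<phi>i x) \<otimes> \<phi>i x') \<in> V" if "x' \<in> ball pt d" "x \<in> ball pt d" for x x'
  proof -
    have "(x', x) \<in> ?S" using d(2) that by blast
    then show ?thesis using \<phi>i_\<phi> by auto
  qed
  obtain K where K: "K > 0" "\<And>v. norm (P v) \<le> K * norm v" using linear_bounded_pos[OF P_linear] by blast
  show ?thesis
  proof (rule that[of d "K + 1"])
    show "0 < d" "0 < K + 1" using d K by auto
    show "ball pt d \<subseteq> \<phi> ` U" using in_S by blast
    fix x x' assume x: "x \<in> ball pt d" and x': "x' \<in> ball pt d"
    show "proj (inv (\<phi>i x) \<otimes> \<phi>i x') \<in> V" using in_S[OF x' x] by blast
    have "\<phi>i x \<in> carrier G" using in_S[OF x x] \<phi>i_G by blast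
    then have "norm ((\<psi> (proj (inv (\<phi>i x) \<otimes> \<phi>i x')) - \<psi> H) - P (x' - x)) \<le> norm (x' - x)"
      using d(3)[OF x' x x] by (simp add: proj_one)
    then have "norm (\<psi> (proj (inv (\<phi>i x) \<otimes> \<phi>i x')) - \<psi> H) \<le> norm (x' - x) + K * norm (x' - x)"
      using K(2)[of "x' - x"] norm_triangle_ineq2[of "\<psi> (proj (inv (\<phi>i x) \<otimes> \<phi>i x')) - \<psi> H" "P (x' - x)"] by linarith
    then show "norm (\<psi> (proj (inv (\<phi>i x) \<otimes> \<phi>i x')) - \<psi> H) \<le> (K + 1) * norm (x' - x)"
      by (simp add: algebra_simps)
  qed
qed

text \<open>Compares \<open>\<mu>\<close> with Lebesgue measure near the base point without using a
  density. The slice \<open>t \<mapsto> \<phi>i (pt + R t)\<close> reaches every point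
  \<open>y\<close> of a neighbourhood \<open>O'\<close> of \<open>H\<close>, say at the parameter
  \<open>t0\<close>, and \<open>\<beta> t\<close>, the inverse of the slice at \<open>t\<close>,
  moves \<open>y\<close> to a distance from \<open>H\<close> of at most a constant times
  \<open>norm (t0 - t)\<close>. So the orbit of \<open>y\<close> spends time of order r^n in
  \<open>HB r\<close>, which \<open>orbit_time\<close> converts into a bound for the
  measure.\<close>

lemma HB_measure_lower:
  obtains c r0 where "0 < c" "0 < r0"
    "\<And>r. 0 < r \<Longrightarrow> r < r0 \<Longrightarrow> ennreal c * emeasure lborel (ball (\<psi> H) r) \<le> emeasure \<mu> (HB r)"
proof -
  obtain \<delta>0 C where q: "0 < \<delta>0" "0 < C" "ball pt \<delta>0 \<subseteq> \<phi> ` U"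
    "\<And>x x'. x \<in> ball pt \<delta>0 \<Longrightarrow> x' \<in> ball pt \<delta>0 \<Longrightarrow> proj (inv (\<phi>i x) \<otimes> \<phi>i x') \<in> V"
    "\<And>x x'. x \<in> ball pt \<delta>0 \<Longrightarrow> x' \<in> ball pt \<delta>0 \<Longrightarrow>
      norm (\<psi> (proj (inv (\<phi>i x) \<otimes> \<phi>i x')) - \<psi> H) \<le> C * norm (x' - x)"
    by (rule quotient_Lipschitz) (rule that)
  obtain R where R: "linear R" "P \<circ> R = id"
    using linear_surjective_right_inverse[OF P_linear P_surj] by blast
  obtain K where K: "K > 0" "\<And>v. norm (R v) \<le> K * norm v" using linear_bounded_pos[OF R(1)] by blast
  have blR: "bounded_linear R" using R(1) by (simp add: linear_conv_bounded_linear)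
  have contR: "continuous_on UNIV (\<lambda>t. pt + R t)"
    by (intro continuous_intros linear_continuous_on[OF blR])
  have "open ((\<lambda>t. pt + R t) -` Dp)" by (rule open_vimage[OF pm_chart(1) contR])
  moreover have "0 \<in> (\<lambda>t. pt + R t) -` Dp" using pt_Dp linear_0[OF R(1)] by simp
  ultimately obtain \<delta>1 where d1: "\<delta>1 > 0" "ball 0 \<delta>1 \<subseteq> (\<lambda>t. pt + R t) -` Dp" using open_contains_ball by blast
  define \<delta> where "\<delta> = min \<delta>1 (\<delta>0 / K)"
  have \<delta>: "\<delta> > 0" using q(1) d1 K by (simp add: \<delta>_def)
  have inD: "pt + R t \<in> Dp" "pt + R t \<in> ball pt \<delta>0" if "t \<in> ball 0 \<delta>" for t
  proof -
    show "pt + R t \<in> Dp" using d1(2) that by (auto simp: \<delta>_def subset_iff)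
    have "norm t < \<delta>0 / K" using that by (auto simp: \<delta>_def)
    then have "K * norm t < \<delta>0" using K(1) by (simp add: pos_less_divide_eq mult.commute)
    then show "pt + R t \<in> ball pt \<delta>0" using K(2)[of t] by (simp add: dist_norm)
  qed
  define \<beta> where "\<beta> = (\<lambda>t. inv (\<phi>i (pt + R t)))"
  have c\<beta>: "continuous_map (top_of_set (ball 0 \<delta>)) T \<beta>"
  proof -
    have 1: "continuous_map (top_of_set (ball 0 \<delta>)) (top_of_set (\<phi> ` U)) (\<lambda>t. pt + R t)"
      using continuous_on_subset[OF contR] inD(2) q(3) by (auto simp: continuous_map_in_subtopology)
    have "continuous_map (top_of_set (ball 0 \<delta>)) T (\<lambda>t. \<phi>i (pt + R t))"
      using continuous_map_compose[OF 1 chart_inv_continuous[OF U_chart]] by (simp add: o_def \<phi>i_def)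
    then show ?thesis unfolding \<beta>_def by (rule continuous_inv)
  qed
  let ?p = "\<lambda>t. pm (pt + R t)"
  define O' where "O' = {y \<in> V. \<psi> y \<in> interior (?p ` ball 0 (\<delta> / 2))}"
  have oO: "openin Y O'" unfolding O'_def by (rule chart_preimage_open[OF V_chart]) simp
  have pm_cont: "continuous_on (ball 0 \<delta>) ?p"
    by (rule continuous_on_compose2[OF smooth_on_imp_continuous_on[OF pm_chart(2)] continuous_on_subset[OF contR]])
      (use inD in auto)
  have pd: "(?p has_derivative (\<lambda>t. P (R t))) (at 0)"
  proof -
    have "((\<lambda>t. pt + R t) has_derivative R) (at 0)"
      using has_derivative_add[OF has_derivative_const bounded_linear_imp_has_derivative[OF blR]] by simp
    from has_derivative_compose[OF this, of pm P] show ?thesis using P_has_derivative linear_0[OF R(1)] by simp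
  qed
  \<comment> \<open>The derivative of \<open>?p\<close> at 0 is \<open>P \<circ> R\<close>, the
    identity, so the image of the half ball contains a neighbourhood of
    \<open>\<psi> H\<close>.\<close>
  have "?p 0 \<in> interior (?p ` ball 0 (\<delta> / 2))"
    by (rule sussmann_open_mapping[OF open_ball pm_cont _ pd bounded_linear_ident])
      (use \<delta> R(2) in \<open>auto simp: o_def id_def fun_eq_iff\<close>)
  then have HO: "H \<in> O'" using H_V pm_pt linear_0[OF R(1)] by (simp add: O'_def)
  have Opos: "emeasure \<mu> O' > 0" using open_positive[OF oO] HO by blast
  \<comment> \<open>Nothing said so far makes the measure of \<open>O'\<close> finite; a finite
    positive lower bound suffices.\<close>
  obtain M where M: "M > 0" "ennreal M \<le> emeasure \<mu> O'"
  proof (cases "emeasure \<mu> O'")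
    case (real x) then show ?thesis using Opos by (intro that[of x]) (auto simp: ennreal_less_zero_iff)
  next
    case top then show ?thesis by (intro that[of 1]) auto
  qed
  define n where "n = DIM(real^'m)"
  define v where "v = unit_ball_vol n"
  have v: "v > 0" by (simp add: v_def)
  have ball: "emeasure lborel (ball (x :: real^'m) r) = ennreal (v * r ^ n)" if "0 \<le> r" for x r
    using emeasure_ball[OF that, of x] by (simp add: v_def n_def)
  \<comment> \<open>Solves \<open>v * s ^ n * M = (v * \<delta> ^ n) * (c * (v * r ^ n))\<close> for
    s = r / (C K); the powers of \<open>r\<close> cancel.\<close>
  define c where "c = M / ((C * K) ^ n * (v * \<delta> ^ n))"
  have c: "c > 0" using M v \<delta> q K by (simp add: c_def)
  show ?thesis
  proof (rule that[of c "C * K * (\<delta> / 2)"])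
    show "0 < C * K * (\<delta> / 2)" using q K \<delta> by simp
    fix r assume r: "0 < r" "r < C * K * (\<delta> / 2)"
    define s where "s = r / (C * K)"
    have s: "0 < s" "s < \<delta> / 2" using r q K by (auto simp: s_def field_simps)
    have sub: "emeasure lborel (ball (0 :: real^'m) s) \<le> emeasure lborel {t \<in> ball 0 \<delta>. \<beta> t <# y \<in> HB r}" if y: "y \<in> O'" for y
    proof -
      obtain t0 where t0: "t0 \<in> ball 0 (\<delta> / 2)" "\<psi> y = ?p t0" using y interior_subset by (force simp: O'_def)
      have t0d: "t0 \<in> ball 0 \<delta>" using t0 \<delta> by auto
      obtain a where a: "a \<in> U" "proj a \<in> V" "pt + R t0 = \<phi> a" using inD(1)[OF t0d] by (auto simp: Dp_def)
      then have "\<psi> y = \<psi> (proj a)" using t0 \<phi>i_\<phi> by (simp add: pm_def)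
      then have ya: "y = proj a" using chart_inj[OF V_chart] a(2) y by (auto simp: O'_def dest: inj_onD)
      have "ball t0 s \<subseteq> {t \<in> ball 0 \<delta>. \<beta> t <# y \<in> HB r}"
      proof
        fix t assume t: "t \<in> ball t0 s"
        have "norm t \<le> norm t0 + dist t0 t" using norm_triangle_ineq2[of t t0] by (simp add: dist_norm norm_minus_commute)
        then have td: "t \<in> ball 0 \<delta>" using t t0 s by simp
        have xG: "\<phi>i (pt + R t) \<in> carrier G" using inD(2)[OF td] q(3) \<phi>i_G by blast
        have "\<beta> t <# y = proj (inv (\<phi>i (pt + R t)) \<otimes> \<phi>i (pt + R t0))"
          using a \<phi>i_\<phi> U_G xG by (simp add: \<beta>_def ya act_proj subset_iff)
        moreover have "norm (\<psi> (proj (inv (\<phi>i (pt + R t)) \<otimes> \<phi>i (pt + R t0))) - \<psi> H) \<le> C * norm (R (t0 - t))"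
          using q(5)[OF inD(2)[OF td] inD(2)[OF t0d]] by (simp add: linear_diff[OF R(1)])
        moreover have "C * norm (R (t0 - t)) < r"
        proof -
          have "C * norm (R (t0 - t)) \<le> C * (K * norm (t0 - t))" using K(2) q(2) by (intro mult_left_mono) auto
          also have "\<dots> < C * (K * s)" using t q K by (simp add: dist_norm)
          also have "\<dots> = r" using q K by (simp add: s_def)
          finally show ?thesis .
        qed
        ultimately show "t \<in> {t \<in> ball 0 \<delta>. \<beta> t <# y \<in> HB r}"
          using q(4)[OF inD(2)[OF td] inD(2)[OF t0d]] td by (simp add: HB_def dist_norm norm_minus_commute)
      qed
      moreover have "open {t \<in> ball 0 \<delta>. \<beta> t <# y \<in> HB r}"
        by (rule orbit_time(2)[OF open_ball c\<beta> openin_HB]) (use y V_lcosets in \<open>auto simp: O'_def\<close>)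
      ultimately have "emeasure lborel (ball t0 s) \<le> emeasure lborel {t \<in> ball 0 \<delta>. \<beta> t <# y \<in> HB r}"
        by (intro emeasure_mono) auto
      then show ?thesis using s ball[of s t0] ball[of s 0] by simp
    qed
    have "ennreal (v * s ^ n) * emeasure \<mu> O' = (\<integral>\<^sup>+ y. ennreal (v * s ^ n) * indicator O' y \<partial>\<mu>)"
      using open_in_sets[OF oO] by (rule nn_integral_cmult_indicator[symmetric])
    also have "\<dots> \<le> (\<integral>\<^sup>+ y. emeasure lborel {t \<in> ball 0 \<delta>. \<beta> t <# y \<in> HB r} \<partial>\<mu>)"
      using sub s ball[of s 0] by (intro nn_integral_mono) (auto simp: indicator_def)
    also have "\<dots> = ennreal (v * \<delta> ^ n) * emeasure \<mu> (HB r)"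
      using orbit_time(1)[OF open_ball c\<beta> openin_HB] \<delta> ball[of \<delta> 0] by simp
    finally have "ennreal (v * s ^ n) * ennreal M \<le> ennreal (v * \<delta> ^ n) * emeasure \<mu> (HB r)"
      using M(2) by (meson mult_left_mono order_trans zero_le)
    moreover have "v * s ^ n * M = (v * \<delta> ^ n) * (c * (v * r ^ n))"
      using v \<delta> q(2) K(1) by (simp add: c_def s_def power_divide power_mult_distrib)
    ultimately have "ennreal (v * \<delta> ^ n) * (ennreal c * ennreal (v * r ^ n)) \<le> ennreal (v * \<delta> ^ n) * emeasure \<mu> (HB r)"
      using v s M \<delta> c r by (simp add: ennreal_mult[symmetric])
    then have "ennreal c * ennreal (v * r ^ n) \<le> emeasure \<mu> (HB r)"
      using v \<delta> by (subst (asm) ennreal_mult_le_mult_iff) auto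
    then show "ennreal c * emeasure lborel (ball (\<psi> H) r) \<le> emeasure \<mu> (HB r)" using ball r by simp
  qed (use c in auto)
qed

text \<open>The stabilizer of \<open>a H\<close> commutes with the involution \<open>Ad(a) \<theta> Ad(a)\<^sup>-\<^sup>1\<close>.\<close>

lemma stabilizer_char:
  assumes a: "a \<in> carrier G" and x: "\<phi>i x \<in> carrier G" and st: "\<phi>i x <# proj a = proj a" and w: "\<theta> w = - w"
  shows "ch x (Ad a w) = 0"
proof -
  define h where "h = inv a \<otimes> \<phi>i x \<otimes> a"
  have hG: "h \<in> carrier G" using a x by (simp add: h_def)
  have "proj h = inv a <# (\<phi>i x <# proj a)" using a x by (simp add: h_def act_proj m_assoc)
  also have "\<dots> = H" using st a by (simp add: act_proj proj_one)
  finally have "\<tau> h = h" using proj_eq_H_iff[OF hG] H_fixed by simp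
  then have Ah: "Ad h (\<theta> v) = \<theta> (Ad h v)" for v using Ad_\<tau>[OF hG, of v] by simp
  have ha: "h \<otimes> inv a = inv a \<otimes> \<phi>i x" using a x by (simp add: h_def m_assoc)
  have "a \<otimes> h = (a \<otimes> inv a) \<otimes> (\<phi>i x \<otimes> a)"
    unfolding h_def using a x by (simp only: m_assoc m_closed inv_closed)
  then have ah: "a \<otimes> h = \<phi>i x \<otimes> a" using a x by simp
  have ha1: "Ad h (Ad (inv a) v) = Ad (inv a) (Ad (\<phi>i x) v)" for v
    using Ad_mult[OF hG, of "inv a" v] Ad_mult[of "inv a" "\<phi>i x" v] ha a x by simp
  have ha2: "Ad a (Ad h v) = Ad (\<phi>i x) (Ad a v)" for v
    using Ad_mult[OF a hG, of v] Ad_mult[OF x a, of v] ah by simp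
  let ?\<sigma> = "\<lambda>v. Ad a (\<theta> (Ad (inv a) v))"
  have lin: "linear ?\<sigma>"
    using linear_compose[OF linear_compose[OF Ad_linear \<theta>_linear] Ad_linear[OF a], of "inv a"] a by (simp add: o_def)
  show ?thesis
  proof (rule ch_zero[OF x lin])
    show "?\<sigma> (?\<sigma> v) = v" for v using a by (simp add: Ad_inv \<theta>_\<theta>)
    show "br (?\<sigma> u) (?\<sigma> v) = ?\<sigma> (br u v)" for u v
      using Ad_br[OF a] Ad_br[of "inv a"] \<theta>_br a by simp
    show "Ad (\<phi>i x) (?\<sigma> v) = ?\<sigma> (Ad (\<phi>i x) v)" for v
      by (simp add: ha2[symmetric] ha1[symmetric] Ah)
    show "?\<sigma> (Ad a w) = - Ad a w" using a w linear_neg[OF Ad_linear[OF a]] by (simp add: Ad_inv)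
  qed
qed

end

section \<open>Orbit maps near a distant point\<close>

context symspace
begin

text \<open>Expanding in the \<open>f k\<close> and moving \<open>Ad (inv g)\<close> to the other
  argument of the Killing form gives the matrix identity K^T L = M N, with K the Gram matrix of the
  \<open>f k\<close>, L the Jacobian, and N the pairing of the vectors \<open>E (v j)\<close> with
  the frame. Taking determinants bounds that of L from below.\<close>

lemma frame_determinant:
  fixes f e v :: "'m \<Rightarrow> real^'n" and M :: "real^'m^'m"
  assumes g: "g \<in> carrier G"
    and f: "\<And>u l. kf u (f l) = (\<Sum>k\<in>UNIV. P u $ k * kf (f k) (f l))"
    and D: "det (\<chi> k l. kf (f k) (f l)) \<noteq> 0"
    and M: "\<And>k. Ad g (f k) = (\<Sum>i\<in>UNIV. M $ k $ i *\<^sub>R e i)" "c \<le> \<bar>det M\<bar>" and c: "0 \<le> c"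
    and E: "linear E"
    and N: "1 / 2 \<le> \<bar>det (\<chi> i j. kf (E (v j)) (e i))\<bar>"
  shows "c / (2 * \<bar>det (\<chi> k l. kf (f k) (f l))\<bar>) \<le> \<bar>det (\<chi> k j. P (Ad (inv g) (E (v j))) $ k)\<bar>"
proof -
  let ?K = "\<chi> k l. kf (f k) (f l)" and ?L = "\<chi> k j. P (Ad (inv g) (E (v j))) $ k"
    and ?N = "\<chi> i j. kf (E (v j)) (e i)"
  have "transpose ?K ** ?L = M ** ?N"
  proof -
    have "(\<Sum>k\<in>UNIV. kf (f k) (f l) * P (Ad (inv g) (E (v j))) $ k) = (\<Sum>i\<in>UNIV. M $ l $ i * kf (E (v j)) (e i))" for l j
    proof -
      have "(\<Sum>k\<in>UNIV. kf (f k) (f l) * P (Ad (inv g) (E (v j))) $ k) = kf (Ad (inv g) (E (v j))) (f l)"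
        by (subst f[of "Ad (inv g) (E (v j))"]) (simp add: mult.commute)
      also have "\<dots> = kf (E (v j)) (Ad g (f l))"
        using kf_Ad[OF g, of "Ad (inv g) (E (v j))" "f l"] Ad_inv(2)[OF g] by simp
      also have "\<dots> = (\<Sum>i\<in>UNIV. M $ l $ i * kf (E (v j)) (e i))"
        by (simp add: M(1) linear_sum[OF kf_linear_right] linear_scale[OF kf_linear_right])
      finally show ?thesis .
    qed
    then show ?thesis by (simp add: vec_eq_iff matrix_matrix_mult_def transpose_def)
  qed
  from arg_cong[OF this, of det] have "det ?K * det ?L = det M * det ?N" by (simp only: det_mul det_transpose)
  then have eq: "\<bar>det ?K\<bar> * \<bar>det ?L\<bar> = \<bar>det M\<bar> * \<bar>det ?N\<bar>" by (simp only: abs_mult[symmetric])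
  have "c * (1 / 2) \<le> \<bar>det M\<bar> * \<bar>det ?N\<bar>" using M(2) N c by (intro mult_mono) auto
  then have "c / 2 \<le> \<bar>det ?K\<bar> * \<bar>det ?L\<bar>" by (simp add: eq)
  then have "c / 2 / \<bar>det ?K\<bar> \<le> \<bar>det ?L\<bar>" using D by (simp add: pos_divide_le_eq mult.commute)
  then show ?thesis by simp
qed

text \<open>Here the radius depends on \<open>g\<close>, since \<open>Ad g\<close> enters. It only
  restricts the size of the test balls \<open>HB r\<close>, which is allowed to depend on
  \<open>g\<close>.\<close>

lemma Ad_small:
  assumes g: "g \<in> carrier G" and e: "0 < \<epsilon>"
  obtains \<delta> where "0 < \<delta>" "ball pt \<delta> \<subseteq> \<phi> ` U"
    "\<And>\<kappa> i. \<kappa> \<in> ball pt \<delta> \<Longrightarrow> norm (Ad (g \<otimes> \<phi>i \<kappa> \<otimes> inv g) ((e :: 'm \<Rightarrow> real^'n) i) - e i) \<le> \<epsilon>"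
proof -
  obtain S where S: "open S" "pt \<in> S" "S \<subseteq> \<phi> ` U" "\<And>v. smooth_on S (\<lambda>x. Ad (\<phi>i x) v)"
    using smooth_Ad by blast
  have blg: "bounded_linear (Ad g)" using Ad_linear[OF g] by (simp add: linear_conv_bounded_linear)
  have c: "continuous_on S (\<lambda>x. Ad g (Ad (\<phi>i x) (Ad (inv g) (e i))))" for i
    by (rule bounded_linear.continuous_on[OF blg smooth_on_imp_continuous_on[OF S(4)]])
  define Q where "Q = (\<Inter>i\<in>(UNIV :: 'm set). S \<inter> (\<lambda>x. Ad g (Ad (\<phi>i x) (Ad (inv g) (e i)))) -` ball (e i) \<epsilon>)"
  have "open Q" unfolding Q_def
    by (intro open_INT ballI continuous_open_preimage[OF c S(1)]) auto
  moreover have "pt \<in> Q" using S(2) e g by (simp add: Q_def \<phi>i_pt Ad_one Ad_inv)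
  ultimately obtain d where d: "d > 0" "ball pt d \<subseteq> Q" using open_contains_ball by blast
  show ?thesis
  proof (rule that[OF d(1)])
    have QS: "Q \<subseteq> S" by (auto simp: Q_def)
    then show "ball pt d \<subseteq> \<phi> ` U" using d(2) S(3) by blast
    fix \<kappa> i assume "\<kappa> \<in> ball pt d"
    then have k: "\<kappa> \<in> Q" using d(2) by blast
    then have kG: "\<phi>i \<kappa> \<in> carrier G" using QS S(3) \<phi>i_G by blast
    have "Ad (g \<otimes> \<phi>i \<kappa> \<otimes> inv g) (e i) = Ad g (Ad (\<phi>i \<kappa>) (Ad (inv g) (e i)))"
      using g kG by (simp add: Ad_mult)
    moreover have "dist (e i) (Ad g (Ad (\<phi>i \<kappa>) (Ad (inv g) (e i)))) < \<epsilon>" using k by (simp add: Q_def)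
    ultimately show "norm (Ad (g \<otimes> \<phi>i \<kappa> \<otimes> inv g) (e i) - e i) \<le> \<epsilon>"
      by (simp add: dist_norm norm_minus_commute)
  qed
qed

lemma quotient_neighbourhoods:
  assumes W: "openin T W" "\<one> \<in> W"
  obtains W1 W2 where "openin T W1" "openin T W2" "\<one> \<in> W1" "\<one> \<in> W2"
    "\<And>a b. a \<in> W1 \<Longrightarrow> b \<in> W2 \<Longrightarrow> inv a \<otimes> b \<in> W"
proof -
  have "continuous_map (prod_topology T T) T (\<lambda>z. inv (fst z) \<otimes> snd z)"
    by (intro continuous_mult continuous_inv continuous_map_fst continuous_map_snd)
  from openin_continuous_map_preimage[OF this W(1)]
  have o: "openin (prod_topology T T) {z \<in> carrier G \<times> carrier G. inv (fst z) \<otimes> snd z \<in> W}" by simp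
  have 1: "(\<one>, \<one>) \<in> {z \<in> carrier G \<times> carrier G. inv (fst z) \<otimes> snd z \<in> W}" using W(2) by simp
  obtain W1 W2 where "openin T W1 \<and> openin T W2 \<and> \<one> \<in> W1 \<and> \<one> \<in> W2 \<and> W1 \<times> W2 \<subseteq> {z \<in> carrier G \<times> carrier G. inv (fst z) \<otimes> snd z \<in> W}"
    using o[unfolded openin_prod_topology_alt, rule_format, OF 1] by (elim exE)
  then have "openin T W1" "openin T W2" "\<one> \<in> W1" "\<one> \<in> W2" and sub: "W1 \<times> W2 \<subseteq> {z \<in> carrier G \<times> carrier G. inv (fst z) \<otimes> snd z \<in> W}"
    by simp_all
  then show ?thesis
  proof (intro that[of W1 W2])
    fix a b assume "a \<in> W1" "b \<in> W2"
    then have "(a, b) \<in> {z \<in> carrier G \<times> carrier G. inv (fst z) \<otimes> snd z \<in> W}" using sub by blast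
    then show "inv a \<otimes> b \<in> W" by simp
  qed
qed

lemma norm_l1_bound: "(\<Sum>i\<in>UNIV. \<bar>(s :: real^'m) $ i\<bar>) \<le> real CARD('m) * norm s"
  by (rule sum_abs_nth_le)

text \<open>Applied to \<open>u = \<phi>(b) - \<phi>(\<one>)\<close> for \<open>b = \<beta>(t') \<beta>(t)\<^sup>-\<^sup>1\<close> in the stabilizer of a point near \<open>g H\<close>, with
  \<open>s = t' - t\<close>: as \<open>u\<close> is orthogonal to the frame to first order, \<open>t = t'\<close>.\<close>

lemma frame_injective:
  fixes e v :: "'m \<Rightarrow> real^'n"
  assumes \<epsilon>: "0 < \<epsilon>" "\<epsilon> \<le> 1" "real CARD('m) * (\<epsilon> * (4 + 3 * K) * C) < 1" and K: "0 < K" "\<And>u v. \<bar>kf u v\<bar> \<le> K * norm u * norm v"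
    and C: "0 < C" "\<And>i. norm (v i) \<le> C" and e: "\<And>i. norm (e i) = 1"
    and dual: "\<And>i j. kf (v i) (e j) = (if i = j then 1 else 0)"
    and e': "\<And>i. norm (e' i - e i) \<le> \<epsilon>"
    and u: "norm (u - (\<Sum>i\<in>UNIV. s $ i *\<^sub>R v i)) \<le> \<epsilon> * norm (\<Sum>i\<in>UNIV. s $ i *\<^sub>R v i)"
    and small: "\<And>i. \<bar>kf u (e' i)\<bar> \<le> \<epsilon> * norm u * norm (e' i)"
  shows "s = 0"
proof -
  let ?V = "\<Sum>i\<in>UNIV. s $ i *\<^sub>R v i" and ?n = "\<Sum>i\<in>UNIV. \<bar>s $ i\<bar>"
  have V: "norm ?V \<le> C * ?n" by (rule norm_sum_scaleR_le[OF C(2)])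
  have uu: "norm u \<le> 2 * norm ?V"
  proof -
    have "norm u \<le> norm (u - ?V) + norm ?V" using norm_triangle_ineq[of "u - ?V" ?V] by simp
    also have "\<dots> \<le> \<epsilon> * norm ?V + norm ?V" using u by simp
    also have "\<dots> \<le> 1 * norm ?V + norm ?V" using \<epsilon>(2) by (intro add_right_mono mult_right_mono) auto
    finally show ?thesis by simp
  qed
  \<comment> \<open>\<open>s $ i\<close> is the pairing of \<open>?V\<close> with
    \<open>e i\<close>. Replacing \<open>?V\<close> by \<open>u\<close> costs \<epsilon> K,
    replacing \<open>e i\<close> by \<open>e' i\<close> costs 2 \<epsilon> K, and the approximate
    orthogonality contributes 4 \<epsilon>, all times \<open>norm ?V\<close>; hence the constant 4 +
    3 K.\<close>
  have si: "\<bar>s $ i\<bar> \<le> \<epsilon> * (4 + 3 * K) * C * ?n" for i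
  proof -
    have e2: "norm (e' i) \<le> 2" using e'[of i] e[of i] \<epsilon>(2) norm_triangle_ineq[of "e' i - e i" "e i"] by simp
    have "kf ?V (e i) = (\<Sum>j\<in>UNIV. s $ j * (if j = i then 1 else 0))"
      by (simp add: linear_sum[OF kf_linear_left] linear_scale[OF kf_linear_left] dual)
    then have "s $ i = kf ?V (e i)" by (simp add: if_distrib cong: if_cong)
    also have "\<dots> = kf u (e' i) - kf u (e' i - e i) - kf (u - ?V) (e i)"
      by (simp add: linear_diff[OF kf_linear_left] linear_diff[OF kf_linear_right])
    finally have "\<bar>s $ i\<bar> \<le> \<bar>kf u (e' i)\<bar> + \<bar>kf u (e' i - e i)\<bar> + \<bar>kf (u - ?V) (e i)\<bar>" by linarith
    moreover have "\<bar>kf u (e' i)\<bar> \<le> \<epsilon> * (2 * norm ?V) * 2"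
      by (rule order_trans[OF small]) (use uu e2 \<epsilon>(1) in \<open>intro mult_mono, auto\<close>)
    moreover have "\<bar>kf u (e' i - e i)\<bar> \<le> K * (2 * norm ?V) * \<epsilon>"
      by (rule order_trans[OF K(2)]) (use uu e'[of i] K(1) in \<open>intro mult_mono, auto\<close>)
    moreover have "\<bar>kf (u - ?V) (e i)\<bar> \<le> K * (\<epsilon> * norm ?V) * 1"
      by (rule order_trans[OF K(2)]) (use u e[of i] K(1) \<epsilon>(1) in \<open>intro mult_mono, auto\<close>)
    ultimately have "\<bar>s $ i\<bar> \<le> \<epsilon> * (4 + 3 * K) * norm ?V" by (simp add: algebra_simps)
    also have "\<dots> \<le> \<epsilon> * (4 + 3 * K) * (C * ?n)" using V \<epsilon>(1) K(1) by (intro mult_left_mono) auto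
    finally show ?thesis by (simp add: mult.assoc)
  qed
  \<comment> \<open>Summation over \<open>i\<close> bounds \<open>?n\<close> by a multiple of itself
    with a factor less than 1.\<close>
  have "?n \<le> (\<Sum>i\<in>(UNIV::'m set). \<epsilon> * (4 + 3 * K) * C * ?n)" by (intro sum_mono si)
  also have "\<dots> = real CARD('m) * (\<epsilon> * (4 + 3 * K) * C) * ?n" by simp
  finally have "(1 - real CARD('m) * (\<epsilon> * (4 + 3 * K) * C)) * ?n \<le> 0" by (simp add: left_diff_distrib)
  then have "?n \<le> 0" using \<epsilon>(3) by (simp add: mult_le_0_iff)
  moreover have "\<bar>s $ i\<bar> \<le> ?n" for i by (rule member_le_sum) auto
  ultimately have "s $ i = 0" for i using order_trans[of "\<bar>s $ i\<bar>" ?n 0] by fastforce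
  then show ?thesis by (simp add: vec_eq_iff)
qed

text \<open>Near \<open>t0\<close> the orbit map factors as
  \<open>t \<mapsto> \<beta>(t) \<beta>(t0)\<^sup>-\<^sup>1\<close>, followed by conjugation with
  \<open>inv g\<close> and the action on \<open>proj (\<phi>i \<kappa>)\<close>: since
  \<open>\<beta>(t0) y\<close> is \<open>g <# proj (\<phi>i \<kappa>)\<close>, moving
  \<open>inv g\<close> past the first factor conjugates it. The three derivatives are
  \<open>E \<circ> L\<close>, \<open>Ad (inv g)\<close> and \<open>Q\<close>.\<close>

lemma orbit_derivative:
  fixes L :: "real^'m \<Rightarrow> real^'n"
  assumes g: "g \<in> carrier G" and \<beta>: "linear L" and x0: "x0 = pt + L t0"
    and E: "((\<lambda>x'. \<phi> (\<phi>i x' \<otimes> inv (\<phi>i x0))) has_derivative E) (at x0)"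
    and S: "open S" "t0 \<in> S" "\<And>t. t \<in> S \<Longrightarrow> pt + L t \<in> \<phi> ` U \<and> \<phi>i (pt + L t) \<otimes> inv (\<phi>i x0) \<in> U"
    and k: "\<kappa> \<in> \<phi> ` U" and Q: "((\<lambda>\<xi>. \<psi> (proj (\<phi>i \<xi> \<otimes> \<phi>i \<kappa>))) has_derivative Q) (at pt)"
    and y: "y \<in> lcosets H" "\<phi>i x0 <# y = g <# proj (\<phi>i \<kappa>)"
  shows "((\<lambda>t. \<psi> (inv g <# (\<phi>i (pt + L t) <# y))) has_derivative (\<lambda>s. Q (Ad (inv g) (E (L s))))) (at t0)"
proof -
  have x0U: "x0 \<in> \<phi> ` U" using S(2,3) x0 by blast
  have x0G: "\<phi>i x0 \<in> carrier G" and kG: "\<phi>i \<kappa> \<in> carrier G" using x0U k \<phi>i_G by auto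
  let ?d = "\<lambda>t. \<phi> (\<phi>i (pt + L t) \<otimes> inv (\<phi>i x0))"
  let ?C = "\<lambda>\<xi>. \<phi> (inv g \<otimes> \<phi>i \<xi> \<otimes> inv (inv g))"
  have bl: "bounded_linear L" using \<beta> by (simp add: linear_conv_bounded_linear)
  have 0: "((\<lambda>t. pt + L t) has_derivative L) (at t0)"
    using has_derivative_add[OF has_derivative_const bounded_linear_imp_has_derivative[OF bl]] by simp
  have 1: "(?d has_derivative (\<lambda>s. E (L s))) (at t0)"
    using has_derivative_compose[OF 0, of "\<lambda>x'. \<phi> (\<phi>i x' \<otimes> inv (\<phi>i x0))" E] E by (simp add: x0)
  have d0: "?d t0 = pt" unfolding x0[symmetric] using x0G by (simp add: pt_def)
  have ig: "inv g \<in> carrier G" using g by simp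
  have 2: "((\<lambda>t. ?C (?d t)) has_derivative (\<lambda>s. Ad (inv g) (E (L s)))) (at t0)"
    using has_derivative_compose[OF 1, of ?C "Ad (inv g)"] Ad_has_derivative[OF ig] unfolding d0 by blast
  have C0: "?C pt = pt" using ig by (simp add: \<phi>i_pt) (simp add: pt_def)
  have 3: "((\<lambda>t. \<psi> (proj (\<phi>i (?C (?d t)) \<otimes> \<phi>i \<kappa>))) has_derivative (\<lambda>s. Q (Ad (inv g) (E (L s))))) (at t0)"
    using has_derivative_compose[OF 2, of "\<lambda>\<xi>. \<psi> (proj (\<phi>i \<xi> \<otimes> \<phi>i \<kappa>))" Q] Q unfolding d0 C0 by blast
  have cC: "continuous_map T T (\<lambda>a. inv g \<otimes> a \<otimes> inv (inv g))"
    using smooth_conj[OF ig] by (simp add: smooth_map_def)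
  obtain S1 where S1: "open S1" "pt \<in> S1" "S1 \<subseteq> \<phi> ` U" "\<forall>x\<in>S1. inv g \<otimes> \<phi>i x \<otimes> inv (inv g) \<in> U"
    using eventually_chart[OF cC conj_one[OF ig]] by blast
  have "\<forall>\<^sub>F t in at t0. ?d t \<in> S1"
  proof -
    have "isCont ?d t0" using has_derivative_continuous[OF 1] .
    then have "(?d \<longlongrightarrow> pt) (at t0)" using d0 by (simp add: isCont_def)
    then show ?thesis using S1(1,2) by (rule topological_tendstoD)
  qed
  moreover have "\<forall>\<^sub>F t in at t0. t \<in> S" using S(1,2) by (simp add: eventually_at_topological) blast
  ultimately have ev: "\<forall>\<^sub>F t in at t0. \<psi> (proj (\<phi>i (?C (?d t)) \<otimes> \<phi>i \<kappa>)) = \<psi> (inv g <# (\<phi>i (pt + L t) <# y))"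
  proof eventually_elim
    case (elim t)
    define x where "x = pt + L t"
    have xG: "\<phi>i x \<in> carrier G" and dU: "\<phi>i x \<otimes> inv (\<phi>i x0) \<in> U" using S(3)[OF elim(2)] \<phi>i_G by (auto simp: x_def)
    have i1: "\<phi>i (?d t) = \<phi>i x \<otimes> inv (\<phi>i x0)" using \<phi>i_\<phi>[OF dU] by (simp add: x_def)
    have i2: "\<phi>i (?C (?d t)) = inv g \<otimes> (\<phi>i x \<otimes> inv (\<phi>i x0)) \<otimes> g"
      using \<phi>i_\<phi>[OF bspec[OF S1(4) elim(1)]] g i1 by simp
    have "\<phi>i x <# y = (\<phi>i x \<otimes> inv (\<phi>i x0)) <# (\<phi>i x0 <# y)"
      using xG x0G y(1) by (simp add: act_act m_assoc)
    also have "\<dots> = proj ((\<phi>i x \<otimes> inv (\<phi>i x0)) \<otimes> (g \<otimes> \<phi>i \<kappa>))"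
      unfolding y(2) using xG x0G g kG by (simp add: act_proj)
    finally have "inv g <# (\<phi>i x <# y) = proj (inv g \<otimes> ((\<phi>i x \<otimes> inv (\<phi>i x0)) \<otimes> (g \<otimes> \<phi>i \<kappa>)))"
      using xG x0G g kG by (simp add: act_proj)
    also have "inv g \<otimes> ((\<phi>i x \<otimes> inv (\<phi>i x0)) \<otimes> (g \<otimes> \<phi>i \<kappa>)) = \<phi>i (?C (?d t)) \<otimes> \<phi>i \<kappa>"
      unfolding i2 using xG x0G g kG by (simp add: m_assoc)
    finally show ?case by (simp add: x_def)
  qed
  have "\<phi>i (?C (?d t0)) \<otimes> \<phi>i \<kappa> = \<phi>i \<kappa>" unfolding d0 unfolding C0 using kG by (simp add: \<phi>i_pt)
  moreover have "inv g <# (\<phi>i (pt + L t0) <# y) = proj (\<phi>i \<kappa>)"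
    using y(2) g kG act_inv(1) by (simp add: x0[symmetric])
  ultimately have at0: "\<psi> (proj (\<phi>i (?C (?d t0)) \<otimes> \<phi>i \<kappa>)) = \<psi> (inv g <# (\<phi>i (pt + L t0) <# y))" by simp
  show ?thesis
    by (rule has_derivative_transform_eventually[OF 3]) (use ev at0 in simp_all)
qed

text \<open>The orbit map \<open>t \<mapsto> \<beta>(t) y\<close> is injective and has Jacobian bounded below, uniformly in \<open>g\<close>, as long as it
  stays in a ball around \<open>g H\<close> whose radius may depend on \<open>g\<close>.\<close>

lemma local_count:
  assumes W: "openin T W" "\<one> \<in> W"
  obtains \<delta> c where "0 < \<delta>" "0 < c"
    "\<And>g. g \<in> carrier G \<Longrightarrow> \<exists>\<beta> r0. continuous_map (top_of_set (ball (0 :: real^'m) \<delta>)) T \<beta> \<and> 0 < r0 \<and>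
      (\<forall>r y. 0 < r \<longrightarrow> r < r0 \<longrightarrow> y \<in> lcosets H \<longrightarrow>
        ({t \<in> ball 0 \<delta>. \<beta> t <# y \<in> (\<lambda>z. g <# z) ` HB r} \<noteq> {} \<longrightarrow> y \<in> (\<lambda>b. proj (b \<otimes> g)) ` W) \<and>
        ennreal c * emeasure lborel {t \<in> ball 0 \<delta>. \<beta> t <# y \<in> (\<lambda>z. g <# z) ` HB r} \<le> emeasure lborel (ball (\<psi> H) r))"
proof -
  obtain f :: "'m \<Rightarrow> real^'n" and C c1 where C: "0 < C" and c1: "0 < c1"
    and f: "\<And>k. \<theta> (f k) = - f k"
    "\<And>u l. kf u (f l) = (\<Sum>k\<in>UNIV. P u $ k * kf (f k) (f l))"
    "det (\<chi> k l. kf (f k) (f l)) \<noteq> 0"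
    and frame: "\<And>g. g \<in> carrier G \<Longrightarrow> \<exists>(e :: 'm \<Rightarrow> real^'n) (v :: 'm \<Rightarrow> real^'n) (M :: real^'m^'m).
      (\<forall>i. norm (e i) = 1) \<and> (\<forall>i. norm (v i) \<le> C) \<and> (\<forall>i j. kf (v i) (e j) = (if i = j then 1 else 0)) \<and>
      (\<forall>k. Ad g (f k) = (\<Sum>i\<in>UNIV. M $ k $ i *\<^sub>R e i)) \<and> c1 \<le> \<bar>det M\<bar> \<and>
      (\<forall>i. \<exists>w. \<theta> w = - w \<and> e i = Ad g w)"
    by (rule adapted_frame) (rule that)
  obtain K where K: "K > 0" "\<And>u v. \<bar>kf u v\<bar> \<le> K * norm u * norm v" using kf_bounded by blast
  obtain KP where KP: "KP > 0" "\<And>v. norm (P v) \<le> KP * norm v" using linear_bounded_pos[OF P_linear] by blast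
  obtain \<eta> where \<eta>: "0 < \<eta>" "\<forall>N :: real^'m^'m. (\<forall>i j. \<bar>N $ i $ j - (if i = j then 1 else 0)\<bar> \<le> \<eta>) \<longrightarrow> 1 / 2 \<le> det N"
    by (rule det_near_one[where 'm = 'm], rule that) auto
  define m where "m = real CARD('m)"
  have m: "m > 0" by (simp add: m_def)
  \<comment> \<open>The first term allows \<epsilon> to be replaced by 1 in crude norm bounds, the
    second keeps the entries of the pairing matrix within \<eta> of the identity, and the third
    makes the factor in \<open>frame_injective\<close> at most 1/2.\<close>
  define \<epsilon> where "\<epsilon> = min 1 (min (\<eta> / (K * C)) (1 / (2 * m * (4 + 3 * K) * C)))"
  have \<epsilon>: "0 < \<epsilon>" "\<epsilon> \<le> 1" using \<eta>(1) K(1) C m by (simp_all add: \<epsilon>_def)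
  have "\<epsilon> \<le> \<eta> / (K * C)" by (simp add: \<epsilon>_def)
  then have \<epsilon>\<eta>: "K * (\<epsilon> * C) \<le> \<eta>" using K(1) C by (simp add: pos_le_divide_eq mult_ac)
  have "\<epsilon> \<le> 1 / (2 * m * (4 + 3 * K) * C)" by (simp add: \<epsilon>_def)
  then have "\<epsilon> * (2 * m * (4 + 3 * K) * C) \<le> 1" using K(1) C m by (simp add: pos_le_divide_eq)
  moreover have "\<epsilon> * (2 * m * (4 + 3 * K) * C) = 2 * (m * (\<epsilon> * (4 + 3 * K) * C))" by (simp only: mult_ac)
  ultimately have "m * (\<epsilon> * (4 + 3 * K) * C) < 1" by linarith
  then have \<epsilon>m: "real CARD('m) * (\<epsilon> * (4 + 3 * K) * C) < 1" by (simp add: m_def)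
  obtain \<delta>1 where d1: "0 < \<delta>1" "ball pt \<delta>1 \<subseteq> \<phi> ` U"
    "\<And>x x'. x \<in> ball pt \<delta>1 \<Longrightarrow> x' \<in> ball pt \<delta>1 \<Longrightarrow> \<phi>i x' \<otimes> inv (\<phi>i x) \<in> U"
    "\<And>x x'. x \<in> ball pt \<delta>1 \<Longrightarrow> x' \<in> ball pt \<delta>1 \<Longrightarrow>
      norm (\<phi> (\<phi>i x' \<otimes> inv (\<phi>i x)) - pt - (x' - x)) \<le> \<epsilon> * norm (x' - x)"
    "\<And>x. x \<in> ball pt \<delta>1 \<Longrightarrow>
      \<exists>E. ((\<lambda>x'. \<phi> (\<phi>i x' \<otimes> inv (\<phi>i x))) has_derivative E) (at x) \<and> (\<forall>v. norm (E v - v) \<le> \<epsilon> * norm v)"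
    by (rule difference_strict[OF \<epsilon>(1)]) (rule that)
  obtain \<delta>2 where d2: "0 < \<delta>2" "\<And>x e. x \<in> ball pt \<delta>2 \<Longrightarrow> ch x e = 0 \<Longrightarrow> ch pt e = 0 \<Longrightarrow>
    \<bar>kf (x - pt) e\<bar> \<le> \<epsilon> * norm (x - pt) * norm e"
    by (rule ch_bound[OF \<epsilon>(1)]) (rule that)
  obtain W1 W2 where W12: "openin T W1" "openin T W2" "\<one> \<in> W1" "\<one> \<in> W2"
    "\<And>a b. a \<in> W1 \<Longrightarrow> b \<in> W2 \<Longrightarrow> inv a \<otimes> b \<in> W"
    by (rule quotient_neighbourhoods[OF W]) (rule that)
  obtain \<delta>3 where d3: "0 < \<delta>3" "ball pt \<delta>3 \<subseteq> \<phi> ` U" "\<And>x. x \<in> ball pt \<delta>3 \<Longrightarrow> \<phi>i x \<in> W1"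
    by (rule chart_ball[OF W12(1,3)]) (rule that)
  \<comment> \<open>Two points of the ball differ by less than \<open>2 * \<delta>0\<close>, and the
    coordinates of the quotient of the two group elements are at most twice that far from
    \<open>pt\<close>, hence within \<open>\<delta>2\<close>.\<close>
  define \<delta>0 where "\<delta>0 = min \<delta>1 (min (\<delta>2 / 4) \<delta>3)"
  have \<delta>0: "0 < \<delta>0" "\<delta>0 \<le> \<delta>1" "\<delta>0 \<le> \<delta>2 / 4" "\<delta>0 \<le> \<delta>3" using d1(1) d2(1) d3(1) by (auto simp: \<delta>0_def)
  define \<delta> where "\<delta> = \<delta>0 / (m * C)"
  have \<delta>: "\<delta> > 0" using \<delta>0(1) m C by (simp add: \<delta>_def)
  define c2 where "c2 = c1 / (2 * \<bar>det (\<chi> k l. kf (f k) (f l))\<bar>)"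
  have c2: "c2 > 0" using c1 f(3) by (simp add: c2_def)
  show ?thesis
  proof (rule that[OF \<delta> half_gt_zero[OF c2]])
    fix g assume g: "g \<in> carrier G"
    have ig: "inv g \<in> carrier G" using g by simp
    obtain e v :: "'m \<Rightarrow> real^'n" and M :: "real^'m^'m" where
      "(\<forall>i. norm (e i) = 1) \<and> (\<forall>i. norm (v i) \<le> C) \<and> (\<forall>i j. kf (v i) (e j) = (if i = j then 1 else 0)) \<and>
      (\<forall>k. Ad g (f k) = (\<Sum>i\<in>UNIV. M $ k $ i *\<^sub>R e i)) \<and> c1 \<le> \<bar>det M\<bar> \<and>
      (\<forall>i. \<exists>w. \<theta> w = - w \<and> e i = Ad g w)"
      using frame[OF g] by (elim exE) (rule that)
    then have e: "\<And>i. norm (e i) = 1" and v: "\<And>i. norm (v i) \<le> C" and dual: "\<And>i j. kf (v i) (e j) = (if i = j then 1 else 0)"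
      and M: "\<And>k. Ad g (f k) = (\<Sum>i\<in>UNIV. M $ k $ i *\<^sub>R e i)" "c1 \<le> \<bar>det M\<bar>"
      and ew: "\<And>i. \<exists>w. \<theta> w = - w \<and> e i = Ad g w"
      by blast+
    define L where "L = (\<lambda>t :: real^'m. \<Sum>i\<in>UNIV. t $ i *\<^sub>R v i)"
    have L: "linear L" unfolding L_def
      by (rule linearI) (simp_all add: scaleR_add_left sum.distrib scaleR_sum_right)
    have Lax: "L (axis j 1) = v j" for j
      by (simp add: L_def axis_nth_eq if_distrib[of "\<lambda>r. r *\<^sub>R _"] cong: if_cong)
    have xt: "pt + L t \<in> ball pt \<delta>0" if "t \<in> ball 0 \<delta>" for t
    proof -
      have "norm (L t) \<le> C * (\<Sum>i\<in>UNIV. \<bar>t $ i\<bar>)" unfolding L_def by (rule norm_sum_scaleR_le[OF v])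
      also have "\<dots> \<le> C * (m * norm t)" using C norm_l1_bound[of t] by (intro mult_left_mono) (auto simp: m_def)
      also have "\<dots> < C * (m * \<delta>)" using that C m by simp
      also have "\<dots> = \<delta>0" using C m by (simp add: \<delta>_def)
      finally show ?thesis by (simp add: dist_norm)
    qed
    have xt1: "pt + L t \<in> ball pt \<delta>1" if "t \<in> ball 0 \<delta>" for t using xt[OF that] \<delta>0(2) by simp
    have xU: "pt + L t \<in> \<phi> ` U" if "t \<in> ball 0 \<delta>" for t using xt1[OF that] d1(2) by blast
    define \<beta> where "\<beta> = (\<lambda>t. \<phi>i (pt + L t))"
    have \<beta>G: "\<beta> t \<in> carrier G" if "t \<in> ball 0 \<delta>" for t using xU[OF that] \<phi>i_G by (simp add: \<beta>_def)
    have \<beta>W: "\<beta> t \<in> W1" if "t \<in> ball 0 \<delta>" for t using xt[OF that] \<delta>0(4) d3(3) by (simp add: \<beta>_def)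
    have c\<beta>: "continuous_map (top_of_set (ball 0 \<delta>)) T \<beta>"
    proof -
      have "continuous_on (ball 0 \<delta>) (\<lambda>t. pt + L t)"
        using L by (intro continuous_intros linear_continuous_on) (simp add: linear_conv_bounded_linear)
      then have 1: "continuous_map (top_of_set (ball 0 \<delta>)) (top_of_set (\<phi> ` U)) (\<lambda>t. pt + L t)"
        using xU by (auto simp: continuous_map_in_subtopology)
      show ?thesis
        using continuous_map_compose[OF 1 chart_inv_continuous[OF U_chart]] by (simp add: o_def \<phi>i_def \<beta>_def)
    qed
    \<comment> \<open>From here on the constants depend on \<open>g\<close>. They only affect
      \<open>r0\<close>, whereas \<delta> and the bound \<open>c2 / 2\<close> are already
      fixed.\<close>
    obtain \<delta>4 where d4: "0 < \<delta>4" "ball pt \<delta>4 \<subseteq> \<phi> ` U"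
      "\<And>\<kappa> i. \<kappa> \<in> ball pt \<delta>4 \<Longrightarrow> norm (Ad (g \<otimes> \<phi>i \<kappa> \<otimes> inv g) (e i) - e i) \<le> \<epsilon>"
      by (rule Ad_small[OF g \<epsilon>(1)]) (rule that)
    obtain KA where KA: "KA > 0" "\<And>v. norm (Ad (inv g) v) \<le> KA * norm v"
      using linear_bounded_pos[OF Ad_linear[OF ig]] by blast
    define Bg where "Bg = KA * (2 * C)"
    have Bg: "Bg > 0" using KA C by (simp add: Bg_def)
    define R where "R = m * m * ((KP + 1) * Bg)"
    obtain \<rho> where \<rho>: "0 < \<rho>" "\<And>X Z :: real^'m^'m. norm X \<le> R \<Longrightarrow> norm Z \<le> R \<Longrightarrow> norm (X - Z) < \<rho> \<Longrightarrow> \<bar>det X - det Z\<bar> < c2 / 2"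
      by (rule det_uniformly_continuous[OF half_gt_zero[OF c2], of R]) (rule that)
    \<comment> \<open>Chosen so that replacing \<open>P\<close> by the derivative \<open>Q\<close>
      at a nearby point changes the Jacobian matrix by less than \<rho>, and so its determinant by
      less than \<open>c2 / 2\<close>.\<close>
    define \<epsilon>g where "\<epsilon>g = min 1 (\<rho> / (2 * m * m * Bg))"
    have \<epsilon>g: "0 < \<epsilon>g" "\<epsilon>g \<le> 1" using \<rho>(1) m Bg by (simp_all add: \<epsilon>g_def)
    have "\<epsilon>g \<le> \<rho> / (2 * m * m * Bg)" by (simp add: \<epsilon>g_def)
    then have "\<epsilon>g * (2 * m * m * Bg) \<le> \<rho>" using m Bg by (simp add: pos_le_divide_eq)
    moreover have "0 < m * m * (\<epsilon>g * Bg)" using m Bg \<epsilon>g by simp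
    ultimately have \<epsilon>g\<rho>: "m * m * (\<epsilon>g * Bg) < \<rho>" by (simp add: mult_ac)
    obtain \<delta>6 where d6: "0 < \<delta>6" "ball pt \<delta>6 \<subseteq> \<phi> ` U"
      "\<And>\<kappa>. \<kappa> \<in> ball pt \<delta>6 \<Longrightarrow>
        \<exists>E. ((\<lambda>\<xi>. \<psi> (proj (\<phi>i \<xi> \<otimes> \<phi>i \<kappa>))) has_derivative E) (at pt) \<and> (\<forall>v. norm (E v - P v) \<le> \<epsilon>g * norm v)"
      by (rule product_derivative[OF \<epsilon>g(1)]) (rule that)
    \<comment> \<open>Three conditions on \<open>k\<close> near the identity: the frame at
      \<open>g k H\<close> stays close to the one at \<open>g H\<close>, the derivative
      \<open>Q\<close> stays close to \<open>P\<close>, and the conjugate of \<open>k\<close> by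
      \<open>g\<close> is so small that \<open>y\<close> lies in \<open>W g H\<close>.\<close>
    define N where "N = {a \<in> U. \<phi> a \<in> ball pt (min \<delta>4 \<delta>6)} \<inter> {a \<in> carrier G. g \<otimes> a \<otimes> inv g \<in> W2}"
    have oN: "openin T N"
    proof -
      have "continuous_map T T (\<lambda>a. g \<otimes> a \<otimes> inv g)" using smooth_conj[OF g] by (simp add: smooth_map_def)
      from openin_continuous_map_preimage[OF this W12(2)]
      have "openin T {a \<in> carrier G. g \<otimes> a \<otimes> inv g \<in> W2}" by simp
      then show ?thesis unfolding N_def using chart_preimage_open[OF U_chart open_ball] by blast
    qed
    have 1: "\<one> \<in> N" using one_U d4(1) d6(1) W12(4) g by (simp add: N_def pt_def)
    obtain r0 where r0: "0 < r0" "\<And>r y. r \<le> r0 \<Longrightarrow> y \<in> HB r \<Longrightarrow> \<exists>k\<in>N. y = proj k"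
      by (rule HB_in_proj[OF oN 1]) (rule that)
    show "\<exists>\<beta> r0. continuous_map (top_of_set (ball (0 :: real^'m) \<delta>)) T \<beta> \<and> 0 < r0 \<and>
      (\<forall>r y. 0 < r \<longrightarrow> r < r0 \<longrightarrow> y \<in> lcosets H \<longrightarrow>
        ({t \<in> ball 0 \<delta>. \<beta> t <# y \<in> (\<lambda>z. g <# z) ` HB r} \<noteq> {} \<longrightarrow> y \<in> (\<lambda>b. proj (b \<otimes> g)) ` W) \<and>
        ennreal (c2 / 2) * emeasure lborel {t \<in> ball 0 \<delta>. \<beta> t <# y \<in> (\<lambda>z. g <# z) ` HB r} \<le> emeasure lborel (ball (\<psi> H) r))"
    proof (intro exI[of _ \<beta>] exI[of _ r0] conjI allI impI)
      show "continuous_map (top_of_set (ball (0 :: real^'m) \<delta>)) T \<beta>" by (rule c\<beta>)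
      show "0 < r0" by (rule r0)
      fix r y assume r: "0 < r" "r < r0" and y: "y \<in> lcosets H"
      define S where "S = {t \<in> ball 0 \<delta>. \<beta> t <# y \<in> (\<lambda>z. g <# z) ` HB r}"
      have S_ball: "t \<in> ball 0 \<delta>" if "t \<in> S" for t using that by (simp add: S_def)
      have S_k: "\<exists>k\<in>N. \<beta> t <# y = g <# proj k \<and> proj k \<in> HB r" if "t \<in> S" for t
      proof -
        have "\<beta> t <# y \<in> (\<lambda>z. g <# z) ` HB r" using that by (simp add: S_def)
        then obtain z where "\<beta> t <# y = g <# z" "z \<in> HB r" by (rule imageE)
        then show ?thesis using r0(2)[of r z] r(2) by auto
      qed
      have NG: "k \<in> carrier G" if "k \<in> N" for k using that by (simp add: N_def)
      have yk: "y = proj (inv (\<beta> t) \<otimes> (g \<otimes> k))" if t: "t \<in> S" and k: "k \<in> N" "\<beta> t <# y = g <# proj k" for t k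
      proof -
        have b: "\<beta> t \<in> carrier G" using \<beta>G[OF S_ball[OF t]] .
        have "y = inv (\<beta> t) <# (\<beta> t <# y)" using act_inv(1)[OF b y] by simp
        then show ?thesis using b g NG[OF k(1)] by (simp add: k(2) act_proj)
      qed
      show "y \<in> (\<lambda>b. proj (b \<otimes> g)) ` W" if ne: "{t \<in> ball 0 \<delta>. \<beta> t <# y \<in> (\<lambda>z. g <# z) ` HB r} \<noteq> {}"
      proof -
        obtain t where t: "t \<in> S" using ne by (auto simp: S_def)
        obtain k where k: "k \<in> N" "\<beta> t <# y = g <# proj k" using S_k[OF t] by blast
        have b: "\<beta> t \<in> carrier G" using \<beta>G[OF S_ball[OF t]] .
        have "g \<otimes> k \<otimes> inv g \<in> W2" using k(1) by (simp add: N_def)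
        then have w: "inv (\<beta> t) \<otimes> (g \<otimes> k \<otimes> inv g) \<in> W" using W12(5) \<beta>W[OF S_ball[OF t]] by blast
        have "inv (\<beta> t) \<otimes> (g \<otimes> k \<otimes> inv g) \<otimes> g = inv (\<beta> t) \<otimes> (g \<otimes> k)"
          using b g NG[OF k(1)] by (simp add: m_assoc)
        then show ?thesis using w yk[OF t k] by (intro image_eqI[of _ _ "inv (\<beta> t) \<otimes> (g \<otimes> k \<otimes> inv g)"]) simp_all
      qed
      define q where "q = (\<lambda>t. \<psi> (inv g <# (\<beta> t <# y)))"
      have q_eq: "inv g <# (\<beta> t <# y) \<in> HB r" if t: "t \<in> S" for t
      proof -
        obtain k where "k \<in> N" "\<beta> t <# y = g <# proj k" "proj k \<in> HB r" using S_k[OF t] by blast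
        then show ?thesis using act_inv(1)[OF g proj_in[OF NG]] by simp
      qed
      have oS: "open S" unfolding S_def
        by (rule orbit_time(2)[OF open_ball c\<beta> openin_act[OF g openin_HB] y])
      have inj: "t = t'" if t: "t \<in> S" and t': "t' \<in> S" and eq: "q t = q t'" for t t'
      proof -
        have bt: "\<beta> t \<in> carrier G" "\<beta> t' \<in> carrier G" using \<beta>G S_ball t t' by auto
        have "inv g <# (\<beta> t <# y) = inv g <# (\<beta> t' <# y)"
          using inj_onD[OF chart_inj[OF V_chart] eq[unfolded q_def]] q_eq[OF t] q_eq[OF t'] by (simp add: HB_def)
        then have "g <# (inv g <# (\<beta> t <# y)) = g <# (inv g <# (\<beta> t' <# y))" by simp
        then have same: "\<beta> t <# y = \<beta> t' <# y" using act_inv(2)[OF g] bt y by simp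
        obtain k where k: "k \<in> N" "\<beta> t <# y = g <# proj k" using S_k[OF t] by blast
        have kG: "k \<in> carrier G" using NG[OF k(1)] .
        \<comment> \<open>Equal to \<open>g \<otimes> k\<close>, but written so that
          \<open>Ad a\<close> is \<open>Ad g\<close> followed by
          \<open>Ad (g \<otimes> k \<otimes> inv g)\<close>, which moves the frame only by
          \<epsilon>. The quotient of \<open>\<beta> t'\<close> and \<open>\<beta> t\<close>
          stabilizes the coset of \<open>a\<close>.\<close>
        define a where "a = g \<otimes> k \<otimes> inv g \<otimes> g"
        have aG: "a \<in> carrier G" and cG: "g \<otimes> k \<otimes> inv g \<in> carrier G" using g kG by (simp_all add: a_def)
        have ya: "\<beta> t <# y = proj a" using g kG by (simp add: k(2) a_def act_proj m_assoc)
        define x where "x = \<phi> (\<beta> t' \<otimes> inv (\<beta> t))"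
        have xball: "pt + L t \<in> ball pt \<delta>1" "pt + L t' \<in> ball pt \<delta>1" using xt1 S_ball t t' by auto
        have bU: "\<beta> t' \<otimes> inv (\<beta> t) \<in> U" using d1(3)[OF xball] by (simp add: \<beta>_def)
        have xi: "\<phi>i x = \<beta> t' \<otimes> inv (\<beta> t)" using \<phi>i_\<phi>[OF bU] by (simp add: x_def)
        have "(\<beta> t' \<otimes> inv (\<beta> t)) <# (\<beta> t <# y) = \<beta> t' <# y" using bt y by (simp add: act_act m_assoc)
        then have st: "\<phi>i x <# proj a = proj a" using same ya xi by simp
        have xG: "\<phi>i x \<in> carrier G" using bt by (simp add: xi)
        define s where "s = t' - t"
        have Ls: "(pt + L t') - (pt + L t) = L s" by (simp add: s_def linear_diff[OF L])
        have dx: "norm (x - pt - L s) \<le> \<epsilon> * norm (L s)"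
          using d1(4)[OF xball] unfolding Ls by (simp add: x_def \<beta>_def)
        have nLs: "norm (L s) < 2 * \<delta>0"
        proof -
          have "dist (pt + L t') (pt + L t) \<le> dist pt (pt + L t') + dist pt (pt + L t)"
            by (rule dist_triangle3)
          also have "\<dots> < 2 * \<delta>0" using xt[OF S_ball[OF t]] xt[OF S_ball[OF t']] by simp
          finally show ?thesis using Ls by (simp add: dist_norm)
        qed
        have "norm (x - pt) \<le> norm (x - pt - L s) + norm (L s)" using norm_triangle_ineq[of "x - pt - L s" "L s"] by simp
        also have "\<dots> \<le> 1 * norm (L s) + norm (L s)"
          using dx mult_right_mono[OF \<epsilon>(2) norm_ge_zero[of "L s"]] by linarith
        finally have "norm (x - pt) < \<delta>2" using nLs \<delta>0(3) by linarith
        then have xb: "x \<in> ball pt \<delta>2" by (simp add: dist_norm norm_minus_commute)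
        have sm: "\<bar>kf (x - pt) (Ad (g \<otimes> k \<otimes> inv g) (e i))\<bar> \<le> \<epsilon> * norm (x - pt) * norm (Ad (g \<otimes> k \<otimes> inv g) (e i))" for i
        proof -
          obtain w where w: "\<theta> w = - w" "e i = Ad g w" using ew by blast
          have ea: "Ad (g \<otimes> k \<otimes> inv g) (e i) = Ad a w" using cG g by (simp add: w(2) a_def Ad_mult)
          have z1: "ch x (Ad a w) = 0" by (rule stabilizer_char[OF aG xG st w(1)])
          have z2: "ch pt (Ad a w) = 0"
            by (rule stabilizer_char[OF aG _ _ w(1)]) (use aG in \<open>simp_all add: \<phi>i_pt\<close>)
          show ?thesis unfolding ea by (rule d2(2)[OF xb z1 z2])
        qed
        have "k \<in> U" "\<phi> k \<in> ball pt \<delta>4" using k(1) by (simp_all add: N_def)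
        then have kA: "norm (Ad (g \<otimes> k \<otimes> inv g) (e i) - e i) \<le> \<epsilon>" for i
          using d4(3)[of "\<phi> k" i] \<phi>i_\<phi>[of k] by simp
        have "s = 0"
          by (rule frame_injective[OF \<epsilon> \<epsilon>m K C v e dual kA dx[unfolded L_def] sm])
        then show "t = t'" by (simp add: s_def)
      qed
      have der: "\<exists>q'. (q has_derivative q') (at t) \<and> c2 / 2 \<le> \<bar>det (matrix q')\<bar>" if t: "t \<in> S" for t
      proof -
        define x0 where "x0 = pt + L t"
        have x0b: "x0 \<in> ball pt \<delta>1" using xt1[OF S_ball[OF t]] by (simp add: x0_def)
        obtain E where E: "((\<lambda>x'. \<phi> (\<phi>i x' \<otimes> inv (\<phi>i x0))) has_derivative E) (at x0)"
          "\<And>v. norm (E v - v) \<le> \<epsilon> * norm v" using d1(5)[OF x0b] by blast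
        have lE: "linear E" using has_derivative_linear[OF E(1)] .
        obtain k where k: "k \<in> N" "\<beta> t <# y = g <# proj k" using S_k[OF t] by blast
        have kU: "k \<in> U" "\<phi> k \<in> ball pt \<delta>6" using k(1) by (simp_all add: N_def)
        obtain Q where Q: "((\<lambda>\<xi>. \<psi> (proj (\<phi>i \<xi> \<otimes> \<phi>i (\<phi> k)))) has_derivative Q) (at pt)"
          "\<And>v. norm (Q v - P v) \<le> \<epsilon>g * norm v" using d6(3)[OF kU(2)] by blast
        have dq: "(q has_derivative (\<lambda>s. Q (Ad (inv g) (E (L s))))) (at t)"
          unfolding q_def \<beta>_def
        proof (rule orbit_derivative[OF g L x0_def E(1) open_ball S_ball[OF t] _ imageI[OF kU(1)] Q(1) y])
          show "\<phi>i x0 <# y = g <# proj (\<phi>i (\<phi> k))" using k(2) \<phi>i_\<phi>[OF kU(1)] by (simp add: \<beta>_def x0_def)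
          fix t' :: "real^'m" assume "t' \<in> ball 0 \<delta>"
          then show "pt + L t' \<in> \<phi> ` U \<and> \<phi>i (pt + L t') \<otimes> inv (\<phi>i x0) \<in> U" using xU d1(3)[OF x0b] xt1 by blast
        qed
        \<comment> \<open>\<open>?L1\<close> is the Jacobian matrix of \<open>q\<close> at
          \<open>t\<close>; \<open>?L0\<close> has \<open>P\<close> in place of \<open>Q\<close>,
          and the identity for the Killing form applies to it.\<close>
        let ?L0 = "\<chi> k j. P (Ad (inv g) (E (v j))) $ k" and ?L1 = "\<chi> k j. Q (Ad (inv g) (E (v j))) $ k"
        have u: "norm (Ad (inv g) (E (v j))) \<le> Bg" for j
        proof -
          have "norm (E (v j)) \<le> norm (E (v j) - v j) + norm (v j)" using norm_triangle_ineq[of "E (v j) - v j" "v j"] by simp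
          also have "\<dots> \<le> 1 * norm (v j) + norm (v j)"
            using E(2)[of "v j"] mult_right_mono[OF \<epsilon>(2) norm_ge_zero[of "v j"]] by linarith
          also have "\<dots> \<le> 2 * C" using v[of j] by simp
          finally have "KA * norm (E (v j)) \<le> Bg" using KA(1) by (simp add: Bg_def)
          then show ?thesis using KA(2)[of "E (v j)"] by linarith
        qed
        have N: "1 / 2 \<le> det (\<chi> i j. kf (E (v j)) (e i))"
        proof (rule \<eta>(2)[rule_format])
          fix i j
          have "kf (E (v j)) (e i) - (if i = j then 1 else 0) = kf (E (v j) - v j) (e i)"
            by (simp add: linear_diff[OF kf_linear_left] dual eq_commute)
          also have "\<bar>\<dots>\<bar> \<le> K * norm (E (v j) - v j) * 1" using K(2)[of "E (v j) - v j" "e i"] e by simp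
          also have "\<dots> \<le> K * (\<epsilon> * C)"
          proof -
            have "norm (E (v j) - v j) \<le> \<epsilon> * C" using E(2)[of "v j"] mult_left_mono[OF v[of j], of \<epsilon>] \<epsilon>(1) by linarith
            then show ?thesis using K(1) by simp
          qed
          finally show "\<bar>(\<chi> i j. kf (E (v j)) (e i)) $ i $ j - (if i = j then 1 else 0)\<bar> \<le> \<eta>" using \<epsilon>\<eta> by simp
        qed
        have N': "1 / 2 \<le> \<bar>det (\<chi> i j. kf (E (v j)) (e i))\<bar>" using N by linarith
        have low: "c2 \<le> \<bar>det ?L0\<bar>" unfolding c2_def
          by (rule frame_determinant[OF g f(2,3) M less_imp_le[OF c1] lE N'])
        have entry: "norm (X :: real^'m^'m) \<le> m * m * b" if "\<And>i j. \<bar>X $ i $ j\<bar> \<le> b" for X b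
        proof -
          have "norm X \<le> (\<Sum>i\<in>(UNIV::'m set). \<Sum>j\<in>(UNIV::'m set). \<bar>X $ i $ j\<bar>)" by (rule norm_matrix_le)
          also have "\<dots> \<le> (\<Sum>i\<in>(UNIV::'m set). \<Sum>j\<in>(UNIV::'m set). b)" by (intro sum_mono that)
          finally show ?thesis by (simp add: m_def)
        qed
        have P_u: "norm (P (Ad (inv g) (E (v j)))) \<le> KP * Bg" for j
          using KP(2)[of "Ad (inv g) (E (v j))"] mult_left_mono[OF u[of j], of KP] KP(1) by linarith
        have QP_u: "norm (Q (Ad (inv g) (E (v j))) - P (Ad (inv g) (E (v j)))) \<le> \<epsilon>g * Bg" for j
          using Q(2)[of "Ad (inv g) (E (v j))"] mult_left_mono[OF u[of j], of \<epsilon>g] \<epsilon>g(1) by linarith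
        have "\<epsilon>g * Bg \<le> Bg" using \<epsilon>g(2) Bg by simp
        then have Q_u: "norm (Q (Ad (inv g) (E (v j)))) \<le> (KP + 1) * Bg" for j
          using P_u[of j] QP_u[of j] norm_triangle_ineq2[of "Q (Ad (inv g) (E (v j)))" "P (Ad (inv g) (E (v j)))"]
          by (simp add: distrib_right)
        have P_u': "norm (P (Ad (inv g) (E (v j)))) \<le> (KP + 1) * Bg" for j
          using P_u[of j] Bg by (simp add: distrib_right)
        have "norm ?L1 \<le> R" unfolding R_def
          by (rule entry) (simp add: order_trans[OF component_le_norm_cart Q_u])
        moreover have "norm ?L0 \<le> R" unfolding R_def
          by (rule entry) (simp add: order_trans[OF component_le_norm_cart P_u'])
        moreover have "norm (?L1 - ?L0) \<le> m * m * (\<epsilon>g * Bg)"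
        proof (rule entry)
          fix i j
          show "\<bar>(?L1 - ?L0) $ i $ j\<bar> \<le> \<epsilon>g * Bg"
            using order_trans[OF component_le_norm_cart QP_u, of j i] by simp
        qed
        ultimately have "\<bar>det ?L1 - det ?L0\<bar> < c2 / 2" using \<epsilon>g\<rho> by (intro \<rho>(2)) auto
        then have "c2 / 2 \<le> \<bar>det ?L1\<bar>" using low by linarith
        moreover have "matrix (\<lambda>s. Q (Ad (inv g) (E (L s)))) = ?L1" by (simp add: matrix_def Lax)
        ultimately show ?thesis using dq by (intro exI[of _ "\<lambda>s. Q (Ad (inv g) (E (L s)))"]) simp
      qed
      obtain q' where q': "\<And>t. t \<in> S \<Longrightarrow> (q has_derivative q' t) (at t)" "\<And>t. t \<in> S \<Longrightarrow> c2 / 2 \<le> \<bar>det (matrix (q' t))\<bar>"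
        using bchoice[of S "\<lambda>t q'. (q has_derivative q') (at t) \<and> c2 / 2 \<le> \<bar>det (matrix q')\<bar>"] der by auto
      have bS: "bounded S" by (rule bounded_subset[OF bounded_ball[of 0 \<delta>]]) (auto simp: S_def)
      have "ennreal (c2 / 2) * emeasure lborel S \<le> emeasure lborel (ball (\<psi> H) r)"
      proof (rule emeasure_le_of_det[OF _ bS q'(1) _ q'(2)])
        show "S \<in> sets borel" using oS by simp
        show "inj_on q S" using inj by (intro inj_onI)
        show "0 \<le> c2 / 2" using c2 by simp
        show "q ` S \<subseteq> ball (\<psi> H) r" using q_eq by (auto simp: q_def HB_def)
      qed simp_all
      then show "ennreal (c2 / 2) * emeasure lborel {t \<in> ball 0 \<delta>. \<beta> t <# y \<in> (\<lambda>z. g <# z) ` HB r} \<le> emeasure lborel (ball (\<psi> H) r)"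
        by (simp add: S_def)
    qed
  qed
qed

text \<open>The total orbit time of the translate of \<open>HB r\<close> by \<open>g\<close> is
  computed in two ways. By invariance it is a constant times the measure of \<open>HB r\<close>,
  which is at least a multiple of the Lebesgue volume of the coordinate ball. On the other hand only
  points of \<open>W g H\<close> contribute, each at most another multiple of that volume. The
  volume cancels and with it \<open>r\<close>.\<close>

theorem volume_lower_bound:
  assumes W: "openin T W" "\<one> \<in> W"
  obtains c where "0 < c" "\<And>g. g \<in> carrier G \<Longrightarrow> ennreal c \<le> emeasure \<mu> ((\<lambda>b. proj (b \<otimes> g)) ` W)"
proof -
  obtain \<delta> c2 where lc: "0 < \<delta>" "0 < c2"
    "\<And>g. g \<in> carrier G \<Longrightarrow> \<exists>\<beta> r0. continuous_map (top_of_set (ball (0 :: real^'m) \<delta>)) T \<beta> \<and> 0 < r0 \<and>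
      (\<forall>r y. 0 < r \<longrightarrow> r < r0 \<longrightarrow> y \<in> lcosets H \<longrightarrow>
        ({t \<in> ball 0 \<delta>. \<beta> t <# y \<in> (\<lambda>z. g <# z) ` HB r} \<noteq> {} \<longrightarrow> y \<in> (\<lambda>b. proj (b \<otimes> g)) ` W) \<and>
        ennreal c2 * emeasure lborel {t \<in> ball 0 \<delta>. \<beta> t <# y \<in> (\<lambda>z. g <# z) ` HB r} \<le> emeasure lborel (ball (\<psi> H) r))"
    by (rule local_count[OF W]) (rule that)
  obtain c0 r1 where c0: "0 < c0" "0 < r1"
    "\<And>r. 0 < r \<Longrightarrow> r < r1 \<Longrightarrow> ennreal c0 * emeasure lborel (ball (\<psi> H) r) \<le> emeasure \<mu> (HB r)"
    by (rule HB_measure_lower) (rule that)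
  define n where "n = DIM(real^'m)"
  define v where "v = unit_ball_vol n"
  have v: "v > 0" by (simp add: v_def)
  have ball: "emeasure lborel (ball (x :: real^'m) r) = ennreal (v * r ^ n)" if "0 \<le> r" for x r
    using emeasure_ball[OF that, of x] by (simp add: v_def n_def)
  show ?thesis
  proof (rule that[of "c2 * (v * \<delta> ^ n) * c0"])
    show "0 < c2 * (v * \<delta> ^ n) * c0" using lc c0 v by simp
    fix g assume g: "g \<in> carrier G"
    obtain \<beta> r0 where b: "continuous_map (top_of_set (ball (0 :: real^'m) \<delta>)) T \<beta>" "0 < r0"
      and b': "\<forall>r y. 0 < r \<longrightarrow> r < r0 \<longrightarrow> y \<in> lcosets H \<longrightarrow>
        ({t \<in> ball 0 \<delta>. \<beta> t <# y \<in> (\<lambda>z. g <# z) ` HB r} \<noteq> {} \<longrightarrow> y \<in> (\<lambda>b. proj (b \<otimes> g)) ` W) \<and>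
        ennreal c2 * emeasure lborel {t \<in> ball 0 \<delta>. \<beta> t <# y \<in> (\<lambda>z. g <# z) ` HB r} \<le> emeasure lborel (ball (\<psi> H) r)"
      using lc(3)[OF g] by (elim exE conjE) (rule that)
    \<comment> \<open>Any radius below both thresholds will do; through \<open>r0\<close> it depends
      on \<open>g\<close>.\<close>
    define r where "r = min r0 r1 / 2"
    have r: "0 < r" "r < r0" "r < r1" using b(2) c0(2) by (auto simp: r_def)
    let ?S = "\<lambda>y. {t \<in> ball 0 \<delta>. \<beta> t <# y \<in> (\<lambda>z. g <# z) ` HB r}" and ?W = "(\<lambda>b. proj (b \<otimes> g)) ` W"
    have "openin Y ?W"
    proof -
      have "?W = (\<lambda>g. proj g) ` (\<lambda>b. b \<otimes> g) ` W" by (simp add: image_image)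
      then show ?thesis using openin_proj[OF openin_right_translate[OF W(1) g]] by simp
    qed
    then have Ws: "?W \<in> sets \<mu>" by (rule open_in_sets)
    have oO: "openin Y ((\<lambda>z. g <# z) ` HB r)" by (rule openin_act[OF g openin_HB])
    have "ennreal (v * \<delta> ^ n) * emeasure \<mu> (HB r) = (\<integral>\<^sup>+ y. emeasure lborel (?S y) \<partial>\<mu>)"
      using orbit_time(1)[OF open_ball b(1) oO] mu_inv[OF g open_in_sets[OF openin_HB]] ball[of \<delta> 0] lc(1) by simp
    also have "\<dots> \<le> (\<integral>\<^sup>+ y. ennreal (v * r ^ n / c2) * indicator ?W y \<partial>\<mu>)"
    proof (rule nn_integral_mono)
      fix y assume "y \<in> space \<mu>"
      then have y: "y \<in> lcosets H" by (simp add: space_mu)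
      note b'' = b'[rule_format, OF r(1,2) y]
      show "emeasure lborel (?S y) \<le> ennreal (v * r ^ n / c2) * indicator ?W y"
      proof (cases "?S y = {}")
        case True
        show ?thesis unfolding True by simp
      next
        case False
        then have yW: "y \<in> ?W" using b'' by blast
        have "ennreal c2 * emeasure lborel (?S y) \<le> ennreal c2 * ennreal (v * r ^ n / c2)"
          using b'' ball[of r] r(1) lc(2) v by (simp add: ennreal_mult[symmetric])
        then have "emeasure lborel (?S y) \<le> ennreal (v * r ^ n / c2)"
          using lc(2) by (subst (asm) ennreal_mult_le_mult_iff) auto
        then show ?thesis using yW by simp
      qed
    qed
    also have "\<dots> = ennreal (v * r ^ n / c2) * emeasure \<mu> ?W" by (rule nn_integral_cmult_indicator[OF Ws])
    finally have le: "ennreal (v * \<delta> ^ n) * emeasure \<mu> (HB r) \<le> ennreal (v * r ^ n / c2) * emeasure \<mu> ?W" .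
    have "ennreal (v * r ^ n) * ennreal (c2 * (v * \<delta> ^ n) * c0) = ennreal c2 * (ennreal (v * \<delta> ^ n) * (ennreal c0 * ennreal (v * r ^ n)))"
      using lc(1,2) c0(1) v r(1) by (simp add: ennreal_mult[symmetric] mult_ac)
    also have "\<dots> \<le> ennreal c2 * (ennreal (v * \<delta> ^ n) * emeasure \<mu> (HB r))"
      using c0(3)[OF r(1,3)] r(1) ball by (intro mult_left_mono) auto
    also have "\<dots> \<le> ennreal c2 * (ennreal (v * r ^ n / c2) * emeasure \<mu> ?W)" by (rule mult_left_mono[OF le]) simp
    also have "\<dots> = ennreal (v * r ^ n) * emeasure \<mu> ?W"
      using lc(2) v r(1) by (simp add: mult.assoc[symmetric] ennreal_mult[symmetric])
    finally have "ennreal (v * r ^ n) * ennreal (c2 * (v * \<delta> ^ n) * c0) \<le> ennreal (v * r ^ n) * emeasure \<mu> ?W" .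
    then show "ennreal (c2 * (v * \<delta> ^ n) * c0) \<le> emeasure \<mu> ?W"
      using v r(1) by (subst (asm) ennreal_mult_le_mult_iff) auto
  qed
qed

end

section \<open>Vanishing at infinity\<close>

lemma smooth_on_empty: "smooth_on {} f"
proof -
  have "Ck_on k {} f" for k by (induction k arbitrary: f) auto
  then show ?thesis by (simp add: smooth_on_def)
qed

context symspace
begin

text \<open>If \<open>\<bar>h\<bar> \<ge> \<epsilon>\<close> at \<open>z\<close>, then the majorant \<open>v\<close> is at least \<open>\<epsilon>\<close> on \<open>W z\<close>, whose volume is bounded
  below.  As \<open>v\<close> is in \<open>L\<^sup>p\<close>, only boundedly many such \<open>W z\<close> can be disjoint.\<close>

theorem smooth_vector_C0:
  assumes p: "1 \<le> p" and f: "f \<in> smooth_vectors G A \<mu> p"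
  shows "\<exists>h\<in>C0_smooth Y B. AE y in \<mu>. f y = h y"
proof -
  obtain h v W where h: "smooth_function B h" "AE y in \<mu>. f y = h y" and W: "openin T W" "\<one> \<in> W"
    and v: "(\<lambda>y. complex_of_real (v y)) \<in> Lp_space \<mu> p" "AE y in \<mu>. \<forall>a\<in>W. cmod (h (inv a <# y)) \<le> v y"
    by (rule smooth_vector_version[OF p f]) (rule that)
  have 1: "\<one> \<in> topspace T" by simp
  \<comment> \<open>\<open>W1\<close> serves the volume bound; the compact set \<open>K1\<close>
    around it makes the sets of all \<open>(inv a \<otimes> b) <# z\<close> with \<open>a\<close>
    and \<open>b\<close> in \<open>K1\<close> compact.\<close>
  obtain W1 K1 where W1: "openin T W1" "compactin T K1" "\<one> \<in> W1" "W1 \<subseteq> K1" "K1 \<subseteq> W"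
    by (rule atlas_compact_neighbourhood[OF atlas_T 1 W]) (rule that)
  have W1G: "W1 \<subseteq> carrier G" and K1G: "K1 \<subseteq> carrier G"
    using openin_subset[OF W1(1)] compactin_subset_topspace[OF W1(2)] by simp_all
  obtain c where c: "0 < c" "\<And>g. g \<in> carrier G \<Longrightarrow> ennreal c \<le> emeasure \<mu> ((\<lambda>b. proj (b \<otimes> g)) ` W1)"
    by (rule volume_lower_bound[OF W1(1,3)]) (rule that)
  define N where "N = (\<lambda>z. (\<lambda>a. a <# z) ` W1)"
  have N_proj: "N (proj g) = (\<lambda>b. proj (b \<otimes> g)) ` W1" if "g \<in> carrier G" for g
    unfolding N_def by (rule image_cong[OF refl]) (use that W1G in \<open>auto simp: act_proj\<close>)
  have N_sets: "N z \<in> sets \<mu>" and N_c: "ennreal c \<le> emeasure \<mu> (N z)" if z: "z \<in> lcosets H" for z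
  proof -
    obtain g where g: "g \<in> carrier G" "z = proj g" using lcosets_cases[OF z] .
    show "ennreal c \<le> emeasure \<mu> (N z)" unfolding g(2) N_proj[OF g(1)] by (rule c(2)[OF g(1)])
    have "(\<lambda>b. proj (b \<otimes> g)) ` W1 = (\<lambda>g. proj g) ` (\<lambda>b. b \<otimes> g) ` W1" by (simp add: image_image)
    then show "N z \<in> sets \<mu>"
      unfolding g(2) N_proj[OF g(1)] using open_in_sets[OF openin_proj[OF openin_right_translate[OF W1(1) g(1)]]] by simp
  qed
  have "vanishes_at_infinity Y h"
    unfolding vanishes_at_infinity_def
  proof (intro allI impI)
    fix \<epsilon> :: real assume \<epsilon>: "0 < \<epsilon>"
    define E where "E = {y \<in> lcosets H. \<epsilon> \<le> cmod (h y)}"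
    define I where "I = (LINT y|\<mu>. \<bar>v y\<bar> powr p)"
    have vi: "integrable \<mu> (\<lambda>y. \<bar>v y\<bar> powr p)" using v(1) by (simp add: Lp_space_def)
    have I: "(\<integral>\<^sup>+ y. ennreal (\<bar>v y\<bar> powr p) \<partial>\<mu>) = ennreal I"
      unfolding I_def by (rule nn_integral_eq_integral[OF vi]) simp
    have I0: "0 \<le> I" by (simp add: I_def)
    \<comment> \<open>Finite packings of \<open>E\<close> by the sets \<open>N z\<close>. The bound
      on their cardinality makes a largest packing available.\<close>
    define Q where "Q = (\<lambda>Z. finite Z \<and> Z \<subseteq> E \<and> disjoint_family_on N Z)"
    have bound: "real (card Z) * c * \<epsilon> powr p \<le> I" if Z: "Q Z" for Z
    proof -
      have ZE: "Z \<subseteq> E" and fZ: "finite Z" and dZ: "disjoint_family_on N Z" using Z by (auto simp: Q_def)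
      have sets: "N ` Z \<subseteq> sets \<mu>" using ZE N_sets by (auto simp: E_def)
      define D where "D = (\<Union>z\<in>Z. N z)"
      have Ds: "D \<in> sets \<mu>" unfolding D_def using fZ sets by (intro sets.finite_UN) auto
      have "of_nat (card Z) * ennreal c = (\<Sum>z\<in>Z. ennreal c)" by simp
      also have "\<dots> \<le> (\<Sum>z\<in>Z. emeasure \<mu> (N z))" using ZE N_c by (intro sum_mono) (auto simp: E_def)
      also have "\<dots> = emeasure \<mu> D" unfolding D_def by (rule sum_emeasure[OF sets dZ fZ])
      finally have 1: "of_nat (card Z) * ennreal c \<le> emeasure \<mu> D" .
      have "AE y in \<mu>. ennreal (\<epsilon> powr p) * indicator D y \<le> ennreal (\<bar>v y\<bar> powr p)"
        using v(2)
      proof eventually_elim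
        case (elim y)
        show ?case
        proof (cases "y \<in> D")
          case True
          then obtain z a where z: "z \<in> Z" "a \<in> W1" "y = a <# z" by (auto simp: D_def N_def)
          have zE: "z \<in> E" using z(1) ZE by blast
          have "inv a <# y = z" using z W1G zE act_inv(1) by (auto simp: E_def)
          then have "cmod (h z) \<le> v y" using elim z(2) W1(4,5) by (metis subsetD)
          then have "\<epsilon> \<le> \<bar>v y\<bar>" using zE by (auto simp: E_def)
          then show ?thesis using True \<epsilon> p by (simp add: powr_mono2 ennreal_leI)
        qed simp
      qed
      then have "(\<integral>\<^sup>+ y. ennreal (\<epsilon> powr p) * indicator D y \<partial>\<mu>) \<le> ennreal I"
        unfolding I[symmetric] by (rule nn_integral_mono_AE)
      then have "ennreal (\<epsilon> powr p) * emeasure \<mu> D \<le> ennreal I"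
        using nn_integral_cmult_indicator[OF Ds] by simp
      then have "ennreal (\<epsilon> powr p) * (of_nat (card Z) * ennreal c) \<le> ennreal I"
        using mult_left_mono[OF 1, of "ennreal (\<epsilon> powr p)"] by (meson order_trans zero_le)
      then have "ennreal (\<epsilon> powr p * (real (card Z) * c)) \<le> ennreal I"
        using c(1) by (simp add: ennreal_mult ennreal_of_nat_eq_real_of_nat)
      then show ?thesis using I0 by (simp add: mult_ac)
    qed
    have pos: "0 < c * \<epsilon> powr p" using c(1) \<epsilon> by simp
    obtain b :: nat where b: "I / (c * \<epsilon> powr p) < real b" using reals_Archimedean2 by blast
    have card_b: "\<forall>Z. Q Z \<longrightarrow> card Z < b"
    proof (intro allI impI)
      fix Z assume "Q Z"
      from bound[OF this] have "real (card Z) \<le> I / (c * \<epsilon> powr p)" using pos by (simp add: pos_le_divide_eq mult.assoc)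
      then show "card Z < b" using b by linarith
    qed
    have "Q {}" by (simp add: Q_def disjoint_family_on_def)
    from ex_has_greatest_nat[of Q, OF this card_b]
    obtain Z where Z: "Q Z" "\<And>Z'. Q Z' \<Longrightarrow> card Z' \<le> card Z" by blast
    have ZE: "Z \<subseteq> E" and fZ: "finite Z" using Z(1) by (auto simp: Q_def)
    \<comment> \<open>If \<open>N y\<close> meets \<open>N z\<close>, then
      \<open>a <# y = b <# z\<close> with \<open>a\<close> and \<open>b\<close> in
      \<open>W1\<close>, so that \<open>y = F z (a, b)\<close>. As the packing \<open>Z\<close> is
      maximal, each \<open>y\<close> in \<open>E\<close> arises in this way from some
      \<open>z\<close> in \<open>Z\<close>.\<close>
    define F where "F = (\<lambda>z ab. (inv (fst ab) \<otimes> snd ab) <# z)"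
    define C where "C = (\<Union>z\<in>Z. F z ` (K1 \<times> K1))"
    have "compactin Y (F z ` (K1 \<times> K1))" if "z \<in> Z" for z
    proof -
      have z: "z \<in> lcosets H" using that ZE by (auto simp: E_def)
      have "continuous_map (prod_topology T T) T (\<lambda>ab. inv (fst ab) \<otimes> snd ab)"
        by (intro continuous_mult continuous_inv continuous_map_fst continuous_map_snd)
      then have 1: "continuous_map (prod_topology T T) (prod_topology T Y) (\<lambda>ab. (inv (fst ab) \<otimes> snd ab, z))"
        using z by (simp add: continuous_map_paired)
      have "continuous_map (prod_topology T T) Y (F z)"
        using continuous_map_compose[OF 1 continuous_act] by (simp add: o_def F_def)
      then show ?thesis using image_compactin[of "prod_topology T T" "K1 \<times> K1"] W1(2) by (simp add: compactin_Times)
    qed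
    then have "compactin Y C" unfolding C_def using fZ by (intro compactin_Union) auto
    moreover have "y \<in> C" if y: "y \<in> E" for y
    proof -
      have yl: "y \<in> lcosets H" using y by (simp add: E_def)
      have yN: "z \<in> N z" if "z \<in> lcosets H" for z
        unfolding N_def by (rule image_eqI[OF _ W1(3)]) (use that in simp)
      have "\<exists>z\<in>Z. N y \<inter> N z \<noteq> {}"
      proof (rule ccontr)
        assume n: "\<not> (\<exists>z\<in>Z. N y \<inter> N z \<noteq> {})"
        then have yZ: "y \<notin> Z" using yN[OF yl] by blast
        have "Q (insert y Z)" using n Z(1) y by (auto simp: Q_def disjoint_family_on_def)
        then show False using Z(2) yZ fZ by fastforce
      qed
      then obtain z a b where z: "z \<in> Z" and ab: "a \<in> W1" "b \<in> W1" "a <# y = b <# z" by (auto simp: N_def)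
      have zl: "z \<in> lcosets H" using z ZE by (auto simp: E_def)
      have aG: "a \<in> carrier G" and bG: "b \<in> carrier G" using ab W1G by auto
      have "y = inv a <# (b <# z)" using act_inv(1)[OF aG yl] ab(3) by simp
      also have "\<dots> = F z (a, b)" using aG bG zl by (simp add: act_act F_def)
      finally show ?thesis using z ab W1(4) by (auto simp: C_def)
    qed
    ultimately show "\<exists>C. compactin Y C \<and> (\<forall>y\<in>topspace Y - C. cmod (h y) < \<epsilon>)"
      by (intro exI[of _ C]) (force simp: E_def)
  qed
  then have "h \<in> C0_smooth Y B" using h(1) by (simp add: C0_smooth_def)
  then show ?thesis using h(2) by blast
qed

end

text \<open>Nonempty open sets of \<open>real^'m\<close> are infinite, so all charts of such a space
  have empty domain and smoothness is vacuous; the space itself is compact.\<close>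

lemma one_point_C0_smooth:
  fixes B :: "('y, real^'m) chart set"
  assumes Y: "smooth_manifold Y B" and pt: "topspace Y \<subseteq> {y0}"
  shows "f \<in> C0_smooth Y B"
proof -
  have fin: "finite (topspace Y)" using pt finite_subset by auto
  have "smooth_on (\<psi> ` V) (\<lambda>x. f (inv_into V \<psi> x))" if V: "(V, \<psi>) \<in> B" for V \<psi>
  proof -
    have Vc: "is_chart Y (V, \<psi>)" using Y V by (auto simp: smooth_manifold_def)
    have "finite (\<psi> ` V)" using finite_subset[OF chart_subset[OF Vc] fin] by simp
    then have "\<psi> ` V = {}" using chart_open[OF Vc] finite_imp_not_open by blast
    then show ?thesis by (simp only: smooth_on_empty)
  qed
  moreover have "vanishes_at_infinity Y f"
    unfolding vanishes_at_infinity_def using finite_imp_compactin[OF subset_refl fin] by blast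
  ultimately show ?thesis by (auto simp: C0_smooth_def smooth_function_def)
qed

theorem theorem3p1:
  fixes G :: "'g monoid"
    and T :: "'g topology"
    and A :: "('g, real ^ 'n) chart set"
    and \<tau> :: "'g \<Rightarrow> 'g"
    and H :: "'g set"
    and B :: "('g set, real ^ 'm) chart set"
    and \<mu> :: "'g set measure"
    and p :: real
  assumes "semisimple_lie_group G T A"
    and "connected_space T"
    and "finite (group_center G)"
    and "involutive_automorphism G T A \<tau>"
    and "subgroup H G"
    and "openin (subtopology T (fixed_group G \<tau>)) H"
    and "quotient_atlas G T A H B"
    and "invariant_radon_measure G T H \<mu>"
    and "1 \<le> p"
  shows "\<forall>f\<in>smooth_vectors G A \<mu> p. \<exists>h\<in>C0_smooth (coset_topology G T H) B.
           AE y in \<mu>. f y = h y"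
proof
  fix f assume f: "f \<in> smooth_vectors G A \<mu> p"
  have lie: "lie_group G T A" using assms(1) by (simp add: semisimple_lie_group_def)
  then have gr: "group G" and top: "topspace T = carrier G" and mT: "smooth_manifold T A" by (simp_all add: lie_group_def)
  interpret group G by (rule gr)
  have mY: "smooth_manifold (coset_topology G T H) B" using assms(7) by (simp add: quotient_atlas_def)
  have qm: "quotient_map T (coset_topology G T H) (\<lambda>g. g <#\<^bsub>G\<^esub> H)" by (rule quotient_map_coset_topology[OF top])
  have surj: "(\<lambda>g. g <#\<^bsub>G\<^esub> H) ` carrier G = topspace (coset_topology G T H)"
    using quotient_imp_surjective_map[OF qm] top by simp
  show "\<exists>h\<in>C0_smooth (coset_topology G T H) B. AE y in \<mu>. f y = h y"
  proof (cases "A = {} \<or> B = {}")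
    case True
    \<comment> \<open>An empty atlas stands for a discrete space, and connectedness of
      \<open>G\<close>, inherited by the quotient, leaves at most one point.\<close>
    have "\<exists>y0. topspace (coset_topology G T H) \<subseteq> {y0}"
    proof (cases "A = {}")
      case A: True
      then have "T = discrete_topology (carrier G)" using mT top one_closed unfolding smooth_manifold_def by auto
      then obtain a where "carrier G \<subseteq> {a}" using assms(2) connected_space_discrete_topology by metis
      then show ?thesis unfolding surj[symmetric] by blast
    next
      case False
      then have "B = {}" using True by simp
      then have "coset_topology G T H = discrete_topology (topspace (coset_topology G T H))"
        using mY surj one_closed unfolding smooth_manifold_def by auto
      moreover have "connected_space (coset_topology G T H)"
        using connected_space_quotient_map_image[OF qm assms(2)] .
      ultimately show ?thesis using connected_space_discrete_topology by metis
    qed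
    then have "f \<in> C0_smooth (coset_topology G T H) B" using one_point_C0_smooth[OF mY] by blast
    then show ?thesis by (intro bexI[of _ f]) simp_all
  next
    case False
    interpret smooth_homspace G T A H B \<mu>
      by (intro smooth_homspace.intro homspace.intro lie.intro lie_axioms.intro homspace_axioms.intro)
        (use gr lie False assms(5,7,8) in simp_all)
    have "\<one>\<^bsub>G\<^esub> \<in> topspace T" "H \<in> topspace (coset_topology G T H)" using H_in by simp_all
    then obtain U \<phi> V \<psi> where U: "(U, \<phi>) \<in> A" "\<one>\<^bsub>G\<^esub> \<in> U" and V: "(V, \<psi>) \<in> B" "H \<in> V"
      by (meson atlas_onE[OF atlas_T] atlas_onE[OF atlas_Y])
    interpret symspace G T A H B \<mu> U \<phi> \<tau> V \<psi>
      using U V assms(1,4,6) by unfold_locales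
    show ?thesis by (rule smooth_vector_C0[OF assms(9) f])
  qed
qed

end
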